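(* Assume $\diamondsuit$. (1) There exists a hereditarily separable totally disconnected rigid Efimov space satisfying the finitely supported Josefson--Nissenzweig property. (2) There exists a hereditarily separable totally disconnected Efimov space $K$ satisfying the finitely supported Josefson--Nissenzweig property and such that any two non-empty clopen subsets of $K$ are homeomorphic.
   Context: $\diamondsuit$ is Jensen's diamond principle on $\omega_1$. An Efimov space is an infinite compact Hausdorff space which contains neither a non-trivial convergent sequence nor a copy of $\beta\mathbb{N}$ (the Čech--Stone compactification of the natural numbers). A space $X$ is rigid if every homeomorphism $f\colon X\to X$ is the identity. A space is hereditarily separable if each of its subspaces is separable. A compact space $K$ has the finitely supported Josefson--Nissenzweig property (fsJNP) if there is a sequence $\langle\mu_n\colon n\in\omega\rangle$ of finitely supported signed Radon measures on $K$ such that $\|\mu_n\|=1$ (total variation norm) for all $n$ and $\lim_n\int_K f\,d\mu_n=0$ for every $f\in C(K)$. *)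

theory Defs
  imports "HOL-Analysis.Analysis"
begin

section \<open>Jensen's diamond principle\<close>

text \<open>
  \<open>cardSuc natLeq\<close> is a well-order of minimal length on an uncountable subset of the type
  \<^typ>\<open>nat set\<close>; its field is \<open>\<omega>\<^sub>1\<close>, and \<open>underS omega1 \<alpha>\<close> is the von Neumann
  ordinal \<open>\<alpha>\<close>, the set of all \<open>\<beta> < \<alpha>\<close>.
\<close>

definition omega1 :: "nat set rel" where
  "omega1 = cardSuc natLeq"

text \<open>
  Closedness: the strict inequalities \<open>\<alpha> < \<beta> < \<gamma>\<close> express that \<open>\<gamma>\<close> is a limit ordinal
  in which \<open>C\<close> is cofinal.
\<close>

definition club_omega1 :: "nat set set \<Rightarrow> bool" where
  "club_omega1 C \<longleftrightarrow>
     C \<subseteq> Field omega1 \<and>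
     (\<forall>\<alpha>\<in>Field omega1. \<exists>\<beta>\<in>C. \<alpha> \<in> underS omega1 \<beta>) \<and>
     (\<forall>\<gamma>\<in>Field omega1.
        underS omega1 \<gamma> \<noteq> {} \<and>
        (\<forall>\<alpha>\<in>underS omega1 \<gamma>. \<exists>\<beta>\<in>C \<inter> underS omega1 \<gamma>. \<alpha> \<in> underS omega1 \<beta>)
        \<longrightarrow> \<gamma> \<in> C)"

definition stationary_omega1 :: "nat set set \<Rightarrow> bool" where
  "stationary_omega1 S \<longleftrightarrow> S \<subseteq> Field omega1 \<and> (\<forall>C. club_omega1 C \<longrightarrow> S \<inter> C \<noteq> {})"

definition diamond :: bool where
  "diamond \<longleftrightarrow>
     (\<exists>A :: nat set \<Rightarrow> nat set set.
        (\<forall>\<alpha>\<in>Field omega1. A \<alpha> \<subseteq> underS omega1 \<alpha>) \<and>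
        (\<forall>X \<subseteq> Field omega1.
           stationary_omega1 {\<alpha> \<in> Field omega1. X \<inter> underS omega1 \<alpha> = A \<alpha>}))"

section \<open>Topological notions\<close>

text \<open>
  The closure of the image of \<open>X\<close> in the cube \<open>[0,1]\<^bsup>C(X,[0,1])\<^esup>\<close> under the evaluation map.
\<close>

definition cech_stone :: "'a topology \<Rightarrow> (('a \<Rightarrow> real) \<Rightarrow> real) topology" where
  "cech_stone X =
     (let F = {f. continuous_map X (top_of_set {0..1}) f};
          Q = product_topology (\<lambda>_. top_of_set {0..1}) F
      in subtopology Q (Q closure_of ((\<lambda>x. \<lambda>f\<in>F. f x) ` topspace X)))"

definition beta_nat :: "((nat \<Rightarrow> real) \<Rightarrow> real) topology" where
  "beta_nat = cech_stone (discrete_topology UNIV)"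

definition contains_copy_of :: "'a topology \<Rightarrow> 'b topology \<Rightarrow> bool" where
  "contains_copy_of X Y \<longleftrightarrow> (\<exists>S \<subseteq> topspace X. subtopology X S homeomorphic_space Y)"

definition has_nontrivial_convergent_sequence :: "'a topology \<Rightarrow> bool" where
  "has_nontrivial_convergent_sequence X \<longleftrightarrow>
     (\<exists>x l. range x \<subseteq> topspace X \<and> limitin X x l sequentially \<and>
            \<not> (\<exists>c. \<forall>\<^sub>F n in sequentially. x n = c))"

definition efimov_space :: "'a topology \<Rightarrow> bool" where
  "efimov_space X \<longleftrightarrow>
     infinite (topspace X) \<and> compact_space X \<and> Hausdorff_space X \<and>
     \<not> has_nontrivial_convergent_sequence X \<and> \<not> contains_copy_of X beta_nat"

definition rigid_space :: "'a topology \<Rightarrow> bool" where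
  "rigid_space X \<longleftrightarrow> (\<forall>f. homeomorphic_map X X f \<longrightarrow> (\<forall>x\<in>topspace X. f x = x))"

definition totally_disconnected_space :: "'a topology \<Rightarrow> bool" where
  "totally_disconnected_space X \<longleftrightarrow> (\<forall>C\<in>connected_components_of X. \<exists>x. C = {x})"

definition clopenin :: "'a topology \<Rightarrow> 'a set \<Rightarrow> bool" where
  "clopenin X U \<longleftrightarrow> openin X U \<and> closedin X U"

section \<open>Signed Radon measures\<close>

definition borel_sets_of :: "'a topology \<Rightarrow> 'a set set" where
  "borel_sets_of K = sigma_sets (topspace K) {U. openin K U}"

text \<open>
  A signed measure is a real-valued set function; its values outside of the Borel sets are
  irrelevant.
\<close>

definition signed_borel_measure :: "'a topology \<Rightarrow> ('a set \<Rightarrow> real) \<Rightarrow> bool" where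
  "signed_borel_measure K \<mu> \<longleftrightarrow>
     \<mu> {} = 0 \<and>
     (\<forall>A :: nat \<Rightarrow> 'a set. range A \<subseteq> borel_sets_of K \<and> disjoint_family A
        \<longrightarrow> (\<lambda>i. \<mu> (A i)) sums \<mu> (\<Union>i. A i))"

definition variation :: "'a topology \<Rightarrow> ('a set \<Rightarrow> real) \<Rightarrow> 'a set \<Rightarrow> ennreal" where
  "variation K \<mu> A =
     (SUP P \<in> {P. finite P \<and> disjoint P \<and> P \<subseteq> borel_sets_of K \<and> \<Union>P \<subseteq> A}.
        \<Sum>B\<in>P. ennreal \<bar>\<mu> B\<bar>)"

definition signed_radon_measure :: "'a topology \<Rightarrow> ('a set \<Rightarrow> real) \<Rightarrow> bool" where
  "signed_radon_measure K \<mu> \<longleftrightarrow>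
     signed_borel_measure K \<mu> \<and>
     (\<forall>B\<in>borel_sets_of K. \<forall>\<epsilon>>0. \<exists>C\<subseteq>B. compactin K C \<and> variation K \<mu> (B - C) < \<epsilon>)"

definition total_variation_norm :: "'a topology \<Rightarrow> ('a set \<Rightarrow> real) \<Rightarrow> ennreal" where
  "total_variation_norm K \<mu> = variation K \<mu> (topspace K)"

definition support_of :: "'a topology \<Rightarrow> ('a set \<Rightarrow> real) \<Rightarrow> 'a set" where
  "support_of K \<mu> =
     {x \<in> topspace K. \<forall>U. openin K U \<and> x \<in> U \<longrightarrow> variation K \<mu> U > 0}"

text \<open>
  The positive part of the Jordan decomposition of \<open>\<mu>\<close>, as a measure in the library's sense.
  Note that \<^const>\<open>ennreal\<close> truncates negative values, which is harmless here because of
  \<open>B = {}\<close>. The negative part of \<open>\<mu>\<close> is the positive part of \<open>-\<mu>\<close>.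
\<close>

definition jordan_pos :: "'a topology \<Rightarrow> ('a set \<Rightarrow> real) \<Rightarrow> 'a measure" where
  "jordan_pos K \<mu> =
     measure_of (topspace K) {U. openin K U}
       (\<lambda>A. SUP B \<in> {B \<in> borel_sets_of K. B \<subseteq> A}. ennreal (\<mu> B))"

definition signed_integral :: "'a topology \<Rightarrow> ('a set \<Rightarrow> real) \<Rightarrow> ('a \<Rightarrow> real) \<Rightarrow> real" where
  "signed_integral K \<mu> f =
     (LINT x|jordan_pos K \<mu>. f x) - (LINT x|jordan_pos K (\<lambda>B. - \<mu> B). f x)"

text \<open>The finitely supported Josefson--Nissenzweig property.\<close>

definition fsJNP :: "'a topology \<Rightarrow> bool" where
  "fsJNP K \<longleftrightarrow>
     (\<exists>\<mu> :: nat \<Rightarrow> 'a set \<Rightarrow> real.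
        (\<forall>n. signed_radon_measure K (\<mu> n) \<and> finite (support_of K (\<mu> n)) \<and>
             total_variation_norm K (\<mu> n) = 1) \<and>
        (\<forall>f. continuous_map K euclideanreal f \<longrightarrow>
             (\<lambda>n. signed_integral K (\<mu> n) f) \<longlonglongrightarrow> 0))"

end

theory Submission
  imports Defs
begin

text \<open>
  The space \<open>K\<close> is the limit of an inverse system of length \<open>\<omega>\<^sub>1\<close>, realized as a closed subset of
  \<open>{0,1}\<^bsup>\<omega>\<^sub>1 \<times> \<omega>\<^esup>\<close>: the image \<open>V\<^sub>\<alpha>\<close> of \<open>K\<close> in stage \<open>\<alpha>\<close> is given by the coordinates in the blocks
  \<open>{\<beta>} \<times> \<omega>\<close> with \<open>\<beta> < \<alpha>\<close>, and block \<open>0\<close> is a Cantor set. At stage \<open>\<alpha>\<close> countably many points \<open>y\<close> of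
  \<open>V\<^sub>\<alpha>\<close> are split: \<open>V\<^sub>\<alpha> - {y}\<close> is divided into two relatively clopen sides that both accumulate at
  \<open>y\<close>, one coordinate in block \<open>\<alpha>\<close> records the side, and \<open>y\<close> is thereby replaced by two points.
  Exactly one point lies above each point that is not split. Diamond guesses at stage \<open>\<alpha>\<close> a sequence
  of points of \<open>V\<^sub>\<alpha>\<close>, and the guesses decide what is done.

  A promise \<open>(T, A)\<close>, made at stage \<open>\<alpha>\<close> for sets of points of \<open>V\<^sub>\<alpha>\<close> such that each point of \<open>A\<close> is
  an accumulation point of \<open>T\<close>, says that in all later spaces every point above \<open>A\<close> remains a limit
  of whole fibres above points of \<open>T\<close>. Promises can be kept because there are only countably many at
  each stage, and countably many such requirements can be met on both sides of one partition
  (\<open>split_point\<close>). At each stage the guessed set promises to keep all its accumulation points, and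
  one of them is split. A nontrivial convergent sequence of \<open>K\<close> would be guessed at a stage where
  its limit is then split, so that it accumulates at two points (\<open>no_convergent_sequence\<close>). A left
  separated \<open>\<omega>\<^sub>1\<close>-sequence would be guessed at a stage where one of its terms lies above an
  accumulation point of the earlier terms and, by the promise, is a limit of them; hence \<open>K\<close> is
  hereditarily separable (\<open>hereditarily_separable\<close>). The Cech--Stone compactification of the
  naturals has an uncountable discrete subspace, so it does not embed into \<open>K\<close>.

  For rigidity the guess is also read as a sequence of pairs \<open>(p, f p)\<close> of a homeomorphism \<open>f\<close> that
  moves a point. These pairs accumulate at a pair \<open>(x, y)\<close> with \<open>x \<noteq> y\<close>. One splits \<open>x\<close> so that \<open>y\<close>
  is a limit both of the \<open>f p\<close> with \<open>p\<close> on the one side of \<open>x\<close> and of those with \<open>p\<close> on the other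
  side, and promises to keep this. Then the inverse of \<open>f\<close> is discontinuous above \<open>y\<close>.

  For the second space every stage adds homeomorphisms of \<open>V\<^sub>\<alpha>\<close> that map any proper nonempty clopen
  set onto any other one. They extend to all later stages if these split whole orbits and carry the
  sides of one point along its orbit. This is consistent if every word in the homeomorphisms that
  fixes a point is the identity. To ensure this, points carry labels in finite sets of sizes
  \<open>N 0, N 1, \<dots>\<close>, on which the generators of a free group act such that every nontrivial reduced word
  moves all labels of almost all levels (\<open>free_labels\<close>, from the residual finiteness of free
  groups). Each new homeomorphism is made to act on the labels of almost all levels as a generator
  of its own does, so nontrivial reduced words move all points. Such homeomorphisms exist by a
  back-and-forth argument (\<open>clopen_shift\<close>) as long as the label map is open and its fibres have no
  isolated points, which is one more countable set of requirements on the splittings.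

  The Josefson--Nissenzweig property comes from the Cantor set in block \<open>0\<close>. Outside of a set of
  small proportion in this Cantor set, any finitely many coordinates of a point are determined by
  finitely many coordinates of block \<open>0\<close>. So if two points of \<open>K\<close> are chosen for every choice of the
  first \<open>n\<close> coordinates of block \<open>0\<close> and get opposite masses of size \<open>2 ^ - (n + 1)\<close>, the integrals
  of a continuous function tend to \<open>0\<close> (\<open>atomic_JN_limit\<close>).
\<close>

unbundle cardinal_syntax

section \<open>The first uncountable ordinal as a type\<close>

lemma omega1_Card_order: "Card_order omega1"
  unfolding omega1_def by (rule cardSuc_Card_order[OF natLeq_Card_order])

lemma omega1_uncountable: "uncountable (Field omega1)"
proof
  assume "countable (Field omega1)"
  then have "|Field omega1| \<le>o |UNIV::nat set|"
    unfolding countable_def by (auto simp: card_of_ordLeq[symmetric])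
  then have "|Field omega1| \<le>o natLeq"
    using card_of_nat ordLeq_ordIso_trans by blast
  moreover have "natLeq <o omega1"
    unfolding omega1_def by (rule cardSuc_greater[OF natLeq_Card_order])
  moreover have "|Field omega1| =o omega1"
    by (rule card_of_Field_ordIso[OF omega1_Card_order])
  ultimately show False
    using not_ordLess_ordLeq[of natLeq omega1] ordIso_ordLeq_trans[OF ordIso_symmetric] by blast
qed

typedef om1 = "Field omega1"
proof -
  have "Field omega1 \<noteq> {}" using omega1_uncountable by auto
  then show ?thesis by blast
qed

instantiation om1 :: linorder
begin
definition "a \<le> b \<longleftrightarrow> (Rep_om1 a, Rep_om1 b) \<in> omega1"
definition "a < b \<longleftrightarrow> a \<le> b \<and> a \<noteq> (b::om1)"
instance
proof -
  have W: "Well_order omega1"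
    using omega1_Card_order card_order_on_well_order_on by blast
  then have T: "trans omega1" "antisym omega1" "total_on (Field omega1) omega1" "refl_on (Field omega1) omega1"
    by (auto simp: well_order_on_def linear_order_on_def partial_order_on_def preorder_on_def)
  show "OFCLASS(om1, linorder_class)"
  proof (intro_classes)
    fix x y z :: om1
    have R: "(Rep_om1 u, Rep_om1 u) \<in> omega1" for u
      using T(4) Rep_om1 by (rule refl_onD)
    have A: "u = v" if "(Rep_om1 u, Rep_om1 v) \<in> omega1" "(Rep_om1 v, Rep_om1 u) \<in> omega1" for u v
      using antisymD[OF T(2) that] by (simp add: Rep_om1_inject)
    show "(x < y) = (x \<le> y \<and> \<not> y \<le> x)"
      using A R unfolding less_eq_om1_def less_om1_def by blast
    show "x \<le> x" unfolding less_eq_om1_def by (rule R)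
    show "x \<le> y \<Longrightarrow> y \<le> z \<Longrightarrow> x \<le> z"
      unfolding less_eq_om1_def by (rule transD[OF T(1)])
    show "x \<le> y \<Longrightarrow> y \<le> x \<Longrightarrow> x = y"
      unfolding less_eq_om1_def by (rule A)
    show "x \<le> y \<or> y \<le> x"
      unfolding less_eq_om1_def using T(3) Rep_om1 R[of x] unfolding total_on_def by (cases "Rep_om1 x = Rep_om1 y") auto
  qed
qed
end

lemma less_om1_iff: "a < b \<longleftrightarrow> Rep_om1 a \<in> underS omega1 (Rep_om1 b)"
  unfolding less_om1_def less_eq_om1_def underS_def by (auto simp: Rep_om1_inject)

instance om1 :: wellorder
proof
  fix P :: "om1 \<Rightarrow> bool" and a
  assume step: "\<And>x. (\<And>y. y < x \<Longrightarrow> P y) \<Longrightarrow> P x"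
  have "wf (omega1 - Id)"
    using omega1_Card_order card_order_on_well_order_on well_order_on_def by blast
  then have "wf (inv_image (omega1 - Id) Rep_om1)" by (rule wf_inv_image)
  moreover have "inv_image (omega1 - Id) Rep_om1 = {(x,y). x < y}"
    by (auto simp: less_om1_def less_eq_om1_def Rep_om1_inject)
  ultimately have "wf {(x::om1,y). x < y}" by simp
  then show "P a" by (induction a rule: wf_induct_rule) (auto intro: step)
qed

lemma underS_om1: "underS omega1 (Rep_om1 a) = Rep_om1 ` {..<a}"
proof -
  have F: "x \<in> Field omega1" if "x \<in> underS omega1 (Rep_om1 a)" for x
    using that unfolding underS_def by (auto simp: Field_def)
  show ?thesis
  proof (intro equalityI subsetI)
    fix x assume x: "x \<in> underS omega1 (Rep_om1 a)"
    then obtain y where "x = Rep_om1 y" using Rep_om1_cases[OF F[OF x]] by blast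
    then show "x \<in> Rep_om1 ` {..<a}" using x by (simp add: less_om1_iff)
  qed (auto simp: less_om1_iff)
qed

lemma countable_lessThan_om1: "countable {..<a::om1}"
proof -
  have C: "Card_order omega1" by (rule omega1_Card_order)
  have "|underS omega1 (Rep_om1 a)| <o omega1"
    by (rule card_of_underS[OF C Rep_om1])
  then have "|underS omega1 (Rep_om1 a)| \<le>o natLeq"
    unfolding omega1_def using cardSuc_ordLeq_ordLess[OF natLeq_Card_order card_of_Card_order] by blast
  then have "|underS omega1 (Rep_om1 a)| \<le>o |UNIV::nat set|"
    using card_of_nat ordIso_symmetric ordLeq_ordIso_trans by blast
  then have "countable (underS omega1 (Rep_om1 a))"
    unfolding countable_def by (meson card_of_ordLeq)
  then have "countable (Rep_om1 ` {..<a})" by (simp add: underS_om1)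
  then show ?thesis
    by (rule countable_image_inj_on) (auto simp: inj_on_def Rep_om1_inject)
qed

lemma uncountable_om1: "uncountable (UNIV::om1 set)"
proof
  assume "countable (UNIV::om1 set)"
  then have "countable (Rep_om1 ` UNIV)" by blast
  moreover have "Rep_om1 ` UNIV = Field omega1"
    using type_definition.Rep_range[OF type_definition_om1] .
  ultimately show False using omega1_uncountable by simp
qed

lemma countable_bounded_om1:
  assumes "countable (A::om1 set)"
  obtains u where "\<And>a. a \<in> A \<Longrightarrow> a < u"
proof -
  have "\<exists>u. \<forall>a\<in>A. a < u"
  proof (rule ccontr)
    assume "\<not> ?thesis"
    then have ex: "\<exists>a\<in>A. u \<le> a" for u by (meson not_le)
    have "UNIV \<subseteq> (\<Union>a\<in>A. insert a {..<a})"
    proof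
      fix u :: om1
      obtain a where "a \<in> A" "u \<le> a" using ex[of u] by blast
      then show "u \<in> (\<Union>a\<in>A. insert a {..<a})" by (auto simp: le_less)
    qed
    moreover have "countable (\<Union>a\<in>A. insert a {..<a})"
      using assms countable_lessThan_om1 by auto
    ultimately show False using uncountable_om1 countable_subset by blast
  qed
  then show ?thesis using that by blast
qed

lemma inj_om1_triples: obtains b :: "om1 \<times> om1 \<times> nat \<Rightarrow> om1" where "inj b"
proof -
  have inf: "infinite (UNIV::om1 set)" using uncountable_om1 countable_finite by blast
  have "|UNIV::nat set| \<le>o |UNIV::om1 set|"
    using inf infinite_iff_card_of_nat by blast
  then have "|(UNIV::om1 set) \<times> (UNIV::nat set)| \<le>o |UNIV::om1 set|"
    using card_of_Times_infinite_simps(1)[OF inf, of "UNIV::nat set"] ordIso_iff_ordLeq by blast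
  then have "|(UNIV::om1 set) \<times> ((UNIV::om1 set) \<times> (UNIV::nat set))| \<le>o |UNIV::om1 set|"
    using card_of_Times_infinite_simps(1)[OF inf, of "(UNIV::om1 set) \<times> (UNIV::nat set)"] ordIso_iff_ordLeq by blast
  then obtain b :: "om1 \<times> om1 \<times> nat \<Rightarrow> om1"
    where "inj_on b ((UNIV::om1 set) \<times> ((UNIV::om1 set) \<times> (UNIV::nat set)))"
    using card_of_ordLeq[THEN iffD2] by blast
  then show ?thesis using that by simp
qed

subsection \<open>Diamond\<close>

text \<open>
  Cofinality: iterate a function that dominates \<open>h\<close> on initial segments \<open>\<omega>\<close> times and take the least
  strict upper bound. Closedness is clear, since closure under \<open>h\<close> is inherited by limits.
\<close>

lemma club_of_closure_points:
  fixes h :: "om1 \<Rightarrow> om1"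
  shows "club_omega1 (Rep_om1 ` {a. (\<exists>g. g < a) \<and> (\<forall>g<a. h g < a)})"
proof -
  have ub: "\<exists>b. a < b \<and> (\<forall>g<b. h g < b)" for a
  proof -
    have "\<exists>u. \<forall>g\<le>d. h g < u \<and> d < u" for d
    proof -
      have "countable (insert d (h ` insert d {..<d}))" using countable_lessThan_om1 by blast
      then obtain u where "\<And>x. x \<in> insert d (h ` insert d {..<d}) \<Longrightarrow> x < u"
        using countable_bounded_om1 by blast
      then show ?thesis by (intro exI[of _ u]) (auto simp: le_less)
    qed
    then have "\<forall>d. \<exists>u. \<forall>g\<le>d. h g < u \<and> d < u" by blast
    from choice[OF this] obtain H where "\<forall>d. \<forall>g\<le>d. h g < H d \<and> d < H d" by blast
    then have H: "\<And>d g. g \<le> d \<Longrightarrow> h g < H d" "\<And>d. d < H d" by auto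
    define s where "s n = (H ^^ n) (H a)" for n
    have s: "s (Suc n) = H (s n)" "s 0 = H a" for n by (auto simp: s_def)
    obtain u where u: "\<And>x. x \<in> range s \<Longrightarrow> x < u"
      using countable_bounded_om1[of "range s"] by auto
    define b where "b = (LEAST b. \<forall>n. s n < b)"
    have b: "s n < b" for n
      unfolding b_def by (rule LeastI2[of _ u]) (use u in auto)
    have "h g < b" if g: "g < b" for g
    proof -
      have "\<not> (\<forall>n. s n < g)" using not_less_Least[of g "\<lambda>b. \<forall>n. s n < b"] g b_def by auto
      then obtain n where "g \<le> s n" by (auto simp: not_less)
      then have "h g < H (s n)" using H by blast
      also have "\<dots> < b" using b[of "Suc n"] s by simp
      finally show ?thesis .
    qed
    moreover have "a < b" using H(2)[of a] b[of 0] s by simp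
    ultimately show ?thesis by blast
  qed
  show ?thesis
    unfolding club_omega1_def
  proof (intro conjI ballI impI)
    show "Rep_om1 ` {a. (\<exists>g. g < a) \<and> (\<forall>g<a. h g < a)} \<subseteq> Field omega1"
      using Rep_om1 by auto
  next
    fix a assume "a \<in> Field omega1"
    then obtain a' where a: "a = Rep_om1 a'" by (metis Rep_om1_cases)
    obtain b where b: "a' < b" "\<forall>g<b. h g < b" using ub by blast
    then show "\<exists>\<beta>\<in>Rep_om1 ` {a. (\<exists>g. g < a) \<and> (\<forall>g<a. h g < a)}. a \<in> underS omega1 \<beta>"
      using a less_om1_iff by auto
  next
    fix c assume "c \<in> Field omega1"
     and c: "underS omega1 c \<noteq> {} \<and>
         (\<forall>\<alpha>\<in>underS omega1 c.
             \<exists>\<beta>\<in>Rep_om1 ` {a. (\<exists>g. g < a) \<and> (\<forall>g<a. h g < a)} \<inter> underS omega1 c.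
                \<alpha> \<in> underS omega1 \<beta>)"
    then obtain c' where c': "c = Rep_om1 c'" by (metis Rep_om1_cases)
    have "\<exists>g. g < c'" using c unfolding c' underS_om1 by auto
    moreover have "h g < c'" if "g < c'" for g
    proof -
      have "Rep_om1 g \<in> underS omega1 c" using that c' underS_om1 by simp
      then obtain b where b: "\<forall>g<b. h g < b" "Rep_om1 b \<in> underS omega1 c" "Rep_om1 g \<in> underS omega1 (Rep_om1 b)"
        using c by blast
      then show ?thesis using less_om1_iff c' by (metis less_trans)
    qed
    ultimately show "c \<in> Rep_om1 ` {a. (\<exists>g. g < a) \<and> (\<forall>g<a. h g < a)}" using c' by blast
  qed
qed

text \<open>
  The form in which the diamond principle is used: one sequence of guesses anticipates every array
  \<open>X\<close> of bits indexed by \<open>\<omega>\<^sub>1 \<times> \<omega>\<^sub>1 \<times> \<omega>\<close>, below an ordinal closed under a given function. The array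
  is folded into a subset of \<open>\<omega>\<^sub>1\<close> by an injection, and closedness of \<open>\<alpha>\<close> under this injection lets
  the guess below \<open>\<alpha>\<close> be read as an array below \<open>\<alpha>\<close>.
\<close>

lemma diamond_arrays:
  assumes diamond
  obtains G :: "om1 \<Rightarrow> om1 \<times> om1 \<times> nat \<Rightarrow> bool"
  where "\<And>X h. \<exists>a. (\<exists>g. g < a) \<and> (\<forall>g<a. h g < a) \<and>
            (\<forall>x b n. x < a \<longrightarrow> b < a \<longrightarrow> G a (x, b, n) = X (x, b, n))"
proof -
  obtain A where A: "\<And>X. X \<subseteq> Field omega1 \<Longrightarrow>
       stationary_omega1 {\<alpha> \<in> Field omega1. X \<inter> underS omega1 \<alpha> = A \<alpha>}"
    using assms unfolding diamond_def by blast
  obtain c :: "om1 \<times> om1 \<times> nat \<Rightarrow> om1" where c: "inj c" by (rule inj_om1_triples)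
  define G where "G a t \<longleftrightarrow> Rep_om1 (c t) \<in> A (Rep_om1 a)" for a t
  have "\<exists>a. (\<exists>g. g < a) \<and> (\<forall>g<a. h g < a) \<and>
            (\<forall>x b n. x < a \<longrightarrow> b < a \<longrightarrow> G a (x, b, n) = X (x, b, n))" for X h
  proof -
    have "\<exists>u. h g < u \<and> (\<forall>x\<le>g. \<forall>b\<le>g. \<forall>n. c (x,b,n) < u)" for g
    proof -
      have "countable (insert (h g) (c ` (insert g {..<g} \<times> insert g {..<g} \<times> UNIV)))"
        using countable_lessThan_om1 by auto
      then obtain u where "\<And>x. x \<in> insert (h g) (c ` (insert g {..<g} \<times> insert g {..<g} \<times> UNIV)) \<Longrightarrow> x < u"
        using countable_bounded_om1 by blast
      then show ?thesis by (intro exI[of _ u]) (auto simp: le_less)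
    qed
    then have "\<forall>g. \<exists>u. h g < u \<and> (\<forall>x\<le>g. \<forall>b\<le>g. \<forall>n. c (x,b,n) < u)" by blast
    from choice[OF this] obtain H where "\<forall>g. h g < H g \<and> (\<forall>x\<le>g. \<forall>b\<le>g. \<forall>n. c (x,b,n) < H g)" by blast
    then have H: "\<And>g. h g < H g" "\<And>g x b n. x \<le> g \<Longrightarrow> b \<le> g \<Longrightarrow> c (x,b,n) < H g" by auto
    define XX where "XX = Rep_om1 ` c ` {t. X t}"
    have "XX \<subseteq> Field omega1" unfolding XX_def using Rep_om1 by auto
    then obtain \<alpha> where al: "\<alpha> \<in> Field omega1" "XX \<inter> underS omega1 \<alpha> = A \<alpha>"
        "\<alpha> \<in> Rep_om1 ` {a. (\<exists>g. g < a) \<and> (\<forall>g<a. H g < a)}"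
      using A[of XX] club_of_closure_points[of H] unfolding stationary_omega1_def by blast
    then obtain a where a: "\<alpha> = Rep_om1 a" "\<exists>g. g < a" "\<forall>g<a. H g < a" by blast
    have "G a (x, b, n) = X (x, b, n)" if "x < a" "b < a" for x b n
    proof -
      have "c (x,b,n) < H (max x b)" using H(2) by simp
      also have "\<dots> < a" using a that by simp
      finally have "Rep_om1 (c (x,b,n)) \<in> underS omega1 \<alpha>" using less_om1_iff a by simp
      then have "G a (x,b,n) \<longleftrightarrow> Rep_om1 (c (x,b,n)) \<in> XX" unfolding G_def using al a by auto
      also have "\<dots> \<longleftrightarrow> X (x,b,n)" unfolding XX_def using c by (auto simp: Rep_om1_inject inj_eq)
      finally show ?thesis .
    qed
    moreover have "\<forall>g<a. h g < a" using a H(1) less_trans by blast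
    ultimately show ?thesis using a by blast
  qed
  then show ?thesis using that by blast
qed

section \<open>Cantor cubes\<close>

text \<open>
  For finite \<open>F\<close> these are the basic neighbourhoods of \<open>z\<close> in the product topology.
\<close>

definition nb :: "'c set \<Rightarrow> ('c \<Rightarrow> bool) \<Rightarrow> ('c \<Rightarrow> bool) set" where
  "nb F z = {z'. \<forall>c\<in>F. z' c = z c}"

lemma nb_self [simp]: "z \<in> nb F z"
  by (simp add: nb_def)

lemma nb_empty [simp]: "nb {} z = UNIV"
  by (simp add: nb_def)

lemma nb_mono: "F \<subseteq> G \<Longrightarrow> nb G z \<subseteq> nb F z"
  by (auto simp: nb_def)

lemma nb_Un: "nb (F \<union> G) z = nb F z \<inter> nb G z"
  by (auto simp: nb_def)

lemma nb_insert: "nb (insert c F) z = {z' \<in> nb F z. z' c = z c}"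
  by (auto simp: nb_def)

lemma nb_eq: "z' \<in> nb F z \<Longrightarrow> nb F z' = nb F z"
  by (auto simp: nb_def)

lemma nb_sym: "z' \<in> nb F z \<longleftrightarrow> z \<in> nb F z'"
  by (auto simp: nb_def)

lemma nb_separate:
  assumes "finite A" "x \<notin> A"
  obtains F where "finite F" "nb F x \<inter> A = {}"
proof -
  have "\<exists>c. a c \<noteq> x c" if "a \<in> A" for a
  proof -
    have "a \<noteq> x" using that assms(2) by blast
    then show ?thesis by (rule contrapos_np) auto
  qed
  then obtain g where g: "\<And>a. a \<in> A \<Longrightarrow> a (g a) \<noteq> x (g a)" by metis
  have "nb (g ` A) x \<inter> A = {}" using g by (auto simp: nb_def)
  then show ?thesis using that assms by blast
qed

lemma open_fun_bool_iff: "open U \<longleftrightarrow> (\<forall>z\<in>U. \<exists>F. finite F \<and> nb F z \<subseteq> U)"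
  for U :: "('c \<Rightarrow> bool) set"
proof
  assume U: "open U"
  show "\<forall>z\<in>U. \<exists>F. finite F \<and> nb F z \<subseteq> U"
  proof
    fix z assume "z \<in> U"
    have "openin (product_topology (\<lambda>i::'c. euclidean) UNIV) U" using U by (simp add: open_fun_def)
    from product_topology_open_contains_basis[OF this \<open>z \<in> U\<close>]
    obtain X where X: "z \<in> (\<Pi>\<^sub>E i\<in>UNIV. X i)" "finite {i. X i \<noteq> topspace (euclidean :: bool topology)}" "(\<Pi>\<^sub>E i\<in>UNIV. X i) \<subseteq> U"
      by blast
    have "nb {i. X i \<noteq> topspace (euclidean :: bool topology)} z \<subseteq> (\<Pi>\<^sub>E i\<in>UNIV. X i)"
    proof
      fix z' assume z': "z' \<in> nb {i. X i \<noteq> topspace (euclidean :: bool topology)} z"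
      have "z' i \<in> X i" for i
        using z' X(1) by (cases "X i = UNIV") (auto simp: nb_def PiE_UNIV_domain)
      then show "z' \<in> (\<Pi>\<^sub>E i\<in>UNIV. X i)" by (simp add: PiE_UNIV_domain)
    qed
    then show "\<exists>F. finite F \<and> nb F z \<subseteq> U" using X(2,3) by (meson order_trans)
  qed
next
  assume *: "\<forall>z\<in>U. \<exists>F. finite F \<and> nb F z \<subseteq> U"
  have op: "open (nb F z)" if "finite F" for F and z :: "'c \<Rightarrow> bool"
  proof -
    have "nb F z = (\<Pi>\<^sub>E i\<in>UNIV. if i \<in> F then {z i} else UNIV)"
      by (auto simp: nb_def PiE_UNIV_domain Pi_def split: if_splits)
    moreover have "openin (product_topology (\<lambda>i. euclidean) UNIV) (\<Pi>\<^sub>E i\<in>UNIV. if i \<in> F then {z i} else UNIV)"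
      by (rule product_topology_basis) (auto simp: open_discrete intro: finite_subset[OF _ that])
    ultimately show ?thesis unfolding open_fun_def by simp
  qed
  have "U = \<Union>{nb F z | F z. finite F \<and> nb F z \<subseteq> U}"
  proof (intro equalityI subsetI)
    fix z assume "z \<in> U"
    then obtain F where "finite F" "nb F z \<subseteq> U" using * by blast
    then show "z \<in> \<Union>{nb F z | F z. finite F \<and> nb F z \<subseteq> U}" using nb_self[of z F] by blast
  qed blast
  moreover have "open \<dots>" using op by (intro open_Union) auto
  ultimately show "open U" by simp
qed

lemma open_nb: "finite F \<Longrightarrow> open (nb F z)"
  unfolding open_fun_bool_iff using nb_eq by blast

lemma compact_UNIV_fun_bool: "compact (UNIV :: ('c \<Rightarrow> bool) set)"
proof -
  have "compact_space (product_topology (\<lambda>i::'c. (euclidean :: bool topology)) UNIV)"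
    unfolding compact_space_product_topology
    by (auto simp: compact_space_def finite_imp_compact)
  then show ?thesis
    by (simp add: euclidean_product_topology compact_space_def)
qed

lemma compact_eq_closed_fun_bool: "closed V \<Longrightarrow> compact (V :: ('c \<Rightarrow> bool) set)"
  using compact_Int_closed[OF compact_UNIV_fun_bool] by fastforce

lemma t2_fun_bool: "x \<noteq> y \<Longrightarrow> \<exists>c. x c \<noteq> (y :: 'c \<Rightarrow> bool) c"
  by (rule ccontr) auto

subsection \<open>Splitting a point\<close>

text \<open>
  A requirement is an upward closed family of subsets of \<open>V\<close> that contains sets which come
  arbitrarily close to \<open>x\<close> but stay off a neighbourhood of \<open>x\<close>. Countably many requirements can be
  met simultaneously on both sides of one partition of \<open>V - {x}\<close> into two relatively clopen pieces:
  cut a neighbourhood of \<open>x\<close> into consecutive annuli, let the annulus number \<open>n\<close> meet the \<open>n\<close>-th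
  entry of a list in which every pair (requirement, side) recurs infinitely often, and put it on the
  side named there.
\<close>

lemma split_point:
  fixes V :: "('c \<Rightarrow> bool) set" and R :: "(('c \<Rightarrow> bool) set \<Rightarrow> bool) set"
  assumes C: "countable C" "\<And>z c. z \<in> V \<Longrightarrow> c \<notin> C \<Longrightarrow> \<not> z c"
    and x: "x \<in> V" and R: "countable R"
    and mono: "\<And>\<rho> A B. \<rho> \<in> R \<Longrightarrow> \<rho> A \<Longrightarrow> A \<subseteq> B \<Longrightarrow> \<rho> B"
    and step: "\<And>\<rho> F. \<rho> \<in> R \<Longrightarrow> finite F \<Longrightarrow> \<exists>F'. finite F' \<and> \<rho> (V \<inter> nb F x - nb F' x)"
  obtains side where
    "\<And>z. z \<in> V \<Longrightarrow> z \<noteq> x \<Longrightarrow> \<exists>F. finite F \<and> (\<forall>z'\<in>V \<inter> nb F z. z' \<noteq> x \<and> side z' = side z)"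
    "\<And>\<rho> F b. \<rho> \<in> R \<Longrightarrow> finite F \<Longrightarrow> \<rho> {z \<in> V \<inter> nb F x. z \<noteq> x \<and> side z = (b::bool)}"
proof -
  \<comment> \<open>the trivial requirement serves as a default in case there are no others\<close>
  define R' where "R' = insert (\<lambda>_. True) R"
  define E where "E = R' \<times> (UNIV::bool set)"
  have E: "countable E" "E \<noteq> {}" using R by (auto simp: E_def R'_def)
  define e where "e n = from_nat_into E (fst (prod_decode n))" for n
  have e_in: "e n \<in> E" for n unfolding e_def using E by (simp add: from_nat_into)
  have e_rec: "\<exists>n\<ge>N. e n = q" if "q \<in> E" for q N
    using that E by (intro exI[of _ "prod_encode (to_nat_on E q, N)"]) (auto simp: e_def le_prod_encode_2)
  have C': "countable (insert undefined C)" using C by simp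
  define cc where "cc = from_nat_into (insert undefined C)"
  have cc: "\<exists>n. cc n = c" if "c \<in> C" for c
    using that C' unfolding cc_def by (metis from_nat_into_surj insertI2)
  define ext where "ext n F = (SOME F'. finite F' \<and> fst (e n) (V \<inter> nb F x - nb F' x))" for n F
  have ext: "finite (ext n F)" "fst (e n) (V \<inter> nb F x - nb (ext n F) x)" if "finite F" for n F
  proof -
    have "\<exists>F'. finite F' \<and> fst (e n) (V \<inter> nb F x - nb F' x)"
      using e_in[of n] step[OF _ that] unfolding E_def R'_def by auto
    then have "finite (ext n F) \<and> fst (e n) (V \<inter> nb F x - nb (ext n F) x)"
      unfolding ext_def by (rule someI_ex)
    then show "finite (ext n F)" "fst (e n) (V \<inter> nb F x - nb (ext n F) x)" by auto
  qed
  define Fs where "Fs = rec_nat {} (\<lambda>n F. F \<union> {cc n} \<union> ext n F)"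
  have Fs: "Fs 0 = {}" "Fs (Suc n) = Fs n \<union> {cc n} \<union> ext n (Fs n)" for n by (auto simp: Fs_def)
  have fin: "finite (Fs n)" for n by (induction n) (auto simp: Fs ext)
  have Fmono: "m \<le> n \<Longrightarrow> Fs m \<subseteq> Fs n" for m n
    by (rule lift_Suc_mono_le[of Fs]) (auto simp: Fs)
  have annulus: "fst (e n) (V \<inter> nb (Fs n) x - nb (Fs (Suc n)) x)" for n
  proof -
    have sub: "V \<inter> nb (Fs n) x - nb (ext n (Fs n)) x \<subseteq> V \<inter> nb (Fs n) x - nb (Fs (Suc n)) x"
      using nb_mono[of "ext n (Fs n)" "Fs (Suc n)" x] by (auto simp: Fs(2))
    show ?thesis
      using mono[of "fst (e n)", OF _ ext(2)[OF fin, of n n] sub] e_in[of n] by (auto simp: E_def R'_def)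
  qed
  define level where "level z = (LEAST n. z \<notin> nb (Fs (Suc n)) x)" for z
  define side where "side z = snd (e (level z))" for z
  have level: "z \<notin> nb (Fs (Suc (level z))) x" if z: "z \<in> V" "z \<noteq> x" for z
  proof -
    obtain c where c: "z c \<noteq> x c" using t2_fun_bool[OF z(2)] by auto
    then have "c \<in> C" using C(2)[OF z(1)] C(2)[OF x] by blast
    then obtain n where "cc n = c" using cc by blast
    then have "z \<notin> nb (Fs (Suc n)) x" using c by (auto simp: nb_def Fs)
    then show ?thesis unfolding level_def by (rule LeastI)
  qed
  have below: "z \<in> nb (Fs (level z)) x" for z
  proof (cases "level z")
    case (Suc n)
    then have "\<not> z \<notin> nb (Fs (Suc n)) x" unfolding level_def by (intro not_less_Least) auto
    then show ?thesis using Suc by simp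
  qed (simp add: Fs)
  have levelI: "level z = n" if "z \<in> nb (Fs n) x" "z \<notin> nb (Fs (Suc n)) x" for z n
    unfolding level_def
  proof (rule Least_equality)
    fix m assume m: "z \<notin> nb (Fs (Suc m)) x"
    show "n \<le> m"
    proof (rule ccontr)
      assume "\<not> n \<le> m"
      then have "Fs (Suc m) \<subseteq> Fs n" by (intro Fmono) auto
      then show False using m that(1) nb_mono by blast
    qed
  qed (use that in auto)
  show ?thesis
  proof (rule that[of side])
    fix z assume z: "z \<in> V" "z \<noteq> x"
    have "z' \<noteq> x \<and> side z' = side z" if "z' \<in> nb (Fs (Suc (level z))) z" for z'
    proof -
      have "z' \<in> nb (Fs (level z)) z" using that nb_mono[OF Fmono[of "level z" "Suc (level z)"]] by auto
      then have 1: "z' \<in> nb (Fs (level z)) x" using below[of z] nb_eq by blast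
      have 2: "z' \<notin> nb (Fs (Suc (level z))) x" using level[OF z] that nb_eq by (metis nb_self)
      have "level z' = level z" by (rule levelI[OF 1 2])
      then show ?thesis using 2 by (auto simp: side_def)
    qed
    then show "\<exists>F. finite F \<and> (\<forall>z'\<in>V \<inter> nb F z. z' \<noteq> x \<and> side z' = side z)" using fin by blast
  next
    fix \<rho> F b assume r: "\<rho> \<in> R" and F: "finite (F :: 'c set)"
    have "\<forall>c\<in>F \<inter> C. \<exists>n. cc n = c" using cc by auto
    then obtain g where g: "\<And>c. c \<in> F \<inter> C \<Longrightarrow> cc (g c) = c" by metis
    obtain N where N: "\<And>c. c \<in> F \<inter> C \<Longrightarrow> g c < N"
      using finite_nat_bounded[of "g ` (F \<inter> C)"] F by blast
    obtain n where n: "n \<ge> N" "e n = (\<rho>, b)" using e_rec[of "(\<rho>, b)" N] r by (auto simp: E_def R'_def)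
    have FC: "F \<inter> C \<subseteq> Fs n"
    proof
      fix c assume c: "c \<in> F \<inter> C"
      then have "c \<in> Fs (Suc (g c))" using g by (auto simp: Fs)
      then show "c \<in> Fs n" using Fmono[of "Suc (g c)" n] N[OF c] n by auto
    qed
    have "V \<inter> nb (Fs n) x - nb (Fs (Suc n)) x \<subseteq> {z \<in> V \<inter> nb F x. z \<noteq> x \<and> side z = b}"
    proof
      fix z assume z: "z \<in> V \<inter> nb (Fs n) x - nb (Fs (Suc n)) x"
      then have "level z = n" by (intro levelI) auto
      moreover have "z \<in> nb F x"
        using z FC C(2)[of z] C(2)[OF x] by (fastforce simp: nb_def)
      ultimately show "z \<in> {z \<in> V \<inter> nb F x. z \<noteq> x \<and> side z = b}"
        using z n by (auto simp: side_def)
    qed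
    then show "\<rho> {z \<in> V \<inter> nb F x. z \<noteq> x \<and> side z = b}"
      using mono[OF r _ ] annulus[of n] n by auto
  qed
qed

section \<open>Finite actions that detect reduced words\<close>

text \<open>A letter \<open>(r, True)\<close> stands for the generator \<open>r\<close> of a free group, and \<open>(r, False)\<close> for its inverse.\<close>

definition reduced_word :: "('a \<times> bool) list \<Rightarrow> bool" where
  "reduced_word w \<longleftrightarrow> successively (\<lambda>x y. fst x = fst y \<longrightarrow> snd x = snd y) w"

lemma reduced_word_Nil [simp]: "reduced_word []"
  and reduced_word_Cons: "reduced_word (a # w) \<longleftrightarrow> (w = [] \<or> (fst a = fst (hd w) \<longrightarrow> snd a = snd (hd w))) \<and> reduced_word w"
  by (auto simp: reduced_word_def successively_Cons)

lemma extend_to_bij: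
  assumes "finite B" "D \<subseteq> B" "inj_on f D" "f ` D \<subseteq> B"
  obtains g where "bij_betw g B B" "\<And>x. x \<in> D \<Longrightarrow> g x = f x"
proof -
  have "card (B - D) = card (B - f ` D)"
    using assms by (simp add: card_Diff_subset card_image finite_subset)
  then obtain h where h: "bij_betw h (B - D) (B - f ` D)"
    using assms by (metis finite_Diff finite_same_card_bij)
  define g where "g x = (if x \<in> D then f x else h x)" for x
  have "bij_betw g D (f ` D)"
    using assms(3) by (auto simp: g_def bij_betw_def inj_on_def)
  moreover have "bij_betw g (B - D) (B - f ` D)"
    using h by (rule bij_betw_cong[THEN iffD1, rotated]) (auto simp: g_def)
  ultimately have "bij_betw g (D \<union> (B - D)) (f ` D \<union> (B - f ` D))"
    by (rule bij_betw_combine) auto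
  moreover have "D \<union> (B - D) = B" "f ` D \<union> (B - f ` D) = B" using assms by auto
  ultimately show ?thesis using that[of g] by (simp add: g_def)
qed

text \<open>
  Residual finiteness of free groups, by the classical argument: left multiplication by a generator
  is a partial injection on the finite set of reduced words of length at most \<open>k\<close>; extend it to a
  permutation. A reduced word of length at most \<open>k\<close> then sends the empty word to the reduced word
  itself.
\<close>

lemma words_detected:
  assumes A: "finite (A :: 'a set)"
  obtains B :: "('a \<times> bool) list set" and \<pi> where
    "finite B" "[] \<in> B" "\<And>a. bij_betw (\<pi> a) B B"
    "\<And>t s w. w \<in> B \<Longrightarrow> \<pi> (t, s) (\<pi> (t, \<not> s) w) = w"
    "\<And>w. reduced_word w \<Longrightarrow> set w \<subseteq> A \<times> UNIV \<Longrightarrow> length w \<le> k \<Longrightarrow> foldr \<pi> w [] = w"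
proof -
  define B where "B = {w :: ('a \<times> bool) list. set w \<subseteq> A \<times> UNIV \<and> length w \<le> k \<and> reduced_word w}"
  have finB: "finite B"
    by (rule finite_subset[OF _ finite_lists_length_le[of "A \<times> UNIV" k]]) (use A in \<open>auto simp: B_def\<close>)
  define D where "D t = {w \<in> B. if w \<noteq> [] \<and> hd w = (t, False) then True else t \<in> A \<and> length w < k}" for t
  define f where "f t w = (if w \<noteq> [] \<and> hd w = (t, False) then tl w else (t, True) # w)" for t :: 'a and w
  have fB: "f t ` D t \<subseteq> B" for t
  proof
    fix v assume "v \<in> f t ` D t"
    then obtain w where w: "w \<in> D t" "v = f t w" by auto
    show "v \<in> B"
    proof (cases "w \<noteq> [] \<and> hd w = (t, False)")
      case True
      then obtain w' where "w = (t, False) # w'" by (cases w) auto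
      then show ?thesis using w by (auto simp: f_def D_def B_def reduced_word_Cons)
    next
      case False
      then show ?thesis using w by (cases w) (auto simp: f_def D_def B_def reduced_word_Cons)
    qed
  qed
  have no: "\<not> (w' \<noteq> [] \<and> hd w' = (t, True))" if "(t, False) # w' \<in> B" for t w'
    using that by (cases w') (auto simp: B_def reduced_word_Cons)
  have inj: "inj_on (f t) (D t)" for t
  proof (rule inj_onI)
    fix v w assume vw: "v \<in> D t" "w \<in> D t" "f t v = f t w"
    have B: "v \<in> B" "w \<in> B" using vw by (auto simp: D_def)
    consider (a) "v \<noteq> [] \<and> hd v = (t, False)" "w \<noteq> [] \<and> hd w = (t, False)"
      | (b) "v \<noteq> [] \<and> hd v = (t, False)" "\<not> (w \<noteq> [] \<and> hd w = (t, False))"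
      | (c) "\<not> (v \<noteq> [] \<and> hd v = (t, False))" "w \<noteq> [] \<and> hd w = (t, False)"
      | (d) "\<not> (v \<noteq> [] \<and> hd v = (t, False))" "\<not> (w \<noteq> [] \<and> hd w = (t, False))" by blast
    then show "v = w"
    proof cases
      case a
      then show ?thesis using vw(3) by (cases v; cases w) (auto simp: f_def)
    next
      case b
      then obtain v' where v: "v = (t, False) # v'" by (cases v) auto
      then have "v' = (t, True) # w" using vw(3) b by (auto simp: f_def)
      then show ?thesis using no[of t v'] v B by auto
    next
      case c
      then obtain w' where w: "w = (t, False) # w'" by (cases w) auto
      then have "w' = (t, True) # v" using vw(3) c by (auto simp: f_def)
      then show ?thesis using no[of t w'] w B by auto
    next
      case d
      then show ?thesis using vw(3) by (simp only: f_def if_False list.inject) 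
    qed
  qed
  have "\<exists>g. bij_betw g B B \<and> (\<forall>x\<in>D t. g x = f t x)" for t
  proof -
    have DB: "D t \<subseteq> B" by (auto simp: D_def)
    obtain g where "bij_betw g B B" "\<And>x. x \<in> D t \<Longrightarrow> g x = f t x"
      using extend_to_bij[OF finB DB inj fB] by blast
    then show ?thesis by blast
  qed
  then obtain g where g: "\<And>t. bij_betw (g t) B B" "\<And>t x. x \<in> D t \<Longrightarrow> g t x = f t x" by metis
  define \<pi> where "\<pi> a = (if snd a then g (fst a) else inv_into B (g (fst a)))" for a
  have bij: "bij_betw (\<pi> a) B B" for a
    using g(1)[of "fst a"] by (auto simp: \<pi>_def bij_betw_inv_into)
  have inv: "\<pi> (t, s) (\<pi> (t, \<not> s) w) = w" if "w \<in> B" for t s w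
    using that g(1)[of t] by (cases s) (auto simp: \<pi>_def bij_betw_def f_inv_into_f)
  have main: "foldr \<pi> w [] = w" if "reduced_word w" "set w \<subseteq> A \<times> UNIV" "length w \<le> k" for w
    using that
  proof (induction w)
    case (Cons a w)
    then have IH: "foldr \<pi> w [] = w" and red: "reduced_word (a # w)" by (auto simp: reduced_word_Cons)
    obtain t s where a: "a = (t, s)" by force
    have wB: "w \<in> B" "a # w \<in> B" using Cons.prems by (auto simp: B_def reduced_word_Cons)
    have "\<pi> a w = a # w"
    proof (cases s)
      case True
      have nh: "\<not> (w \<noteq> [] \<and> hd w = (t, False))" using red True a by (auto simp: reduced_word_Cons)
      have "w \<in> D t" using wB Cons.prems nh a by (auto simp: D_def)
      then show ?thesis using g(2)[of w t] nh True a by (simp add: \<pi>_def f_def)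
    next
      case False
      have "a # w \<in> D t" using wB False a by (auto simp: D_def)
      then have "g t (a # w) = w" using g(2) False a by (simp add: f_def)
      then show ?thesis using False a wB g(1)[of t] by (auto simp: \<pi>_def bij_betw_def intro!: inv_into_f_eq)
    qed
    then show ?case using IH by simp
  qed simp
  show ?thesis using that[of B \<pi>] finB bij inv main by (auto simp: B_def)
qed

text \<open>
  The left translation action of the permutation group obtained before turns "moves one point" into
  "moves every point". Here this group is represented by the enumerations of \<open>B\<close>, and these are
  numbered in order to have labels that are natural numbers. At level \<open>k\<close> only the first \<open>k\<close> bits of
  a generator \<open>r\<close> are read; so for each reduced word in the continuum many generators almost all
  levels see that it is reduced.
\<close>

theorem free_labels:
  obtains N :: "nat \<Rightarrow> nat" and \<sigma> :: "nat set \<times> bool \<Rightarrow> nat \<Rightarrow> nat \<Rightarrow> nat" where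
    "\<And>k. 0 < N k"
    "\<And>a k. bij_betw (\<sigma> a k) {..<N k} {..<N k}"
    "\<And>r s k l. l < N k \<Longrightarrow> \<sigma> (r, s) k (\<sigma> (r, \<not> s) k l) = l"
    "\<And>w. reduced_word w \<Longrightarrow> w \<noteq> [] \<Longrightarrow> \<exists>k0. \<forall>k\<ge>k0. \<forall>l<N k. foldr (\<lambda>a. \<sigma> a k) w l \<noteq> l"
proof -
  have "\<exists>(n::nat) \<tau>. 0 < n \<and> (\<forall>a. bij_betw (\<tau> a) {..<n} {..<n}) \<and> (\<forall>r s. \<forall>l<n. \<tau> (r, s) (\<tau> (r, \<not> s) l) = l) \<and>
     (\<forall>w. reduced_word w \<longrightarrow> w \<noteq> [] \<longrightarrow> set w \<subseteq> Pow {..<k} \<times> UNIV \<longrightarrow> length w \<le> k \<longrightarrow> (\<forall>l<n. foldr \<tau> w l \<noteq> l))"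
    for k :: nat
  proof -
    have "finite (Pow {..<k})" by simp
    then obtain B :: "(nat set \<times> bool) list set" and \<pi> where B:
      "finite B" "[] \<in> B" and bij: "\<And>a. bij_betw (\<pi> a) B B"
      and inv: "\<And>t s w. w \<in> B \<Longrightarrow> \<pi> (t, s) (\<pi> (t, \<not> s) w) = w"
      and det: "\<And>w. reduced_word w \<Longrightarrow> set w \<subseteq> Pow {..<k} \<times> UNIV \<Longrightarrow> length w \<le> k \<Longrightarrow> foldr \<pi> w [] = w"
      by (rule words_detected[where k = k]) blast
    define Q where "Q = {xs. distinct xs \<and> set xs = B}"
    have "finite Q" "Q \<noteq> {}"
      using finite_subset_distinct[OF B(1)] finite_distinct_list[OF B(1)] unfolding Q_def
      by (auto elim!: rev_finite_subset)
    define n where "n = card Q"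
    obtain h where h: "bij_betw h {..<n} Q"
      using ex_bij_betw_nat_finite[OF \<open>finite Q\<close>] by (auto simp: n_def atLeast0LessThan)
    have hQ: "h l \<in> Q" if "l < n" for l using h that by (auto simp: bij_betw_def)
    define h' where "h' = inv_into {..<n} h"
    have h'1: "h' (h l) = l" if "l < n" for l unfolding h'_def using h that by (auto simp: bij_betw_def)
    have h'2: "h (h' xs) = xs" "h' xs < n" if "xs \<in> Q" for xs 
      unfolding h'_def using h that f_inv_into_f[of xs h "{..<n}"] inv_into_into[of xs h "{..<n}"]
      by (auto simp: bij_betw_def)
    have map_Q: "map p xs \<in> Q" if "bij_betw p B B" "xs \<in> Q" for p xs
      using that by (auto simp: Q_def bij_betw_def distinct_map)
    define \<tau> where "\<tau> a l = h' (map (\<pi> a) (h l))" for a l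
    have \<tau>n: "\<tau> a l < n" if "l < n" for a l unfolding \<tau>_def using h'2 map_Q[OF bij hQ[OF that]] by blast
    have h\<tau>: "h (\<tau> a l) = map (\<pi> a) (h l)" if "l < n" for a l
      unfolding \<tau>_def using h'2 map_Q[OF bij hQ[OF that]] by blast
    have inv\<tau>: "\<tau> (r, s) (\<tau> (r, \<not> s) l) = l" if "l < n" for r s l
    proof -
      have "map (\<pi> (r, s) \<circ> \<pi> (r, \<not> s)) (h l) = h l"
        using hQ[OF that] inv by (auto simp: Q_def intro!: map_idI)
      then have "h (\<tau> (r, s) (\<tau> (r, \<not> s) l)) = h l" using h\<tau> \<tau>n that by simp
      then show ?thesis using h'1 \<tau>n that by metis
    qed
    have "bij_betw (\<tau> a) {..<n} {..<n}" for a
    proof (rule bij_betw_byWitness[where f' = "\<tau> (fst a, \<not> snd a)"])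
      show "\<forall>l\<in>{..<n}. \<tau> (fst a, \<not> snd a) (\<tau> a l) = l"
        using inv\<tau>[of _ "fst a" "\<not> snd a"] by simp
      show "\<forall>l\<in>{..<n}. \<tau> a (\<tau> (fst a, \<not> snd a) l) = l"
        using inv\<tau>[of _ "fst a" "snd a"] by simp
    qed (auto dest: \<tau>n[of _ a] \<tau>n[of _ "(fst a, \<not> snd a)"])
    moreover have "foldr \<tau> w l \<noteq> l" if w: "reduced_word w" "w \<noteq> []" "set w \<subseteq> Pow {..<k} \<times> UNIV" "length w \<le> k" "l < n" for w l
    proof -
      have "foldr \<tau> w l < n \<and> h (foldr \<tau> w l) = map (foldr \<pi> w) (h l)"
        using w(5) by (induction w) (auto simp: \<tau>n h\<tau> map_idI)
      then have *: "h (foldr \<tau> w l) = map (foldr \<pi> w) (h l)" by blast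
      have "[] \<in> set (h l)" using hQ[OF w(5)] B by (auto simp: Q_def)
      moreover have "foldr \<pi> w [] \<noteq> []" using det[OF w(1,3,4)] w(2) by simp
      ultimately have "map (foldr \<pi> w) (h l) \<noteq> h l" using map_eq_conv[of "foldr \<pi> w" "h l" id] by auto
      then show ?thesis using * by auto
    qed
    moreover have "0 < n" using \<open>finite Q\<close> \<open>Q \<noteq> {}\<close> by (auto simp: n_def card_gt_0_iff)
    ultimately have "0 < n \<and> (\<forall>a. bij_betw (\<tau> a) {..<n} {..<n}) \<and> (\<forall>r s. \<forall>l<n. \<tau> (r, s) (\<tau> (r, \<not> s) l) = l) \<and>
     (\<forall>w. reduced_word w \<longrightarrow> w \<noteq> [] \<longrightarrow> set w \<subseteq> Pow {..<k} \<times> UNIV \<longrightarrow> length w \<le> k \<longrightarrow> (\<forall>l<n. foldr \<tau> w l \<noteq> l))"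
      using inv\<tau> by simp
    then show ?thesis by blast
  qed
  note ex = this
  have "\<exists>n\<tau> :: nat \<times> (nat set \<times> bool \<Rightarrow> nat \<Rightarrow> nat). 0 < fst n\<tau> \<and> (\<forall>a. bij_betw (snd n\<tau> a) {..<fst n\<tau>} {..<fst n\<tau>}) \<and>
     (\<forall>r s. \<forall>l<fst n\<tau>. snd n\<tau> (r, s) (snd n\<tau> (r, \<not> s) l) = l) \<and>
     (\<forall>w. reduced_word w \<longrightarrow> w \<noteq> [] \<longrightarrow> set w \<subseteq> Pow {..<k} \<times> UNIV \<longrightarrow> length w \<le> k \<longrightarrow>
        (\<forall>l<fst n\<tau>. foldr (snd n\<tau>) w l \<noteq> l))" for k :: nat
  proof -
    from ex[of k] obtain n :: nat and \<tau> where nt: "0 < n \<and> (\<forall>a. bij_betw (\<tau> a) {..<n} {..<n}) \<and> (\<forall>r s. \<forall>l<n. \<tau> (r, s) (\<tau> (r, \<not> s) l) = l) \<and>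
     (\<forall>w. reduced_word w \<longrightarrow> w \<noteq> [] \<longrightarrow> set w \<subseteq> Pow {..<k} \<times> UNIV \<longrightarrow> length w \<le> k \<longrightarrow> (\<forall>l<n. foldr \<tau> w l \<noteq> l))"
      by (elim exE)
    show ?thesis using nt by (intro exI[of _ "(n, \<tau>)"]) simp
  qed
  then have "\<forall>k. \<exists>n\<tau> :: nat \<times> (nat set \<times> bool \<Rightarrow> nat \<Rightarrow> nat). 0 < fst n\<tau> \<and> (\<forall>a. bij_betw (snd n\<tau> a) {..<fst n\<tau>} {..<fst n\<tau>}) \<and>
     (\<forall>r s. \<forall>l<fst n\<tau>. snd n\<tau> (r, s) (snd n\<tau> (r, \<not> s) l) = l) \<and>
     (\<forall>w. reduced_word w \<longrightarrow> w \<noteq> [] \<longrightarrow> set w \<subseteq> Pow {..<k} \<times> UNIV \<longrightarrow> length w \<le> k \<longrightarrow>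
        (\<forall>l<fst n\<tau>. foldr (snd n\<tau>) w l \<noteq> l))" by blast
  from choice[OF this] obtain n\<tau> :: "nat \<Rightarrow> nat \<times> (nat set \<times> bool \<Rightarrow> nat \<Rightarrow> nat)" where n\<tau>:
    "\<forall>k. 0 < fst (n\<tau> k) \<and> (\<forall>a. bij_betw (snd (n\<tau> k) a) {..<fst (n\<tau> k)} {..<fst (n\<tau> k)}) \<and>
     (\<forall>r s. \<forall>l<fst (n\<tau> k). snd (n\<tau> k) (r, s) (snd (n\<tau> k) (r, \<not> s) l) = l) \<and>
     (\<forall>w. reduced_word w \<longrightarrow> w \<noteq> [] \<longrightarrow> set w \<subseteq> Pow {..<k} \<times> UNIV \<longrightarrow> length w \<le> k \<longrightarrow>
        (\<forall>l<fst (n\<tau> k). foldr (snd (n\<tau> k)) w l \<noteq> l))"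
    by (rule exE)
  define N \<tau> where "N k = fst (n\<tau> k)" and "\<tau> k = snd (n\<tau> k)" for k
  have NT: "\<And>k::nat. 0 < N k" "\<And>k a. bij_betw (\<tau> k a) {..<N k} {..<N k}"
     "\<And>k r s l. l < N k \<Longrightarrow> \<tau> k (r, s) (\<tau> k (r, \<not> s) l) = l"
     "\<And>k w l. reduced_word w \<Longrightarrow> w \<noteq> [] \<Longrightarrow> set w \<subseteq> Pow {..<k} \<times> UNIV \<Longrightarrow> length w \<le> k \<Longrightarrow> l < N k \<Longrightarrow> foldr (\<tau> k) w l \<noteq> l"
    using n\<tau> unfolding N_def \<tau>_def by blast+
  define \<sigma> where "\<sigma> a k = \<tau> k (fst a \<inter> {..<k}, snd a)" for a k
  have "\<exists>k0. \<forall>k\<ge>k0. \<forall>l<N k. foldr (\<lambda>a. \<sigma> a k) w l \<noteq> l" if w: "reduced_word w" "w \<noteq> []" for w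
  proof -
    \<comment> \<open>beyond \<open>k0\<close> the truncations of the generators in \<open>w\<close> are distinct\<close>
    have "\<exists>d. \<forall>r\<in>fst ` set w. \<forall>r'\<in>fst ` set w. r \<noteq> r' \<longrightarrow> (\<exists>m<d. m \<in> r \<longleftrightarrow> m \<notin> r')"
    proof -
      have "\<forall>p\<in>{p \<in> fst ` set w \<times> fst ` set w. fst p \<noteq> snd p}. \<exists>m. m \<in> fst p \<longleftrightarrow> m \<notin> snd p" by auto
      from bchoice[OF this] obtain g where
        "\<forall>p\<in>{p \<in> fst ` set w \<times> fst ` set w. fst p \<noteq> snd p}. g p \<in> fst p \<longleftrightarrow> g p \<notin> snd p" by (rule exE)
      then have g: "\<And>p. p \<in> {p \<in> fst ` set w \<times> fst ` set w. fst p \<noteq> snd p} \<Longrightarrow> g p \<in> fst p \<longleftrightarrow> g p \<notin> snd p"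
        by blast
      have "finite (g ` {p \<in> fst ` set w \<times> fst ` set w. fst p \<noteq> snd p})" by auto
      then obtain d where d: "g ` {p \<in> fst ` set w \<times> fst ` set w. fst p \<noteq> snd p} \<subseteq> {..<d}"
        using finite_nat_bounded by blast
      have "\<exists>m<d. m \<in> r \<longleftrightarrow> m \<notin> r'" if rr: "r \<in> fst ` set w" "r' \<in> fst ` set w" "r \<noteq> r'" for r r'
      proof -
        have "(r, r') \<in> {p \<in> fst ` set w \<times> fst ` set w. fst p \<noteq> snd p}" using rr by auto
        note rr' = this
        have "g (r, r') < d" using d imageI[OF rr', of g] by blast
        moreover have "g (r, r') \<in> r \<longleftrightarrow> g (r, r') \<notin> r'" using g[OF rr'] by simp
        ultimately have "g (r, r') < d \<and> (g (r, r') \<in> r \<longleftrightarrow> g (r, r') \<notin> r')" by blast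
        then show ?thesis by blast
      qed
      then show ?thesis by blast
    qed
    then obtain d where d: "\<forall>r\<in>fst ` set w. \<forall>r'\<in>fst ` set w. r \<noteq> r' \<longrightarrow> (\<exists>m<d. m \<in> r \<longleftrightarrow> m \<notin> r')"
      by (rule exE)
    have "foldr (\<lambda>a. \<sigma> a k) w l \<noteq> l" if k: "k \<ge> max d (length w)" and l: "l < N k" for k l
    proof -
      define tr where "tr = (\<lambda>a :: nat set \<times> bool. (fst a \<inter> {..<k}, snd a))"
      have inj: "inj_on (\<lambda>r. r \<inter> {..<k}) (fst ` set w)"
      proof (rule inj_onI, rule ccontr)
        fix r r' assume rr: "r \<in> fst ` set w" "r' \<in> fst ` set w" "r \<inter> {..<k} = r' \<inter> {..<k}" "r \<noteq> r'"
        from d[rule_format, OF rr(1,2,4)] obtain m where m: "m < d" "m \<in> r \<longleftrightarrow> m \<notin> r'" by blast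
        then have "m \<in> {..<k}" using k by auto
        then show False using rr(3) m(2) by blast
      qed
      have "reduced_word (map tr v)" if "reduced_word v" "set v \<subseteq> set w" for v
        using that
      proof (induction v)
        case (Cons a v)
        show ?case
        proof (cases v)
          case (Cons b u)
          have "fst a = fst b" if "fst a \<inter> {..<k} = fst b \<inter> {..<k}"
            using inj_onD[OF inj that] Cons.prems Cons by auto
          then show ?thesis using Cons.IH Cons.prems Cons by (auto simp: reduced_word_Cons tr_def)
        qed (simp add: reduced_word_Cons)
      qed simp
      then have "foldr (\<tau> k) (map tr w) l \<noteq> l"
        using w l k by (intro NT(4)) (auto simp: tr_def)
      moreover have "foldr (\<tau> k) (map tr v) l = foldr (\<lambda>a. \<sigma> a k) v l" for v
        by (induction v) (simp_all add: \<sigma>_def tr_def)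
      ultimately show ?thesis by simp
    qed
    then show ?thesis by blast
  qed
  then show ?thesis
    by (intro that[of N \<sigma>]) (auto simp: NT \<sigma>_def)
qed

section \<open>Homeomorphisms that shift labels\<close>

text \<open>Compactness turns local determination by finitely many coordinates into a uniform one.\<close>

lemma compact_nb_cover:
  assumes "compact V" "\<And>z. z \<in> V \<Longrightarrow> finite (F z)"
  obtains A where "finite A" "A \<subseteq> V" "V \<subseteq> (\<Union>z\<in>A. nb (F z) z)"
proof -
  have op: "\<And>z. z \<in> V \<Longrightarrow> open (nb (F z) z)" using assms(2) open_nb by blast
  have "V \<subseteq> (\<Union>z\<in>V. nb (F z) z)" by auto
  from compactE_image[OF assms(1) op this] obtain A where "A \<subseteq> V" "finite A" "V \<subseteq> (\<Union>z\<in>A. nb (F z) z)" by metis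
  then show ?thesis using that by metis
qed

lemma locally_constant_uniform:
  assumes "compact V" "\<And>z. z \<in> V \<Longrightarrow> \<exists>F. finite F \<and> (\<forall>z'\<in>V \<inter> nb F z. Q z' = Q z)"
  obtains F where "finite F" "\<forall>z\<in>V. \<forall>z'\<in>V \<inter> nb F z. Q z' = Q z"
proof -
  have "\<forall>z\<in>V. \<exists>F. finite F \<and> (\<forall>z'\<in>V \<inter> nb F z. Q z' = Q z)" using assms(2) by blast
  from bchoice[OF this] obtain f where
    f0: "\<forall>z\<in>V. finite (f z) \<and> (\<forall>z'\<in>V \<inter> nb (f z) z. Q z' = Q z)" by (rule exE)
  then have f: "\<And>z. z \<in> V \<Longrightarrow> finite (f z)" "\<And>z z'. z \<in> V \<Longrightarrow> z' \<in> V \<Longrightarrow> z' \<in> nb (f z) z \<Longrightarrow> Q z' = Q z"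
    by blast+
  obtain A where A: "finite A" "A \<subseteq> V" "V \<subseteq> (\<Union>z\<in>A. nb (f z) z)"
    by (rule compact_nb_cover[OF assms(1), of f, OF f(1)])
  have "Q z' = Q z" if z: "z \<in> V" "z' \<in> V" "z' \<in> nb (\<Union>(f ` A)) z" for z z'
  proof -
    obtain p where p: "p \<in> A" "z \<in> nb (f p) p" using A z by auto
    have "z' \<in> nb (f p) z" using z(3) p(1) by (auto simp: nb_def)
    then have "z' \<in> nb (f p) p" using p(2) nb_eq by blast
    then show ?thesis using f(2)[of p z] f(2)[of p z'] p A z by auto
  qed
  moreover have "finite (\<Union>(f ` A))" using A f by auto
  ultimately show ?thesis using that by blast
qed

definition finitely_determined :: "('c \<Rightarrow> bool) set \<Rightarrow> ('c \<Rightarrow> bool) set \<Rightarrow> bool" where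
  "finitely_determined V D \<longleftrightarrow> D \<subseteq> V \<and> (\<exists>F. finite F \<and> (\<forall>z\<in>V. \<forall>z'\<in>V \<inter> nb F z. z \<in> D \<longrightarrow> z' \<in> D))"

lemma finitely_determinedI:
  assumes "D \<subseteq> V" "finite F" "\<And>z z'. z \<in> V \<Longrightarrow> z' \<in> V \<Longrightarrow> z' \<in> nb F z \<Longrightarrow> z \<in> D \<Longrightarrow> z' \<in> D"
  shows "finitely_determined V D"
  using assms unfolding finitely_determined_def by blast

lemma finitely_determinedE:
  assumes "finitely_determined V D"
  obtains F where "finite F" "\<forall>z\<in>V. \<forall>z'\<in>V \<inter> nb F z. z' \<in> D \<longleftrightarrow> z \<in> D"
proof -
  obtain F where F0: "finite F" "\<forall>z\<in>V. \<forall>z'\<in>V \<inter> nb F z. z \<in> D \<longrightarrow> z' \<in> D"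
    using assms unfolding finitely_determined_def by blast
  note F = F0(1) F0(2)[rule_format, OF _ IntI]
  have "z' \<in> D \<longleftrightarrow> z \<in> D" if "z \<in> V" "z' \<in> V" "z' \<in> nb F z" for z z'
  proof
    show "z' \<in> D \<Longrightarrow> z \<in> D" by (rule F(2)[OF that(2,1)]) (use that in \<open>simp add: nb_sym\<close>)
    show "z \<in> D \<Longrightarrow> z' \<in> D" by (rule F(2)[OF that])
  qed
  then show ?thesis using that[OF F(1)] by blast
qed

lemma finitely_determined_subset: "finitely_determined V D \<Longrightarrow> D \<subseteq> V"
  by (simp add: finitely_determined_def)

lemma finitely_determined_compact:
  assumes "compact V" "D \<subseteq> V" "\<And>z. z \<in> V \<Longrightarrow> \<exists>F. finite F \<and> (\<forall>z'\<in>V \<inter> nb F z. (z' \<in> D) = (z \<in> D))"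
  shows "finitely_determined V D"
proof -
  obtain F where "finite F" "\<forall>z\<in>V. \<forall>z'\<in>V \<inter> nb F z. (z' \<in> D) = (z \<in> D)"
    by (rule locally_constant_uniform[OF assms(1), of "\<lambda>z. z \<in> D", OF assms(3)])
  then show ?thesis using assms(2) by (intro finitely_determinedI) blast+
qed

lemma finitely_determined_combine:
  assumes "finitely_determined V D" "finitely_determined V E"
  shows "finitely_determined V {z \<in> V. P (z \<in> D) (z \<in> E)}"
proof -
  obtain F where F0: "finite F" "\<forall>z\<in>V. \<forall>z'\<in>V \<inter> nb F z. z' \<in> D \<longleftrightarrow> z \<in> D"
    using assms(1) by (rule finitely_determinedE)
  obtain G where G0: "finite G" "\<forall>z\<in>V. \<forall>z'\<in>V \<inter> nb G z. z' \<in> E \<longleftrightarrow> z \<in> E"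
    using assms(2) by (rule finitely_determinedE)
  show ?thesis
  proof (rule finitely_determinedI[of _ _ "F \<union> G"])
    fix z z' assume z: "z \<in> V" "z' \<in> V" "z' \<in> nb (F \<union> G) z" "z \<in> {z \<in> V. P (z \<in> D) (z \<in> E)}"
    have "z' \<in> V \<inter> nb F z" "z' \<in> V \<inter> nb G z" using z by (auto simp: nb_Un)
    then have "(z' \<in> D) = (z \<in> D)" "(z' \<in> E) = (z \<in> E)"
      using F0(2) G0(2) z(1) by blast+
    then show "z' \<in> {z \<in> V. P (z \<in> D) (z \<in> E)}" using z by simp
  qed (use F0 G0 in auto)
qed

lemma finitely_determined_Int:
  assumes "finitely_determined V D" "finitely_determined V E"
  shows "finitely_determined V (D \<inter> E)"
proof -
  have "D \<inter> E = {z \<in> V. z \<in> D \<and> z \<in> E}" using finitely_determined_subset[OF assms(1)] by blast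
  then show ?thesis using finitely_determined_combine[OF assms, of "(\<and>)"] by simp
qed

lemma finitely_determined_Diff:
  assumes "finitely_determined V D" "finitely_determined V E"
  shows "finitely_determined V (D - E)"
proof -
  have "D - E = {z \<in> V. z \<in> D \<and> z \<notin> E}" using finitely_determined_subset[OF assms(1)] by blast
  then show ?thesis using finitely_determined_combine[OF assms, of "\<lambda>a b. a \<and> \<not> b"] by simp
qed

lemma finitely_determined_UNIV: "finitely_determined V V"
  by (rule finitely_determinedI[of _ _ "{}"]) auto

lemma finitely_determined_coordinate: "finitely_determined V {z \<in> V. z c}"
  by (rule finitely_determinedI[of _ _ "{c}"]) (auto simp: nb_def)

lemma finitely_determined_nb:
  assumes "finitely_determined V D" "z \<in> D"
  obtains F where "finite F" "V \<inter> nb F z \<subseteq> D"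
proof -
  obtain F where F0: "finite F" "\<forall>z\<in>V. \<forall>z'\<in>V \<inter> nb F z. z' \<in> D \<longleftrightarrow> z \<in> D"
    using assms(1) by (rule finitely_determinedE)
  note F = F0(1) F0(2)[rule_format, OF _ IntI]
  then show ?thesis using that[OF F(1)] assms finitely_determined_subset by blast
qed

text \<open>
  The labels \<open>L z 0, L z 1, \<dots>\<close> form a continuous map of \<open>V\<close> into a product of finite sets. The
  condition \<open>rich\<close> says at once that this map is open and that its fibres have no isolated points.
\<close>

locale labelled_space =
  fixes V :: "('c \<Rightarrow> bool) set" and C :: "'c set" and L :: "('c \<Rightarrow> bool) \<Rightarrow> nat \<Rightarrow> nat" and N :: "nat \<Rightarrow> nat"
  assumes closed_V: "closed V" and countable_C: "countable C"
    and support: "\<And>z c. z \<in> V \<Longrightarrow> c \<notin> C \<Longrightarrow> \<not> z c"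
    and L_less: "\<And>z k. z \<in> V \<Longrightarrow> L z k < N k"
    and L_local: "\<And>z k. z \<in> V \<Longrightarrow> \<exists>F. finite F \<and> (\<forall>z'\<in>V \<inter> nb F z. L z' k = L z k)"
    and rich: "\<And>z F. z \<in> V \<Longrightarrow> finite F \<Longrightarrow>
      \<exists>k. \<forall>l. (\<forall>i. l i < N i) \<longrightarrow> (\<forall>i<k. l i = L z i) \<longrightarrow> (\<exists>q\<in>V \<inter> nb F z. q \<noteq> z \<and> L q = l)"
begin

lemma compact_V: "compact V"
  by (rule compact_eq_closed_fun_bool[OF closed_V])

lemma L_local_below:
  obtains F where "finite F" "\<forall>z\<in>V. \<forall>z'\<in>V \<inter> nb F z. \<forall>i. i < k \<longrightarrow> L z' i = L z i"
proof -
  have "\<exists>F. finite F \<and> (\<forall>z\<in>V. \<forall>z'\<in>V \<inter> nb F z. L z' i = L z i)" for i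
  proof -
    obtain F where "finite F" "\<forall>z\<in>V. \<forall>z'\<in>V \<inter> nb F z. L z' i = L z i"
      by (rule locally_constant_uniform[OF compact_V, of "\<lambda>z. L z i", OF L_local])
    then show ?thesis by blast
  qed
  then have "\<forall>i. \<exists>F. finite F \<and> (\<forall>z\<in>V. \<forall>z'\<in>V \<inter> nb F z. L z' i = L z i)" by blast
  from choice[OF this] obtain f where
    f0: "\<forall>i. finite (f i) \<and> (\<forall>z\<in>V. \<forall>z'\<in>V \<inter> nb (f i) z. L z' i = L z i)" by (rule exE)
  then have f: "\<And>i. finite (f i)" "\<And>i. \<forall>z\<in>V. \<forall>z'\<in>V \<inter> nb (f i) z. L z' i = L z i" by blast+
  have "L z' i = L z i" if "z \<in> V" "z' \<in> V" "z' \<in> nb (\<Union>i<k. f i) z" "i < k" for z z' i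
  proof -
    have "z' \<in> nb (f i) z" using that nb_mono[of "f i" "\<Union>i<k. f i" z] by auto
    then show ?thesis using f(2) that by blast
  qed
  then show ?thesis using that[of "\<Union>i<k. f i"] f(1) by blast
qed

lemma L_local_nbs:
  fixes kk :: "('c \<Rightarrow> bool) \<Rightarrow> nat"
  obtains f where "\<forall>z. finite (f z)"
    "\<forall>z\<in>V. \<forall>z'\<in>V \<inter> nb (f z) z. \<forall>i<kk z. L z' i = L z i"
proof -
  have "\<exists>F. finite F \<and> (\<forall>z\<in>V. \<forall>z'\<in>V. \<forall>i<k. z' \<in> nb F z \<longrightarrow> L z' i = L z i)" for k
  proof -
    obtain F where F0: "finite F" "\<forall>z\<in>V. \<forall>z'\<in>V \<inter> nb F z. \<forall>i. i < k \<longrightarrow> L z' i = L z i"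
      by (rule L_local_below[of k])
    then show ?thesis by (intro exI[of _ F]) blast
  qed
  then have "\<forall>k. \<exists>F. finite F \<and> (\<forall>z\<in>V. \<forall>z'\<in>V. \<forall>i<k. z' \<in> nb F z \<longrightarrow> L z' i = L z i)" by blast
  from choice[OF this] obtain g where
    g: "\<forall>k. finite (g k) \<and> (\<forall>z\<in>V. \<forall>z'\<in>V. \<forall>i<k. z' \<in> nb (g k) z \<longrightarrow> L z' i = L z i)" by (rule exE)
  show ?thesis by (rule that[of "\<lambda>z. g (kk z)"]) (use g in blast)+
qed

lemma finitely_determined_label:
  assumes "finitely_determined V D" "\<And>z z'. z \<in> V \<Longrightarrow> z' \<in> V \<Longrightarrow> (\<And>i. i < k \<Longrightarrow> L z' i = L z i) \<Longrightarrow> P z = P z'"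
  shows "finitely_determined V {z \<in> D. P z}"
proof -
  obtain F where F0: "finite F" "\<forall>z\<in>V. \<forall>z'\<in>V \<inter> nb F z. \<forall>i. i < k \<longrightarrow> L z' i = L z i"
    by (rule L_local_below[of k])
  note F = F0(1) F0(2)[rule_format, OF _ IntI]
  have "finitely_determined V {z \<in> V. P z}"
    by (rule finitely_determinedI[of _ _ F]) (use F assms(2) in blast)+
  moreover have "{z \<in> D. P z} = D \<inter> {z \<in> V. P z}" using assms(1) finitely_determined_subset by blast
  ultimately show ?thesis using finitely_determined_Int[OF assms(1)] by simp
qed

text \<open>
  Above level \<open>k\<close> the labels of points of \<open>D\<close> can be changed at will. This is openness of the label
  map on \<open>D\<close>, made uniform.
\<close>

definition full :: "nat \<Rightarrow> ('c \<Rightarrow> bool) set \<Rightarrow> bool" where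
  "full k D \<longleftrightarrow> (\<forall>q\<in>D. \<forall>l. (\<forall>i. l i < N i) \<longrightarrow> (\<forall>i<k. l i = L q i) \<longrightarrow> (\<exists>q'\<in>D. L q' = l))"

lemma full_mono: "full k D \<Longrightarrow> k \<le> k' \<Longrightarrow> full k' D"
  unfolding full_def by (meson order_less_le_trans)

text \<open>
  By \<open>rich\<close>, each point of \<open>D\<close> has a level above which its labels can be changed within \<open>D\<close>;
  finitely many of these levels suffice by compactness.
\<close>

lemma eventually_full:
  assumes D: "finitely_determined V D"
  obtains k where "full k D"
proof -
  have "\<exists>k. \<forall>l. (\<forall>i. l i < N i) \<longrightarrow> (\<forall>i<k. l i = L z i) \<longrightarrow> (\<exists>q\<in>D. L q = l)" if z: "z \<in> D" for z
  proof -
    obtain F where F: "finite F" "V \<inter> nb F z \<subseteq> D" by (rule finitely_determined_nb[OF D z])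
    have "z \<in> V" using z finitely_determined_subset[OF D] by blast
    from rich[OF this F(1)] obtain k where
      "\<forall>l. (\<forall>i. l i < N i) \<longrightarrow> (\<forall>i<k. l i = L z i) \<longrightarrow> (\<exists>q\<in>V \<inter> nb F z. q \<noteq> z \<and> L q = l)" by (rule exE)
    then show ?thesis using F(2) by (intro exI[of _ k]) blast
  qed
  then have "\<forall>z\<in>D. \<exists>k. \<forall>l. (\<forall>i. l i < N i) \<longrightarrow> (\<forall>i<k. l i = L z i) \<longrightarrow> (\<exists>q\<in>D. L q = l)" by blast
  from bchoice[OF this] obtain kk where
    "\<forall>z\<in>D. \<forall>l. (\<forall>i. l i < N i) \<longrightarrow> (\<forall>i<kk z. l i = L z i) \<longrightarrow> (\<exists>q\<in>D. L q = l)" by (rule exE)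
  then have kk: "\<And>z l. z \<in> D \<Longrightarrow> (\<forall>i. l i < N i) \<Longrightarrow> (\<forall>i<kk z. l i = L z i) \<Longrightarrow> (\<exists>q\<in>D. L q = l)" by blast
  obtain f where f0: "\<forall>z. finite (f z)" "\<forall>z\<in>V. \<forall>z'\<in>V \<inter> nb (f z) z. \<forall>i<kk z. L z' i = L z i"
    by (rule L_local_nbs[of kk])
  then have f: "\<And>z. z \<in> V \<Longrightarrow> finite (f z)" "\<And>z z' i. z \<in> V \<Longrightarrow> z' \<in> V \<inter> nb (f z) z \<Longrightarrow> i < kk z \<Longrightarrow> L z' i = L z i"
    by blast+
  obtain F where F0: "finite F" "\<forall>z\<in>V. \<forall>z'\<in>V \<inter> nb F z. z' \<in> D \<longleftrightarrow> z \<in> D"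
    using D by (rule finitely_determinedE)
  note F = F0(1) F0(2)[rule_format, OF _ IntI]
  obtain A where A: "finite A" "A \<subseteq> V" "V \<subseteq> (\<Union>z\<in>A. nb (f z \<union> F) z)"
    by (rule compact_nb_cover[OF compact_V, of "\<lambda>z. f z \<union> F"]) (use f(1) F(1) in auto)
  obtain k where k: "\<And>p. p \<in> A \<Longrightarrow> kk p \<le> k"
  proof -
    have "finite (kk ` A)" using A(1) by simp
    then obtain k where "kk ` A \<subseteq> {..<k}" using finite_nat_bounded by blast
    then have "kk p \<le> k" if "p \<in> A" for p using that by fastforce
    then show ?thesis using that by blast
  qed
  have "full k D"
    unfolding full_def
  proof (intro ballI allI impI)
    fix q l assume q: "q \<in> D" and l: "\<forall>i. l i < N i" "\<forall>i<k. l i = L q i"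
    have qV: "q \<in> V" using q finitely_determined_subset[OF D] by auto
    then obtain p where p: "p \<in> A" "q \<in> nb (f p \<union> F) p" using A by auto
    have "p \<in> D" using F(2)[of p q] p q qV A by (auto simp: nb_Un)
    moreover have "\<forall>i<kk p. l i = L p i"
      using f(2)[of p q] p qV A l(2) k[OF p(1)] by (auto simp: nb_Un)
    ultimately show "\<exists>q'\<in>D. L q' = l" using kk l(1) by blast
  qed
  then show ?thesis by (rule that)
qed

text \<open>
  A weaker form of \<open>full k\<close> in which the labels below level \<open>k\<close> are not controlled; unlike \<open>full k\<close>
  it passes to both parts of a suitable division of \<open>D\<close> without a change of \<open>k\<close>.
\<close>

definition tail_full :: "nat \<Rightarrow> ('c \<Rightarrow> bool) set \<Rightarrow> bool" where
  "tail_full k D \<longleftrightarrow> (\<forall>l. (\<forall>i. l i < N i) \<longrightarrow> (\<exists>q\<in>D. \<forall>i\<ge>k. L q i = l i))"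

lemma full_imp_tail_full:
  assumes "full k D" "q \<in> D" "D \<subseteq> V"
  shows "tail_full k D"
  unfolding tail_full_def
proof (intro allI impI)
  fix l assume l: "\<forall>i. l i < N i"
  define l' where "l' i = (if i < k then L q i else l i)" for i
  have "\<forall>i. l' i < N i" "\<forall>i<k. l' i = L q i" using l assms L_less by (auto simp: l'_def)
  then obtain q' where "q' \<in> D" "L q' = l'" using assms unfolding full_def by blast
  then show "\<exists>q\<in>D. \<forall>i\<ge>k. L q i = l i" by (intro bexI[of _ q']) (auto simp: l'_def)
qed

lemma tail_full_nonempty: "V \<noteq> {} \<Longrightarrow> tail_full k D \<Longrightarrow> D \<noteq> {}"
  unfolding tail_full_def using L_less by blast

text \<open>
  Each fibre of the label map over a point of the image of \<open>D\<close> contains two points of \<open>D\<close>; a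
  coordinate that separates them also separates points in all nearby fibres, and finitely many such
  coordinates suffice.
\<close>

lemma halve:
  assumes D: "finitely_determined V D" and t: "tail_full k D"
  obtains D' where "finitely_determined V D'" "D' \<subseteq> D" "tail_full k D'" "tail_full k (D - D')"
proof -
  have DV: "D \<subseteq> V" using D by (rule finitely_determined_subset)
  have "\<exists>c k'. full k' {z \<in> D. z c = q c} \<and> full k' (D - {z \<in> D. z c = q c}) \<and> (\<exists>q'\<in>D. q' c \<noteq> q c \<and> L q' = L q)"
    if q: "q \<in> D" for q
  proof -
    obtain F where F: "finite F" "V \<inter> nb F q \<subseteq> D" by (rule finitely_determined_nb[OF D q])
    have "\<exists>q'\<in>V \<inter> nb F q. q' \<noteq> q \<and> L q' = L q"
      using rich[OF _ F(1), of q] q DV L_less by blast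
    then obtain q' where q': "q' \<in> D" "q' \<noteq> q" "L q' = L q" using F by blast
    then obtain c where c: "q' c \<noteq> q c" using t2_fun_bool by blast
    define E where "E = {z \<in> D. z c = q c}"
    have "E = (if q c then D \<inter> {z \<in> V. z c} else D - {z \<in> V. z c})" using DV by (auto simp: E_def)
    then have E: "finitely_determined V E" "finitely_determined V (D - E)"
      using D by (auto intro!: finitely_determined_Int finitely_determined_Diff finitely_determined_coordinate)
    obtain k1 where "full k1 E" by (rule eventually_full[OF E(1)])
    moreover obtain k2 where "full k2 (D - E)" by (rule eventually_full[OF E(2)])
    ultimately have "full (max k1 k2) E" "full (max k1 k2) (D - E)" using full_mono[of k1 E "max k1 k2"] full_mono[of k2 "D - E" "max k1 k2"] by simp_all
    then show ?thesis using q' c unfolding E_def by blast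
  qed
  note ex = this
  have "\<forall>q\<in>D. \<exists>ck. full (snd ck) {z \<in> D. z (fst ck) = q (fst ck)} \<and> full (snd ck) (D - {z \<in> D. z (fst ck) = q (fst ck)})
      \<and> (\<exists>q'\<in>D. q' (fst ck) \<noteq> q (fst ck) \<and> L q' = L q)"
  proof
    fix q assume "q \<in> D"
    from ex[OF this] obtain c k where "full k {z \<in> D. z c = q c} \<and> full k (D - {z \<in> D. z c = q c})
      \<and> (\<exists>q'\<in>D. q' c \<noteq> q c \<and> L q' = L q)" by (elim exE)
    then show "\<exists>ck. full (snd ck) {z \<in> D. z (fst ck) = q (fst ck)} \<and> full (snd ck) (D - {z \<in> D. z (fst ck) = q (fst ck)})
      \<and> (\<exists>q'\<in>D. q' (fst ck) \<noteq> q (fst ck) \<and> L q' = L q)" by (intro exI[of _ "(c, k)"]) simp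
  qed
  from bchoice[OF this] obtain ck where ck: "\<forall>q\<in>D. full (snd (ck q)) {z \<in> D. z (fst (ck q)) = q (fst (ck q))}
      \<and> full (snd (ck q)) (D - {z \<in> D. z (fst (ck q)) = q (fst (ck q))})
      \<and> (\<exists>q'\<in>D. q' (fst (ck q)) \<noteq> q (fst (ck q)) \<and> L q' = L q)" by (rule exE)
  define c kk where "c q = fst (ck q)" and "kk q = snd (ck q)" for q
  have c: "\<And>q. q \<in> D \<Longrightarrow> full (kk q) {z \<in> D. z (c q) = q (c q)}"
      "\<And>q. q \<in> D \<Longrightarrow> full (kk q) (D - {z \<in> D. z (c q) = q (c q)})"
      "\<And>q. q \<in> D \<Longrightarrow> \<exists>q'\<in>D. q' (c q) \<noteq> q (c q) \<and> L q' = L q"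
    using ck by (auto simp: c_def kk_def)
  obtain f where f0: "\<forall>z. finite (f z)" "\<forall>z\<in>V. \<forall>z'\<in>V \<inter> nb (f z) z. \<forall>i<kk z. L z' i = L z i"
    by (rule L_local_nbs[of kk])
  then have f: "\<And>z. z \<in> V \<Longrightarrow> finite (f z)" "\<And>z z' i. z \<in> V \<Longrightarrow> z' \<in> V \<inter> nb (f z) z \<Longrightarrow> i < kk z \<Longrightarrow> L z' i = L z i"
    by blast+
  obtain G where G0: "finite G" "\<forall>z\<in>V. \<forall>z'\<in>V \<inter> nb G z. z' \<in> D \<longleftrightarrow> z \<in> D"
    using D by (rule finitely_determinedE)
  note G = G0(1) G0(2)[rule_format, OF _ IntI]
  obtain A where A: "finite A" "A \<subseteq> V" "V \<subseteq> (\<Union>z\<in>A. nb (f z \<union> G) z)"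
    by (rule compact_nb_cover[OF compact_V, of "\<lambda>z. f z \<union> G"]) (use f(1) G(1) in auto)
  define P where "P l q \<longleftrightarrow> q \<in> A \<inter> D \<and> (\<forall>i<kk q. l i = L q i)" for l q
  define pick where "pick l = (SOME q. P l q)" for l
  have pick: "P (L z) (pick (L z))" if "z \<in> D" for z
  proof -
    have zV: "z \<in> V" using that DV by auto
    then obtain p where p: "p \<in> A" "z \<in> nb (f p \<union> G) p" using A by auto
    have "p \<in> D" using G(2)[of p z] p that zV A by (auto simp: nb_Un)
    then have "P (L z) p" using f(2)[of p z] p zV A by (auto simp: P_def nb_Un)
    then show ?thesis unfolding pick_def by (rule someI[of "P (L z)"])
  qed
  obtain k1 where k1: "\<And>p. p \<in> A \<Longrightarrow> kk p \<le> k1"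
  proof -
    have "finite (kk ` A)" using A(1) by simp
    then obtain k where "kk ` A \<subseteq> {..<k}" using finite_nat_bounded by blast
    then have "kk p \<le> k" if "p \<in> A" for p using that by fastforce
    then show ?thesis using that by blast
  qed
  have pick_cong: "pick l = pick l'" if "\<And>i. i < k1 \<Longrightarrow> l i = l' i" for l l'
  proof -
    have "P l q = P l' q" for q
    proof (cases "q \<in> A")
      case True
      then have "l i = l' i" if "i < kk q" for i using that k1[of q] \<open>\<And>i. i < k1 \<Longrightarrow> l i = l' i\<close> by simp
      then show ?thesis by (simp add: P_def)
    qed (simp add: P_def)
    then have "P l = P l'" by blast
    then show ?thesis by (simp add: pick_def)
  qed
  define D' where "D' = {z \<in> D. z (c (pick (L z))) = pick (L z) (c (pick (L z)))}"
  obtain H where H0: "finite H" "\<forall>z\<in>V. \<forall>z'\<in>V \<inter> nb H z. \<forall>i. i < k1 \<longrightarrow> L z' i = L z i"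
    by (rule L_local_below[of k1])
  note H = H0(1) H0(2)[rule_format, OF _ IntI]
  have D': "finitely_determined V D'"
  proof (rule finitely_determinedI[of _ _ "G \<union> H \<union> c ` A"])
    fix z z' assume z: "z \<in> V" "z' \<in> V" "z' \<in> nb (G \<union> H \<union> c ` A) z" "z \<in> D'"
    then have "pick (L z') = pick (L z)" using H(2)[of z z'] by (intro pick_cong) (auto simp: nb_Un)
    moreover have "z' \<in> D" using z G(2)[of z z'] by (auto simp: nb_Un D'_def)
    moreover have "pick (L z) \<in> A" using pick[of z] z by (auto simp: D'_def P_def)
    ultimately show "z' \<in> D'" using z by (auto simp: D'_def nb_def)
  qed (use D DV G H A in \<open>auto simp: D'_def\<close>)
  have lab: "\<exists>z'\<in>D'. L z' = L z" "\<exists>z'\<in>D - D'. L z' = L z" if z: "z \<in> D" for z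
  proof -
    define q where "q = pick (L z)"
    have q: "q \<in> D" "\<forall>i<kk q. L z i = L q i" using pick[OF z] by (auto simp: P_def q_def)
    have lz: "\<forall>i. L z i < N i" using z DV L_less by auto
    have "q \<in> {z \<in> D. z (c q) = q (c q)}" using q by simp
    with c(1)[OF q(1), unfolded full_def] lz q(2)
    have "\<exists>z'\<in>{z \<in> D. z (c q) = q (c q)}. L z' = L z" by blast
    then obtain z' where z': "z' \<in> D" "z' (c q) = q (c q)" "L z' = L z" by blast
    then show "\<exists>z'\<in>D'. L z' = L z" by (intro bexI[of _ z']) (auto simp: D'_def q_def)
    obtain q' where q': "q' \<in> D" "q' (c q) \<noteq> q (c q)" "L q' = L q" using c(3) q by blast
    then have "q' \<in> D - {z \<in> D. z (c q) = q (c q)}" by simp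
    moreover have "\<forall>i<kk q. L z i = L q' i" using q q' by simp
    ultimately have "\<exists>z'\<in>D - {z \<in> D. z (c q) = q (c q)}. L z' = L z"
      using c(2)[OF q(1), unfolded full_def] lz by blast
    then obtain z'' where z'': "z'' \<in> D" "z'' (c q) \<noteq> q (c q)" "L z'' = L z" by blast
    then show "\<exists>z'\<in>D - D'. L z' = L z" by (intro bexI[of _ z'']) (auto simp: D'_def q_def)
  qed
  have "tail_full k D'" "tail_full k (D - D')"
  proof -
    show "tail_full k D'" unfolding tail_full_def
    proof (intro allI impI)
      fix l assume "\<forall>i. l i < N i"
      then obtain q where q: "q \<in> D" "\<forall>i\<ge>k. L q i = l i" using t unfolding tail_full_def by blast
      then obtain z' where "z' \<in> D'" "L z' = L q" using lab(1) by blast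
      then show "\<exists>q\<in>D'. \<forall>i\<ge>k. L q i = l i" using q by (intro bexI[of _ z']) simp_all
    qed
    show "tail_full k (D - D')" unfolding tail_full_def
    proof (intro allI impI)
      fix l assume "\<forall>i. l i < N i"
      then obtain q where q: "q \<in> D" "\<forall>i\<ge>k. L q i = l i" using t unfolding tail_full_def by blast
      then obtain z' where "z' \<in> D - D'" "L z' = L q" using lab(2) by blast
      then show "\<exists>q\<in>D - D'. \<forall>i\<ge>k. L q i = l i" using q by (intro bexI[of _ z']) simp_all
    qed
  qed
  then show ?thesis using that D' by (auto simp: D'_def)
qed

end

text \<open>
  Back and forth. A pair \<open>(A, B)\<close> of clopen sets is matched at level \<open>k\<close> if the labels of levels
  from \<open>k0\<close> up to \<open>k\<close> are constant on both sets and correspond under \<open>\<sigma>\<close>, whereas all label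
  sequences from level \<open>k\<close> on occur in both sets.
\<close>

locale label_shift = labelled_space +
  fixes \<sigma> \<tau> :: "nat \<Rightarrow> nat \<Rightarrow> nat" and k0 :: nat
  assumes \<sigma>_less: "\<And>i l. l < N i \<Longrightarrow> \<sigma> i l < N i" and \<tau>_less: "\<And>i l. l < N i \<Longrightarrow> \<tau> i l < N i"
    and \<tau>\<sigma>: "\<And>i l. l < N i \<Longrightarrow> \<tau> i (\<sigma> i l) = l" and \<sigma>\<tau>: "\<And>i l. l < N i \<Longrightarrow> \<sigma> i (\<tau> i l) = l"
begin

definition matched :: "nat \<Rightarrow> ('a \<Rightarrow> bool) set \<Rightarrow> ('a \<Rightarrow> bool) set \<Rightarrow> bool" where
  "matched k A B \<longleftrightarrow> finitely_determined V A \<and> finitely_determined V B \<and> A \<noteq> {} \<and> B \<noteq> {} \<and>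
     tail_full k A \<and> tail_full k B \<and> (\<forall>p\<in>A. \<forall>q\<in>B. \<forall>i. k0 \<le> i \<longrightarrow> i < k \<longrightarrow> L q i = \<sigma> i (L p i))"

text \<open>
  Partitions of \<open>A\<close> and of \<open>B\<close> together with a bijection between their pieces.
\<close>

definition pairing :: "('a \<Rightarrow> bool) set \<Rightarrow> ('a \<Rightarrow> bool) set \<Rightarrow> (('a \<Rightarrow> bool) set \<times> ('a \<Rightarrow> bool) set) set \<Rightarrow> bool" where
  "pairing A B PP \<longleftrightarrow> (\<forall>p\<in>A. \<exists>!P. P \<in> PP \<and> p \<in> fst P) \<and> (\<forall>q\<in>B. \<exists>!P. P \<in> PP \<and> q \<in> snd P) \<and>
     (\<forall>P\<in>PP. fst P \<subseteq> A \<and> snd P \<subseteq> B)"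

definition pattern :: "nat \<Rightarrow> ('a \<Rightarrow> bool) \<Rightarrow> nat \<Rightarrow> nat" where
  "pattern k z i = (if k0 \<le> i \<and> i < k then L z i else 0)"

lemma finitely_determined_pattern:
  "finitely_determined V A \<Longrightarrow> finitely_determined V {z \<in> A. pattern k z = s}"
proof (rule finitely_determined_label[of _ k])
  fix z z' assume "\<And>i. i < k \<Longrightarrow> L z' i = L z i"
  then have "pattern k z = pattern k z'" by (auto simp: pattern_def)
  then show "(pattern k z = s) = (pattern k z' = s)" by simp
qed

lemma pattern_tail_full:
  assumes A: "tail_full k A" "A \<subseteq> V" "k0 \<le> k" "k \<le> k'" and s: "\<And>i. k \<le> i \<Longrightarrow> i < k' \<Longrightarrow> s i < N i"
    and const: "\<And>p i. p \<in> A \<Longrightarrow> k0 \<le> i \<Longrightarrow> i < k \<Longrightarrow> L p i = s i"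
  shows "tail_full k' {z \<in> A. pattern k' z = (\<lambda>i. if k0 \<le> i \<and> i < k' then s i else 0)}"
  unfolding tail_full_def
proof (intro allI impI)
  fix l assume l: "\<forall>i. l i < N i"
  define l' where "l' i = (if k \<le> i \<and> i < k' then s i else l i)" for i
  have "\<forall>i. l' i < N i" using l s by (auto simp: l'_def)
  then obtain q where q: "q \<in> A" "\<forall>i\<ge>k. L q i = l' i" using A(1) unfolding tail_full_def by blast
  have "pattern k' q = (\<lambda>i. if k0 \<le> i \<and> i < k' then s i else 0)"
  proof
    fix i
    show "pattern k' q i = (if k0 \<le> i \<and> i < k' then s i else 0)"
      using q const[OF q(1), of i] by (cases "i < k") (auto simp: pattern_def l'_def)
  qed
  moreover have "\<forall>i\<ge>k'. L q i = l i" using q A(4) by (auto simp: l'_def)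
  ultimately show "\<exists>q\<in>{z \<in> A. pattern k' z = (\<lambda>i. if k0 \<le> i \<and> i < k' then s i else 0)}. \<forall>i\<ge>k'. L q i = l i"
    using q(1) by blast
qed

text \<open>
  Cut \<open>A\<close> into the pieces on which the coordinate \<open>c\<close> and the labels below \<open>k'\<close> are constant, where
  \<open>k'\<close> is so large that both parts of \<open>A\<close> with respect to \<open>c\<close> are full at level \<open>k'\<close>. The labels of
  a piece of \<open>A\<close> prescribe the labels of its partner in \<open>B\<close>. If a label pattern occurs in both parts
  of \<open>A\<close>, the set of points of \<open>B\<close> with the corresponding pattern has to be halved.
\<close>

lemma refine_left:
  assumes m: "matched k A B" "k0 \<le> k"
  obtains k' PP where "k < k'" "pairing A B PP" "\<forall>P\<in>PP. matched k' (fst P) (snd P)"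
    "\<forall>P\<in>PP. \<forall>p\<in>fst P. \<forall>q\<in>fst P. p c = q c"
proof -
  have A: "finitely_determined V A" "A \<noteq> {}" "tail_full k A" "A \<subseteq> V" 
    and B: "finitely_determined V B" "B \<noteq> {}" "tail_full k B" "B \<subseteq> V"
    and AB: "\<And>p q i. p \<in> A \<Longrightarrow> q \<in> B \<Longrightarrow> k0 \<le> i \<Longrightarrow> i < k \<Longrightarrow> L q i = \<sigma> i (L p i)"
    using m(1) finitely_determined_subset unfolding matched_def by blast+
  define A1 A2 where "A1 = A \<inter> {z \<in> V. z c}" and "A2 = A - {z \<in> V. z c}"
  have fd: "finitely_determined V A1" "finitely_determined V A2"
    using A(1) unfolding A1_def A2_def
    by (auto intro!: finitely_determined_Int finitely_determined_Diff finitely_determined_coordinate)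
  obtain k1 where k1: "full k1 A1" by (rule eventually_full[OF fd(1)])
  obtain k2 where k2: "full k2 A2" by (rule eventually_full[OF fd(2)])
  define k' where "k' = Suc (max k (max k1 k2))"
  have k': "k < k'" "full k' A1" "full k' A2"
    using full_mono[OF k1, of k'] full_mono[OF k2, of k'] by (auto simp: k'_def)
  define shift where "shift s i = (if k0 \<le> i \<and> i < k' then \<sigma> i (s i) else (0::nat))" for s i
  define As where "As s = {z \<in> A. pattern k' z = s}" for s
  define Bs where "Bs s = {z \<in> B. pattern k' z = shift s}" for s
  define S where "S = pattern k' ` A"
  have fdA: "finitely_determined V {z \<in> A1. pattern k' z = s}" "finitely_determined V {z \<in> A2. pattern k' z = s}" for s
    using fd finitely_determined_pattern by auto
  have fdB: "finitely_determined V (Bs s)" for s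
    unfolding Bs_def using B(1) by (rule finitely_determined_pattern)
  have tA: "tail_full k' {z \<in> A'. pattern k' z = s}"
    if ne: "{z \<in> A'. pattern k' z = s} \<noteq> {}" and A': "A' = A1 \<or> A' = A2" for s A'
  proof -
    obtain q where q: "q \<in> A'" "pattern k' q = s" using ne by blast
    have "tail_full k' A'" "full k' A'" "A' \<subseteq> V"
      using full_imp_tail_full[of k' A' q] q k' A' fd[THEN finitely_determined_subset] by auto
    show ?thesis
      unfolding tail_full_def
    proof (intro allI impI)
      fix l assume l: "\<forall>i. l i < N i"
      define l' where "l' i = (if i < k' then L q i else l i)" for i
      have "\<forall>i. l' i < N i" "\<forall>i<k'. l' i = L q i" using l q \<open>A' \<subseteq> V\<close> L_less by (auto simp: l'_def)
      with \<open>full k' A'\<close>[unfolded full_def, rule_format, OF q(1), of l'] obtain q' where q': "q' \<in> A'" "L q' = l'" by blast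
      have "pattern k' q' = pattern k' q" by (rule ext) (simp add: pattern_def q'(2) l'_def)
      then have "pattern k' q' = s" using q by simp
      then show "\<exists>q\<in>{z \<in> A'. pattern k' z = s}. \<forall>i\<ge>k'. L q i = l i"
        using q' by (intro bexI[of _ q']) (auto simp: l'_def)
    qed
  qed
  have tB: "tail_full k' (Bs s)" if s: "s \<in> S" for s
  proof -
    obtain p where p: "p \<in> A" "s = pattern k' p" using s by (auto simp: S_def)
    have sh: "shift s = (\<lambda>i. if k0 \<le> i \<and> i < k' then \<sigma> i (L p i) else 0)"
      using p by (auto simp: shift_def pattern_def)
    have "tail_full k' {z \<in> B. pattern k' z = (\<lambda>i. if k0 \<le> i \<and> i < k' then \<sigma> i (L p i) else 0)}"
      by (rule pattern_tail_full[OF B(3,4) m(2)]) (use k' p A L_less \<sigma>_less AB in auto)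
    then show ?thesis by (simp add: Bs_def sh)
  qed
  have "\<exists>B1. finitely_determined V B1 \<and> B1 \<subseteq> Bs s \<and> tail_full k' B1 \<and> tail_full k' (Bs s - B1)" if "s \<in> S" for s
    by (rule halve[OF fdB tB[OF that]]) blast
  then have "\<forall>s\<in>S. \<exists>B1. finitely_determined V B1 \<and> B1 \<subseteq> Bs s \<and> tail_full k' B1 \<and> tail_full k' (Bs s - B1)" by blast
  from bchoice[OF this] obtain H where
    H: "\<forall>s\<in>S. finitely_determined V (H s) \<and> H s \<subseteq> Bs s \<and> tail_full k' (H s) \<and> tail_full k' (Bs s - H s)" by (rule exE)
  \<comment> \<open>if one of the two halves of \<open>As s\<close> is empty, the other one has to be paired with all of \<open>Bs s\<close>\<close>
  define B1 where "B1 s = (if {z \<in> A2. pattern k' z = s} = {} then Bs s else if {z \<in> A1. pattern k' z = s} = {} then {} else H s)" for s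
  define PP where "PP = {({z \<in> A1. pattern k' z = s}, B1 s) | s. s \<in> S \<and> {z \<in> A1. pattern k' z = s} \<noteq> {}} \<union>
     {({z \<in> A2. pattern k' z = s}, Bs s - B1 s) | s. s \<in> S \<and> {z \<in> A2. pattern k' z = s} \<noteq> {}}"
  have B1s: "B1 s \<subseteq> Bs s" if "s \<in> S" for s using H that by (auto simp: B1_def)
  have A12: "A1 \<union> A2 = A" "A1 \<inter> A2 = {}" by (auto simp: A1_def A2_def)
  have Sne: "{z \<in> A1. pattern k' z = s} \<noteq> {} \<or> {z \<in> A2. pattern k' z = s} \<noteq> {}" if "s \<in> S" for s
    using that A12 by (auto simp: S_def)
  have inS: "pattern k' p \<in> S" if "p \<in> A" for p using that by (auto simp: S_def)
  have shift_inj: "s = s'" if ss: "s \<in> S" "s' \<in> S" "shift s = shift s'" for s s'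
  proof
    fix i
    obtain p p' where p: "p \<in> A" "s = pattern k' p" "p' \<in> A" "s' = pattern k' p'"
      using ss(1,2) unfolding S_def by blast
    show "s i = s' i"
    proof (cases "k0 \<le> i \<and> i < k'")
      case True
      then have "\<sigma> i (L p i) = \<sigma> i (L p' i)" using fun_cong[OF ss(3), of i] p by (simp add: shift_def pattern_def)
      then have "L p i = L p' i" using \<tau>\<sigma>[of "L p i" i] \<tau>\<sigma>[of "L p' i" i] L_less p A by (metis subsetD)
      then show ?thesis using True p by (simp add: pattern_def)
    qed (use p in \<open>auto simp: pattern_def\<close>)
  qed
  have Bcov: "\<exists>s\<in>S. q \<in> Bs s" if q: "q \<in> B" for q
  proof -
    obtain p0 where p0: "p0 \<in> A" using A(2) by blast
    define s0 where "s0 i = \<tau> i (L q i)" for i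
    have s0: "s0 i < N i" for i using q B L_less \<tau>_less by (auto simp: s0_def)
    have "L p i = s0 i" if "p \<in> A" "k0 \<le> i" "i < k" for p i
      using AB[OF that(1) q that(2,3)] \<tau>\<sigma> L_less that A by (auto simp: s0_def)
    then have "tail_full k' {z \<in> A. pattern k' z = (\<lambda>i. if k0 \<le> i \<and> i < k' then s0 i else 0)}"
      using k' s0 by (intro pattern_tail_full[OF A(3,4) m(2)]) auto
    then obtain p where p: "p \<in> A" "pattern k' p = (\<lambda>i. if k0 \<le> i \<and> i < k' then s0 i else 0)"
      using tail_full_nonempty p0 A(4) by blast
    have "\<sigma> i (s0 i) = L q i" for i
      using \<sigma>\<tau> L_less q B(4) unfolding s0_def by blast
    then have "shift (pattern k' p) = pattern k' q"
      by (intro ext) (simp add: p(2) shift_def pattern_def)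
    then have "q \<in> Bs (pattern k' p)" using q by (simp add: Bs_def)
    then show ?thesis using inS[OF p(1)] by blast
  qed
  have "pairing A B PP"
    unfolding pairing_def
  proof (intro conjI ballI)
    fix p assume p: "p \<in> A"
    show "\<exists>!P. P \<in> PP \<and> p \<in> fst P"
    proof (cases "p \<in> A1")
      case True
      then have "({z \<in> A1. pattern k' z = pattern k' p}, B1 (pattern k' p)) \<in> PP" using inS[OF p] by (auto simp: PP_def)
      note in_PP = this
      show ?thesis
      proof (rule ex1I)
        fix P assume P: "P \<in> PP \<and> p \<in> fst P"
        then consider s where "P = ({z \<in> A1. pattern k' z = s}, B1 s)" | s where "P = ({z \<in> A2. pattern k' z = s}, Bs s - B1 s)"
          unfolding PP_def by blast
        then show "P = ({z \<in> A1. pattern k' z = pattern k' p}, B1 (pattern k' p))"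
          using P True A12 by cases auto
      qed (use in_PP True p A12 in auto)
    next
      case False
      then have "p \<in> A2" using p A12 by blast
      then have "{z \<in> A2. pattern k' z = pattern k' p} \<noteq> {}" by blast
      then have "({z \<in> A2. pattern k' z = pattern k' p}, Bs (pattern k' p) - B1 (pattern k' p)) \<in> PP"
        using inS[OF p] unfolding PP_def by blast
      note in_PP = this
      show ?thesis
      proof (rule ex1I)
        fix P assume P: "P \<in> PP \<and> p \<in> fst P"
        then consider s where "P = ({z \<in> A1. pattern k' z = s}, B1 s)" | s where "P = ({z \<in> A2. pattern k' z = s}, Bs s - B1 s)"
          unfolding PP_def by blast
        then show "P = ({z \<in> A2. pattern k' z = pattern k' p}, Bs (pattern k' p) - B1 (pattern k' p))"
          using P False A12 by cases auto
      qed (use in_PP False p A12 in auto)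
    qed
  next
    fix q assume q: "q \<in> B"
    obtain s where s: "s \<in> S" "q \<in> Bs s" using Bcov[OF q] by blast
    have uniq: "s' = s" if "s' \<in> S" "q \<in> Bs s'" for s'
      using that s shift_inj by (auto simp: Bs_def)
    have uniq1: "s' = s" if "s' \<in> S" "q \<in> B1 s'" for s' using uniq that B1s by blast
    show "\<exists>!P. P \<in> PP \<and> q \<in> snd P"
    proof (cases "q \<in> B1 s")
      case True
      then have "{z \<in> A1. pattern k' z = s} \<noteq> {}" using Sne[OF s(1)] by (auto simp: B1_def split: if_splits)
      then have "({z \<in> A1. pattern k' z = s}, B1 s) \<in> PP" using s unfolding PP_def by blast
      note in_PP = this
      show ?thesis
      proof (rule ex1I)
        fix P assume P: "P \<in> PP \<and> q \<in> snd P"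
        then consider s' where "P = ({z \<in> A1. pattern k' z = s'}, B1 s')" "s' \<in> S" "q \<in> B1 s'"
          | s' where "P = ({z \<in> A2. pattern k' z = s'}, Bs s' - B1 s')" "s' \<in> S" "q \<in> Bs s' - B1 s'"
          unfolding PP_def by (elim conjE UnE CollectE exE) simp_all
        then show "P = ({z \<in> A1. pattern k' z = s}, B1 s)"
        proof cases
          case 1
          then show ?thesis using uniq1[OF 1(2,3)] True by simp
        next
          case 2
          then show ?thesis using uniq[OF 2(2)] True by simp
        qed
      qed (use in_PP True in simp)
    next
      case False
      then have "{z \<in> A2. pattern k' z = s} \<noteq> {}" using s by (auto simp: B1_def split: if_splits)
      then have "({z \<in> A2. pattern k' z = s}, Bs s - B1 s) \<in> PP" using s unfolding PP_def by blast
      note in_PP = this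
      show ?thesis
      proof (rule ex1I)
        fix P assume P: "P \<in> PP \<and> q \<in> snd P"
        then consider s' where "P = ({z \<in> A1. pattern k' z = s'}, B1 s')" "s' \<in> S" "q \<in> B1 s'"
          | s' where "P = ({z \<in> A2. pattern k' z = s'}, Bs s' - B1 s')" "s' \<in> S" "q \<in> Bs s' - B1 s'"
          unfolding PP_def by (elim conjE UnE CollectE exE) simp_all
        then show "P = ({z \<in> A2. pattern k' z = s}, Bs s - B1 s)"
        proof cases
          case 1
          then show ?thesis using uniq1[OF 1(2,3)] False by simp
        next
          case 2
          then show ?thesis using uniq[OF 2(2)] False by simp
        qed
      qed (use in_PP False s in simp)
    qed
  next
    fix P assume "P \<in> PP"
    have "Bs s \<subseteq> B" for s by (auto simp: Bs_def)
    then have "B1 s \<subseteq> B" "Bs s - B1 s \<subseteq> B" if "s \<in> S" for s using B1s[OF that] by blast+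
    moreover have "(\<exists>s\<in>S. P = ({z \<in> A1. pattern k' z = s}, B1 s)) \<or> (\<exists>s\<in>S. P = ({z \<in> A2. pattern k' z = s}, Bs s - B1 s))"
      using \<open>P \<in> PP\<close> unfolding PP_def by blast
    ultimately show "fst P \<subseteq> A" "snd P \<subseteq> B" using A12(1) by fastforce+
  qed
  moreover have "matched k' (fst P) (snd P)" if "P \<in> PP" for P
  proof -
    obtain s where s: "s \<in> S" and P: "P = ({z \<in> A1. pattern k' z = s}, B1 s) \<and> {z \<in> A1. pattern k' z = s} \<noteq> {}
       \<or> P = ({z \<in> A2. pattern k' z = s}, Bs s - B1 s) \<and> {z \<in> A2. pattern k' z = s} \<noteq> {}"
      using \<open>P \<in> PP\<close> unfolding PP_def by blast
    have lab: "L q i = \<sigma> i (L p i)" if "p \<in> fst P" "q \<in> snd P" "k0 \<le> i" "i < k'" for p q i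
    proof -
      have "pattern k' p = s" "pattern k' q = shift s" using that P B1s[OF s] by (auto simp: Bs_def)
      then have "pattern k' q i = shift (pattern k' p) i" by simp
      then show ?thesis using that(3,4) by (simp add: pattern_def shift_def)
    qed
    have V: "V \<noteq> {}" using A by blast
    have Bparts: "finitely_determined V (snd P) \<and> tail_full k' (snd P)"
      using P H s fdB tB[OF s] finitely_determined_Diff[OF fdB] 
      by (auto simp: B1_def finitely_determined_Diff)
    have tA12: "{z \<in> A1. pattern k' z = s} \<noteq> {} \<Longrightarrow> tail_full k' {z \<in> A1. pattern k' z = s}"
      "{z \<in> A2. pattern k' z = s} \<noteq> {} \<Longrightarrow> tail_full k' {z \<in> A2. pattern k' z = s}"
      using tA[of A1 s] tA[of A2 s] by blast+
    have "finitely_determined V (fst P) \<and> tail_full k' (fst P) \<and> fst P \<noteq> {}"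
      using P
    proof (elim disjE conjE)
      assume "P = ({z \<in> A1. pattern k' z = s}, B1 s)" "{z \<in> A1. pattern k' z = s} \<noteq> {}"
      then show ?thesis using fdA(1)[of s] tA12(1) by simp
    next
      assume "P = ({z \<in> A2. pattern k' z = s}, Bs s - B1 s)" "{z \<in> A2. pattern k' z = s} \<noteq> {}"
      then show ?thesis using fdA(2)[of s] tA12(2) by simp
    qed
    then show ?thesis using Bparts tail_full_nonempty[OF V] lab unfolding matched_def by blast
  qed
  moreover have "p c = q c" if "P \<in> PP" "p \<in> fst P" "q \<in> fst P" for P p q
    using that A unfolding PP_def A1_def A2_def by auto
  ultimately show ?thesis using that k'(1) by blast
qed

text \<open>
  The inverse shift exchanges the roles of \<open>A\<close> and \<open>B\<close>.
\<close>

lemma refine_right: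
  assumes m: "matched k A B" "k0 \<le> k"
  obtains k' PP where "k < k'" "pairing A B PP" "\<forall>P\<in>PP. matched k' (fst P) (snd P)"
    "\<forall>P\<in>PP. \<forall>p\<in>snd P. \<forall>q\<in>snd P. p c = q c"
proof -
  interpret flip: label_shift V C L N \<tau> \<sigma> k0
    by unfold_locales (auto simp: \<sigma>_less \<tau>_less \<tau>\<sigma> \<sigma>\<tau>)
  have eq: "(l' = \<sigma> i l) = (l = \<tau> i l')" if "l < N i" "l' < N i" for l l' i
    using that \<tau>\<sigma> \<sigma>\<tau> by metis
  have flip: "flip.matched k B A \<longleftrightarrow> matched k A B" for k A B
  proof -
    have "(L q i = \<sigma> i (L p i)) = (L p i = \<tau> i (L q i))" if "p \<in> V" "q \<in> V" for p q i
      using eq L_less that by simp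
    then show ?thesis
      unfolding matched_def flip.matched_def finitely_determined_def by blast
  qed
  obtain k' PP where PP: "k < k'" "flip.pairing B A PP" "\<forall>P\<in>PP. flip.matched k' (fst P) (snd P)"
    "\<forall>P\<in>PP. \<forall>p\<in>fst P. \<forall>q\<in>fst P. p c = q c"
    by (rule flip.refine_left[OF _ m(2), of B A]) (use m(1) flip in auto)
  define QQ where "QQ = prod.swap ` PP"
  have inQ: "P \<in> QQ \<longleftrightarrow> prod.swap P \<in> PP" for P
    unfolding QQ_def by (metis image_iff swap_swap)
  have "(\<exists>!P. R (prod.swap P)) \<longleftrightarrow> (\<exists>!P. R P)" for R :: "('a \<Rightarrow> bool) set \<times> ('a \<Rightarrow> bool) set \<Rightarrow> bool"
    by (metis swap_swap)
  from this[of "\<lambda>P. P \<in> PP \<and> X (fst P) (snd P)" for X]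
  have ex: "(\<exists>!P. P \<in> QQ \<and> X (snd P) (fst P)) \<longleftrightarrow> (\<exists>!P. P \<in> PP \<and> X (fst P) (snd P))" for X
    unfolding inQ by simp
  have "\<forall>P\<in>QQ. fst P \<subseteq> A \<and> snd P \<subseteq> B"
    using PP(2) unfolding QQ_def flip.pairing_def by auto
  then have "pairing A B QQ"
    using PP(2) ex[of "\<lambda>a b. _ \<in> a"] ex[of "\<lambda>a b. _ \<in> b"] inQ unfolding pairing_def flip.pairing_def by simp
  moreover have "\<forall>P\<in>QQ. matched k' (fst P) (snd P)" using PP(3) flip by (simp add: QQ_def)
  moreover have "\<forall>P\<in>QQ. \<forall>p\<in>snd P. \<forall>q\<in>snd P. p c = q c" using PP(4) by (simp add: QQ_def)
  ultimately show ?thesis using that[OF PP(1)] by blast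
qed

lemma closed_finitely_determined:
  assumes "finitely_determined V D"
  shows "closed D"
proof -
  have "\<exists>F. finite F \<and> nb F z \<subseteq> - D" if z: "z \<in> - D" for z
  proof (cases "z \<in> V")
    case True
    obtain F where F0: "finite F" "\<forall>z\<in>V. \<forall>z'\<in>V \<inter> nb F z. z' \<in> D \<longleftrightarrow> z \<in> D"
      using assms by (rule finitely_determinedE)
    then have "nb F z \<subseteq> - D" using True z finitely_determined_subset[OF assms] by blast
    then show ?thesis using F0(1) by blast
  next
    case False
    have "open (- V)" using closed_V by (simp add: open_Compl)
    then obtain F where "finite F" "nb F z \<subseteq> - V" using False unfolding open_fun_bool_iff by blast
    then show ?thesis using finitely_determined_subset[OF assms] by blast
  qed
  then have "open (- D)" unfolding open_fun_bool_iff by blast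
  then show ?thesis by (simp add: closed_def)
qed

text \<open>
  Refine on the left and on the right in turn, deciding one coordinate after the other. A point of
  \<open>A\<close> determines a decreasing sequence of matched pairs whose first components contain it. By
  compactness the second components have a common point, which is unique since all coordinates get
  decided; this point is the image. Continuity holds because finitely many steps decide finitely
  many coordinates.
\<close>

theorem shift_homeomorphism:
  assumes m: "matched k0 A B"
  obtains h h' where "\<forall>p\<in>A. h p \<in> B \<and> h' (h p) = p \<and> (\<forall>i\<ge>k0. L (h p) i = \<sigma> i (L p i))"
    "\<forall>q\<in>B. h' q \<in> A \<and> h (h' q) = q"
    "\<forall>p\<in>A. \<forall>F. finite F \<longrightarrow> (\<exists>G. finite G \<and> (\<forall>p'\<in>A \<inter> nb G p. h p' \<in> nb F (h p)))"
    "\<forall>q\<in>B. \<forall>F. finite F \<longrightarrow> (\<exists>G. finite G \<and> (\<forall>q'\<in>B \<inter> nb G q. h' q' \<in> nb F (h' q)))"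
proof -
  have VA: "A \<subseteq> V" "B \<subseteq> V" using m by (auto simp: matched_def finitely_determined_subset)
  have C': "countable (insert undefined C)" using countable_C by simp
  define cc where "cc = from_nat_into (insert undefined C)"
  have cc: "\<exists>n. cc n = c" if "c \<in> C" for c
    using that C' unfolding cc_def by (metis from_nat_into_surj insertI2)
  define good where "good n k P k' PP \<longleftrightarrow> k < k' \<and> pairing (fst P) (snd P) PP \<and> (\<forall>Q\<in>PP. matched k' (fst Q) (snd Q)) \<and>
     (\<forall>Q\<in>PP. if even n then (\<forall>p\<in>fst Q. \<forall>q\<in>fst Q. p (cc (n div 2)) = q (cc (n div 2)))
        else (\<forall>p\<in>snd Q. \<forall>q\<in>snd Q. p (cc (n div 2)) = q (cc (n div 2))))" for n k P k' PP
  define st where "st n k P = (SOME R. good n k P (fst R) (snd R))" for n k P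
  have st: "good n k P (fst (st n k P)) (snd (st n k P))" if mm: "matched k (fst P) (snd P)" "k0 \<le> k" for n k P
  proof -
    have "\<exists>k' PP. good n k P k' PP"
    proof (cases "even n")
      case True
      obtain k' PP where "k < k'" "pairing (fst P) (snd P) PP" "\<forall>P\<in>PP. matched k' (fst P) (snd P)"
          "\<forall>P\<in>PP. \<forall>p\<in>fst P. \<forall>q\<in>fst P. p (cc (n div 2)) = q (cc (n div 2))"
        by (rule refine_left[OF mm, of "cc (n div 2)"])
      then show ?thesis using True unfolding good_def by (intro exI[of _ k'] exI[of _ PP]) simp
    next
      case False
      obtain k' PP where "k < k'" "pairing (fst P) (snd P) PP" "\<forall>P\<in>PP. matched k' (fst P) (snd P)"
          "\<forall>P\<in>PP. \<forall>p\<in>snd P. \<forall>q\<in>snd P. p (cc (n div 2)) = q (cc (n div 2))"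
        by (rule refine_right[OF mm, of "cc (n div 2)"])
      then show ?thesis using False unfolding good_def by (intro exI[of _ k'] exI[of _ PP]) simp
    qed
    then obtain k' PP where "good n k P k' PP" by blast
    then have "good n k P (fst (k', PP)) (snd (k', PP))" by simp
    then show ?thesis unfolding st_def by (rule someI[of "\<lambda>R. good n k P (fst R) (snd R)"])
  qed
  \<comment> \<open>\<open>cell p n\<close> is the level and the pair with \<open>p\<close> in its first component after \<open>n\<close> steps; \<open>dcell\<close> follows points of \<open>B\<close>\<close>
  define cell where "cell p = rec_nat (k0, (A, B)) (\<lambda>n S. (fst (st n (fst S) (snd S)),
     THE Q. Q \<in> snd (st n (fst S) (snd S)) \<and> p \<in> fst Q))" for p
  define dcell where "dcell q = rec_nat (k0, (A, B)) (\<lambda>n S. (fst (st n (fst S) (snd S)),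
     THE Q. Q \<in> snd (st n (fst S) (snd S)) \<and> q \<in> snd Q))" for q
  define lev where "lev p n = fst (cell p n)" for p n
  define lft where "lft p n = fst (snd (cell p n))" for p n
  define rgt where "rgt p n = snd (snd (cell p n))" for p n
  have cell0: "cell p 0 = (k0, (A, B))" "dcell p 0 = (k0, (A, B))" for p by (simp_all add: cell_def dcell_def)
  have cellS: "cell p (Suc n) = (fst (st n (lev p n) (snd (cell p n))), THE Q. Q \<in> snd (st n (lev p n) (snd (cell p n))) \<and> p \<in> fst Q)" for p n
    by (simp add: cell_def lev_def)
  have inv: "matched (lev p n) (lft p n) (rgt p n) \<and> k0 + n \<le> lev p n \<and> p \<in> lft p n" if p: "p \<in> A" for p n
  proof (induction n)
    case 0
    then show ?case using m p by (simp add: lev_def lft_def rgt_def cell0)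
  next
    case (Suc n)
    let ?S = "st n (lev p n) (snd (cell p n))"
    have g: "good n (lev p n) (snd (cell p n)) (fst ?S) (snd ?S)"
      by (rule st) (use Suc in \<open>auto simp: lft_def rgt_def\<close>)
    then have "\<exists>!Q. Q \<in> snd ?S \<and> p \<in> fst Q"
      using Suc unfolding good_def pairing_def lft_def by blast
    from theI'[OF this] have "snd (cell p (Suc n)) \<in> snd ?S \<and> p \<in> lft p (Suc n)"
      by (simp add: cellS lft_def)
    moreover have "lev p (Suc n) = fst ?S" by (simp add: lev_def cellS)
    ultimately show ?case using g Suc unfolding good_def lft_def rgt_def by auto
  qed
  have dinv: "matched (fst (dcell q n)) (fst (snd (dcell q n))) (snd (snd (dcell q n))) \<and> k0 + n \<le> fst (dcell q n) \<and> q \<in> snd (snd (dcell q n))" if q: "q \<in> B" for q n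
  proof (induction n)
    case 0
    then show ?case using m q by (simp add: cell0)
  next
    case (Suc n)
    let ?S = "st n (fst (dcell q n)) (snd (dcell q n))"
    have g: "good n (fst (dcell q n)) (snd (dcell q n)) (fst ?S) (snd ?S)"
      by (rule st) (use Suc in auto)
    then have "\<exists>!Q. Q \<in> snd ?S \<and> q \<in> snd Q"
      using Suc unfolding good_def pairing_def by blast
    from theI'[OF this] have "snd (dcell q (Suc n)) \<in> snd ?S \<and> q \<in> snd (snd (dcell q (Suc n)))"
      by (simp add: dcell_def)
    moreover have "fst (dcell q (Suc n)) = fst ?S" by (simp add: dcell_def)
    ultimately show ?case using g Suc unfolding good_def by auto
  qed
  have good: "good n (lev p n) (snd (cell p n)) (lev p (Suc n)) (snd (st n (lev p n) (snd (cell p n))))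
      \<and> snd (cell p (Suc n)) \<in> snd (st n (lev p n) (snd (cell p n)))" if p: "p \<in> A" for p n
  proof -
    let ?S = "st n (lev p n) (snd (cell p n))"
    have g: "good n (lev p n) (snd (cell p n)) (fst ?S) (snd ?S)"
      by (rule st) (use inv[OF p, of n] in \<open>auto simp: lft_def rgt_def\<close>)
    then have "\<exists>!Q. Q \<in> snd ?S \<and> p \<in> fst Q"
      using inv[OF p, of n] unfolding good_def pairing_def lft_def by blast
    from theI'[OF this] show ?thesis using g by (simp add: cellS lev_def)
  qed
  have dgood: "good n (fst (dcell q n)) (snd (dcell q n)) (fst (dcell q (Suc n))) (snd (st n (fst (dcell q n)) (snd (dcell q n))))
      \<and> snd (dcell q (Suc n)) \<in> snd (st n (fst (dcell q n)) (snd (dcell q n)))" if q: "q \<in> B" for q n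
  proof -
    let ?S = "st n (fst (dcell q n)) (snd (dcell q n))"
    have g: "good n (fst (dcell q n)) (snd (dcell q n)) (fst ?S) (snd ?S)"
      by (rule st) (use dinv[OF q, of n] in auto)
    then have "\<exists>!Q. Q \<in> snd ?S \<and> q \<in> snd Q"
      using dinv[OF q, of n] unfolding good_def pairing_def by blast
    from theI'[OF this] show ?thesis using g by (simp add: dcell_def)
  qed
  \<comment> \<open>a point on one side and a point on the other side correspond if they share all cells\<close>
  have same: "dcell q n = cell p n" if p: "p \<in> A" and q: "\<And>n. q \<in> rgt p n" for p q n
  proof (induction n)
    case 0
    then show ?case by (simp add: cell0)
  next
    case (Suc n)
    have qB: "q \<in> B" using q[of 0] by (simp add: rgt_def cell0)
    let ?S = "st n (lev p n) (snd (cell p n))"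
    have S: "st n (fst (dcell q n)) (snd (dcell q n)) = ?S" using Suc by (simp add: lev_def)
    have "\<exists>!Q. Q \<in> snd ?S \<and> q \<in> snd Q"
      using good[OF p, of n] q[of n] unfolding good_def pairing_def rgt_def by blast
    then have "snd (dcell q (Suc n)) = snd (cell p (Suc n))"
      using good[OF p, of n] dgood[OF qB, of n] q[of "Suc n"] dinv[OF qB, of "Suc n"] S unfolding rgt_def by auto
    moreover have "fst (dcell q (Suc n)) = fst (cell p (Suc n))" using S by (simp add: dcell_def cell_def lev_def)
    ultimately show ?case by (simp add: prod_eq_iff)
  qed
  have same': "cell p n = dcell q n" if q: "q \<in> B" and p: "\<And>n. p \<in> fst (snd (dcell q n))" for p q n
  proof (induction n)
    case 0
    then show ?case by (simp add: cell0)
  next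
    case (Suc n)
    have pA: "p \<in> A" using p[of 0] by (simp add: cell0)
    let ?S = "st n (fst (dcell q n)) (snd (dcell q n))"
    have S: "st n (lev p n) (snd (cell p n)) = ?S" using Suc by (simp add: lev_def)
    have "\<exists>!Q. Q \<in> snd ?S \<and> p \<in> fst Q"
      using dgood[OF q, of n] p[of n] unfolding good_def pairing_def by blast
    then have "snd (cell p (Suc n)) = snd (dcell q (Suc n))"
      using dgood[OF q, of n] good[OF pA, of n] p[of "Suc n"] inv[OF pA, of "Suc n"] S unfolding lft_def by auto
    moreover have "fst (cell p (Suc n)) = fst (dcell q (Suc n))" using S by (simp add: dcell_def cell_def lev_def)
    ultimately show ?case by (simp add: prod_eq_iff)
  qed
  have nested: "(\<Inter>n. F n) \<noteq> {}"
    if "\<And>n. finitely_determined V (F n)" "\<And>n. F n \<noteq> {}" "\<And>n. F (Suc n) \<subseteq> F n" for F :: "nat \<Rightarrow> ('a \<Rightarrow> bool) set"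
  proof -
    have dec: "F n \<subseteq> F m" if "m \<le> n" for m n
      using that \<open>\<And>n. F (Suc n) \<subseteq> F n\<close> by (rule lift_Suc_antimono_le[rotated])
    have "V \<inter> \<Inter>(range F) \<noteq> {}"
    proof (rule compact_imp_fip[OF compact_V])
      fix T assume "T \<in> range F"
      then show "closed T" using closed_finitely_determined that(1) by auto
    next
      fix F' assume F': "finite F'" "F' \<subseteq> range F"
      then obtain I where I: "finite I" "F' = F ` I" by (meson finite_subset_image)
      obtain n where "I \<subseteq> {..<n}" using finite_nat_bounded[OF I(1)] by blast
      then have "i < n" if "i \<in> I" for i using that by blast
      then have "F n \<subseteq> F i" if "i \<in> I" for i using that dec[of i n] less_imp_le by blast
      then have "F n \<subseteq> \<Inter>F'" unfolding I(2) by blast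
      moreover have "F n \<subseteq> V" by (rule finitely_determined_subset[OF that(1)])
      ultimately show "V \<inter> \<Inter>F' \<noteq> {}" using that(2)[of n] by blast
    qed
    then show ?thesis by blast
  qed
  have sub: "lft p (Suc n) \<subseteq> lft p n" "rgt p (Suc n) \<subseteq> rgt p n" if "p \<in> A" for p n
    using good[OF that, of n] unfolding good_def pairing_def lft_def rgt_def by blast+
  have dsub: "fst (snd (dcell q (Suc n))) \<subseteq> fst (snd (dcell q n))" if "q \<in> B" for q n
    using dgood[OF that, of n] unfolding good_def pairing_def by blast
  have "\<exists>q. \<forall>n. q \<in> rgt p n" if p: "p \<in> A" for p
  proof -
    have "(\<Inter>n. rgt p n) \<noteq> {}"
      by (rule nested) (use inv[OF p] sub[OF p] in \<open>simp_all add: matched_def\<close>)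
    then show ?thesis by blast
  qed
  then have "\<forall>p\<in>A. \<exists>q. \<forall>n. q \<in> rgt p n" by blast
  from bchoice[OF this] obtain h where h: "\<forall>p\<in>A. \<forall>n. h p \<in> rgt p n" by (rule exE)
  have "\<exists>p. \<forall>n. p \<in> fst (snd (dcell q n))" if q: "q \<in> B" for q
  proof -
    have "(\<Inter>n. fst (snd (dcell q n))) \<noteq> {}"
      by (rule nested) (use dinv[OF q] dsub[OF q] in \<open>simp_all add: matched_def\<close>)
    then show ?thesis by blast
  qed
  then have "\<forall>q\<in>B. \<exists>p. \<forall>n. p \<in> fst (snd (dcell q n))" by blast
  from bchoice[OF this] obtain h' where h': "\<forall>q\<in>B. \<forall>n. h' q \<in> fst (snd (dcell q n))" by (rule exE)
  have hB: "h p \<in> B" if "p \<in> A" for p using h that by (metis rgt_def cell0(1) snd_conv)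
  have h'A: "h' q \<in> A" if "q \<in> B" for q using h' that by (metis cell0(2) snd_conv fst_conv)
  have decl: "p' (cc n) = p (cc n)" if "p \<in> A" "p' \<in> lft p (Suc (2 * n))" for p p' n
  proof -
    have "\<forall>Q\<in>snd (st (2 * n) (lev p (2 * n)) (snd (cell p (2 * n)))). \<forall>p\<in>fst Q. \<forall>q\<in>fst Q. p (cc n) = q (cc n)"
      using good[OF that(1), of "2 * n"] unfolding good_def by simp
    then show ?thesis
      using good[OF that(1), of "2 * n"] that(2) inv[OF that(1), of "Suc (2 * n)"] unfolding lft_def by blast
  qed
  have decr: "q' (cc n) = q (cc n)" if "p \<in> A" "q \<in> rgt p (Suc (Suc (2 * n)))" "q' \<in> rgt p (Suc (Suc (2 * n)))" for p q q' n
  proof -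
    have "\<forall>Q\<in>snd (st (Suc (2 * n)) (lev p (Suc (2 * n))) (snd (cell p (Suc (2 * n))))). \<forall>p\<in>snd Q. \<forall>q\<in>snd Q. p (cc n) = q (cc n)"
      using good[OF that(1), of "Suc (2 * n)"] unfolding good_def by simp
    then show ?thesis
      using good[OF that(1), of "Suc (2 * n)"] that(2,3) unfolding rgt_def by blast
  qed
  have uniq: "p = p'" if "p \<in> A" "p' \<in> A" "\<And>n. p' (cc n) = p (cc n)" for p p'
  proof
    fix c
    show "p c = p' c" using cc[of c] that support[of p c] support[of p' c] VA by (cases "c \<in> C") auto
  qed
  have uniqB: "p = p'" if "p \<in> B" "p' \<in> B" "\<And>n. p' (cc n) = p (cc n)" for p p'
  proof
    fix c
    show "p c = p' c" using cc[of c] that support[of p c] support[of p' c] VA by (cases "c \<in> C") auto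
  qed
  have celleq: "dcell (h p) n = cell p n" if "p \<in> A" for p n using same[OF that] h that by blast
  have celleq': "cell (h' q) n = dcell q n" if "q \<in> B" for q n using same'[OF that] h' that by blast
  have h'h: "h' (h p) = p" if p: "p \<in> A" for p
  proof (rule sym, rule uniq[OF p h'A[OF hB[OF p]]])
    fix n
    show "h' (h p) (cc n) = p (cc n)"
      by (rule decl[OF p]) (use h' hB[OF p] celleq[OF p] in \<open>simp add: lft_def\<close>, metis)
  qed
  have hh': "h (h' q) = q" if q: "q \<in> B" for q
  proof (rule sym, rule uniqB[OF q hB[OF h'A[OF q]]])
    fix n
    have "q \<in> rgt (h' q) (Suc (Suc (2 * n)))" using dinv[OF q] celleq'[OF q] by (simp add: rgt_def)
    moreover have "h (h' q) \<in> rgt (h' q) (Suc (Suc (2 * n)))" using h h'A[OF q] by blast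
    ultimately show "h (h' q) (cc n) = q (cc n)" by (rule decr[OF h'A[OF q]])
  qed
  have lab: "L (h p) i = \<sigma> i (L p i)" if p: "p \<in> A" "k0 \<le> i" for p i
    using inv[OF p(1), of "Suc i"] h p unfolding matched_def by auto
  have key: "p' \<in> lft p n \<Longrightarrow> cell p' n = cell p n" if "p \<in> A" "p' \<in> A" for p p' n
  proof (induction n)
    case (Suc n)
    then have IH: "cell p' n = cell p n" using sub[OF that(1)] by blast
    have "\<exists>!Q. Q \<in> snd (st n (lev p n) (snd (cell p n))) \<and> p' \<in> fst Q"
      using good[OF that(1), of n] sub[OF that(1), of n] Suc.prems unfolding good_def pairing_def lft_def by blast
    then have "snd (cell p' (Suc n)) = snd (cell p (Suc n))"
      using good[OF that(1), of n] good[OF that(2), of n] inv[OF that(2), of "Suc n"] Suc.prems IH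
      unfolding lft_def lev_def by auto
    moreover have "fst (cell p' (Suc n)) = fst (cell p (Suc n))" using IH by (simp add: cell_def)
    ultimately show ?case by (simp add: prod_eq_iff)
  qed (simp add: cell0)
  have coord: "\<exists>n. \<forall>c\<in>F \<inter> C. \<exists>i<n. cc i = c" if F: "finite F" for F
  proof -
    have "\<forall>c\<in>F \<inter> C. \<exists>i. cc i = c" using cc by blast
    from bchoice[OF this] obtain g where g: "\<forall>c\<in>F \<inter> C. cc (g c) = c" by (rule exE)
    have "finite (g ` (F \<inter> C))" using F by simp
    from finite_nat_bounded[OF this] obtain n where "g ` (F \<inter> C) \<subseteq> {..<n}" by (rule exE)
    then have "\<exists>i<n. cc i = c" if c: "c \<in> F \<inter> C" for c
    proof -
      have "g c \<in> {..<n}" using c \<open>g ` (F \<inter> C) \<subseteq> {..<n}\<close> by blast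
      then show ?thesis using bspec[OF g c] by (intro exI[of _ "g c"]) simp
    qed
    then show ?thesis by blast
  qed
  have cont: "\<exists>G. finite G \<and> (\<forall>p'\<in>A \<inter> nb G p. h p' \<in> nb F (h p))" if p: "p \<in> A" and F: "finite F" for p F
  proof -
    obtain n where n: "\<forall>c\<in>F \<inter> C. \<exists>i<n. cc i = c" using coord[OF F] by blast
    obtain G where G: "finite G" "V \<inter> nb G p \<subseteq> lft p (2 * n)"
      using inv[OF p, of "2 * n"] finitely_determined_nb unfolding matched_def by metis
    have "h p' \<in> nb F (h p)" if p': "p' \<in> A \<inter> nb G p" for p'
    proof -
      have "p' \<in> lft p (2 * n)" using p' G VA by blast
      then have eq: "cell p' (2 * n) = cell p (2 * n)" using key p p' by blast
      have "h p' c = h p c" if c: "c \<in> F" for c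
      proof (cases "c \<in> C")
        case True
        then obtain i where i: "i < n" "cc i = c" using n c by blast
        have r: "rgt p (2 * n) \<subseteq> rgt p (Suc (Suc (2 * i)))"
          by (rule lift_Suc_antimono_le[of "rgt p"]) (use sub[OF p] i in auto)
        have "h p' \<in> rgt p (2 * n)" "h p \<in> rgt p (2 * n)" using h p p' eq unfolding rgt_def by (metis IntD1)+
        then show ?thesis using decr[OF p, of "h p" i "h p'"] r i by blast
      next
        case False
        then show ?thesis using support hB p p' VA by blast
      qed
      then show ?thesis by (simp add: nb_def)
    qed
    then show ?thesis using G by blast
  qed
  have cont': "\<exists>G. finite G \<and> (\<forall>q'\<in>B \<inter> nb G q. h' q' \<in> nb F (h' q))" if q: "q \<in> B" and F: "finite F" for q F
  proof -
    define p where "p = h' q"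
    have p: "p \<in> A" "h p = q" using h'A hh' q by (auto simp: p_def)
    obtain n where n: "\<forall>c\<in>F \<inter> C. \<exists>i<n. cc i = c" using coord[OF F] by blast
    have "q \<in> rgt p (2 * n)" using h p by blast
    then obtain G where G: "finite G" "V \<inter> nb G q \<subseteq> rgt p (2 * n)"
      using inv[OF p(1), of "2 * n"] finitely_determined_nb unfolding matched_def by metis
    have "h' q' \<in> nb F (h' q)" if q': "q' \<in> B \<inter> nb G q" for q'
    proof -
      have q'': "q' \<in> rgt p (2 * n)" "q' \<in> B" using q' G VA by blast+
      have deq: "dcell q' m = cell p m" if "m \<le> 2 * n" for m
        using that
      proof (induction m)
        case (Suc m)
        have IH: "dcell q' m = cell p m" using Suc by simp
        have qm: "q' \<in> rgt p j" if "j \<le> 2 * n" for j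
          using lift_Suc_antimono_le[of "rgt p", OF sub(2)[OF p(1)] that] q'' by blast
        have "\<exists>!Q. Q \<in> snd (st m (lev p m) (snd (cell p m))) \<and> q' \<in> snd Q"
          using good[OF p(1), of m] qm[of m] Suc.prems unfolding good_def pairing_def rgt_def by auto
        then have "snd (dcell q' (Suc m)) = snd (cell p (Suc m))"
          using good[OF p(1), of m] dgood[OF q''(2), of m] dinv[OF q''(2), of "Suc m"] qm[OF Suc.prems] IH
          unfolding rgt_def lev_def by auto
        moreover have "fst (dcell q' (Suc m)) = fst (cell p (Suc m))" using IH by (simp add: cell_def dcell_def)
        ultimately show ?case by (simp add: prod_eq_iff)
      qed (simp add: cell0)
      have hl: "h' q' \<in> lft p (2 * n)" using h' q''(2) deq[of "2 * n"] unfolding lft_def by (metis order_refl)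
      have "h' q' c = p c" if c: "c \<in> F" for c
      proof (cases "c \<in> C")
        case True
        then obtain i where i: "i < n" "cc i = c" using n c by blast
        have "lft p (2 * n) \<subseteq> lft p (Suc (2 * i))"
          by (rule lift_Suc_antimono_le[of "lft p"]) (use sub[OF p(1)] i in auto)
        then show ?thesis using decl[OF p(1), of "h' q'" i] hl i by blast
      next
        case False
        then show ?thesis using support h'A p q'' VA by blast
      qed
      then show ?thesis by (simp add: nb_def p_def)
    qed
    then show ?thesis using G by blast
  qed
  show ?thesis
  proof (rule that[of h h'])
    show "\<forall>p\<in>A. h p \<in> B \<and> h' (h p) = p \<and> (\<forall>i\<ge>k0. L (h p) i = \<sigma> i (L p i))"
      by (intro ballI conjI allI impI hB h'h lab)
    show "\<forall>q\<in>B. h' q \<in> A \<and> h (h' q) = q"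
      by (intro ballI conjI h'A hh')
    show "\<forall>p\<in>A. \<forall>F. finite F \<longrightarrow> (\<exists>G. finite G \<and> (\<forall>p'\<in>A \<inter> nb G p. h p' \<in> nb F (h p)))"
      by (intro ballI allI impI cont)
    show "\<forall>q\<in>B. \<forall>F. finite F \<longrightarrow> (\<exists>G. finite G \<and> (\<forall>q'\<in>B \<inter> nb G q. h' q' \<in> nb F (h' q)))"
      by (intro ballI allI impI cont')
  qed
qed

end

context labelled_space
begin

text \<open>Any two nonempty clopen sets become equally rich in labels once finitely many labels are ignored.\<close>

theorem clopen_shift:
  assumes U: "finitely_determined V U" "U \<noteq> {}" and W: "finitely_determined V W" "W \<noteq> {}"
    and \<sigma>: "\<And>i l. l < N i \<Longrightarrow> \<sigma> i l < N i" and \<tau>: "\<And>i l. l < N i \<Longrightarrow> \<tau> i l < N i"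
    and inv: "\<And>i l. l < N i \<Longrightarrow> \<tau> i (\<sigma> i l) = l" "\<And>i l. l < N i \<Longrightarrow> \<sigma> i (\<tau> i l) = l"
  obtains k0 h h' where "\<forall>p\<in>U. h p \<in> W \<and> h' (h p) = p \<and> (\<forall>i\<ge>k0. L (h p) i = \<sigma> i (L p i))"
    "\<forall>q\<in>W. h' q \<in> U \<and> h (h' q) = q"
    "\<forall>p\<in>U. \<forall>F. finite F \<longrightarrow> (\<exists>G. finite G \<and> (\<forall>p'\<in>U \<inter> nb G p. h p' \<in> nb F (h p)))"
    "\<forall>q\<in>W. \<forall>F. finite F \<longrightarrow> (\<exists>G. finite G \<and> (\<forall>q'\<in>W \<inter> nb G q. h' q' \<in> nb F (h' q)))"
proof -
  obtain k1 where k1: "full k1 U" by (rule eventually_full[OF U(1)])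
  obtain k2 where k2: "full k2 W" by (rule eventually_full[OF W(1)])
  define k0 where "k0 = max k1 k2"
  have k0: "full k0 U" "full k0 W" using full_mono[OF k1, of k0] full_mono[OF k2, of k0] by (auto simp: k0_def)
  have t: "tail_full k0 U" "tail_full k0 W"
    using full_imp_tail_full k0 U W finitely_determined_subset by blast+
  interpret label_shift V C L N \<sigma> \<tau> k0
    by unfold_locales (use \<sigma> \<tau> inv in auto)
  have "matched k0 U W" using U W t by (auto simp: matched_def)
  then show ?thesis by (rule shift_homeomorphism) (rule that)
qed

end

section \<open>Towers of split points\<close>

instantiation om1 :: order_bot
begin
definition "bot = (LEAST a::om1. True)"
instance by intro_classes (simp add: bot_om1_def Least_le)
end

type_synonym point = "om1 \<times> nat \<Rightarrow> bool"
type_synonym letter = "om1 \<times> nat \<times> bool"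

definition res :: "point \<Rightarrow> om1 \<Rightarrow> point" where
  "res z a = (\<lambda>(b, n). b < a \<and> z (b, n))"

lemma res_apply: "res z a (b, n) \<longleftrightarrow> b < a \<and> z (b, n)"
  by (simp add: res_def)

lemma res_res: "b \<le> a \<Longrightarrow> res (res z a) b = res z b"
  by (auto simp: res_def fun_eq_iff)

lemma res_nb: "z' \<in> nb H z \<Longrightarrow> res z' a \<in> nb H (res z a)"
  by (auto simp: nb_def res_def)

text \<open>
  The data of one stage: the points that are split, the sides on which the other points lie, the
  permutations by which the homeomorphisms constructed so far act on the split points, new
  homeomorphisms, and promises. A promise \<open>(T, A)\<close> says that at all later stages every point above
  \<open>A\<close> is a limit of whole fibres above points of \<open>T\<close>.
\<close>

record stage =
  split_pts :: "point set"
  side :: "point \<Rightarrow> point \<Rightarrow> bool"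
  perm :: "letter \<Rightarrow> nat \<Rightarrow> nat"
  gen :: "nat \<times> bool \<Rightarrow> point \<Rightarrow> point"
  promises :: "(point set \<times> point set) set"

text \<open>
  The number, within the block of a stage, of the coordinate that records on which side of a split
  point a point lies.
\<close>

definition idx :: "stage \<Rightarrow> point \<Rightarrow> nat" where
  "idx S = to_nat_on (split_pts S)"

lemma idx_eq: "countable (split_pts S) \<Longrightarrow> x \<in> split_pts S \<Longrightarrow> y \<in> split_pts S \<Longrightarrow> idx S x = idx S y \<longleftrightarrow> x = y"
  unfolding idx_def by (rule to_nat_on_inj)

text \<open>
  The possible blocks above a point \<open>p\<close>. The coordinate that belongs to a split point \<open>y \<noteq> p\<close> is
  prescribed; that of \<open>p\<close> itself is free if \<open>p\<close> is split, so that two points lie above \<open>p\<close>.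
\<close>

definition fits :: "stage \<Rightarrow> point \<Rightarrow> (nat \<Rightarrow> bool) \<Rightarrow> bool" where
  "fits S p u \<longleftrightarrow> (\<forall>n. u n \<longrightarrow> n \<in> idx S ` split_pts S) \<and>
     (\<forall>y\<in>split_pts S. p \<noteq> y \<longrightarrow> u (idx S y) = side S y p)"

text \<open>The block of coordinates with index \<open>bot\<close> is unrestricted, so the first space of a tower is a Cantor set.\<close>

definition tow :: "(om1 \<Rightarrow> stage) \<Rightarrow> om1 set \<Rightarrow> point set" where
  "tow F B = {z. (\<forall>b n. b \<notin> B \<longrightarrow> \<not> z (b, n)) \<and>
     (\<forall>b\<in>B. b \<noteq> bot \<longrightarrow> fits (F b) (res z b) (\<lambda>n. z (b, n)))}"

lemma tow_cong: "(\<And>b. b \<in> B \<Longrightarrow> F b = F' b) \<Longrightarrow> tow F B = tow F' B"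
  by (auto simp: tow_def)

lemma tow_off: "z \<in> tow F B \<Longrightarrow> b \<notin> B \<Longrightarrow> \<not> z (b, n)"
  by (simp add: tow_def)

lemma tow_fits: "z \<in> tow F B \<Longrightarrow> b \<in> B \<Longrightarrow> b \<noteq> bot \<Longrightarrow> fits (F b) (res z b) (\<lambda>n. z (b, n))"
  by (simp add: tow_def)

lemma res_in_tow:
  assumes "z \<in> tow F B" "{..<b} \<subseteq> B"
  shows "res z b \<in> tow F {..<b}"
proof -
  have "fits (F c) (res (res z b) c) (\<lambda>n. res z b (c, n))" if "c < b" "c \<noteq> bot" for c
  proof -
    have "fits (F c) (res z c) (\<lambda>n. z (c, n))" using tow_fits[OF assms(1)] assms(2) that by blast
    then show ?thesis using that by (simp add: res_res less_imp_le res_apply)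
  qed
  then show ?thesis by (auto simp: tow_def res_apply)
qed

lemma res_id: "z \<in> tow F {..<b} \<Longrightarrow> res z b = z"
  by (auto simp: fun_eq_iff res_apply dest: tow_off)

definition acc :: "point set \<Rightarrow> point set \<Rightarrow> point set" where
  "acc V T = {z \<in> V. \<forall>H. finite H \<longrightarrow> (\<exists>s\<in>T \<inter> nb H z. s \<noteq> z)}"

text \<open>
  A letter \<open>(i, m, s)\<close> acts by the \<open>m\<close>-th generator of stage \<open>i\<close> or its inverse. From stage \<open>i\<close> on
  the homeomorphism is extended: it permutes the coordinates of a block as it permutes the points
  split at that stage.
\<close>

definition act :: "(om1 \<Rightarrow> stage) \<Rightarrow> letter \<Rightarrow> point \<Rightarrow> point" where
  "act F j z = (\<lambda>(b, n). if b < fst j then gen (F (fst j)) (snd j) (res z (fst j)) (b, n)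
     else z (b, perm (F b) j n))"

definition inv_letter :: "letter \<Rightarrow> letter" where
  "inv_letter j = (fst j, fst (snd j), \<not> snd (snd j))"

lemma inv_letter_simps [simp]: "fst (inv_letter j) = fst j" "inv_letter (inv_letter j) = j"
  by (simp_all add: inv_letter_def)

text \<open>The same action cut off at stage \<open>a\<close>; it refers to the stages up to \<open>a\<close> only.\<close>

definition acta :: "(om1 \<Rightarrow> stage) \<Rightarrow> om1 \<Rightarrow> letter \<Rightarrow> point \<Rightarrow> point" where
  "acta F a j z = (\<lambda>(b, n). if b < fst j then gen (F (fst j)) (snd j) (res z (fst j)) (b, n)
     else b < a \<and> z (b, perm (F b) j n))"

lemma acta_eq_act: "z \<in> tow F {..<a} \<Longrightarrow> acta F a j z = act F j z"
  by (auto simp: fun_eq_iff act_def acta_def dest: tow_off)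

lemma acta_cong:
  assumes "\<And>b. b \<le> a \<Longrightarrow> F b = F' b" "fst j \<le> a"
  shows "acta F a j = acta F' a j"
  using assms by (auto simp: fun_eq_iff acta_def)

text \<open>
  \<open>G\<close> provides the guesses. The labels of level \<open>k\<close> are the numbers below \<open>N k\<close>, and \<open>\<sigma>\<close> is the
  action of a free group on them; \<open>code (i, m)\<close> is the free generator that governs the \<open>m\<close>-th
  homeomorphism of stage \<open>i\<close>. Sequences of type \<open>\<omega>\<close> are guessed at the positions \<open>\<nu> 0, \<nu> 1, \<dots>\<close> of an
  \<open>\<omega>\<^sub>1\<close>-sequence. The flag \<open>homog\<close> selects the space with many homeomorphisms; otherwise the rigid
  one is constructed.
\<close>

locale parameters =
  fixes G :: "om1 \<Rightarrow> om1 \<times> om1 \<times> nat \<Rightarrow> bool" and N :: "nat \<Rightarrow> nat"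
    and \<sigma> :: "nat set \<times> bool \<Rightarrow> nat \<Rightarrow> nat \<Rightarrow> nat"
    and code :: "om1 \<times> nat \<Rightarrow> nat set" and \<nu> :: "nat \<Rightarrow> om1" and homog :: bool
  assumes guess: "\<And>X h. \<exists>a. (\<exists>g. g < a) \<and> (\<forall>g<a. h g < a) \<and>
            (\<forall>x b n. x < a \<longrightarrow> b < a \<longrightarrow> G a (x, b, n) = X (x, b, n))"
    and N_pos: "\<And>k. 0 < N k"
    and \<sigma>_bij: "\<And>a k. bij_betw (\<sigma> a k) {..<N k} {..<N k}"
    and \<sigma>_inv: "\<And>r s k l. l < N k \<Longrightarrow> \<sigma> (r, s) k (\<sigma> (r, \<not> s) k l) = l"
    and \<sigma>_free: "\<And>w. reduced_word w \<Longrightarrow> w \<noteq> [] \<Longrightarrow> \<exists>k0. \<forall>k\<ge>k0. \<forall>l<N k. foldr (\<lambda>a. \<sigma> a k) w l \<noteq> l"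
    and code: "inj code" and \<nu>: "inj \<nu>"
begin

lemma \<sigma>_less: "l < N k \<Longrightarrow> \<sigma> a k l < N k"
  using \<sigma>_bij[of a k] by (auto simp: bij_betw_def)

text \<open>
  The label of level \<open>k\<close> is read off the first \<open>N k\<close> coordinates with numbers \<open>prod_encode (k, j)\<close>
  in the block \<open>bot\<close>; every number below \<open>N k\<close> occurs as a label, and infinitely many coordinates
  have no influence on labels.
\<close>

definition lab :: "point \<Rightarrow> nat \<Rightarrow> nat" where
  "lab z k = (LEAST j. \<not> z (bot, prod_encode (k, j)) \<or> Suc j = N k)"

lemma lab_less: "lab z k < N k"
proof -
  have "lab z k \<le> N k - 1" unfolding lab_def by (rule Least_le) (use N_pos[of k] in simp)
  then show ?thesis using N_pos[of k] by simp
qed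

lemma lab_cong:
  assumes "\<And>j. j < N k \<Longrightarrow> z (bot, prod_encode (k, j)) = z' (bot, prod_encode (k, j))"
  shows "lab z k = lab z' k"
proof -
  have *: "lab z k = lab z' k" if "lab z k \<le> lab z' k" 
    and eq: "\<And>j. j < N k \<Longrightarrow> z (bot, prod_encode (k, j)) = z' (bot, prod_encode (k, j))" for z z'
  proof (rule antisym[OF that(1)])
    have "\<not> z (bot, prod_encode (k, lab z k)) \<or> Suc (lab z k) = N k"
      unfolding lab_def by (rule LeastI[of _ "N k - 1"]) (use N_pos[of k] in simp)
    then show "lab z' k \<le> lab z k"
      unfolding lab_def[of z'] by (intro Least_le) (use eq lab_less in blast)
  qed
  show ?thesis using *[of z z'] *[of z' z] assms by (metis linear)
qed

lemma lab_value:
  assumes "l < N k" "\<And>j. j < N k \<Longrightarrow> z (bot, prod_encode (k, j)) \<longleftrightarrow> j < l"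
  shows "lab z k = l"
  unfolding lab_def
proof (rule Least_equality)
  show "\<not> z (bot, prod_encode (k, l)) \<or> Suc l = N k" using assms by blast
  fix j assume j: "\<not> z (bot, prod_encode (k, j)) \<or> Suc j = N k"
  show "l \<le> j"
  proof (rule ccontr)
    assume "\<not> l \<le> j"
    then show False using j assms by auto
  qed
qed

lemma lab_res: "bot < a \<Longrightarrow> lab (res z a) = lab z"
  by (rule ext, rule lab_cong) (simp add: res_apply)

definition letters :: "om1 \<Rightarrow> letter set" where
  "letters a = {j. homog \<and> fst j \<noteq> bot \<and> fst j \<le> a}"

definition row :: "om1 \<Rightarrow> om1 \<Rightarrow> point" where
  "row a x = (\<lambda>(b, n). b < a \<and> G a (x, b, n))"

definition guessed :: "(om1 \<Rightarrow> stage) \<Rightarrow> om1 \<Rightarrow> point set" where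
  "guessed F a = row a ` ({..<a} \<union> range \<nu>) \<inter> tow F {..<a}"

text \<open>
  The guess is read as the sequence of pairs formed by its rows \<open>\<nu> (2 * n)\<close> and \<open>\<nu> (2 * n + 1)\<close>; the
  limit has to lie off the diagonal and is approached in both components by points different from
  the limit.
\<close>

definition pair_limit :: "(om1 \<Rightarrow> stage) \<Rightarrow> om1 \<Rightarrow> point \<Rightarrow> point \<Rightarrow> bool" where
  "pair_limit F a x y \<longleftrightarrow> x \<in> tow F {..<a} \<and> y \<in> tow F {..<a} \<and> x \<noteq> y \<and>
     (\<forall>H. finite H \<longrightarrow> (\<exists>n. row a (\<nu> (2*n)) \<in> tow F {..<a} \<inter> nb H x \<and> row a (\<nu> (2*n)) \<noteq> x \<and>
        row a (\<nu> (2*n+1)) \<in> tow F {..<a} \<inter> nb H y \<and> row a (\<nu> (2*n+1)) \<noteq> y))"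

definition sides_ok :: "(om1 \<Rightarrow> stage) \<Rightarrow> om1 \<Rightarrow> bool" where
  "sides_ok F a \<longleftrightarrow> (\<forall>y\<in>split_pts (F a). \<forall>z\<in>tow F {..<a}. z \<noteq> y \<longrightarrow>
     (\<exists>H. finite H \<and> (\<forall>z'\<in>tow F {..<a} \<inter> nb H z. z' \<noteq> y \<and> side (F a) y z' = side (F a) y z)))"

text \<open>
  Each of the two sides of \<open>y\<close> contains whole fibres close to \<open>y\<close>, so both points above \<open>y\<close> inherit
  the promise.
\<close>

definition promises_kept :: "(om1 \<Rightarrow> stage) \<Rightarrow> om1 \<Rightarrow> bool" where
  "promises_kept F a \<longleftrightarrow> (\<forall>b\<le>a. b \<noteq> bot \<longrightarrow> (\<forall>(T, A)\<in>promises (F b). \<forall>y\<in>split_pts (F a). res y b \<in> A \<longrightarrow>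
     (\<forall>H c. finite H \<longrightarrow> (\<exists>s\<in>T. s \<noteq> res y b \<and>
        (\<forall>z\<in>tow F {..<a}. res z b = s \<longrightarrow> z \<in> nb H y \<and> side (F a) y z = c)))))"

text \<open>
  Likewise, each of the two sides of \<open>y\<close> realizes all label sequences close to that of \<open>y\<close>.
\<close>

definition labels_kept :: "(om1 \<Rightarrow> stage) \<Rightarrow> om1 \<Rightarrow> bool" where
  "labels_kept F a \<longleftrightarrow> (\<forall>y\<in>split_pts (F a). \<forall>H c. finite H \<longrightarrow>
     (\<exists>k. \<forall>l. (\<forall>i. l i < N i) \<longrightarrow> (\<forall>i<k. l i = lab y i) \<longrightarrow>
        (\<exists>q\<in>tow F {..<a} \<inter> nb H y. q \<noteq> y \<and> side (F a) y q = c \<and> lab q = l)))"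

definition gens_ok :: "(om1 \<Rightarrow> stage) \<Rightarrow> om1 \<Rightarrow> bool" where
  "gens_ok F a \<longleftrightarrow>
     (\<forall>m s. \<forall>z\<in>tow F {..<a}. gen (F a) (m, s) z \<in> tow F {..<a} \<and> gen (F a) (m, s) (gen (F a) (m, \<not> s) z) = z \<and>
        (\<forall>H. finite H \<longrightarrow> (\<exists>H'. finite H' \<and> (\<forall>z'\<in>tow F {..<a} \<inter> nb H' z. gen (F a) (m, s) z' \<in> nb H (gen (F a) (m, s) z))))) \<and>
     (\<forall>m s. \<exists>k0. \<forall>z\<in>tow F {..<a}. \<forall>k\<ge>k0. lab (gen (F a) (m, s) z) k = \<sigma> (code (a, m), s) k (lab z k)) \<and>
     (\<forall>U W. finitely_determined (tow F {..<a}) U \<longrightarrow> finitely_determined (tow F {..<a}) W \<longrightarrow> U \<noteq> {} \<longrightarrow> W \<noteq> {} \<longrightarrow>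
        U \<noteq> tow F {..<a} \<longrightarrow> W \<noteq> tow F {..<a} \<longrightarrow> (\<exists>m. \<forall>z\<in>tow F {..<a}. gen (F a) (m, True) z \<in> W \<longleftrightarrow> z \<in> U))"

text \<open>
  The letters available at stage \<open>a\<close> carry split points to split points and sides to sides. The
  permutation \<open>perm\<close> is inverse to the motion of split points since it acts on coordinates.
\<close>

definition equivariant :: "(om1 \<Rightarrow> stage) \<Rightarrow> om1 \<Rightarrow> bool" where
  "equivariant F a \<longleftrightarrow> (\<forall>j\<in>letters a. (\<forall>n. n \<notin> idx (F a) ` split_pts (F a) \<longrightarrow> perm (F a) j n = n) \<and>
     (\<forall>y\<in>split_pts (F a). acta F a j y \<in> split_pts (F a) \<and> perm (F a) j (idx (F a) (acta F a j y)) = idx (F a) y \<and>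
        (\<forall>z\<in>tow F {..<a}. z \<noteq> y \<longrightarrow> side (F a) (acta F a j y) (acta F a j z) = side (F a) y z)))"

definition guess_used :: "(om1 \<Rightarrow> stage) \<Rightarrow> om1 \<Rightarrow> bool" where
  "guess_used F a \<longleftrightarrow> (guessed F a, acc (tow F {..<a}) (guessed F a)) \<in> promises (F a) \<and>
     (acc (tow F {..<a}) (guessed F a) \<noteq> {} \<longrightarrow> split_pts (F a) \<inter> acc (tow F {..<a}) (guessed F a) \<noteq> {})"

text \<open>
  If the guessed pairs are of the form \<open>(p, f p)\<close>, the two promises make the inverse of \<open>f\<close>
  discontinuous above \<open>y\<close>.
\<close>

definition map_killed :: "(om1 \<Rightarrow> stage) \<Rightarrow> om1 \<Rightarrow> bool" where
  "map_killed F a \<longleftrightarrow> (\<exists>x y. pair_limit F a x y) \<longrightarrow>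
     (\<exists>x y. x \<in> split_pts (F a) \<and> y \<in> tow F {..<a} \<and>
       (\<forall>c. ({row a (\<nu> (2*n+1)) | n. row a (\<nu> (2*n)) \<in> tow F {..<a} \<and> row a (\<nu> (2*n+1)) \<in> tow F {..<a} \<and>
          row a (\<nu> (2*n)) \<noteq> x \<and> side (F a) x (row a (\<nu> (2*n))) = c}, {y}) \<in> promises (F a)))"

definition step :: "(om1 \<Rightarrow> stage) \<Rightarrow> om1 \<Rightarrow> bool" where
  "step F a \<longleftrightarrow> countable (split_pts (F a)) \<and> split_pts (F a) \<subseteq> tow F {..<a} \<and>
     sides_ok F a \<and> promises_kept F a \<and> labels_kept F a \<and> equivariant F a \<and>
     countable (promises (F a)) \<and> (\<forall>(T, A)\<in>promises (F a). A \<subseteq> acc (tow F {..<a}) T) \<and>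
     guess_used F a \<and> (homog \<longrightarrow> gens_ok F a) \<and> (\<not> homog \<longrightarrow> map_killed F a)"

lemma step_cong:
  assumes "\<And>b. b \<le> a \<Longrightarrow> F b = F' b"
  shows "step F a = step F' a"
proof -
  have t: "tow F {..<a} = tow F' {..<a}" by (rule tow_cong) (simp add: assms)
  have a: "F a = F' a" by (simp add: assms)
  have "acta F a j = acta F' a j" if "j \<in> letters a" for j
    by (rule acta_cong[OF assms]) (use that in \<open>auto simp: letters_def\<close>)
  then have "equivariant F a = equivariant F' a" unfolding equivariant_def t a by simp
  moreover have "promises_kept F a = promises_kept F' a" unfolding promises_kept_def t a using assms by simp
  moreover have "guess_used F a = guess_used F' a" unfolding guess_used_def guessed_def t a by simp
  moreover have "map_killed F a = map_killed F' a" unfolding map_killed_def pair_limit_def t a by simp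
  ultimately show ?thesis unfolding step_def sides_ok_def labels_kept_def gens_ok_def t a by simp
qed

end

subsection \<open>Properties preserved along a tower\<close>

locale tower = parameters +
  fixes F :: "om1 \<Rightarrow> stage" and B :: "om1 set"
  assumes down: "\<And>b c. b \<in> B \<Longrightarrow> c \<le> b \<Longrightarrow> c \<in> B"
    and step: "\<And>b. b \<in> B \<Longrightarrow> b \<noteq> bot \<Longrightarrow> step F b"
begin

lemma below: "b \<in> B \<Longrightarrow> {..<b} \<subseteq> B"
  using down by (auto intro: less_imp_le)

lemma initial_tower: "{..<b} \<subseteq> B \<Longrightarrow> tower G N \<sigma> code \<nu> homog F {..<b}"
  by unfold_locales (use step in auto)

lemma pts: "b \<in> B \<Longrightarrow> b \<noteq> bot \<Longrightarrow> countable (split_pts (F b))" "b \<in> B \<Longrightarrow> b \<noteq> bot \<Longrightarrow> split_pts (F b) \<subseteq> tow F {..<b}"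
  using step by (auto simp: step_def)

lemma fits_exists:
  assumes "countable (split_pts S)"
  shows "\<exists>u. fits S p u"
proof
  show "fits S p (\<lambda>n. \<exists>y\<in>split_pts S. idx S y = n \<and> side S y p)"
    using idx_eq[OF assms] by (auto simp: fits_def)
qed

text \<open>
  Recursion along \<open>\<omega>\<^sub>1\<close>: above every point there is an admissible next block.
\<close>

lemma lift:
  assumes p: "p \<in> tow F B'" and B': "B' \<subseteq> B" "\<And>b c. b \<in> B' \<Longrightarrow> c \<le> b \<Longrightarrow> c \<in> B'"
  obtains z where "z \<in> tow F B" "\<And>b n. b \<in> B' \<Longrightarrow> z (b, n) = p (b, n)"
proof -
  define P where "P w c r \<longleftrightarrow> (if c \<in> B' then r = (\<lambda>n. p (c, n))
     else if c \<in> B \<and> c \<noteq> bot then fits (F c) (\<lambda>(d, n). d < c \<and> w d n) r else r = (\<lambda>_. False))"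
    for w c and r :: "nat \<Rightarrow> bool"
  have "\<exists>w. \<forall>c. P w c (w c)"
  proof (rule dependent_wellorder_choice)
    fix r :: "nat \<Rightarrow> bool" and f g :: "om1 \<Rightarrow> nat \<Rightarrow> bool" and x assume "\<And>y. y < x \<Longrightarrow> f y = g y"
    then have "(\<lambda>(d, n). d < x \<and> f d n) = (\<lambda>(d, n). d < x \<and> g d n)" by auto
    then show "P f x r = P g x r" by (simp add: P_def)
  next
    fix c and f :: "om1 \<Rightarrow> nat \<Rightarrow> bool"
    show "\<exists>r. P f c r" using fits_exists[OF pts(1)[of c]] by (auto simp: P_def)
  qed
  then obtain w where w: "\<And>c. P w c (w c)" by blast
  define z where "z = (\<lambda>(b, n). w b n)"
  have zp: "z (b, n) = p (b, n)" if "b \<in> B'" for b n using w[of b] that by (simp add: P_def z_def)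
  have "z \<in> tow F B"
  proof -
    have "fits (F b) (res z b) (\<lambda>n. z (b, n))" if b: "b \<in> B" "b \<noteq> bot" for b
    proof (cases "b \<in> B'")
      case True
      then have "res z b = res p b" using zp B'(2)[of b] by (auto simp: res_def fun_eq_iff less_imp_le)
      then show ?thesis using tow_fits[OF p True b(2)] zp True by simp
    next
      case False
      then have "fits (F b) (\<lambda>(d, n). d < b \<and> w d n) (w b)" using w[of b] b by (simp add: P_def)
      then show ?thesis by (simp add: res_def z_def case_prod_beta')
    qed
    moreover have "\<not> z (b, n)" if "b \<notin> B" for b n
    proof -
      have "b \<notin> B'" using that B' by blast
      then show ?thesis using w[of b] that by (simp add: P_def z_def)
    qed
    ultimately show ?thesis by (auto simp: tow_def)
  qed
  then show ?thesis using that zp by blast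
qed

lemma lift_stage:
  assumes p: "p \<in> tow F {..<b}" and b: "{..<b} \<subseteq> B"
  obtains z where "z \<in> tow F B" "res z b = p"
proof -
  obtain z where z: "z \<in> tow F B" "\<And>c n. c \<in> {..<b} \<Longrightarrow> z (c, n) = p (c, n)"
    by (rule lift[OF p b]) auto
  have "res z b (c, n) = p (c, n)" for c n
    using z(2)[of c n] tow_off[OF p, of c n] by (cases "c < b") (auto simp: res_apply)
  then have "res z b = p" by (auto simp: fun_eq_iff)
  then show ?thesis using that z by blast
qed

lemma lift_block:
  assumes p: "p \<in> tow F {..<b}" and b: "b \<in> B" "b \<noteq> bot" and u: "fits (F b) p u"
  obtains z where "z \<in> tow F B" "res z b = p" "\<And>n. z (b, n) = u n"
proof -
  define p' where "p' = (\<lambda>(c, n). if c = b then u n else p (c, n))"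
  have r: "res p' c = res p c" if "c \<le> b" for c using that by (auto simp: p'_def res_def fun_eq_iff)
  have "p' \<in> tow F {..b}"
  proof -
    have "fits (F c) (res p' c) (\<lambda>n. p' (c, n))" if "c \<le> b" "c \<noteq> bot" for c
    proof (cases "c = b")
      case True
      then show ?thesis using u r[of b] res_id[OF p] by (simp add: p'_def)
    next
      case False
      then show ?thesis using tow_fits[OF p, of c] r[of c] that by (simp add: p'_def)
    qed
    moreover have "\<not> p' (c, n)" if "\<not> c \<le> b" for c n using tow_off[OF p, of c] that by (auto simp: p'_def)
    ultimately show ?thesis by (auto simp: tow_def)
  qed
  then obtain z where z: "z \<in> tow F B" "\<And>c n. c \<in> {..b} \<Longrightarrow> z (c, n) = p' (c, n)"
    by (rule lift) (use down b in auto)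
  have "res z b (c, n) = p (c, n)" for c n
    using z(2)[of c n] tow_off[OF p, of c n] by (cases "c < b") (auto simp: res_apply p'_def)
  then have "res z b = p" by (auto simp: fun_eq_iff)
  moreover have "z (b, n) = u n" for n using z(2)[of b n] by (simp add: p'_def)
  ultimately show ?thesis using that z by blast
qed

text \<open>
  At the first stage where a point violates the side conditions, the violation persists nearby
  because sides are locally constant away from the split points.
\<close>

lemma closed_tow: "closed (tow F B)"
proof -
  have "\<exists>H. finite H \<and> nb H z \<subseteq> - tow F B" if z: "z \<in> - tow F B" for z
  proof (cases "\<exists>b n. b \<notin> B \<and> z (b, n)")
    case True
    then obtain b n where "b \<notin> B" "z (b, n)" by blast
    then have "nb {(b, n)} z \<subseteq> - tow F B" using tow_off[of _ F B b n] by (auto simp: nb_def)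
    then show ?thesis by blast
  next
    case False
    define Bad where "Bad b \<longleftrightarrow> b \<in> B \<and> b \<noteq> bot \<and> \<not> fits (F b) (res z b) (\<lambda>n. z (b, n))" for b
    have "\<exists>b. Bad b" using z False by (auto simp: tow_def Bad_def)
    then obtain b where b: "Bad b" and least: "\<And>c. c < b \<Longrightarrow> \<not> Bad c"
      using exists_least_iff[of Bad] by blast
    have bB: "b \<in> B" "b \<noteq> bot" using b by (auto simp: Bad_def)
    have r: "res z b \<in> tow F {..<b}"
    proof -
      have "fits (F c) (res z c) (\<lambda>n. z (c, n))" if "c < b" "c \<noteq> bot" for c
        using least[OF that(1)] that down[OF bB(1)] by (auto simp: Bad_def)
      then show ?thesis by (auto simp: tow_def res_apply res_res less_imp_le)
    qed
    consider n where "z (b, n)" "n \<notin> idx (F b) ` split_pts (F b)"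
      | y where "y \<in> split_pts (F b)" "res z b \<noteq> y" "z (b, idx (F b) y) \<noteq> side (F b) y (res z b)"
      using b unfolding Bad_def fits_def by blast
    then show ?thesis
    proof cases
      case (1 n)
      have "z' \<notin> tow F B" if "z' \<in> nb {(b, n)} z" for z'
        using tow_fits[of z' F B, OF _ bB] that 1 by (auto simp: nb_def fits_def)
      then show ?thesis by (intro exI[of _ "{(b, n)}"]) auto
    next
      case (2 y)
      have so: "sides_ok F b" using step[OF bB] by (simp add: step_def)
      obtain H where H: "finite H" "\<forall>z'\<in>tow F {..<b} \<inter> nb H (res z b). z' \<noteq> y \<and> side (F b) y z' = side (F b) y (res z b)"
        using so[unfolded sides_ok_def, rule_format, OF 2(1) r 2(2)] by blast
      have "z' \<notin> tow F B" if z': "z' \<in> nb (insert (b, idx (F b) y) H) z" for z'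
      proof
        assume t: "z' \<in> tow F B"
        have "res z' b \<in> tow F {..<b} \<inter> nb H (res z b)"
          using res_in_tow[OF t below[OF bB(1)]] z' res_nb by (auto simp: nb_insert)
        then have *: "res z' b \<noteq> y" "side (F b) y (res z' b) = side (F b) y (res z b)" using H(2) by blast+
        have "z' (b, idx (F b) y) = side (F b) y (res z' b)"
          using tow_fits[OF t bB] 2(1) *(1) by (auto simp: fits_def)
        moreover have "z' (b, idx (F b) y) = z (b, idx (F b) y)" using z' by (simp add: nb_insert)
        ultimately show False using 2(3) *(2) by blast
      qed
      then show ?thesis using H(1) by (intro exI[of _ "insert (b, idx (F b) y) H"]) auto
    qed
  qed
  then have "open (- tow F B)" unfolding open_fun_bool_iff by blast
  then show ?thesis by (simp add: closed_def)
qed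

text \<open>
  A basic neighbourhood of \<open>z\<close> all of whose coordinates lie in blocks up to \<open>b\<close> contains the inverse
  image of a neighbourhood of \<open>res z b\<close>, or of one side of it if \<open>res z b\<close> is split at stage \<open>b\<close>.
\<close>

lemma neighbourhood_at:
  assumes z: "z \<in> tow F B" and b: "b \<in> B" "b \<noteq> bot" and H: "finite H" "\<And>c n. (c, n) \<in> H \<Longrightarrow> c \<in> B \<Longrightarrow> c \<le> b"
  obtains H' where "finite H'"
    "res z b \<notin> split_pts (F b) \<longrightarrow> (\<forall>z'\<in>tow F B. res z' b \<in> nb H' (res z b) \<longrightarrow> z' \<in> nb H z)"
    "res z b \<in> split_pts (F b) \<longrightarrow> (\<forall>z'\<in>tow F B. res z' b \<in> nb H' (res z b) \<longrightarrow> res z' b \<noteq> res z b \<longrightarrow>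
        side (F b) (res z b) (res z' b) = z (b, idx (F b) (res z b)) \<longrightarrow> z' \<in> nb H z)"
proof -
  let ?S = "F b" and ?p = "res z b"
  have so: "sides_ok F b" using step[OF b] by (simp add: step_def)
  have p: "?p \<in> tow F {..<b}" by (rule res_in_tow[OF z below[OF b(1)]])
  have "\<forall>y\<in>split_pts ?S. \<exists>K. finite K \<and> (?p \<noteq> y \<longrightarrow> (\<forall>z'\<in>tow F {..<b} \<inter> nb K ?p. z' \<noteq> y \<and> side ?S y z' = side ?S y ?p))"
  proof
    fix y assume y: "y \<in> split_pts ?S"
    show "\<exists>K. finite K \<and> (?p \<noteq> y \<longrightarrow> (\<forall>z'\<in>tow F {..<b} \<inter> nb K ?p. z' \<noteq> y \<and> side ?S y z' = side ?S y ?p))"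
    proof (cases "?p = y")
      case False
      then show ?thesis using so[unfolded sides_ok_def, rule_format, OF y p] by blast
    qed (auto intro: exI[of _ "{}"])
  qed
  from bchoice[OF this] obtain K where K: "\<forall>y\<in>split_pts ?S. finite (K y) \<and>
    (?p \<noteq> y \<longrightarrow> (\<forall>z'\<in>tow F {..<b} \<inter> nb (K y) ?p. z' \<noteq> y \<and> side ?S y z' = side ?S y ?p))" by (rule exE)
  define Ys where "Ys = {y \<in> split_pts ?S. (b, idx ?S y) \<in> H}"
  have "finite Ys"
  proof (rule inj_on_finite[of "\<lambda>y. (b, idx ?S y)" _ H])
    show "inj_on (\<lambda>y. (b, idx ?S y)) Ys" using idx_eq[OF pts(1)[OF b]] by (auto simp: inj_on_def Ys_def)
  qed (use H in \<open>auto simp: Ys_def\<close>)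
  define H' where "H' = H \<union> (\<Union>y\<in>Ys. K y)"
  have fin: "finite H'" using \<open>finite Ys\<close> H K by (auto simp: H'_def Ys_def)
  have main: "z' (c, n) = z (c, n)" if z': "z' \<in> tow F B" "res z' b \<in> nb H' ?p" "(c, n) \<in> H"
     and side: "?p \<in> split_pts ?S \<longrightarrow> res z' b \<noteq> ?p \<and> side ?S ?p (res z' b) = z (b, idx ?S ?p)" for z' c n
  proof (cases "c \<in> B")
    case False
    then show ?thesis using tow_off[OF z] tow_off[OF z'(1)] by simp
  next
    case True
    then consider "c < b" | "c = b" using H(2)[OF z'(3)] by fastforce
    then show ?thesis
    proof cases
      case 1
      have "res z' b (c, n) = res z b (c, n)" using z'(2,3) unfolding nb_def H'_def by blast
      then show ?thesis using 1 by (simp add: res_apply)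
    next
      case 2
      have f: "fits ?S ?p (\<lambda>n. z (b, n))" "fits ?S (res z' b) (\<lambda>n. z' (b, n))"
        using tow_fits[OF z b] tow_fits[OF z'(1) b] by auto
      show ?thesis
      proof (cases "n \<in> idx ?S ` split_pts ?S")
        case False
        then show ?thesis using f 2 by (auto simp: fits_def)
      next
        case True
        then obtain y where y: "y \<in> split_pts ?S" "n = idx ?S y" by blast
        show ?thesis
        proof (cases "y = ?p")
          case True
          then have "z' (b, n) = side ?S ?p (res z' b)" using f(2) y side by (auto simp: fits_def)
          then show ?thesis using side y True 2 by simp
        next
          case False
          have yY: "y \<in> Ys" using y z'(3) 2 by (simp add: Ys_def)
          have "nb H' ?p \<subseteq> nb (K y) ?p" by (rule nb_mono) (use yY in \<open>auto simp: H'_def\<close>)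
          then have "res z' b \<in> tow F {..<b} \<inter> nb (K y) ?p"
            using z'(2) res_in_tow[OF z'(1) below[OF b(1)]] by blast
          moreover have "\<forall>z'\<in>tow F {..<b} \<inter> nb (K y) ?p. z' \<noteq> y \<and> side ?S y z' = side ?S y ?p"
            using bspec[OF K y(1)] False by blast
          ultimately have "res z' b \<noteq> y \<and> side ?S y (res z' b) = side ?S y ?p" by (rule bspec[rotated])
          then have *: "res z' b \<noteq> y" "side ?S y (res z' b) = side ?S y ?p" by blast+
          have "z' (b, n) = side ?S y (res z' b)" using f(2) y *(1) by (auto simp: fits_def)
          moreover have "z (b, n) = side ?S y ?p" using f(1) y False by (auto simp: fits_def)
          ultimately show ?thesis using *(2) 2 by simp
        qed
      qed
    qed
  qed
  show ?thesis
  proof (rule that[OF fin])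
    show "?p \<notin> split_pts ?S \<longrightarrow> (\<forall>z'\<in>tow F B. res z' b \<in> nb H' ?p \<longrightarrow> z' \<in> nb H z)"
      using main unfolding nb_def by auto
    show "?p \<in> split_pts ?S \<longrightarrow> (\<forall>z'\<in>tow F B. res z' b \<in> nb H' ?p \<longrightarrow> res z' b \<noteq> ?p \<longrightarrow>
        side ?S ?p (res z' b) = z (b, idx ?S ?p) \<longrightarrow> z' \<in> nb H z)"
      using main unfolding nb_def by auto
  qed
qed

lemma neighbourhood_cases:
  assumes "finite (H :: (om1 \<times> nat) set)"
  obtains "\<And>c n. (c, n) \<in> H \<Longrightarrow> c \<in> B \<Longrightarrow> c < b0"
    | b where "b \<in> B" "b0 \<le> b" "\<And>c n. (c, n) \<in> H \<Longrightarrow> c \<in> B \<Longrightarrow> c \<le> b"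
proof (cases "\<forall>c\<in>fst ` H \<inter> B. c < b0")
  case True
  then show ?thesis using that(1) by force
next
  case False
  have fin: "finite (fst ` H \<inter> B)" using assms by simp
  have ne: "fst ` H \<inter> B \<noteq> {}" using False by blast
  show ?thesis
  proof (rule that(2)[of "Max (fst ` H \<inter> B)"])
    show "Max (fst ` H \<inter> B) \<in> B" using Max_in[OF fin ne] by blast
    obtain c where "c \<in> fst ` H \<inter> B" "b0 \<le> c" using False by (auto simp: not_less)
    then show "b0 \<le> Max (fst ` H \<inter> B)" using Max_ge[OF fin] by (meson order_trans)
    fix c n assume "(c, n) \<in> H" "c \<in> B"
    then have "c \<in> fst ` H \<inter> B" by force
    then show "c \<le> Max (fst ` H \<inter> B)" by (rule Max_ge[OF fin])
  qed
qed

lemma acc_promise: "b \<in> B \<Longrightarrow> b \<noteq> bot \<Longrightarrow> (T, A) \<in> promises (F b) \<Longrightarrow> A \<subseteq> acc (tow F {..<b}) T"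
  using step[of b] unfolding step_def by blast

text \<open>
  If \<open>H\<close> mentions blocks below \<open>b0\<close> only, the promise is just accumulation. Otherwise let \<open>b\<close> be the
  last block that \<open>H\<close> mentions. If \<open>res z b\<close> is not split at stage \<open>b\<close>, the neighbourhood contains
  the inverse image of a neighbourhood of \<open>res z b\<close>, and the claim is inherited from stage \<open>b\<close>;
  otherwise it contains the part of such an inverse image on one side of \<open>res z b\<close>, and stage \<open>b\<close>
  kept the promise on this side.
\<close>

lemma promise_step:
  assumes b0: "b0 \<in> B" "b0 \<noteq> bot" "(T, A) \<in> promises (F b0)" and z: "z \<in> tow F B" "res z b0 \<in> A" and H: "finite H"
    and IH: "\<And>b z H. b \<in> B \<Longrightarrow> b0 < b \<Longrightarrow> z \<in> tow F {..<b} \<Longrightarrow> res z b0 \<in> A \<Longrightarrow> finite H \<Longrightarrow>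
      \<exists>s\<in>T. s \<noteq> res z b0 \<and> (\<forall>z'\<in>tow F {..<b}. res z' b0 = s \<longrightarrow> z' \<in> nb H z)"
  shows "\<exists>s\<in>T. s \<noteq> res z b0 \<and> (\<forall>z'\<in>tow F B. res z' b0 = s \<longrightarrow> z' \<in> nb H z)"
proof -
  have a: "res z b0 \<in> acc (tow F {..<b0}) T" using acc_promise[OF b0] z by blast
  consider "\<And>c n. (c, n) \<in> H \<Longrightarrow> c \<in> B \<Longrightarrow> c < b0"
    | b where "b \<in> B" "b0 \<le> b" "\<And>c n. (c, n) \<in> H \<Longrightarrow> c \<in> B \<Longrightarrow> c \<le> b"
    using neighbourhood_cases[OF H, of b0] by metis
  then show ?thesis
  proof cases
    case 1
    obtain s where s: "s \<in> T" "s \<in> nb H (res z b0)" "s \<noteq> res z b0"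
      using a H unfolding acc_def by blast
    have "z' \<in> nb H z" if z': "z' \<in> tow F B" "res z' b0 = s" for z'
    proof -
      have "z' (c, n) = z (c, n)" if c: "(c, n) \<in> H" for c n
      proof (cases "c \<in> B")
        case True
        have "res z' b0 (c, n) = res z b0 (c, n)" using s(2) z'(2) c unfolding nb_def by blast
        then show ?thesis using 1[OF c True] by (simp add: res_apply)
      next
        case False
        then show ?thesis using tow_off[OF z(1)] tow_off[OF z'(1)] by simp
      qed
      then show ?thesis by (auto simp: nb_def)
    qed
    then show ?thesis using s by blast
  next
    case (2 b)
    have bb: "b \<noteq> bot" using 2(2) b0(2) bot_unique by blast
    have below_b: "{..<b} \<subseteq> B" by (rule below[OF 2(1)])
    obtain H' where H': "finite H'"
      "res z b \<notin> split_pts (F b) \<longrightarrow> (\<forall>z'\<in>tow F B. res z' b \<in> nb H' (res z b) \<longrightarrow> z' \<in> nb H z)"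
      "res z b \<in> split_pts (F b) \<longrightarrow> (\<forall>z'\<in>tow F B. res z' b \<in> nb H' (res z b) \<longrightarrow> res z' b \<noteq> res z b \<longrightarrow>
        side (F b) (res z b) (res z' b) = z (b, idx (F b) (res z b)) \<longrightarrow> z' \<in> nb H z)"
      by (rule neighbourhood_at[OF z(1) 2(1) bb H 2(3)])
    have rr: "res (res z' b) b0 = res z' b0" for z' by (rule res_res[OF 2(2)])
    show ?thesis
    proof (cases "res z b \<in> split_pts (F b)")
      case False
      have "\<exists>s\<in>T. s \<noteq> res z b0 \<and> (\<forall>z'\<in>tow F {..<b}. res z' b0 = s \<longrightarrow> z' \<in> nb H' (res z b))"
      proof (cases "b0 = b")
        case True
        obtain s where s: "s \<in> T" "s \<in> nb H' (res z b0)" "s \<noteq> res z b0"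
          using a H'(1) unfolding acc_def by blast
        then show ?thesis using True res_id by (intro bexI[of _ s]) auto
      next
        case False
        then show ?thesis
          using IH[OF 2(1) _ res_in_tow[OF z(1) below_b] _ H'(1)] 2(2) z(2) rr by simp
      qed
      then obtain s where s: "s \<in> T" "s \<noteq> res z b0" "\<forall>z'\<in>tow F {..<b}. res z' b0 = s \<longrightarrow> z' \<in> nb H' (res z b)" by blast
      have "z' \<in> nb H z" if "z' \<in> tow F B" "res z' b0 = s" for z'
        using H'(2) False that s(3) res_in_tow[OF that(1) below_b] rr[of z'] by blast
      then show ?thesis using s by blast
    next
      case True
      have pk: "promises_kept F b" using step[OF 2(1) bb] by (simp add: step_def)
      have "res (res z b) b0 \<in> A" using z(2) rr by simp
      then obtain s where s: "s \<in> T" "s \<noteq> res (res z b) b0"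
        "\<forall>z'\<in>tow F {..<b}. res z' b0 = s \<longrightarrow> z' \<in> nb H' (res z b) \<and> side (F b) (res z b) z' = z (b, idx (F b) (res z b))"
        using pk[unfolded promises_kept_def, rule_format, OF 2(2) b0(2,3), simplified, rule_format, OF True _ H'(1)] by blast
      have "z' \<in> nb H z" if z': "z' \<in> tow F B" "res z' b0 = s" for z'
      proof -
        have "res z' b \<noteq> res z b" using s(2) z'(2) rr by metis
        then show ?thesis
          using H'(3) True z' s(3) res_in_tow[OF z'(1) below_b] rr[of z'] by blast
      qed
      then show ?thesis using s rr by auto
    qed
  qed
qed

lemma promise:
  assumes b0: "b0 \<in> B" "b0 \<noteq> bot" "(T, A) \<in> promises (F b0)" and z: "z \<in> tow F B" "res z b0 \<in> A" and H: "finite H"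
  shows "\<exists>s\<in>T. s \<noteq> res z b0 \<and> (\<forall>z'\<in>tow F B. res z' b0 = s \<longrightarrow> z' \<in> nb H z)"
proof -
  have *: "\<exists>s\<in>T. s \<noteq> res z b0 \<and> (\<forall>z'\<in>tow F {..<b}. res z' b0 = s \<longrightarrow> z' \<in> nb H z)"
    if "b \<in> B" "b0 < b" "z \<in> tow F {..<b}" "res z b0 \<in> A" "finite H" for b z H
    using that
  proof (induction b arbitrary: z H rule: less_induct)
    case (less b)
    interpret st: tower G N \<sigma> code \<nu> homog F "{..<b}" by (rule initial_tower[OF below[OF less.prems(1)]])
    show ?case
      by (rule st.promise_step[OF _ b0(2,3)]) (use less down[OF less.prems(1)] in auto)
  qed
  show ?thesis by (rule promise_step[OF assms *])
qed

text \<open>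
  A basic neighbourhood restricts the coordinates of finitely many levels of labels only; those of
  the remaining levels are at free disposal, and so are infinitely many coordinates without
  influence on labels, one of which is changed to obtain a point different from \<open>z\<close>.
\<close>

lemma rich_bottom:
  assumes z: "z \<in> tow F B" and B0: "bot \<in> B" and H: "finite H" "\<And>c n. (c, n) \<in> H \<Longrightarrow> c \<in> B \<Longrightarrow> c = bot"
  shows "\<exists>k. \<forall>l. (\<forall>i. l i < N i) \<longrightarrow> (\<forall>i<k. l i = lab z i) \<longrightarrow> (\<exists>q\<in>tow F B \<inter> nb H z. q \<noteq> z \<and> lab q = l)"
proof -
  have "finite (snd ` H)" using H by simp
  then obtain M where M: "snd ` H \<subseteq> {..<M}" using finite_nat_bounded by blast
  define n0 where "n0 = prod_encode (0, max M (N 0))"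
  have n0: "M \<le> n0" using le_prod_encode_2[of "max M (N 0)" 0] by (simp add: n0_def)
  have "\<exists>q\<in>tow F B \<inter> nb H z. q \<noteq> z \<and> lab q = l" if l: "\<forall>i. l i < N i" "\<forall>i<Suc M. l i = lab z i" for l
  proof -
    define u where "u n = (if fst (prod_decode n) < Suc M then (z (bot, n) \<noteq> (n = n0)) else snd (prod_decode n) < l (fst (prod_decode n)))" for n
    define p where "p = (\<lambda>(c::om1, n). c = bot \<and> u n)"
    have "p \<in> tow F {bot}" by (auto simp: tow_def p_def)
    then obtain q where q: "q \<in> tow F B" "\<And>c n. c \<in> {bot} \<Longrightarrow> q (c, n) = p (c, n)"
      by (rule lift) (use B0 bot_unique in auto)
    have qu: "q (bot, n) = u n" for n using q(2)[of bot n] by (simp add: p_def)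
    have "q (bot, n0) \<noteq> z (bot, n0)" by (simp add: qu u_def n0_def)
    then have "q \<noteq> z" by blast
    moreover have "q \<in> nb H z"
    proof -
      have "q (c, n) = z (c, n)" if c: "(c, n) \<in> H" for c n
      proof (cases "c \<in> B")
        case True
        then have cb: "c = bot" using H(2) c by blast
        have "n < M" using c M by force
        moreover have "fst (prod_decode n) \<le> n" using le_prod_encode_1[of "fst (prod_decode n)" "snd (prod_decode n)"] by simp
        ultimately show ?thesis using n0 by (simp add: cb qu u_def)
      next
        case False
        then show ?thesis using tow_off[OF z] tow_off[OF q(1)] by simp
      qed
      then show ?thesis by (auto simp: nb_def)
    qed
    moreover have "lab q = l"
    proof
      fix k
      show "lab q k = l k"
      proof (cases "k < Suc M")
        case True
        have "prod_encode (k, j) \<noteq> n0" if "j < N k" for j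
          using that unfolding n0_def by (auto simp: prod_encode_eq)
        then have "lab q k = lab z k" using True by (intro lab_cong) (simp add: qu u_def)
        then show ?thesis using l True by simp
      next
        case False
        then show ?thesis using l by (intro lab_value) (auto simp: qu u_def)
      qed
    qed
    ultimately show ?thesis using q(1) by blast
  qed
  then show ?thesis by blast
qed

text \<open>
  The same reduction to the last block mentioned in \<open>H\<close> as for promises.
\<close>

lemma rich_step:
  assumes z: "z \<in> tow F B" and B0: "bot \<in> B" and H: "finite H"
    and IH: "\<And>b z H. b \<in> B \<Longrightarrow> b \<noteq> bot \<Longrightarrow> z \<in> tow F {..<b} \<Longrightarrow> finite H \<Longrightarrow>
      \<exists>k. \<forall>l. (\<forall>i. l i < N i) \<longrightarrow> (\<forall>i<k. l i = lab z i) \<longrightarrow> (\<exists>q\<in>tow F {..<b} \<inter> nb H z. q \<noteq> z \<and> lab q = l)"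
  shows "\<exists>k. \<forall>l. (\<forall>i. l i < N i) \<longrightarrow> (\<forall>i<k. l i = lab z i) \<longrightarrow> (\<exists>q\<in>tow F B \<inter> nb H z. q \<noteq> z \<and> lab q = l)"
proof -
  obtain b where b: "b \<in> B" "\<And>c n. (c, n) \<in> H \<Longrightarrow> c \<in> B \<Longrightarrow> c \<le> b"
    using neighbourhood_cases[OF H, of bot] B0 by (metis bot.extremum_strict bot_least)
  show ?thesis
  proof (cases "b = bot")
    case True
    then show ?thesis using b(2) bot_unique by (intro rich_bottom[OF z B0 H]) blast
  next
    case False
    have below_b: "{..<b} \<subseteq> B" by (rule below[OF b(1)])
    have bb: "bot < b" using False bot.not_eq_extremum by blast
    obtain H' where H': "finite H'"
      "res z b \<notin> split_pts (F b) \<longrightarrow> (\<forall>z'\<in>tow F B. res z' b \<in> nb H' (res z b) \<longrightarrow> z' \<in> nb H z)"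
      "res z b \<in> split_pts (F b) \<longrightarrow> (\<forall>z'\<in>tow F B. res z' b \<in> nb H' (res z b) \<longrightarrow> res z' b \<noteq> res z b \<longrightarrow>
        side (F b) (res z b) (res z' b) = z (b, idx (F b) (res z b)) \<longrightarrow> z' \<in> nb H z)"
      by (rule neighbourhood_at[OF z b(1) False H b(2)])
    have "\<exists>k. \<forall>l. (\<forall>i. l i < N i) \<longrightarrow> (\<forall>i<k. l i = lab z i) \<longrightarrow>
       (\<exists>q\<in>tow F {..<b} \<inter> nb H' (res z b). q \<noteq> res z b \<and> lab q = l \<and>
          (res z b \<in> split_pts (F b) \<longrightarrow> side (F b) (res z b) q = z (b, idx (F b) (res z b))))"
    proof (cases "res z b \<in> split_pts (F b)")
      case True
      have "labels_kept F b" using step[OF b(1) False] by (simp add: step_def)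
      from this[unfolded labels_kept_def, rule_format, OF True H'(1), of "z (b, idx (F b) (res z b))"]
      show ?thesis unfolding lab_res[OF bb] by blast
    next
      case F: False
      from IH[OF b(1) False res_in_tow[OF z below_b] H'(1)] show ?thesis using F unfolding lab_res[OF bb] by blast
    qed
    then obtain k where k: "\<And>l. (\<forall>i. l i < N i) \<Longrightarrow> (\<forall>i<k. l i = lab z i) \<Longrightarrow>
       (\<exists>q\<in>tow F {..<b} \<inter> nb H' (res z b). q \<noteq> res z b \<and> lab q = l \<and>
          (res z b \<in> split_pts (F b) \<longrightarrow> side (F b) (res z b) q = z (b, idx (F b) (res z b))))" by blast
    have "\<exists>q\<in>tow F B \<inter> nb H z. q \<noteq> z \<and> lab q = l" if l: "\<forall>i. l i < N i" "\<forall>i<k. l i = lab z i" for l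
    proof -
      obtain q where q: "q \<in> tow F {..<b}" "q \<in> nb H' (res z b)" "q \<noteq> res z b" "lab q = l"
        "res z b \<in> split_pts (F b) \<longrightarrow> side (F b) (res z b) q = z (b, idx (F b) (res z b))" using k[OF l] by blast
      obtain q' where q': "q' \<in> tow F B" "res q' b = q" by (rule lift_stage[OF q(1) below_b])
      have "q' \<in> nb H z" using H'(2,3) q q' by (cases "res z b \<in> split_pts (F b)") auto
      moreover have "q' \<noteq> z" using q(3) q'(2) by blast
      moreover have "lab q' = l" using lab_res[OF bb, of q'] q'(2) q(4) by simp
      ultimately show ?thesis using q'(1) by blast
    qed
    then show ?thesis by blast
  qed
qed

lemma rich:
  assumes z: "z \<in> tow F B" and B0: "bot \<in> B" and H: "finite H"
  shows "\<exists>k. \<forall>l. (\<forall>i. l i < N i) \<longrightarrow> (\<forall>i<k. l i = lab z i) \<longrightarrow> (\<exists>q\<in>tow F B \<inter> nb H z. q \<noteq> z \<and> lab q = l)"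
proof -
  have "\<exists>k. \<forall>l. (\<forall>i. l i < N i) \<longrightarrow> (\<forall>i<k. l i = lab z i) \<longrightarrow> (\<exists>q\<in>tow F {..<b} \<inter> nb H z. q \<noteq> z \<and> lab q = l)"
    if "b \<in> B" "b \<noteq> bot" "z \<in> tow F {..<b}" "finite H" for b z H
    using that
  proof (induction b arbitrary: z H rule: less_induct)
    case (less b)
    interpret st: tower G N \<sigma> code \<nu> homog F "{..<b}" by (rule initial_tower[OF below[OF less.prems(1)]])
    have "bot < b" using less.prems(2) bot.not_eq_extremum by blast
    then show ?case
      by (intro st.rich_step) (use less down[OF less.prems(1)] in auto)
  qed
  then show ?thesis by (rule rich_step[OF assms])
qed

lemma no_isolated:
  assumes "z \<in> tow F B" "bot \<in> B" "finite H"
  obtains q where "q \<in> tow F B" "q \<in> nb H z" "q \<noteq> z"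
  using rich[OF assms] lab_less by blast

end

subsection \<open>The group action\<close>

lemma act_below: "b < fst j \<Longrightarrow> act F j z (b, n) = gen (F (fst j)) (snd j) (res z (fst j)) (b, n)"
  and act_above: "\<not> b < fst j \<Longrightarrow> act F j z (b, n) = z (b, perm (F b) j n)"
  by (simp_all add: act_def)

lemma res_act:
  assumes "fst j \<le> a"
  shows "res (act F j z) a = act F j (res z a)"
proof
  fix c show "res (act F j z) a c = act F j (res z a) c"
    using assms by (cases c) (auto simp: res_apply act_def res_res)
qed

lemma res_act_at:
  assumes "gen (F (fst j)) (snd j) (res z (fst j)) \<in> tow F {..<fst j}"
  shows "res (act F j z) (fst j) = gen (F (fst j)) (snd j) (res z (fst j))"
proof
  fix c show "res (act F j z) (fst j) c = gen (F (fst j)) (snd j) (res z (fst j)) c"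
    using tow_off[OF assms, of "fst c" "snd c"]
    by (cases c; cases "fst c < fst j") (simp_all add: res_apply act_below)
qed

locale tower_action = tower +
  fixes i :: om1
  assumes homog: homog and i: "i \<noteq> bot" "{..<i} \<subseteq> B" and gens: "gens_ok F i"
begin

lemma gen_tow: "z \<in> tow F {..<i} \<Longrightarrow> gen (F i) (m, s) z \<in> tow F {..<i}"
  and gen_inv: "z \<in> tow F {..<i} \<Longrightarrow> gen (F i) (m, s) (gen (F i) (m, \<not> s) z) = z"
  and gen_cont: "z \<in> tow F {..<i} \<Longrightarrow> finite H \<Longrightarrow>
      \<exists>H'. finite H' \<and> (\<forall>z'\<in>tow F {..<i} \<inter> nb H' z. gen (F i) (m, s) z' \<in> nb H (gen (F i) (m, s) z))"
  and gen_lab: "\<exists>k0. \<forall>z\<in>tow F {..<i}. \<forall>k\<ge>k0. lab (gen (F i) (m, s) z) k = \<sigma> (code (i, m), s) k (lab z k)"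
proof -
  note g = gens[unfolded gens_ok_def]
  show "z \<in> tow F {..<i} \<Longrightarrow> gen (F i) (m, s) z \<in> tow F {..<i}"
    using conjunct1[OF g, rule_format, of z m s] by blast
  show "z \<in> tow F {..<i} \<Longrightarrow> gen (F i) (m, s) (gen (F i) (m, \<not> s) z) = z"
    using conjunct1[OF g, rule_format, of z m s] by blast
  show "z \<in> tow F {..<i} \<Longrightarrow> finite H \<Longrightarrow>
      \<exists>H'. finite H' \<and> (\<forall>z'\<in>tow F {..<i} \<inter> nb H' z. gen (F i) (m, s) z' \<in> nb H (gen (F i) (m, s) z))"
    using conjunct1[OF g, rule_format, of z m s] by simp
  show "\<exists>k0. \<forall>z\<in>tow F {..<i}. \<forall>k\<ge>k0. lab (gen (F i) (m, s) z) k = \<sigma> (code (i, m), s) k (lab z k)"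
    using conjunct1[OF conjunct2[OF g]] by (elim allE)
qed

lemma res_act_i: "z \<in> tow F B \<Longrightarrow> res (act F (i, m, s) z) i = gen (F i) (m, s) (res z i)"
  using res_act_at[of F "(i, m, s)" z] gen_tow res_in_tow[OF _ i(2)] by simp

lemma letter_in: "i \<le> b \<Longrightarrow> (i, m, s) \<in> letters b"
  unfolding letters_def using homog i by simp

lemma equi:
  assumes b: "b \<in> B" "i \<le> b"
  shows "n \<notin> idx (F b) ` split_pts (F b) \<Longrightarrow> perm (F b) (i, m, s) n = n"
    and "y \<in> split_pts (F b) \<Longrightarrow> act F (i, m, s) y \<in> split_pts (F b)"
    and "y \<in> split_pts (F b) \<Longrightarrow> perm (F b) (i, m, s) (idx (F b) (act F (i, m, s) y)) = idx (F b) y"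
    and "y \<in> split_pts (F b) \<Longrightarrow> z \<in> tow F {..<b} \<Longrightarrow> z \<noteq> y \<Longrightarrow>
       side (F b) (act F (i, m, s) y) (act F (i, m, s) z) = side (F b) y z"
proof -
  have bb: "b \<noteq> bot" using b(2) i(1) bot_unique by blast
  have e: "equivariant F b" using step[OF b(1) bb] by (simp add: step_def)
  note e' = bspec[OF e[unfolded equivariant_def] letter_in[OF b(2), of m s]]
  have y: "acta F b (i, m, s) y = act F (i, m, s) y" if "y \<in> split_pts (F b)" for y
    using pts(2)[OF b(1) bb] that by (intro acta_eq_act) blast
  show "n \<notin> idx (F b) ` split_pts (F b) \<Longrightarrow> perm (F b) (i, m, s) n = n" using e' by blast
  show "y \<in> split_pts (F b) \<Longrightarrow> act F (i, m, s) y \<in> split_pts (F b)" using e' y by metis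
  show "y \<in> split_pts (F b) \<Longrightarrow> perm (F b) (i, m, s) (idx (F b) (act F (i, m, s) y)) = idx (F b) y" using e' y by metis
  show "y \<in> split_pts (F b) \<Longrightarrow> z \<in> tow F {..<b} \<Longrightarrow> z \<noteq> y \<Longrightarrow>
       side (F b) (act F (i, m, s) y) (act F (i, m, s) z) = side (F b) y z"
    using e' y acta_eq_act by metis
qed

text \<open>
  On the blocks from \<open>i\<close> on, the claim is that the permutations belonging to \<open>s\<close> and \<open>\<not> s\<close> are
  inverse to each other. This reduces to the claim for split points, which are points of earlier
  spaces.
\<close>

lemma act_inv_step:
  assumes IH: "\<And>b m s y. b \<in> B \<Longrightarrow> i \<le> b \<Longrightarrow> y \<in> tow F {..<b} \<Longrightarrow> act F (i, m, s) (act F (i, m, \<not> s) y) = y"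
    and z: "z \<in> tow F B"
  shows "act F (i, m, s) (act F (i, m, \<not> s) z) = z"
proof -
  have "act F (i, m, s) (act F (i, m, \<not> s) z) (c, n) = z (c, n)" for c n
  proof (cases "c < i")
    case True
    have r: "res z i \<in> tow F {..<i}" by (rule res_in_tow[OF z i(2)])
    show ?thesis using True res_act_i[OF z, of m "\<not> s"] gen_inv[OF r, of m s] by (simp add: act_below res_apply)
  next
    case c: False
    show ?thesis
    proof (cases "c \<in> B")
      case True
      have ic: "i \<le> c" using c by simp
      have "perm (F c) (i, m, \<not> s) (perm (F c) (i, m, s) n) = n"
      proof (cases "n \<in> idx (F c) ` split_pts (F c)")
        case n: True
        then obtain y where y: "y \<in> split_pts (F c)" "n = idx (F c) y" by blast
        have "c \<noteq> bot" using ic i(1) bot_unique by blast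
        then have yt: "y \<in> tow F {..<c}" using pts(2)[OF True] y by blast
        define y' where "y' = act F (i, m, \<not> s) y"
        have y': "y' \<in> split_pts (F c)" unfolding y'_def by (rule equi(2)[OF True ic y(1)])
        have "act F (i, m, s) y' = y" unfolding y'_def by (rule IH[OF True ic yt])
        then have "perm (F c) (i, m, s) n = idx (F c) y'" using equi(3)[OF True ic y', of m s] y(2) by simp
        moreover have "perm (F c) (i, m, \<not> s) (idx (F c) y') = n"
          using equi(3)[OF True ic y(1), of m "\<not> s"] y(2) by (simp add: y'_def)
        ultimately show ?thesis by simp
      next
        case False
        then show ?thesis using equi(1)[OF True ic] by metis
      qed
      then show ?thesis using c by (simp add: act_above)
    next
      case False
      then show ?thesis using c tow_off[OF z] by (simp add: act_above)
    qed
  qed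
  then show ?thesis by (auto simp: fun_eq_iff)
qed

lemma act_inv:
  assumes z: "z \<in> tow F B"
  shows "act F (i, m, s) (act F (i, m, \<not> s) z) = z"
proof -
  have "act F (i, m, s) (act F (i, m, \<not> s) y) = y" if "b \<in> B" "i \<le> b" "y \<in> tow F {..<b}" for b m s y
    using that
  proof (induction b arbitrary: m s y rule: less_induct)
    case (less b)
    interpret st: tower_action G N \<sigma> code \<nu> homog F "{..<b}" i
      by (intro tower_action.intro initial_tower below less.prems(1) tower_action_axioms.intro)
        (use homog i gens less.prems in auto)
    show ?case
      by (rule st.act_inv_step) (use less down[OF less.prems(1)] in auto)
  qed
  then show ?thesis by (rule act_inv_step[OF _ z])
qed

lemma act_tow:
  assumes z: "z \<in> tow F B"
  shows "act F (i, m, s) z \<in> tow F B"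
proof -
  let ?g = "act F (i, m, s)"
  have ri: "res (?g z) i \<in> tow F {..<i}"
    using res_act_i[OF z, of m s] gen_tow[OF res_in_tow[OF z i(2)]] by simp
  have "fits (F b) (res (?g z) b) (\<lambda>n. ?g z (b, n))" if b: "b \<in> B" "b \<noteq> bot" for b
  proof (cases "b < i")
    case True
    have "fits (F b) (res (res (?g z) i) b) (\<lambda>n. res (?g z) i (b, n))"
      using tow_fits[OF ri] True b(2) by simp
    then show ?thesis using True by (simp add: res_res less_imp_le res_apply)
  next
    case False
    then have ib: "i \<le> b" by simp
    let ?p = "res z b"
    have pt: "?p \<in> tow F {..<b}" by (rule res_in_tow[OF z below[OF b(1)]])
    interpret st: tower_action G N \<sigma> code \<nu> homog F "{..<b}" i
      by (intro tower_action.intro initial_tower below b(1) tower_action_axioms.intro)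
        (use homog i gens ib in auto)
    have f: "fits (F b) ?p (\<lambda>n. z (b, n))" by (rule tow_fits[OF z b])
    have r: "res (?g z) b = ?g ?p" by (rule res_act) (simp add: ib)
    show ?thesis
      unfolding fits_def r
    proof (intro conjI allI impI ballI)
      fix n assume "?g z (b, n)"
      then have "z (b, perm (F b) (i, m, s) n)" using False by (simp add: act_above)
      then have "perm (F b) (i, m, s) n \<in> idx (F b) ` split_pts (F b)" using f by (auto simp: fits_def)
      then show "n \<in> idx (F b) ` split_pts (F b)" using equi(1)[OF b(1) ib] by metis
    next
      fix y assume y: "y \<in> split_pts (F b)" "?g ?p \<noteq> y"
      define x where "x = act F (i, m, \<not> s) y"
      have x: "x \<in> split_pts (F b)" unfolding x_def by (rule equi(2)[OF b(1) ib y(1)])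
      have yt: "y \<in> tow F {..<b}" using pts(2)[OF b] y by blast
      have gx: "?g x = y" unfolding x_def by (rule st.act_inv[OF yt])
      have px: "?p \<noteq> x" using y(2) gx by blast
      have "?g z (b, idx (F b) y) = z (b, idx (F b) x)"
        using False equi(3)[OF b(1) ib x, of m s] by (simp add: act_above gx)
      also have "\<dots> = side (F b) x ?p" using f x px by (auto simp: fits_def)
      also have "\<dots> = side (F b) y (?g ?p)" using equi(4)[OF b(1) ib x pt px, of m s] gx by simp
      finally show "?g z (b, idx (F b) y) = side (F b) y (?g ?p)" .
    qed
  qed
  moreover have "\<not> ?g z (b, n)" if "b \<notin> B" for b n
  proof -
    have "\<not> b < i" using that i(2) by auto
    then show ?thesis using tow_off[OF z that] by (simp add: act_above)
  qed
  ultimately show ?thesis by (auto simp: tow_def)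
qed

lemma act_cont:
  assumes z: "z \<in> tow F B" and H: "finite H"
  obtains H' where "finite H'" "\<forall>z'\<in>tow F B \<inter> nb H' z. act F (i, m, s) z' \<in> nb H (act F (i, m, s) z)"
proof -
  obtain H1 where H1: "finite H1"
    "\<forall>z'\<in>tow F {..<i} \<inter> nb H1 (res z i). gen (F i) (m, s) z' \<in> nb H (gen (F i) (m, s) (res z i))"
    using gen_cont[OF res_in_tow[OF z i(2)] H, of m s] by blast
  define H2 where "H2 = (\<lambda>c. (fst c, perm (F (fst c)) (i, m, s) (snd c))) ` H"
  have "act F (i, m, s) z' (c, n) = act F (i, m, s) z (c, n)"
    if z': "z' \<in> tow F B" "z' \<in> nb (H1 \<union> H2) z" and c: "(c, n) \<in> H" for z' c n
  proof (cases "c < i")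
    case True
    have "res z' i \<in> tow F {..<i} \<inter> nb H1 (res z i)"
      using res_in_tow[OF z'(1) i(2)] z'(2) res_nb by (auto simp: nb_Un)
    then have "gen (F i) (m, s) (res z' i) \<in> nb H (gen (F i) (m, s) (res z i))" using H1(2) by blast
    then have "gen (F i) (m, s) (res z' i) (c, n) = gen (F i) (m, s) (res z i) (c, n)" using c by (auto simp: nb_def)
    then show ?thesis using True by (simp add: act_below)
  next
    case False
    have "(c, perm (F c) (i, m, s) n) \<in> H2" using c by (force simp: H2_def)
    then have "z' (c, perm (F c) (i, m, s) n) = z (c, perm (F c) (i, m, s) n)" using z'(2) by (auto simp: nb_def)
    then show ?thesis using False by (simp add: act_above)
  qed
  then have "\<forall>z'\<in>tow F B \<inter> nb (H1 \<union> H2) z. act F (i, m, s) z' \<in> nb H (act F (i, m, s) z)"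
    by (auto simp: nb_def)
  then show ?thesis by (rule that[rotated]) (use H H1 in \<open>auto simp: H2_def\<close>)
qed

lemma act_lab: "\<exists>k0. \<forall>z\<in>tow F B. \<forall>k\<ge>k0. lab (act F (i, m, s) z) k = \<sigma> (code (i, m), s) k (lab z k)"
proof -
  obtain k0 where k0: "\<forall>z\<in>tow F {..<i}. \<forall>k\<ge>k0. lab (gen (F i) (m, s) z) k = \<sigma> (code (i, m), s) k (lab z k)"
    using gen_lab[of m s] by (rule exE)
  have ib: "bot < i" using i(1) bot.not_eq_extremum by blast
  have "lab (act F (i, m, s) z) k = \<sigma> (code (i, m), s) k (lab z k)" if z: "z \<in> tow F B" "k \<ge> k0" for z k
  proof -
    have "lab (act F (i, m, s) z) = lab (gen (F i) (m, s) (res z i))"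
      using lab_res[OF ib, of "act F (i, m, s) z"] res_act_i[OF z(1)] by simp
    then show ?thesis using k0 res_in_tow[OF z(1) i(2)] z(2) lab_res[OF ib, of z] by simp
  qed
  then show ?thesis by blast
qed

end

lemma not_reduced_word_split:
  assumes "\<not> reduced_word w"
  obtains u x y v where "w = u @ x # y # v" "fst x = fst y" "snd x \<noteq> snd y"
proof -
  have "\<exists>u x y v. w = u @ x # y # v \<and> fst x = fst y \<and> snd x \<noteq> snd y" using assms
  proof (induction w)
    case (Cons a w)
    show ?case
    proof (cases "reduced_word w")
      case True
      then have "w \<noteq> []" "fst a = fst (hd w)" "snd a \<noteq> snd (hd w)" using Cons.prems by (auto simp: reduced_word_Cons)
      then show ?thesis by (intro exI[of _ "[]"] exI[of _ a] exI[of _ "hd w"] exI[of _ "tl w"]) simp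
    next
      case False
      then obtain u x y v where "w = u @ x # y # v" "fst x = fst y" "snd x \<noteq> snd y" using Cons.IH by blast
      then show ?thesis by (intro exI[of _ "a # u"] exI[of _ x] exI[of _ y] exI[of _ v]) simp
    qed
  qed simp
  then show ?thesis using that by blast
qed

definition wact :: "(om1 \<Rightarrow> stage) \<Rightarrow> letter list \<Rightarrow> point \<Rightarrow> point" where
  "wact F w z = foldr (act F) w z"

lemma wact_simps [simp]: "wact F [] z = z" "wact F (j # w) z = act F j (wact F w z)"
  "wact F (u @ v) z = wact F u (wact F v z)"
  by (simp_all add: wact_def)

definition inv_word :: "letter list \<Rightarrow> letter list" where
  "inv_word w = rev (map inv_letter w)"

locale tower_words = tower +
  fixes Lt :: "letter set"
  assumes Lt: "\<And>j. j \<in> Lt \<Longrightarrow> homog \<and> fst j \<noteq> bot \<and> {..<fst j} \<subseteq> B \<and> gens_ok F (fst j)"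
    and Lt_inv: "\<And>j. j \<in> Lt \<Longrightarrow> inv_letter j \<in> Lt"
begin

lemma action: "j \<in> Lt \<Longrightarrow> tower_action G N \<sigma> code \<nu> homog F B (fst j)"
  using Lt by (intro tower_action.intro tower_action_axioms.intro tower_axioms) blast+

lemma letter_tow: "j \<in> Lt \<Longrightarrow> z \<in> tow F B \<Longrightarrow> act F j z \<in> tow F B"
  using tower_action.act_tow[OF action, of j z "fst (snd j)" "snd (snd j)"] by simp

lemma letter_inv: "j \<in> Lt \<Longrightarrow> z \<in> tow F B \<Longrightarrow> act F j (act F (inv_letter j) z) = z"
  using tower_action.act_inv[OF action, of j z "fst (snd j)" "snd (snd j)"] by (simp add: inv_letter_def)

lemma letter_inv': "j \<in> Lt \<Longrightarrow> z \<in> tow F B \<Longrightarrow> act F (inv_letter j) (act F j z) = z"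
  using letter_inv[OF Lt_inv, of j z] by simp

lemma wact_tow: "set w \<subseteq> Lt \<Longrightarrow> z \<in> tow F B \<Longrightarrow> wact F w z \<in> tow F B"
  by (induction w) (auto intro: letter_tow)

lemma inv_word_Lt: "set w \<subseteq> Lt \<Longrightarrow> set (inv_word w) \<subseteq> Lt"
  using Lt_inv by (auto simp: inv_word_def)

lemma wact_inv: "set w \<subseteq> Lt \<Longrightarrow> z \<in> tow F B \<Longrightarrow> wact F w (wact F (inv_word w) z) = z"
proof (induction w arbitrary: z)
  case (Cons j w)
  have "wact F (j # w) (wact F (inv_word (j # w)) z) = act F j (wact F w (wact F (inv_word w) (act F (inv_letter j) z)))"
    by (simp add: inv_word_def)
  also have "\<dots> = act F j (act F (inv_letter j) z)"
    using Cons.prems Lt_inv[of j] letter_tow[of "inv_letter j" z] by (subst Cons.IH) simp_all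
  also have "\<dots> = z" using Cons.prems by (intro letter_inv) auto
  finally show ?case .
qed (simp add: inv_word_def)

lemma inv_word_inv: "inv_word (inv_word w) = w"
  by (simp add: inv_word_def rev_map comp_def)

lemma wact_inv': "set w \<subseteq> Lt \<Longrightarrow> z \<in> tow F B \<Longrightarrow> wact F (inv_word w) (wact F w z) = z"
  using wact_inv[OF inv_word_Lt, of w z] by (simp add: inv_word_inv)

lemma wact_cont:
  assumes "set w \<subseteq> Lt" "z \<in> tow F B" "finite H"
  shows "\<exists>H'. finite H' \<and> (\<forall>z'\<in>tow F B \<inter> nb H' z. wact F w z' \<in> nb H (wact F w z))"
  using assms
proof (induction w arbitrary: H)
  case (Cons j w)
  obtain H1 where H1: "finite H1" "\<forall>z'\<in>tow F B \<inter> nb H1 (wact F w z). act F j z' \<in> nb H (act F j (wact F w z))"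
    using tower_action.act_cont[OF action, of j "wact F w z" H "fst (snd j)" "snd (snd j)"] Cons.prems wact_tow by auto
  obtain H2 where H2: "finite H2" "\<forall>z'\<in>tow F B \<inter> nb H2 z. wact F w z' \<in> nb H1 (wact F w z)"
    using Cons.IH[of H1] Cons.prems H1(1) by auto
  have "wact F (j # w) z' \<in> nb H (wact F (j # w) z)" if "z' \<in> tow F B \<inter> nb H2 z" for z'
    using that H1(2) H2(2) wact_tow[of w z'] Cons.prems by simp
  then show ?case using H2(1) by blast
qed auto

lemma wact_lab:
  assumes "set w \<subseteq> Lt"
  shows "\<exists>k0. \<forall>z\<in>tow F B. \<forall>k\<ge>k0. lab (wact F w z) k =
    foldr (\<lambda>a. \<sigma> a k) (map (\<lambda>j. (code (fst j, fst (snd j)), snd (snd j))) w) (lab z k)"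
  using assms
proof (induction w)
  case (Cons j w)
  obtain k1 where k1: "\<forall>z\<in>tow F B. \<forall>k\<ge>k1. lab (wact F w z) k =
    foldr (\<lambda>a. \<sigma> a k) (map (\<lambda>j. (code (fst j, fst (snd j)), snd (snd j))) w) (lab z k)" using Cons by auto
  have "\<exists>k0. \<forall>z\<in>tow F B. \<forall>k\<ge>k0. lab (act F j z) k = \<sigma> (code (fst j, fst (snd j)), snd (snd j)) k (lab z k)"
    using tower_action.act_lab[OF action, of j "fst (snd j)" "snd (snd j)"] Cons.prems by simp
  then obtain k2 where k2: "\<forall>z\<in>tow F B. \<forall>k\<ge>k2. lab (act F j z) k = \<sigma> (code (fst j, fst (snd j)), snd (snd j)) k (lab z k)"
    by (rule exE)
  have "lab (wact F (j # w) z) k = foldr (\<lambda>a. \<sigma> a k) (map (\<lambda>j. (code (fst j, fst (snd j)), snd (snd j))) (j # w)) (lab z k)"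
    if "z \<in> tow F B" "k \<ge> max k1 k2" for z k
  proof -
    have "wact F w z \<in> tow F B" using wact_tow Cons.prems that by simp
    then show ?thesis using k1 k2 that by simp
  qed
  then show ?case by blast
qed auto

text \<open>
  A letter acts on the labels of almost all levels as its free generator does. So a nonempty word
  whose sequence of free generators is reduced changes almost all labels of every point and has no
  fixed points; a word that is not reduced can be shortened, as \<open>code\<close> is injective.
\<close>

lemma free:
  assumes "set w \<subseteq> Lt" "z \<in> tow F B" "wact F w z = z" "z' \<in> tow F B"
  shows "wact F w z' = z'"
  using assms
proof (induction "length w" arbitrary: w rule: less_induct)
  case less
  let ?sym = "\<lambda>j :: letter. (code (fst j, fst (snd j)), snd (snd j))"
  show ?case
  proof (cases "reduced_word (map ?sym w)")
    case True
    show ?thesis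
    proof (cases "w = []")
      case False
      then obtain k1 where k1: "\<forall>k\<ge>k1. \<forall>l<N k. foldr (\<lambda>a. \<sigma> a k) (map ?sym w) l \<noteq> l"
        using \<sigma>_free[OF True] by auto
      obtain k2 where k2: "\<forall>z\<in>tow F B. \<forall>k\<ge>k2. lab (wact F w z) k = foldr (\<lambda>a. \<sigma> a k) (map ?sym w) (lab z k)"
        using wact_lab[OF less.prems(1)] by (rule exE)
      have "lab (wact F w z) (max k1 k2) \<noteq> lab z (max k1 k2)"
        using k1 k2 lab_less less.prems(2) by (simp del: foldr_map)
      then show ?thesis using less.prems(3) by simp
    qed simp
  next
    case False
    then obtain u x y v where uv: "map ?sym w = u @ x # y # v" "fst x = fst y" "snd x \<noteq> snd y"
      by (rule not_reduced_word_split)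
    from uv(1)[unfolded map_eq_append_conv] obtain u' r where "w = u' @ r \<and> map ?sym u' = u \<and> map ?sym r = x # y # v"
      by (elim exE) simp
    then have r: "w = u' @ r" "map ?sym r = x # y # v" by simp_all
    obtain j r' where r'_def: "r = j # r'" using r(2) by (cases r) simp_all
    then have r': "r = j # r'" "?sym j = x" "map ?sym r' = y # v"
      using r(2) by (simp_all only: list.map list.inject)
    obtain j' v' where r''_def: "r' = j' # v'" using r'(3) by (cases r') simp_all
    then have r'': "r' = j' # v'" "?sym j' = y" using r'(3) by (simp_all only: list.map list.inject)
    have w: "w = u' @ j # j' # v'" and jj: "?sym j = x" "?sym j' = y" using r r' r'' by simp_all
    have "code (fst j, fst (snd j)) = code (fst j', fst (snd j'))" using uv(2) jj by auto
    then have "(fst j, fst (snd j)) = (fst j', fst (snd j'))" by (rule injD[OF code])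
    moreover have "snd (snd j) \<noteq> snd (snd j')" using uv(3) jj by auto
    ultimately have "j' = inv_letter j" by (cases j; cases j') (auto simp: inv_letter_def)
    then have cancel: "wact F w p = wact F (u' @ v') p" if "p \<in> tow F B" for p
      using letter_inv[of j "wact F v' p"] wact_tow[of v' p] that less.prems(1) w by simp
    have "wact F (u' @ v') z' = z'"
      by (rule less.hyps) (use less.prems w cancel in auto)
    then show ?thesis using cancel less.prems(4) by simp
  qed
qed

end

subsection \<open>Construction of one stage\<close>

lemma countable_finitely_determined:
  assumes C: "countable C" and V: "\<And>z c. z \<in> V \<Longrightarrow> c \<notin> C \<Longrightarrow> \<not> z c"
  shows "countable {D. finitely_determined V D}"
proof -
  define f where "f = (\<lambda>(F, P). {z \<in> V. {c \<in> F. z c} \<in> P})"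
  define I where "I = {F. finite F \<and> F \<subseteq> C}"
  have I: "countable I" unfolding I_def by (rule countable_Collect_finite_subset[OF C])
  have "countable (I \<times> {P. finite P \<and> P \<subseteq> I})"
    by (intro countable_SIGMA I countable_Collect_finite_subset)
  moreover have "{D. finitely_determined V D} \<subseteq> f ` (I \<times> {P. finite P \<and> P \<subseteq> I})"
  proof
    fix D assume "D \<in> {D. finitely_determined V D}"
    then have D: "finitely_determined V D" by simp
    obtain F where F: "finite F" "\<forall>z\<in>V. \<forall>z'\<in>V \<inter> nb F z. z' \<in> D \<longleftrightarrow> z \<in> D"
      using D by (rule finitely_determinedE)
    define P where "P = (\<lambda>z. {c \<in> F \<inter> C. z c}) ` D"
    have P: "P \<subseteq> Pow (F \<inter> C)" by (auto simp: P_def)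
    have "finite P" by (rule finite_subset[OF P]) (use F in simp)
    moreover have "P \<subseteq> I" using P F(1) by (auto simp: I_def intro: finite_subset)
    moreover have "D = f (F \<inter> C, P)"
    proof (intro equalityI subsetI)
      fix z assume "z \<in> D"
      then show "z \<in> f (F \<inter> C, P)" using finitely_determined_subset[OF D] by (auto simp: f_def P_def)
    next
      fix z assume "z \<in> f (F \<inter> C, P)"
      then obtain z' where z: "z \<in> V" "z' \<in> D" "{c \<in> F \<inter> C. z c} = {c \<in> F \<inter> C. z' c}"
        by (auto simp: f_def P_def)
      have z'V: "z' \<in> V" using z(2) finitely_determined_subset[OF D] by blast
      have "z c = z' c" if "c \<in> F" for c using V[OF z(1), of c] V[OF z'V, of c] z(3) that by blast
      then have "z \<in> V \<inter> nb F z'" using z(1) by (simp add: nb_def)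
      then show "z \<in> D" using F(2) z'V z(2) by blast
    qed
    moreover have "F \<inter> C \<in> I" using F(1) by (simp add: I_def)
    ultimately show "D \<in> f ` (I \<times> {P. finite P \<and> P \<subseteq> I})" by blast
  qed
  ultimately show ?thesis by (rule countable_subset[OF _ countable_image, rotated])
qed

lemma (in tower) labelled: "bot \<in> B \<Longrightarrow> countable B \<Longrightarrow> labelled_space (tow F B) (B \<times> UNIV) lab N"
proof
  show "closed (tow F B)" by (rule closed_tow)
  show "bot \<in> B \<Longrightarrow> countable B \<Longrightarrow> countable (B \<times> (UNIV :: nat set))" by simp
  show "\<And>z c. z \<in> tow F B \<Longrightarrow> c \<notin> B \<times> UNIV \<Longrightarrow> \<not> z c" using tow_off by fastforce
  show "\<And>z k. lab z k < N k" by (rule lab_less)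
  show "\<exists>H. finite H \<and> (\<forall>z'\<in>tow F B \<inter> nb H z. lab z' k = lab z k)" for z k
  proof (intro exI[of _ "(\<lambda>j. (bot, prod_encode (k, j))) ` {..<N k}"] conjI ballI)
    fix z' assume "z' \<in> tow F B \<inter> nb ((\<lambda>j. (bot, prod_encode (k, j))) ` {..<N k}) z"
    then show "lab z' k = lab z k" by (intro lab_cong) (auto simp: nb_def)
  qed simp
  show "\<And>z H. bot \<in> B \<Longrightarrow> z \<in> tow F B \<Longrightarrow> finite H \<Longrightarrow>
    \<exists>k. \<forall>l. (\<forall>i. l i < N i) \<longrightarrow> (\<forall>i<k. l i = lab z i) \<longrightarrow> (\<exists>q\<in>tow F B \<inter> nb H z. q \<noteq> z \<and> lab q = l)"
    by (rule rich)
qed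

context labelled_space
begin

text \<open>Shifts between two clopen sets and between their complements glue to a self-homeomorphism.\<close>

lemma global_shift:
  assumes U: "finitely_determined V U" "U \<noteq> {}" "U \<noteq> V" and W: "finitely_determined V W" "W \<noteq> {}" "W \<noteq> V"
    and \<sigma>: "\<And>i l. l < N i \<Longrightarrow> \<sigma> i l < N i" and \<tau>: "\<And>i l. l < N i \<Longrightarrow> \<tau> i l < N i"
    and inv: "\<And>i l. l < N i \<Longrightarrow> \<tau> i (\<sigma> i l) = l" "\<And>i l. l < N i \<Longrightarrow> \<sigma> i (\<tau> i l) = l"
  shows "\<exists>h h' k0. \<forall>z\<in>V. h z \<in> V \<and> h' z \<in> V \<and> h' (h z) = z \<and> h (h' z) = z \<and> (h z \<in> W \<longleftrightarrow> z \<in> U) \<and>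
     (\<forall>i\<ge>k0. L (h z) i = \<sigma> i (L z i) \<and> L (h' z) i = \<tau> i (L z i)) \<and>
     (\<forall>F. finite F \<longrightarrow> (\<exists>G. finite G \<and> (\<forall>z'\<in>V \<inter> nb G z. h z' \<in> nb F (h z)))) \<and>
     (\<forall>F. finite F \<longrightarrow> (\<exists>G. finite G \<and> (\<forall>z'\<in>V \<inter> nb G z. h' z' \<in> nb F (h' z))))"
proof -
  have UV: "U \<subseteq> V" "W \<subseteq> V" using U W finitely_determined_subset by blast+
  have U': "finitely_determined V (V - U)" "V - U \<noteq> {}" and W': "finitely_determined V (V - W)" "V - W \<noteq> {}"
    using finitely_determined_Diff[OF finitely_determined_UNIV] U W UV by auto
  obtain k1 h1 h1' where 1: "\<forall>p\<in>U. h1 p \<in> W \<and> h1' (h1 p) = p \<and> (\<forall>i\<ge>k1. L (h1 p) i = \<sigma> i (L p i))"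
    "\<forall>q\<in>W. h1' q \<in> U \<and> h1 (h1' q) = q"
    "\<forall>p\<in>U. \<forall>F. finite F \<longrightarrow> (\<exists>G. finite G \<and> (\<forall>p'\<in>U \<inter> nb G p. h1 p' \<in> nb F (h1 p)))"
    "\<forall>q\<in>W. \<forall>F. finite F \<longrightarrow> (\<exists>G. finite G \<and> (\<forall>q'\<in>W \<inter> nb G q. h1' q' \<in> nb F (h1' q)))"
    by (rule clopen_shift[OF U(1,2) W(1,2) \<sigma> \<tau> inv])
  obtain k2 h2 h2' where 2: "\<forall>p\<in>V-U. h2 p \<in> V-W \<and> h2' (h2 p) = p \<and> (\<forall>i\<ge>k2. L (h2 p) i = \<sigma> i (L p i))"
    "\<forall>q\<in>V-W. h2' q \<in> V-U \<and> h2 (h2' q) = q"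
    "\<forall>p\<in>V-U. \<forall>F. finite F \<longrightarrow> (\<exists>G. finite G \<and> (\<forall>p'\<in>(V-U) \<inter> nb G p. h2 p' \<in> nb F (h2 p)))"
    "\<forall>q\<in>V-W. \<forall>F. finite F \<longrightarrow> (\<exists>G. finite G \<and> (\<forall>q'\<in>(V-W) \<inter> nb G q. h2' q' \<in> nb F (h2' q)))"
    by (rule clopen_shift[OF U' W' \<sigma> \<tau> inv])
  define h where "h z = (if z \<in> U then h1 z else h2 z)" for z
  define h' where "h' z = (if z \<in> W then h1' z else h2' z)" for z
  have maps: "h z \<in> V \<and> h' z \<in> V \<and> h' (h z) = z \<and> h (h' z) = z \<and> (h z \<in> W \<longleftrightarrow> z \<in> U)" if z: "z \<in> V" for z
  proof -
    have "h z \<in> V \<and> h' (h z) = z \<and> (h z \<in> W \<longleftrightarrow> z \<in> U)"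
      using bspec[OF 1(1), of z] bspec[OF 2(1), of z] z UV by (cases "z \<in> U") (auto simp: h_def h'_def)
    moreover have "h' z \<in> V \<and> h (h' z) = z"
      using bspec[OF 1(2), of z] bspec[OF 2(2), of z] z UV by (cases "z \<in> W") (auto simp: h_def h'_def)
    ultimately show ?thesis by blast
  qed
  have lab: "L (h z) i = \<sigma> i (L z i)" if "z \<in> V" "i \<ge> max k1 k2" for z i
    using bspec[OF 1(1), of z] bspec[OF 2(1), of z] that by (cases "z \<in> U") (simp_all add: h_def)
  have lab': "L (h' z) i = \<tau> i (L z i)" if z: "z \<in> V" "i \<ge> max k1 k2" for z i
  proof -
    have "L z i = \<sigma> i (L (h' z) i)" using lab[of "h' z" i] maps[OF z(1)] z(2) by simp
    then show ?thesis using inv(1) L_less maps z(1) by metis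
  qed
  have cont: "\<exists>G. finite G \<and> (\<forall>z'\<in>V \<inter> nb G z. h z' \<in> nb F (h z))" if z: "z \<in> V" and F: "finite F" for z F
  proof (cases "z \<in> U")
    case True
    obtain G where G: "finite G" "\<forall>p'\<in>U \<inter> nb G z. h1 p' \<in> nb F (h1 z)" using 1(3) True F by blast
    obtain K where K: "finite K" "V \<inter> nb K z \<subseteq> U" by (rule finitely_determined_nb[OF U(1) True])
    show ?thesis using G K True by (intro exI[of _ "G \<union> K"]) (auto simp: h_def nb_Un)
  next
    case False
    then have zU: "z \<in> V - U" using z by blast
    obtain G where G: "finite G" "\<forall>p'\<in>(V-U) \<inter> nb G z. h2 p' \<in> nb F (h2 z)" using 2(3) zU F by blast
    obtain K where K: "finite K" "V \<inter> nb K z \<subseteq> V - U" by (rule finitely_determined_nb[OF U'(1) zU])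
    have "h z' \<in> nb F (h z)" if z': "z' \<in> V \<inter> nb (G \<union> K) z" for z'
    proof -
      have "z' \<in> (V - U) \<inter> nb G z" using z' K(2) by (auto simp: nb_Un)
      then show ?thesis using G(2) False by (auto simp: h_def)
    qed
    then show ?thesis using G(1) K(1) by (intro exI[of _ "G \<union> K"]) simp
  qed
  have cont': "\<exists>G. finite G \<and> (\<forall>z'\<in>V \<inter> nb G z. h' z' \<in> nb F (h' z))" if z: "z \<in> V" and F: "finite F" for z F
  proof (cases "z \<in> W")
    case True
    obtain G where G: "finite G" "\<forall>p'\<in>W \<inter> nb G z. h1' p' \<in> nb F (h1' z)" using 1(4) True F by blast
    obtain K where K: "finite K" "V \<inter> nb K z \<subseteq> W" by (rule finitely_determined_nb[OF W(1) True])
    show ?thesis using G K True by (intro exI[of _ "G \<union> K"]) (auto simp: h'_def nb_Un)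
  next
    case False
    then have zW: "z \<in> V - W" using z by blast
    obtain G where G: "finite G" "\<forall>p'\<in>(V-W) \<inter> nb G z. h2' p' \<in> nb F (h2' z)" using 2(4) zW F by blast
    obtain K where K: "finite K" "V \<inter> nb K z \<subseteq> V - W" by (rule finitely_determined_nb[OF W'(1) zW])
    have "h' z' \<in> nb F (h' z)" if z': "z' \<in> V \<inter> nb (G \<union> K) z" for z'
    proof -
      have "z' \<in> (V - W) \<inter> nb G z" using z' K(2) by (auto simp: nb_Un)
      then show ?thesis using G(2) False by (auto simp: h'_def)
    qed
    then show ?thesis using G(1) K(1) by (intro exI[of _ "G \<union> K"]) simp
  qed
  show ?thesis
    by (rule exI[of _ h], rule exI[of _ h'], rule exI[of _ "max k1 k2"])
      (intro ballI conjI allI impI lab lab' cont cont'; simp add: maps)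
qed

end

locale new_stage = parameters +
  fixes F :: "om1 \<Rightarrow> stage" and a :: om1
  assumes a: "a \<noteq> bot" and steps: "\<And>b. b < a \<Longrightarrow> b \<noteq> bot \<Longrightarrow> step F b"
begin

abbreviation "V \<equiv> tow F {..<a}"

sublocale tower G N \<sigma> code \<nu> homog F "{..<a}"
  by unfold_locales (use steps in auto)

lemma bot_a: "bot < a"
  using a bot.not_eq_extremum by blast

sublocale labelled_space V "{..<a} \<times> UNIV" lab N
  by (rule labelled) (use bot_a countable_lessThan_om1 in auto)

lemma V_nonempty: "V \<noteq> {}"
proof -
  have "(\<lambda>_. False) \<in> tow F {..<bot}" by (auto simp: tow_def bot.extremum_strict)
  then obtain z where "z \<in> V" by (rule lift_stage) auto
  then show ?thesis by blast
qed

text \<open>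
  Only countably many pairs of clopen sets have to be served, because the space of a countable stage
  is metrizable.
\<close>

lemma generators_exist:
  assumes homog
  shows "\<exists>g. \<forall>F'. (\<forall>b<a. F' b = F b) \<longrightarrow> gen (F' a) = g \<longrightarrow> gens_ok F' a"
proof -
  define P where "P = {(U, W). finitely_determined V U \<and> finitely_determined V W \<and> U \<noteq> {} \<and> W \<noteq> {} \<and> U \<noteq> V \<and> W \<noteq> V}"
  have cfd: "countable {D. finitely_determined V D}"
    by (rule countable_finitely_determined[OF countable_C]) (rule support)
  have cP: "countable P"
    by (rule countable_subset[OF _ countable_SIGMA[OF cfd cfd]]) (auto simp: P_def)
  have "P \<noteq> {}"
  proof -
    obtain z where z: "z \<in> V" using V_nonempty by blast
    obtain q where q: "q \<in> V" "q \<noteq> z" using no_isolated[OF z, of "{}"] bot_a by auto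
    then obtain c where c: "q c \<noteq> z c" using t2_fun_bool by blast
    define U where "U = {z \<in> V. z c}"
    have "finitely_determined V U" unfolding U_def by (rule finitely_determined_coordinate)
    moreover have "U \<noteq> {}" "U \<noteq> V" using z q c by (auto simp: U_def)
    ultimately have "(U, U) \<in> P" by (simp add: P_def)
    then show ?thesis by blast
  qed
  define pr where "pr = from_nat_into P"
  have pr: "pr m \<in> P" for m unfolding pr_def using \<open>P \<noteq> {}\<close> by (rule from_nat_into)
  define good where "good m h h' k0 \<longleftrightarrow> (\<forall>z\<in>V. h z \<in> V \<and> h' z \<in> V \<and> h' (h z) = z \<and> h (h' z) = z \<and> (h z \<in> snd (pr m) \<longleftrightarrow> z \<in> fst (pr m)) \<and>
     (\<forall>i\<ge>k0. lab (h z) i = \<sigma> (code (a, m), True) i (lab z i) \<and> lab (h' z) i = \<sigma> (code (a, m), False) i (lab z i)) \<and>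
     (\<forall>F. finite F \<longrightarrow> (\<exists>G. finite G \<and> (\<forall>z'\<in>V \<inter> nb G z. h z' \<in> nb F (h z)))) \<and>
     (\<forall>F. finite F \<longrightarrow> (\<exists>G. finite G \<and> (\<forall>z'\<in>V \<inter> nb G z. h' z' \<in> nb F (h' z)))))"
    for m and h h' :: "point \<Rightarrow> point" and k0 :: nat
  have "\<exists>h h' k0. good m h h' k0" for m
    unfolding good_def
  proof (rule global_shift)
    show "finitely_determined V (fst (pr m))" "fst (pr m) \<noteq> {}" "fst (pr m) \<noteq> V"
      "finitely_determined V (snd (pr m))" "snd (pr m) \<noteq> {}" "snd (pr m) \<noteq> V"
      using pr[of m] by (cases "pr m", simp add: P_def)+
    show "l < N i \<Longrightarrow> \<sigma> (code (a, m), False) i (\<sigma> (code (a, m), True) i l) = l"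
      "l < N i \<Longrightarrow> \<sigma> (code (a, m), True) i (\<sigma> (code (a, m), False) i l) = l" for i l
      using \<sigma>_inv[of l i "code (a, m)" False] \<sigma>_inv[of l i "code (a, m)" True] by simp_all
  qed (rule \<sigma>_less, assumption)+
  note ex = this
  have "\<exists>hh. \<exists>k0. good m (fst hh) (snd hh) k0" for m
  proof -
    from ex[of m] obtain h h' k0 where "good m h h' k0" by (elim exE)
    then have "good m (fst (h, h')) (snd (h, h')) k0" by simp
    then show ?thesis by (intro exI)
  qed
  then have "\<forall>m. \<exists>hh. \<exists>k0. good m (fst hh) (snd hh) k0" by (rule allI)
  from choice[OF this] obtain hh where hh: "\<forall>m. \<exists>k0. good m (fst (hh m)) (snd (hh m)) k0" by (rule exE)
  define g where "g ms = (if snd ms then fst (hh (fst ms)) else snd (hh (fst ms)))" for ms :: "nat \<times> bool"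
  have g: "\<exists>k0. good m (g (m, True)) (g (m, False)) k0" for m using hh by (simp add: g_def)
  have "gens_ok F' a" if F': "\<forall>b<a. F' b = F b" "gen (F' a) = g" for F'
  proof -
    have t: "tow F' {..<a} = V" by (rule tow_cong) (use F' in simp)
    show ?thesis
      unfolding gens_ok_def t F'(2)
    proof (intro conjI)
      show "\<forall>m s. \<forall>z\<in>V. g (m, s) z \<in> V \<and> g (m, s) (g (m, \<not> s) z) = z \<and>
        (\<forall>H. finite H \<longrightarrow> (\<exists>H'. finite H' \<and> (\<forall>z'\<in>V \<inter> nb H' z. g (m, s) z' \<in> nb H (g (m, s) z))))"
      proof (intro allI ballI)
        fix m s z assume z: "z \<in> V"
        obtain k0 where "good m (g (m, True)) (g (m, False)) k0" using g[of m] by (rule exE)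
        from bspec[OF this[unfolded good_def] z]
        show "g (m, s) z \<in> V \<and> g (m, s) (g (m, \<not> s) z) = z \<and>
          (\<forall>H. finite H \<longrightarrow> (\<exists>H'. finite H' \<and> (\<forall>z'\<in>V \<inter> nb H' z. g (m, s) z' \<in> nb H (g (m, s) z))))"
          by (cases s) simp_all
      qed
      show "\<forall>m s. \<exists>k0. \<forall>z\<in>V. \<forall>k\<ge>k0. lab (g (m, s) z) k = \<sigma> (code (a, m), s) k (lab z k)"
      proof (intro allI)
        fix m s
        obtain k0 where k: "good m (g (m, True)) (g (m, False)) k0" using g[of m] by (rule exE)
        have "lab (g (m, s) z) k = \<sigma> (code (a, m), s) k (lab z k)" if "z \<in> V" "k \<ge> k0" for z k
          using bspec[OF k[unfolded good_def] that(1)] that(2) by (cases s) simp_all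
        then show "\<exists>k0. \<forall>z\<in>V. \<forall>k\<ge>k0. lab (g (m, s) z) k = \<sigma> (code (a, m), s) k (lab z k)" by blast
      qed
      show "\<forall>U W. finitely_determined V U \<longrightarrow> finitely_determined V W \<longrightarrow> U \<noteq> {} \<longrightarrow> W \<noteq> {} \<longrightarrow>
        U \<noteq> V \<longrightarrow> W \<noteq> V \<longrightarrow> (\<exists>m. \<forall>z\<in>V. g (m, True) z \<in> W \<longleftrightarrow> z \<in> U)"
      proof (intro allI impI)
        fix U W assume "finitely_determined V U" "finitely_determined V W" "U \<noteq> {}" "W \<noteq> {}" "U \<noteq> V" "W \<noteq> V"
        then have "(U, W) \<in> P" by (simp add: P_def)
        from from_nat_into_surj[OF cP this] obtain m where m: "pr m = (U, W)" unfolding pr_def by (rule exE)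
        obtain k0 where k: "good m (g (m, True)) (g (m, False)) k0" using g[of m] by (rule exE)
        have "g (m, True) z \<in> W \<longleftrightarrow> z \<in> U" if "z \<in> V" for z
          using bspec[OF k[unfolded good_def] that] m by simp
        then show "\<exists>m. \<forall>z\<in>V. g (m, True) z \<in> W \<longleftrightarrow> z \<in> U" by blast
      qed
    qed
  qed
  then show ?thesis by blast
qed

end

text \<open>
  The orbit of \<open>x0\<close> will be split. If the guess has accumulation points, \<open>x0\<close> is one of them; in the
  rigid case the guessed pairs accumulate at \<open>(x0, y0)\<close> if they accumulate anywhere off the
  diagonal.
\<close>

locale new_stage_gens = new_stage +
  fixes g :: "nat \<times> bool \<Rightarrow> point \<Rightarrow> point" and x0 y0 :: point
  assumes g: "\<And>F'. homog \<Longrightarrow> (\<forall>b<a. F' b = F b) \<Longrightarrow> gen (F' a) = g \<Longrightarrow> gens_ok F' a"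
    and x0: "x0 \<in> V" "acc V (guessed F a) \<noteq> {} \<Longrightarrow> x0 \<in> acc V (guessed F a)"
    and pair: "\<not> homog \<Longrightarrow> \<exists>x y. pair_limit F a x y \<Longrightarrow> pair_limit F a x0 y0"
begin

text \<open>
  A provisional stage \<open>a\<close> that consists of the new generators only, so that words in the letters of
  stage \<open>a\<close> act on \<open>V\<close>.
\<close>

definition "F1 = F(a := \<lparr>split_pts = {}, side = undefined, perm = undefined, gen = g, promises = {}\<rparr>)"

lemma F1: "b < a \<Longrightarrow> F1 b = F b" "gen (F1 a) = g" "tow F1 {..<a} = V"
  unfolding F1_def by (auto intro!: tow_cong)

lemma letters_a: "j \<in> letters a \<Longrightarrow> homog" "j \<in> letters a \<Longrightarrow> fst j \<noteq> bot" "j \<in> letters a \<Longrightarrow> fst j \<le> a"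
  by (simp_all add: letters_def)

sublocale W: tower_words G N \<sigma> code \<nu> homog F1 "{..<a}" "letters a"
proof
  show "b \<in> {..<a} \<Longrightarrow> c \<le> b \<Longrightarrow> c \<in> {..<a}" for b c by auto
  show "b \<in> {..<a} \<Longrightarrow> b \<noteq> bot \<Longrightarrow> step F1 b" for b
    using steps step_cong[of b F1 F] F1(1) by auto
  show "inv_letter j \<in> letters a" if "j \<in> letters a" for j using that unfolding letters_def by simp
  show "homog \<and> fst j \<noteq> bot \<and> {..<fst j} \<subseteq> {..<a} \<and> gens_ok F1 (fst j)" if j: "j \<in> letters a" for j
  proof -
    have "gens_ok F1 (fst j)"
    proof (cases "fst j = a")
      case True
      then show ?thesis using g[of F1] F1 letters_a(1)[OF j] by simp
    next
      case False
      then have "fst j < a" using letters_a(3)[OF j] by simp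
      then have "step F1 (fst j)" using steps letters_a(2)[OF j] step_cong[of "fst j" F1 F] F1(1) by auto
      then show ?thesis using letters_a(1)[OF j] unfolding step_def by blast
    qed
    then show ?thesis using letters_a[OF j] by auto
  qed
qed

abbreviation "words \<equiv> {w. set w \<subseteq> letters a}"

lemma countable_words: "countable words"
proof -
  have "insert a {..<a} = {..a}" by auto
  then have "countable {..a}" using countable_lessThan_om1[of a] by (metis countable_insert)
  then have "countable ({..a} \<times> (UNIV :: nat set) \<times> (UNIV :: bool set))" by simp
  then have "countable (letters a)" by (rule countable_subset[rotated]) (auto simp: letters_def)
  then have "countable (lists (letters a))" by (rule countable_lists)
  moreover have "words = lists (letters a)" by (auto simp: in_lists_conv_set)
  ultimately show ?thesis by simp
qed

lemma wV: "w \<in> words \<Longrightarrow> z \<in> V \<Longrightarrow> wact F1 w z \<in> V"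
  and wV_inv: "w \<in> words \<Longrightarrow> z \<in> V \<Longrightarrow> wact F1 (inv_word w) z \<in> V"
  and w_inv: "w \<in> words \<Longrightarrow> z \<in> V \<Longrightarrow> wact F1 w (wact F1 (inv_word w) z) = z"
  and w_inv': "w \<in> words \<Longrightarrow> z \<in> V \<Longrightarrow> wact F1 (inv_word w) (wact F1 w z) = z"
  using W.wact_tow[of w z] W.wact_tow[of "inv_word w" z] W.inv_word_Lt[of w] W.wact_inv[of w z] W.wact_inv'[of w z]
  by (simp_all add: F1(3))

lemma w_cont: "w \<in> words \<Longrightarrow> z \<in> V \<Longrightarrow> finite H \<Longrightarrow> \<exists>H'. finite H' \<and> (\<forall>z'\<in>V \<inter> nb H' z. wact F1 w z' \<in> nb H (wact F1 w z))"
  using W.wact_cont[of w z H] by (simp add: F1(3))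

lemma w_cont_inv: "w \<in> words \<Longrightarrow> z \<in> V \<Longrightarrow> finite H \<Longrightarrow>
   \<exists>H'. finite H' \<and> (\<forall>z'\<in>V \<inter> nb H' z. wact F1 (inv_word w) z' \<in> nb H (wact F1 (inv_word w) z))"
  using w_cont[of "inv_word w" z H] W.inv_word_Lt[of w] by simp

definition "old_promises = {(b, T, A). b < a \<and> b \<noteq> bot \<and> (T, A) \<in> promises (F b)} \<union> {(a, guessed F a, acc V (guessed F a))}"

lemma countable_old_promises: "countable old_promises"
proof -
  have "countable (promises (F b))" if "b < a" "b \<noteq> bot" for b using steps[OF that] by (simp add: step_def)
  then have "countable (\<Union>b\<in>{..<a} - {bot}. (\<lambda>p. (b, p)) ` promises (F b))"
    using countable_lessThan_om1 by (intro countable_UN) auto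
  moreover have "{(b, T, A). b < a \<and> b \<noteq> bot \<and> (T, A) \<in> promises (F b)} \<subseteq> (\<Union>b\<in>{..<a} - {bot}. (\<lambda>p. (b, p)) ` promises (F b))"
    by auto
  ultimately show ?thesis unfolding old_promises_def by (auto intro: countable_subset)
qed

text \<open>
  The requirements at \<open>x0\<close>. The requirements for the other points of the orbit are pulled back to
  \<open>x0\<close> along words.
\<close>

definition "req_promise bw Z \<longleftrightarrow> (case bw of ((b, T, A), w) \<Rightarrow> \<exists>s\<in>T. s \<noteq> res (wact F1 w x0) b \<and>
    (\<forall>z\<in>V. res z b = s \<longrightarrow> wact F1 (inv_word w) z \<in> Z))"

definition "req_label w Z \<longleftrightarrow> (\<exists>k. \<forall>l. (\<forall>i. l i < N i) \<longrightarrow> (\<forall>i<k. l i = lab (wact F1 w x0) i) \<longrightarrow>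
    (\<exists>q\<in>V. wact F1 (inv_word w) q \<in> Z \<and> lab q = l))"

definition "req_pair H Z \<longleftrightarrow> (\<exists>n. row a (\<nu> (2*n)) \<in> Z \<and> row a (\<nu> (2*n+1)) \<in> V \<inter> nb H y0 \<and> row a (\<nu> (2*n+1)) \<noteq> y0)"

definition "promise_index = {((b, T, A), w). (b, T, A) \<in> old_promises \<and> w \<in> words \<and> res (wact F1 w x0) b \<in> A}"

definition "pair_index = (if \<not> homog \<and> (\<exists>x y. pair_limit F a x y) then {H. finite H \<and> H \<subseteq> {..<a} \<times> (UNIV :: nat set)} else {})"

definition "reqs = req_promise ` promise_index \<union> req_label ` words \<union> req_pair ` pair_index"

lemma countable_reqs: "countable reqs"
proof -
  have "countable promise_index"
    by (rule countable_subset[OF _ countable_SIGMA[OF countable_old_promises countable_words]]) (auto simp: promise_index_def)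
  moreover have "countable pair_index"
    using countable_Collect_finite_subset[OF countable_C] by (simp add: pair_index_def)
  ultimately show ?thesis using countable_words by (auto simp: reqs_def)
qed

lemma req_promise_mono: "req_promise bw Z \<Longrightarrow> Z \<subseteq> Z' \<Longrightarrow> req_promise bw Z'"
  unfolding req_promise_def by (cases bw; cases "fst bw") fastforce

lemma req_label_mono:
  assumes "req_label w Z" "Z \<subseteq> Z'"
  shows "req_label w Z'"
proof -
  obtain k where "\<forall>l. (\<forall>i. l i < N i) \<longrightarrow> (\<forall>i<k. l i = lab (wact F1 w x0) i) \<longrightarrow>
    (\<exists>q\<in>V. wact F1 (inv_word w) q \<in> Z \<and> lab q = l)" using assms(1) unfolding req_label_def by (rule exE)
  then have "\<forall>l. (\<forall>i. l i < N i) \<longrightarrow> (\<forall>i<k. l i = lab (wact F1 w x0) i) \<longrightarrow>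
    (\<exists>q\<in>V. wact F1 (inv_word w) q \<in> Z' \<and> lab q = l)" using assms(2) by blast
  then show ?thesis unfolding req_label_def by (rule exI)
qed

lemma req_pair_mono: "req_pair H Z \<Longrightarrow> Z \<subseteq> Z' \<Longrightarrow> req_pair H Z'"
  unfolding req_pair_def by blast

lemma reqs_mono:
  assumes "\<rho> \<in> reqs" "\<rho> Z" "Z \<subseteq> Z'"
  shows "\<rho> Z'"
  using assms(1) unfolding reqs_def
proof (elim UnE imageE)
  fix bw assume "\<rho> = req_promise bw"
  then show ?thesis using assms(2,3) req_promise_mono by simp
next
  fix w assume "\<rho> = req_label w"
  then show ?thesis using assms(2,3) req_label_mono by simp
next
  fix H assume "\<rho> = req_pair H"
  then show ?thesis using assms(2,3) req_pair_mono by simp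
qed

lemma pull_back:
  assumes w: "w \<in> words" and c: "finite K"
  obtains H where "finite H" "\<And>z. z \<in> V \<Longrightarrow> z \<in> nb H (wact F1 w x0) \<Longrightarrow> wact F1 (inv_word w) z \<in> V \<inter> nb K x0"
proof -
  have y: "wact F1 w x0 \<in> V" by (rule wV[OF w x0(1)])
  obtain H where "finite H" "\<forall>z'\<in>V \<inter> nb H (wact F1 w x0). wact F1 (inv_word w) z' \<in> nb K (wact F1 (inv_word w) (wact F1 w x0))"
    using w_cont_inv[OF w y c] by blast
  then show ?thesis using that[of H] wV_inv[OF w] w_inv'[OF w x0(1)] by auto
qed

lemma push_forward:
  assumes w: "w \<in> words" and c: "finite H"
  obtains K where "finite K" "\<And>z. z \<in> V \<Longrightarrow> wact F1 (inv_word w) z \<in> nb K x0 \<Longrightarrow> z \<in> nb H (wact F1 w x0)"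
proof -
  obtain K where K: "finite K" "\<forall>u\<in>V \<inter> nb K x0. wact F1 w u \<in> nb H (wact F1 w x0)"
    using w_cont[OF w x0(1) c] by blast
  have "z \<in> nb H (wact F1 w x0)" if z: "z \<in> V" "wact F1 (inv_word w) z \<in> nb K x0" for z
  proof -
    have "wact F1 (inv_word w) z \<in> V \<inter> nb K x0" using wV_inv[OF w z(1)] z(2) by blast
    then show ?thesis using K(2) w_inv[OF w z(1)] by metis
  qed
  then show ?thesis using that K(1) by blast
qed

text \<open>
  Let \<open>y\<close> be the image of \<open>x0\<close> under the word. A promise provides a whole fibre near \<open>y\<close> above a
  point other than that below \<open>y\<close>, and a coordinate in which these two points differ separates the
  fibre from \<open>y\<close>. For labels, take a point near \<open>y\<close> that has all labels in common with \<open>y\<close>, and a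
  small neighbourhood of this point that omits \<open>y\<close>.
\<close>

lemma reqs_step:
  assumes "\<rho> \<in> reqs" and K: "finite K"
  shows "\<exists>K'. finite K' \<and> \<rho> (V \<inter> nb K x0 - nb K' x0)"
  using assms(1) unfolding reqs_def
proof (elim UnE imageE)
  fix bw assume bw: "\<rho> = req_promise bw" "bw \<in> promise_index"
  obtain b T A w where bw': "bw = ((b, T, A), w)" by (metis prod.exhaust)
  have p: "(b, T, A) \<in> old_promises" "w \<in> words" "res (wact F1 w x0) b \<in> A" using bw(2) by (auto simp: promise_index_def bw')
  let ?y = "wact F1 w x0"
  have y: "?y \<in> V" by (rule wV[OF p(2) x0(1)])
  obtain H where H: "finite H" "\<And>z. z \<in> V \<Longrightarrow> z \<in> nb H ?y \<Longrightarrow> wact F1 (inv_word w) z \<in> V \<inter> nb K x0"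
    by (rule pull_back[OF p(2) K]) blast
  have "\<exists>s\<in>T. s \<noteq> res ?y b \<and> (\<forall>z\<in>V. res z b = s \<longrightarrow> z \<in> nb H ?y)"
  proof (cases "b < a")
    case True
    then show ?thesis using p(1,3) H(1) y by (intro promise) (auto simp: old_promises_def)
  next
    case False
    then have b: "b = a" "T = guessed F a" "A = acc V (guessed F a)" using p(1) by (auto simp: old_promises_def)
    then have "?y \<in> acc V (guessed F a)" using p(3) res_id[OF y] by simp
    then obtain s where "s \<in> guessed F a" "s \<in> nb H ?y" "s \<noteq> ?y" using H(1) unfolding acc_def by blast
    then show ?thesis using b res_id[OF y] res_id[of _ F a] by (intro bexI[of _ s]) auto
  qed
  then obtain s where s: "s \<in> T" "s \<noteq> res ?y b" "\<forall>z\<in>V. res z b = s \<longrightarrow> z \<in> nb H ?y" by blast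
  obtain c where c: "s c \<noteq> res ?y b c" using t2_fun_bool[OF s(2)] by blast
  obtain K' where K': "finite K'" "\<And>z. z \<in> V \<Longrightarrow> wact F1 (inv_word w) z \<in> nb K' x0 \<Longrightarrow> z \<in> nb {c} ?y"
    by (rule push_forward[OF p(2), of "{c}"]) auto
  have "wact F1 (inv_word w) z \<in> V \<inter> nb K x0 - nb K' x0" if z: "z \<in> V" "res z b = s" for z
  proof -
    have "z \<notin> nb {c} ?y" using c z(2) by (cases c) (auto simp: nb_def res_apply)
    then show ?thesis using K'(2) H(2) s(3) z by blast
  qed
  then have "\<rho> (V \<inter> nb K x0 - nb K' x0)" using s unfolding bw(1) bw' req_promise_def by auto
  then show ?thesis using K'(1) by blast
next
  fix w assume w: "\<rho> = req_label w" "w \<in> words"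
  let ?y = "wact F1 w x0"
  have y: "?y \<in> V" by (rule wV[OF w(2) x0(1)])
  obtain H where H: "finite H" "\<And>z. z \<in> V \<Longrightarrow> z \<in> nb H ?y \<Longrightarrow> wact F1 (inv_word w) z \<in> V \<inter> nb K x0"
    by (rule pull_back[OF w(2) K]) blast
  obtain q0 where q0: "q0 \<in> V" "q0 \<in> nb H ?y" "q0 \<noteq> ?y" "lab q0 = lab ?y"
    using rich[OF y H(1)] lab_less by blast
  obtain c where c: "q0 c \<noteq> ?y c" using t2_fun_bool[OF q0(3)] by blast
  obtain K' where K': "finite K'" "\<And>z. z \<in> V \<Longrightarrow> wact F1 (inv_word w) z \<in> nb K' x0 \<Longrightarrow> z \<in> nb {c} ?y"
    by (rule push_forward[OF w(2), of "{c}"]) auto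
  obtain k where k: "\<forall>l. (\<forall>i. l i < N i) \<longrightarrow> (\<forall>i<k. l i = lab q0 i) \<longrightarrow> (\<exists>q\<in>V \<inter> nb (insert c H) q0. q \<noteq> q0 \<and> lab q = l)"
    using rich[OF q0(1), of "insert c H"] H(1) by auto
  have "\<exists>q\<in>V. wact F1 (inv_word w) q \<in> V \<inter> nb K x0 - nb K' x0 \<and> lab q = l"
    if l: "\<forall>i. l i < N i" "\<forall>i<k. l i = lab ?y i" for l
  proof -
    obtain q where q: "q \<in> V" "q \<in> nb (insert c H) q0" "lab q = l" using k l q0(4) by auto
    have "q \<in> nb H ?y" using q(2) q0(2) nb_eq by (auto simp: nb_insert)
    moreover have "q \<notin> nb {c} ?y" using q(2) c by (auto simp: nb_def)
    ultimately show ?thesis using H(2) K'(2) q by blast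
  qed
  then have "\<rho> (V \<inter> nb K x0 - nb K' x0)" unfolding w(1) req_label_def by blast
  then show ?thesis using K'(1) by blast
next
  fix H assume H: "\<rho> = req_pair H" "H \<in> pair_index"
  then have "pair_limit F a x0 y0" "finite H" using pair by (auto simp: pair_index_def split: if_splits)
  then obtain n where n: "row a (\<nu> (2*n)) \<in> V \<inter> nb (K \<union> H) x0" "row a (\<nu> (2*n)) \<noteq> x0"
     "row a (\<nu> (2*n+1)) \<in> V \<inter> nb (K \<union> H) y0" "row a (\<nu> (2*n+1)) \<noteq> y0"
    using K unfolding pair_limit_def by (metis finite_UnI)
  obtain c where c: "row a (\<nu> (2*n)) c \<noteq> x0 c" using t2_fun_bool[OF n(2)] by blast
  have "\<rho> (V \<inter> nb K x0 - nb {c} x0)"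
    unfolding H(1) req_pair_def using n c by (intro exI[of _ n]) (auto simp: nb_Un nb_def)
  then show ?thesis by blast
qed

text \<open>
  Partition \<open>V - {x0}\<close> into two sides and transport the partition along words to the other points of
  the orbit. Freeness makes the result independent of the word.
\<close>

lemma stage_exists: "\<exists>r. step (F(a := r)) a"
proof -
  have "\<exists>sd. (\<forall>z\<in>V. z \<noteq> x0 \<longrightarrow> (\<exists>H. finite H \<and> (\<forall>z'\<in>V \<inter> nb H z. z' \<noteq> x0 \<and> sd z' = sd z))) \<and>
    (\<forall>\<rho>\<in>reqs. \<forall>K c. finite K \<longrightarrow> \<rho> {z \<in> V \<inter> nb K x0. z \<noteq> x0 \<and> sd z = (c::bool)})"
  proof (rule split_point[of "{..<a} \<times> UNIV" V x0 reqs])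
    show "countable ({..<a} \<times> (UNIV :: nat set))" by (rule countable_C)
    show "\<And>z c. z \<in> V \<Longrightarrow> c \<notin> {..<a} \<times> UNIV \<Longrightarrow> \<not> z c" by (rule support)
    show "x0 \<in> V" "countable reqs" by (rule x0(1), rule countable_reqs)
    show "\<And>\<rho> A B. \<rho> \<in> reqs \<Longrightarrow> \<rho> A \<Longrightarrow> A \<subseteq> B \<Longrightarrow> \<rho> B" by (rule reqs_mono)
    show "\<And>\<rho> K. \<rho> \<in> reqs \<Longrightarrow> finite K \<Longrightarrow> \<exists>K'. finite K' \<and> \<rho> (V \<inter> nb K x0 - nb K' x0)" by (rule reqs_step)
    fix sd
    assume 1: "\<And>z. z \<in> V \<Longrightarrow> z \<noteq> x0 \<Longrightarrow> \<exists>F. finite F \<and> (\<forall>z'\<in>V \<inter> nb F z. z' \<noteq> x0 \<and> sd z' = sd z)"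
      and 2: "\<And>\<rho> K c. \<rho> \<in> reqs \<Longrightarrow> finite K \<Longrightarrow> \<rho> {z \<in> V \<inter> nb K x0. z \<noteq> x0 \<and> sd z = (c::bool)}"
    show ?thesis
    proof (intro exI[of _ sd] conjI)
      show "\<forall>z\<in>V. z \<noteq> x0 \<longrightarrow> (\<exists>H. finite H \<and> (\<forall>z'\<in>V \<inter> nb H z. z' \<noteq> x0 \<and> sd z' = sd z))"
        by (intro ballI impI 1)
      show "\<forall>\<rho>\<in>reqs. \<forall>K c. finite K \<longrightarrow> \<rho> {z \<in> V \<inter> nb K x0. z \<noteq> x0 \<and> sd z = (c::bool)}"
      proof (intro ballI allI impI)
        fix \<rho> c and K :: "(om1 \<times> nat) set" assume "\<rho> \<in> reqs" "finite K"
        then show "\<rho> {z \<in> V \<inter> nb K x0. z \<noteq> x0 \<and> sd z = (c::bool)}" by (rule 2)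
      qed
    qed
  qed
  then obtain sd where sd1: "\<forall>z\<in>V. z \<noteq> x0 \<longrightarrow> (\<exists>H. finite H \<and> (\<forall>z'\<in>V \<inter> nb H z. z' \<noteq> x0 \<and> sd z' = sd z))"
    and sd2: "\<forall>\<rho>\<in>reqs. \<forall>K c. finite K \<longrightarrow> \<rho> {z \<in> V \<inter> nb K x0. z \<noteq> x0 \<and> sd z = (c::bool)}"
    by (elim exE conjE)
  define Y where "Y = (\<lambda>w. wact F1 w x0) ` words"
  have cY: "countable Y" using countable_words by (simp add: Y_def)
  have YV: "Y \<subseteq> V" using wV x0(1) by (auto simp: Y_def)
  have x0Y: "x0 \<in> Y" unfolding Y_def by (rule image_eqI[of _ _ "[]"]) auto
  define pick where "pick y = (SOME w. w \<in> words \<and> wact F1 w x0 = y)" for y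
  have pick: "pick y \<in> words" "wact F1 (pick y) x0 = y" if "y \<in> Y" for y
  proof -
    have "\<exists>w. w \<in> words \<and> wact F1 w x0 = y" using that by (auto simp: Y_def)
    from someI_ex[OF this] show "pick y \<in> words" "wact F1 (pick y) x0 = y" unfolding pick_def by blast+
  qed
  define sdY where "sdY y z = sd (wact F1 (inv_word (pick y)) z)" for y z
  define pm where "pm j n = (if n \<in> to_nat_on Y ` Y then to_nat_on Y (act F1 (inv_letter j) (from_nat_into Y n)) else n)" for j n
  define Q where "Q c = {row a (\<nu> (2*n+1)) | n. row a (\<nu> (2*n)) \<in> V \<and> row a (\<nu> (2*n+1)) \<in> V \<and>
          row a (\<nu> (2*n)) \<noteq> x0 \<and> sdY x0 (row a (\<nu> (2*n))) = c}" for c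
  define prs where "prs = insert (guessed F a, acc V (guessed F a))
     (if \<not> homog \<and> (\<exists>x y. pair_limit F a x y) then {(Q c, {y0}) | c. True} else {})"
  define r where "r = \<lparr>split_pts = Y, side = sdY, perm = pm, gen = g, promises = prs\<rparr>"
  define F2 where "F2 = F(a := r)"
  have F2: "F2 b = F b" if "b < a" for b using that by (simp add: F2_def)
  have F2a: "F2 a = r" by (simp add: F2_def)
  have t: "tow F2 {..<a} = V" by (rule tow_cong) (simp add: F2)
  have acta: "acta F2 a j z = act F1 j z" if "z \<in> V" "fst j \<le> a" for j z
  proof -
    have "acta F2 a j z = acta F1 a j z"
      using that(2) by (cases "fst j = a") (auto simp: acta_def fun_eq_iff F2 F1 F2a r_def)
    then show ?thesis using acta_eq_act[of z F1 a j] that F1(3) by simp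
  qed
  have gd: "guessed F2 a = guessed F a" by (simp add: guessed_def t)
  have pl: "pair_limit F2 a = pair_limit F a" by (simp add: pair_limit_def t fun_eq_iff)
  have trivial: "Y = {x0}" "sdY x0 = sd" if "\<not> homog"
  proof -
    have "letters a = {}" unfolding letters_def using that by simp
    then have w: "words = {[]}" by simp
    then show "Y = {x0}" by (simp add: Y_def)
    have "pick x0 = []" using pick(1)[OF x0Y] w by simp
    then show "sdY x0 = sd" by (simp add: sdY_def inv_word_def fun_eq_iff)
  qed
  have ne: "z \<noteq> y \<longleftrightarrow> wact F1 (inv_word (pick y)) z \<noteq> x0" if "y \<in> Y" "z \<in> V" for y z
    using w_inv[OF pick(1)[OF that(1)] that(2)] w_inv'[OF pick(1)[OF that(1)] x0(1)] pick(2)[OF that(1)] by metis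
  have "sides_ok F2 a"
    unfolding sides_ok_def t F2a
  proof (intro ballI impI)
    fix y z assume "y \<in> split_pts r" and z: "z \<in> V" "z \<noteq> y"
    then have y: "y \<in> Y" by (simp add: r_def)
    let ?u = "wact F1 (inv_word (pick y)) z"
    have u: "?u \<in> V" "?u \<noteq> x0" using wV_inv[OF pick(1)[OF y] z(1)] ne[OF y z(1)] z(2) by blast+
    obtain K where K: "finite K" "\<forall>z'\<in>V \<inter> nb K ?u. z' \<noteq> x0 \<and> sd z' = sd ?u" using sd1 u by blast
    obtain H where H: "finite H" "\<forall>z'\<in>V \<inter> nb H z. wact F1 (inv_word (pick y)) z' \<in> nb K ?u"
      using w_cont_inv[OF pick(1)[OF y] z(1) K(1)] by blast
    have "z' \<noteq> y \<and> side r y z' = side r y z" if z': "z' \<in> V \<inter> nb H z" for z'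
    proof -
      have "wact F1 (inv_word (pick y)) z' \<in> V \<inter> nb K ?u" using H(2) z' wV_inv[OF pick(1)[OF y]] by blast
      then have "wact F1 (inv_word (pick y)) z' \<noteq> x0 \<and> sd (wact F1 (inv_word (pick y)) z') = sd ?u" by (rule bspec[OF K(2)])
      then show ?thesis using ne[OF y] z' by (simp add: r_def sdY_def)
    qed
    then show "\<exists>H. finite H \<and> (\<forall>z'\<in>V \<inter> nb H z. z' \<noteq> y \<and> side r y z' = side r y z)" using H(1) by blast
  qed
  moreover have "promises_kept F2 a"
    unfolding promises_kept_def t F2a
  proof (intro allI impI ballI, clarify)
    fix b T A y and H :: "(om1 \<times> nat) set" and c :: bool
    assume b: "b \<le> a" "b \<noteq> bot" "(T, A) \<in> promises (F2 b)" and "y \<in> split_pts r" "res y b \<in> A" and H: "finite H"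
    then have y: "y \<in> Y" "res y b \<in> A" by (auto simp: r_def)
    have "(b, T, A) \<in> old_promises"
    proof (cases "b < a")
      case True
      then show ?thesis using b F2 by (simp add: old_promises_def)
    next
      case False
      then have ba: "b = a" using b(1) by simp
      then consider "(T, A) = (guessed F a, acc V (guessed F a))" | "\<not> homog" "\<exists>x y. pair_limit F a x y" "A = {y0}"
        using b(3) by (auto simp: F2a r_def prs_def split: if_splits)
      then show ?thesis
      proof cases
        case 1
        then show ?thesis using ba by (simp add: old_promises_def)
      next
        case 2
        have "y = x0" using trivial(1)[OF 2(1)] y(1) by simp
        then have "x0 = y0" using y(2) 2(3) ba res_id[OF x0(1)] by simp
        then show ?thesis using pair[OF 2(1,2)] by (simp add: pair_limit_def)
      qed
    qed
    then have "((b, T, A), pick y) \<in> promise_index" using pick[OF y(1)] y(2) by (simp add: promise_index_def)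
    then have rq: "req_promise ((b, T, A), pick y) \<in> reqs" by (simp add: reqs_def)
    obtain K where K: "finite K" "\<And>z. z \<in> V \<Longrightarrow> wact F1 (inv_word (pick y)) z \<in> nb K x0 \<Longrightarrow> z \<in> nb H (wact F1 (pick y) x0)"
      by (rule push_forward[OF pick(1)[OF y(1)] H]) blast
    have "req_promise ((b, T, A), pick y) {z \<in> V \<inter> nb K x0. z \<noteq> x0 \<and> sd z = c}" by (rule sd2[rule_format, OF rq K(1)])
    then obtain s where s: "s \<in> T" "s \<noteq> res y b"
      "\<forall>z\<in>V. res z b = s \<longrightarrow> wact F1 (inv_word (pick y)) z \<in> {z \<in> V \<inter> nb K x0. z \<noteq> x0 \<and> sd z = c}"
      unfolding req_promise_def using pick(2)[OF y(1)] by auto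
    have "z \<in> nb H y \<and> side r y z = c" if "z \<in> V" "res z b = s" for z
      using bspec[OF s(3) that(1)] that K(2)[OF that(1)] pick(2)[OF y(1)] by (simp add: r_def sdY_def)
    then show "\<exists>s\<in>T. s \<noteq> res y b \<and> (\<forall>z\<in>V. res z b = s \<longrightarrow> z \<in> nb H y \<and> side r y z = c)" using s by blast
  qed
  moreover have "labels_kept F2 a"
    unfolding labels_kept_def t F2a
  proof (intro allI impI ballI)
    fix y and H :: "(om1 \<times> nat) set" and c :: bool assume "y \<in> split_pts r" and H: "finite H"
    then have y: "y \<in> Y" by (simp add: r_def)
    have rq: "req_label (pick y) \<in> reqs" using pick(1)[OF y] by (simp add: reqs_def)
    obtain K where K: "finite K" "\<And>z. z \<in> V \<Longrightarrow> wact F1 (inv_word (pick y)) z \<in> nb K x0 \<Longrightarrow> z \<in> nb H (wact F1 (pick y) x0)"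
      by (rule push_forward[OF pick(1)[OF y] H]) blast
    have "req_label (pick y) {z \<in> V \<inter> nb K x0. z \<noteq> x0 \<and> sd z = c}" by (rule sd2[rule_format, OF rq K(1)])
    then obtain k where k: "\<forall>l. (\<forall>i. l i < N i) \<longrightarrow> (\<forall>i<k. l i = lab y i) \<longrightarrow>
       (\<exists>q\<in>V. wact F1 (inv_word (pick y)) q \<in> {z \<in> V \<inter> nb K x0. z \<noteq> x0 \<and> sd z = c} \<and> lab q = l)"
      unfolding req_label_def pick(2)[OF y] by (rule exE)
    have "\<exists>q\<in>V \<inter> nb H y. q \<noteq> y \<and> side r y q = c \<and> lab q = l" if l: "\<forall>i. l i < N i" "\<forall>i<k. l i = lab y i" for l
    proof -
      obtain q where q: "q \<in> V" "wact F1 (inv_word (pick y)) q \<in> {z \<in> V \<inter> nb K x0. z \<noteq> x0 \<and> sd z = c}" "lab q = l"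
        using k l by blast
      then show ?thesis using K(2)[OF q(1)] pick(2)[OF y] ne[OF y q(1)] by (intro bexI[of _ q]) (auto simp: r_def sdY_def)
    qed
    then show "\<exists>k. \<forall>l. (\<forall>i. l i < N i) \<longrightarrow> (\<forall>i<k. l i = lab y i) \<longrightarrow>
        (\<exists>q\<in>V \<inter> nb H y. q \<noteq> y \<and> side r y q = c \<and> lab q = l)" by blast
  qed
  moreover have "equivariant F2 a"
    unfolding equivariant_def t F2a
  proof (intro ballI conjI allI impI)
    fix j n assume "n \<notin> idx r ` split_pts r"
    then show "perm r j n = n" by (simp add: r_def pm_def idx_def)
  next
    fix j y assume j: "j \<in> letters a" and "y \<in> split_pts r"
    then have y: "y \<in> Y" by (simp add: r_def)
    have yV: "y \<in> V" using YV y by blast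
    have w: "j # pick y \<in> words" using j pick(1)[OF y] by simp
    have a: "acta F2 a j y = act F1 j y" by (rule acta[OF yV letters_a(3)[OF j]])
    have gy: "wact F1 (j # pick y) x0 = act F1 j y" using pick(2)[OF y] by simp
    have gyY: "act F1 j y \<in> Y" unfolding Y_def using w gy by (metis image_eqI)
    show "acta F2 a j y \<in> split_pts r" using gyY a by (simp add: r_def)
    have "act F1 (inv_letter j) (act F1 j y) = y" using W.letter_inv'[OF j, of y] yV F1(3) by simp
    then show "perm r j (idx r (acta F2 a j y)) = idx r y"
      using gyY cY by (simp add: a r_def pm_def idx_def)
    fix z assume z: "z \<in> V" "z \<noteq> y"
    have az: "acta F2 a j z = act F1 j z" by (rule acta[OF z(1) letters_a(3)[OF j]])
    let ?v = "pick (act F1 j y)"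
    have v: "?v \<in> words" "wact F1 ?v x0 = act F1 j y" using pick[OF gyY] by auto
    let ?u = "wact F1 (inv_word (pick y)) z"
    have u: "?u \<in> V" by (rule wV_inv[OF pick(1)[OF y] z(1)])
    have "wact F1 (inv_word ?v @ (j # pick y)) x0 = x0"
      using w_inv'[OF v(1) x0(1)] v(2) gy by simp
    moreover have "set (inv_word ?v @ (j # pick y)) \<subseteq> letters a" using W.inv_word_Lt[of ?v] v(1) w by auto
    ultimately have "wact F1 (inv_word ?v @ (j # pick y)) ?u = ?u"
      using W.free[of "inv_word ?v @ (j # pick y)" x0 ?u] x0(1) u F1(3) by blast
    then have "wact F1 (inv_word ?v) (act F1 j z) = ?u" using w_inv[OF pick(1)[OF y] z(1)] by simp
    then show "side r (acta F2 a j y) (acta F2 a j z) = side r y z"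
      by (simp add: a az r_def sdY_def)
  qed
  moreover have "countable prs"
  proof -
    have "{(Q c, {y0}) | c. True} = range (\<lambda>c. (Q c, {y0}))" by blast
    then have "countable {(Q c, {y0}) | c. True}" by simp
    then show ?thesis by (simp add: prs_def)
  qed
  moreover have "A \<subseteq> acc V T" if TA: "(T, A) \<in> prs" for T A
  proof -
    consider "(T, A) = (guessed F a, acc V (guessed F a))"
      | c where "\<not> homog" "\<exists>x y. pair_limit F a x y" "(T, A) = (Q c, {y0})"
      using TA by (auto simp: prs_def split: if_splits)
    then show ?thesis
    proof cases
      case (2 c)
      have y0V: "y0 \<in> V" using pair[OF 2(1,2)] by (simp add: pair_limit_def)
      have "\<exists>s\<in>Q c \<inter> nb H y0. s \<noteq> y0" if H: "finite H" for H :: "(om1 \<times> nat) set"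
      proof -
        let ?H = "H \<inter> {..<a} \<times> UNIV"
        have "?H \<in> pair_index" unfolding pair_index_def using H 2(1,2) by simp
        then have "req_pair ?H \<in> reqs" by (simp add: reqs_def)
        from sd2[rule_format, OF this finite.emptyI]
        have "req_pair ?H {z \<in> V \<inter> nb {} x0. z \<noteq> x0 \<and> sd z = c}" .
        then obtain n where n: "row a (\<nu> (2*n)) \<in> V" "row a (\<nu> (2*n)) \<noteq> x0" "sd (row a (\<nu> (2*n))) = c"
          "row a (\<nu> (2*n+1)) \<in> V" "row a (\<nu> (2*n+1)) \<in> nb ?H y0" "row a (\<nu> (2*n+1)) \<noteq> y0"
          unfolding req_pair_def by auto
        have "row a (\<nu> (2*n+1)) d = y0 d" if "d \<in> H" for d
          using n(5) that support[OF n(4), of d] support[OF y0V, of d] by (cases "d \<in> {..<a} \<times> UNIV") (auto simp: nb_def)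
        then have "row a (\<nu> (2*n+1)) \<in> nb H y0" by (simp add: nb_def)
        moreover have "row a (\<nu> (2*n+1)) \<in> Q c" using n trivial(2)[OF 2(1)] unfolding Q_def by auto
        ultimately show ?thesis using n(6) by blast
      qed
      then show ?thesis using 2(3) y0V by (auto simp: acc_def)
    qed simp
  qed
  moreover have "guess_used F2 a"
    unfolding guess_used_def t gd F2a
  proof
    show "(guessed F a, acc V (guessed F a)) \<in> promises r" by (simp add: r_def prs_def)
    show "acc V (guessed F a) \<noteq> {} \<longrightarrow> split_pts r \<inter> acc V (guessed F a) \<noteq> {}"
      using x0(2) x0Y by (auto simp: r_def)
  qed
  moreover have "gens_ok F2 a" if homog
    by (rule g[OF that]) (simp_all add: F2 F2a r_def)
  moreover have "map_killed F2 a" if nh: "\<not> homog"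
    unfolding map_killed_def t F2a pl
  proof
    assume ex: "\<exists>x y. pair_limit F a x y"
    show "\<exists>x y. x \<in> split_pts r \<and> y \<in> V \<and>
       (\<forall>c. ({row a (\<nu> (2*n+1)) | n. row a (\<nu> (2*n)) \<in> V \<and> row a (\<nu> (2*n+1)) \<in> V \<and>
          row a (\<nu> (2*n)) \<noteq> x \<and> side r x (row a (\<nu> (2*n))) = c}, {y}) \<in> promises r)"
    proof (intro exI conjI allI)
      show "x0 \<in> split_pts r" using x0Y by (simp add: r_def)
      show "y0 \<in> V" using pair[OF nh ex] by (simp add: pair_limit_def)
      fix c
      have "(Q c, {y0}) \<in> promises r" using nh ex by (auto simp: r_def prs_def)
      then show "({row a (\<nu> (2*n+1)) | n. row a (\<nu> (2*n)) \<in> V \<and> row a (\<nu> (2*n+1)) \<in> V \<and>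
          row a (\<nu> (2*n)) \<noteq> x0 \<and> side r x0 (row a (\<nu> (2*n))) = c}, {y0}) \<in> promises r"
        by (simp add: Q_def r_def)
    qed
  qed
  ultimately have "step F2 a"
    unfolding step_def t F2a using cY YV by (auto simp: r_def)
  then show ?thesis unfolding F2_def by blast
qed

end

context parameters
begin

lemma step_exists:
  assumes steps: "\<And>b. b < a \<Longrightarrow> b \<noteq> bot \<Longrightarrow> step F b" and a: "a \<noteq> bot"
  shows "\<exists>r. step (F(a := r)) a"
proof -
  interpret new_stage G N \<sigma> code \<nu> homog F a by unfold_locales (use assms in auto)
  have "\<exists>g. homog \<longrightarrow> (\<forall>F'. (\<forall>b<a. F' b = F b) \<longrightarrow> gen (F' a) = g \<longrightarrow> gens_ok F' a)"
    using generators_exist by blast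
  then obtain g where g: "homog \<longrightarrow> (\<forall>F'. (\<forall>b<a. F' b = F b) \<longrightarrow> gen (F' a) = g \<longrightarrow> gens_ok F' a)" by (rule exE)
  have "\<exists>x0 y0. x0 \<in> V \<and> (acc V (guessed F a) \<noteq> {} \<longrightarrow> x0 \<in> acc V (guessed F a)) \<and>
    (\<not> homog \<longrightarrow> (\<exists>x y. pair_limit F a x y) \<longrightarrow> pair_limit F a x0 y0)"
  proof (cases "\<not> homog \<and> (\<exists>x y. pair_limit F a x y)")
    case True
    then obtain x y where xy: "pair_limit F a x y" by blast
    have "x \<in> acc V (guessed F a)"
      unfolding acc_def
    proof (intro CollectI conjI allI impI)
      show "x \<in> V" using xy by (simp add: pair_limit_def)
      fix H :: "(om1 \<times> nat) set" assume "finite H"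
      then obtain n where "row a (\<nu> (2*n)) \<in> V \<inter> nb H x" "row a (\<nu> (2*n)) \<noteq> x"
        using xy unfolding pair_limit_def by blast
      then show "\<exists>s\<in>guessed F a \<inter> nb H x. s \<noteq> x" unfolding guessed_def by blast
    qed
    then show ?thesis using xy by (auto simp: acc_def)
  next
    case False
    show ?thesis
    proof (cases "acc V (guessed F a) = {}")
      case True
      then show ?thesis using False V_nonempty by blast
    next
      case ne: False
      then obtain x where "x \<in> acc V (guessed F a)" by blast
      then show ?thesis using False by (auto simp: acc_def)
    qed
  qed
  then obtain x0 y0 where xy: "x0 \<in> V" "acc V (guessed F a) \<noteq> {} \<longrightarrow> x0 \<in> acc V (guessed F a)"
    "\<not> homog \<longrightarrow> (\<exists>x y. pair_limit F a x y) \<longrightarrow> pair_limit F a x0 y0" by (elim exE conjE)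
  interpret new_stage_gens G N \<sigma> code \<nu> homog F a g x0 y0
    by unfold_locales (use g xy in blast)+
  show ?thesis by (rule stage_exists)
qed

theorem tower_exists: "\<exists>F. \<forall>a. a \<noteq> bot \<longrightarrow> step F a"
proof -
  have "\<exists>f. \<forall>a. a \<noteq> bot \<longrightarrow> step (f(a := f a)) a"
  proof (rule dependent_wellorder_choice)
    fix r :: stage and f g :: "om1 \<Rightarrow> stage" and x assume "\<And>y. y < x \<Longrightarrow> f y = g y"
    then have "step (f(x := r)) x = step (g(x := r)) x" by (intro step_cong) (auto simp: le_less)
    then show "(x \<noteq> bot \<longrightarrow> step (f(x := r)) x) = (x \<noteq> bot \<longrightarrow> step (g(x := r)) x)" by simp
  next
    fix x and f :: "om1 \<Rightarrow> stage" assume "\<And>y. y < x \<Longrightarrow> y \<noteq> bot \<longrightarrow> step (f(y := f y)) y"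
    then have "\<And>b. b < x \<Longrightarrow> b \<noteq> bot \<Longrightarrow> step f b" by simp
    then show "\<exists>r. x \<noteq> bot \<longrightarrow> step (f(x := r)) x" using step_exists[of x f] by blast
  qed
  then show ?thesis by simp
qed

end

section \<open>The limit space\<close>

definition cube :: "('c \<Rightarrow> bool) set \<Rightarrow> ('c \<Rightarrow> bool) topology" where
  "cube K = subtopology euclidean K"

lemma topspace_cube [simp]: "topspace (cube K) = K"
  by (simp add: cube_def)

lemma openin_cube: "openin (cube K) U \<longleftrightarrow> U \<subseteq> K \<and> (\<forall>z\<in>U. \<exists>H. finite H \<and> K \<inter> nb H z \<subseteq> U)"
proof
  assume "openin (cube K) U"
  then obtain T where T: "open T" "U = T \<inter> K"
    unfolding cube_def openin_subtopology by auto
  then show "U \<subseteq> K \<and> (\<forall>z\<in>U. \<exists>H. finite H \<and> K \<inter> nb H z \<subseteq> U)"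
    unfolding open_fun_bool_iff by blast
next
  assume U: "U \<subseteq> K \<and> (\<forall>z\<in>U. \<exists>H. finite H \<and> K \<inter> nb H z \<subseteq> U)"
  define T where "T = \<Union>{nb H z | H z. finite H \<and> z \<in> U \<and> K \<inter> nb H z \<subseteq> U}"
  have "open T" unfolding T_def using open_nb by (intro open_Union) blast
  moreover have "U = T \<inter> K"
  proof (intro equalityI subsetI)
    fix z assume z: "z \<in> U"
    then obtain H where "finite H" "K \<inter> nb H z \<subseteq> U" using U by blast
    then have "nb H z \<subseteq> T" using z by (auto simp: T_def)
    then show "z \<in> T \<inter> K" using nb_self[of z H] U z by blast
  qed (auto simp: T_def)
  ultimately show "openin (cube K) U" unfolding cube_def openin_subtopology by auto
qed

lemma openin_cube_nb: "finite H \<Longrightarrow> openin (cube K) (K \<inter> nb H z)"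
  unfolding openin_cube using nb_eq by blast

lemma subtopology_cube: "S \<subseteq> K \<Longrightarrow> subtopology (cube K) S = cube S"
  unfolding cube_def subtopology_subtopology by (simp add: Int_absorb1)

lemma continuous_cube_iff:
  "continuous_map (cube K) (cube M) f \<longleftrightarrow> f ` K \<subseteq> M \<and>
     (\<forall>z\<in>K. \<forall>H. finite H \<longrightarrow> (\<exists>H'. finite H' \<and> (\<forall>z'\<in>K \<inter> nb H' z. f z' \<in> nb H (f z))))"
proof
  assume f: "continuous_map (cube K) (cube M) f"
  have im: "f ` K \<subseteq> M" using continuous_map_image_subset_topspace[OF f] by simp
  have "\<exists>H'. finite H' \<and> (\<forall>z'\<in>K \<inter> nb H' z. f z' \<in> nb H (f z))" if "z \<in> K" "finite H" for z H
  proof -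
    have "openin (cube K) {x \<in> topspace (cube K). f x \<in> M \<inter> nb H (f z)}"
      by (rule openin_continuous_map_preimage[OF f openin_cube_nb[OF that(2)]])
    moreover have "z \<in> {x \<in> topspace (cube K). f x \<in> M \<inter> nb H (f z)}" using that im by auto
    ultimately obtain H' where "finite H'" "K \<inter> nb H' z \<subseteq> {x \<in> topspace (cube K). f x \<in> M \<inter> nb H (f z)}"
      unfolding openin_cube by blast
    then show ?thesis by blast
  qed
  then show "f ` K \<subseteq> M \<and> (\<forall>z\<in>K. \<forall>H. finite H \<longrightarrow> (\<exists>H'. finite H' \<and> (\<forall>z'\<in>K \<inter> nb H' z. f z' \<in> nb H (f z))))"
    using im by blast
next
  assume f: "f ` K \<subseteq> M \<and> (\<forall>z\<in>K. \<forall>H. finite H \<longrightarrow> (\<exists>H'. finite H' \<and> (\<forall>z'\<in>K \<inter> nb H' z. f z' \<in> nb H (f z))))"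
  show "continuous_map (cube K) (cube M) f"
    unfolding continuous_map
  proof (intro conjI allI impI)
    show "f ` topspace (cube K) \<subseteq> topspace (cube M)" using f by simp
    fix U assume U: "openin (cube M) U"
    show "openin (cube K) {x \<in> topspace (cube K). f x \<in> U}"
      unfolding openin_cube
    proof (intro conjI ballI)
      fix z assume z: "z \<in> {x \<in> topspace (cube K). f x \<in> U}"
      then obtain H where H: "finite H" "M \<inter> nb H (f z) \<subseteq> U" using U unfolding openin_cube by blast
      have "z \<in> K" using z by simp
      with f H(1) obtain H' where H': "finite H'" "\<forall>z'\<in>K \<inter> nb H' z. f z' \<in> nb H (f z)" by blast
      then have "K \<inter> nb H' z \<subseteq> {x \<in> topspace (cube K). f x \<in> U}" using H(2) f by auto
      then show "\<exists>H. finite H \<and> K \<inter> nb H z \<subseteq> {x \<in> topspace (cube K). f x \<in> U}" using H'(1) by blast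
    qed auto
  qed
qed

lemma clopen_finitely_determined:
  assumes K: "compact K" and U: "clopenin (cube K) U"
  shows "finitely_determined K U"
proof (rule finitely_determined_compact[OF K])
  show "U \<subseteq> K" using U unfolding clopenin_def openin_cube by blast
  fix z assume z: "z \<in> K"
  show "\<exists>H. finite H \<and> (\<forall>z'\<in>K \<inter> nb H z. (z' \<in> U) = (z \<in> U))"
  proof (cases "z \<in> U")
    case True
    then obtain H where "finite H" "K \<inter> nb H z \<subseteq> U" using U unfolding clopenin_def openin_cube by blast
    then show ?thesis using True by blast
  next
    case False
    have "openin (cube K) (K - U)" using U unfolding clopenin_def by (simp add: closedin_def)
    then obtain H where "finite H" "K \<inter> nb H z \<subseteq> K - U" using False z unfolding openin_cube by blast
    then show ?thesis using False by blast
  qed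
qed

lemma cube_totally_disconnected: "totally_disconnected_space (cube K)"
  unfolding totally_disconnected_space_def
proof
  fix C assume C: "C \<in> connected_components_of (cube K)"
  have con: "connectedin (cube K) C" using C by (rule connectedin_connected_components_of)
  have ne: "C \<noteq> {}" using C by (rule nonempty_connected_components_of)
  have "x = y" if xy: "x \<in> C" "y \<in> C" for x y
  proof (rule ccontr)
    assume "x \<noteq> y"
    then obtain c where c: "x c \<noteq> y c" using t2_fun_bool by blast
    have o: "openin (cube K) (K \<inter> nb {c} x)" "openin (cube K) (K \<inter> nb {c} y)" by (simp_all add: openin_cube_nb)
    have CK: "C \<subseteq> K" using connectedin_subset_topspace[OF con] by simp
    have "C \<subseteq> (K \<inter> nb {c} x) \<union> (K \<inter> nb {c} y)" using CK c by (auto simp: nb_def)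
    moreover have "(K \<inter> nb {c} x) \<inter> (K \<inter> nb {c} y) \<inter> C = {}" using c by (auto simp: nb_def)
    moreover have "(K \<inter> nb {c} x) \<inter> C \<noteq> {}" "(K \<inter> nb {c} y) \<inter> C \<noteq> {}" using xy CK nb_self[of _ "{c}"] by blast+
    ultimately show False using con o unfolding connectedin by blast
  qed
  then show "\<exists>x. C = {x}" using ne by blast
qed

lemma cube_compact: "compact K \<Longrightarrow> compact_space (cube K)"
  by (simp add: cube_def compact_space_subtopology)

lemma cube_Hausdorff: "Hausdorff_space (cube K)"
  unfolding Hausdorff_space_def
proof (intro allI impI)
  fix x y assume xy: "x \<in> topspace (cube K) \<and> y \<in> topspace (cube K) \<and> x \<noteq> y"
  then obtain c where c: "x c \<noteq> y c" using t2_fun_bool by blast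
  show "\<exists>U V. openin (cube K) U \<and> openin (cube K) V \<and> x \<in> U \<and> y \<in> V \<and> disjnt U V"
    by (rule exI[of _ "K \<inter> nb {c} x"], rule exI[of _ "K \<inter> nb {c} y"])
      (use xy c openin_cube_nb[of "{c}" K x] openin_cube_nb[of "{c}" K y] in \<open>auto simp: disjnt_def nb_def\<close>)
qed

lemma homeomorphic_cubeI:
  assumes "\<And>z. z \<in> K \<Longrightarrow> f z \<in> M \<and> g (f z) = z" "\<And>z. z \<in> M \<Longrightarrow> g z \<in> K \<and> f (g z) = z"
    and "\<And>z H. z \<in> K \<Longrightarrow> finite H \<Longrightarrow> \<exists>H'. finite H' \<and> (\<forall>z'\<in>K \<inter> nb H' z. f z' \<in> nb H (f z))"
    and "\<And>z H. z \<in> M \<Longrightarrow> finite H \<Longrightarrow> \<exists>H'. finite H' \<and> (\<forall>z'\<in>M \<inter> nb H' z. g z' \<in> nb H (g z))"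
  shows "cube K homeomorphic_space cube M"
  unfolding homeomorphic_space_def homeomorphic_maps_def
proof (intro exI conjI ballI)
  show "continuous_map (cube K) (cube M) f" unfolding continuous_cube_iff using assms(1,3) by blast
  show "continuous_map (cube M) (cube K) g" unfolding continuous_cube_iff using assms(2,4) by blast
qed (use assms(1,2) in auto)

lemma homeomorphic_cube_glue:
  assumes 1: "cube K1 homeomorphic_space cube M1" and 2: "cube K2 homeomorphic_space cube M2"
    and K: "finitely_determined (K1 \<union> K2) K1" "K1 \<inter> K2 = {}" and M: "finitely_determined (M1 \<union> M2) M1" "M1 \<inter> M2 = {}"
  shows "cube (K1 \<union> K2) homeomorphic_space cube (M1 \<union> M2)"
proof -
  obtain f1 g1 where f1: "continuous_map (cube K1) (cube M1) f1" "continuous_map (cube M1) (cube K1) g1"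
    "\<forall>z\<in>K1. g1 (f1 z) = z" "\<forall>z\<in>M1. f1 (g1 z) = z"
    using 1 unfolding homeomorphic_space_def homeomorphic_maps_def by auto
  obtain f2 g2 where f2: "continuous_map (cube K2) (cube M2) f2" "continuous_map (cube M2) (cube K2) g2"
    "\<forall>z\<in>K2. g2 (f2 z) = z" "\<forall>z\<in>M2. f2 (g2 z) = z"
    using 2 unfolding homeomorphic_space_def homeomorphic_maps_def by auto
  have glue: "\<exists>H'. finite H' \<and> (\<forall>z'\<in>(A1 \<union> A2) \<inter> nb H' z. (if z' \<in> A1 then h1 z' else h2 z') \<in> nb H (if z \<in> A1 then h1 z else h2 z))"
    if h1: "continuous_map (cube A1) (cube B1) h1" and h2: "continuous_map (cube A2) (cube B2) h2"
      and fd: "finitely_determined (A1 \<union> A2) A1" and z: "z \<in> A1 \<union> A2" and H: "finite H"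
    for A1 A2 B1 B2 h1 h2 z H
  proof -
    obtain L where L: "finite L" "\<forall>z\<in>A1 \<union> A2. \<forall>z'\<in>(A1 \<union> A2) \<inter> nb L z. z' \<in> A1 \<longleftrightarrow> z \<in> A1"
      using fd by (rule finitely_determinedE)
    show ?thesis
    proof (cases "z \<in> A1")
      case True
      obtain H' where H': "finite H'" "\<forall>z'\<in>A1 \<inter> nb H' z. h1 z' \<in> nb H (h1 z)"
        using h1 True H unfolding continuous_cube_iff by blast
      have "(if z' \<in> A1 then h1 z' else h2 z') \<in> nb H (h1 z)" if z': "z' \<in> (A1 \<union> A2) \<inter> nb (L \<union> H') z" for z'
      proof -
        have "z' \<in> A1" using L(2) z z' True by (auto simp: nb_Un)
        then show ?thesis using H'(2) z' by (auto simp: nb_Un)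
      qed
      then show ?thesis using True L(1) H'(1) by (intro exI[of _ "L \<union> H'"]) simp
    next
      case False
      then have zA: "z \<in> A2" using z by blast
      obtain H' where H': "finite H'" "\<forall>z'\<in>A2 \<inter> nb H' z. h2 z' \<in> nb H (h2 z)"
        using h2 zA H unfolding continuous_cube_iff by blast
      have "(if z' \<in> A1 then h1 z' else h2 z') \<in> nb H (h2 z)" if z': "z' \<in> (A1 \<union> A2) \<inter> nb (L \<union> H') z" for z'
      proof -
        have "z' \<notin> A1" using L(2) z z' False by (auto simp: nb_Un)
        then show ?thesis using H'(2) z' by (auto simp: nb_Un)
      qed
      then show ?thesis using False L(1) H'(1) by (intro exI[of _ "L \<union> H'"]) simp
    qed
  qed
  have im: "f1 z \<in> M1" if "z \<in> K1" for z using that f1(1) unfolding continuous_cube_iff by blast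
  have im': "g1 z \<in> K1" if "z \<in> M1" for z using that f1(2) unfolding continuous_cube_iff by blast
  have im2: "f2 z \<in> M2" if "z \<in> K2" for z using that f2(1) unfolding continuous_cube_iff by blast
  have im2': "g2 z \<in> K2" if "z \<in> M2" for z using that f2(2) unfolding continuous_cube_iff by blast
  show ?thesis
  proof (rule homeomorphic_cubeI[where f = "\<lambda>z. if z \<in> K1 then f1 z else f2 z" and g = "\<lambda>z. if z \<in> M1 then g1 z else g2 z"])
    show "(if z \<in> K1 then f1 z else f2 z) \<in> M1 \<union> M2 \<and>
      (if (if z \<in> K1 then f1 z else f2 z) \<in> M1 then g1 (if z \<in> K1 then f1 z else f2 z) else g2 (if z \<in> K1 then f1 z else f2 z)) = z"
      if "z \<in> K1 \<union> K2" for z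
    proof (cases "z \<in> K1")
      case True
      then show ?thesis using im f1(3) by simp
    next
      case False
      then have "z \<in> K2" using that by blast
      then have "f2 z \<in> M2" "f2 z \<notin> M1" using im2 M(2) by blast+
      then show ?thesis using False f2(3) \<open>z \<in> K2\<close> by simp
    qed
    show "(if z \<in> M1 then g1 z else g2 z) \<in> K1 \<union> K2 \<and>
      (if (if z \<in> M1 then g1 z else g2 z) \<in> K1 then f1 (if z \<in> M1 then g1 z else g2 z) else f2 (if z \<in> M1 then g1 z else g2 z)) = z"
      if "z \<in> M1 \<union> M2" for z
    proof (cases "z \<in> M1")
      case True
      then show ?thesis using im' f1(4) by simp
    next
      case False
      then have "z \<in> M2" using that by blast
      then have "g2 z \<in> K2" "g2 z \<notin> K1" using im2' K(2) by blast+
      then show ?thesis using False f2(4) \<open>z \<in> M2\<close> by simp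
    qed
  next
    show "\<And>z H. z \<in> K1 \<union> K2 \<Longrightarrow> finite H \<Longrightarrow> \<exists>H'. finite H' \<and> (\<forall>z'\<in>(K1 \<union> K2) \<inter> nb H' z.
       (if z' \<in> K1 then f1 z' else f2 z') \<in> nb H (if z \<in> K1 then f1 z else f2 z))"
      by (rule glue[OF f1(1) f2(1) K(1)])
    show "\<And>z H. z \<in> M1 \<union> M2 \<Longrightarrow> finite H \<Longrightarrow> \<exists>H'. finite H' \<and> (\<forall>z'\<in>(M1 \<union> M2) \<inter> nb H' z.
       (if z' \<in> M1 then g1 z' else g2 z') \<in> nb H (if z \<in> M1 then g1 z else g2 z))"
      by (rule glue[OF f1(2) f2(2) M(1)])
  qed
qed

locale limit_tower = parameters +
  fixes F :: "om1 \<Rightarrow> stage"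
  assumes steps: "\<And>a. a \<noteq> bot \<Longrightarrow> step F a"
begin

sublocale tower G N \<sigma> code \<nu> homog F UNIV
  by unfold_locales (use steps in auto)

abbreviation "K \<equiv> tow F UNIV"

lemma compact_K: "compact K"
  by (rule compact_eq_closed_fun_bool[OF closed_tow])

lemma no_isolated_K: "z \<in> K \<Longrightarrow> finite H \<Longrightarrow> \<exists>q\<in>K. q \<in> nb H z \<and> q \<noteq> z"
  using no_isolated[of z H] by auto

lemma K_nonempty: "K \<noteq> {}"
proof -
  have "(\<lambda>_. False) \<in> tow F {..<bot}" by (auto simp: tow_def bot.extremum_strict)
  then obtain z where "z \<in> K" by (rule lift_stage) auto
  then show ?thesis by blast
qed

lemma infinite_nb: "z \<in> K \<Longrightarrow> finite H \<Longrightarrow> infinite (K \<inter> nb H z)"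
proof
  assume z: "z \<in> K" "finite H" and fin: "finite (K \<inter> nb H z)"
  obtain H' where H': "finite H'" "nb H' z \<inter> (K \<inter> nb H z - {z}) = {}"
    by (rule nb_separate[of "K \<inter> nb H z - {z}" z]) (use fin in auto)
  obtain q where "q \<in> K" "q \<in> nb (H \<union> H') z" "q \<noteq> z" using no_isolated_K[OF z(1), of "H \<union> H'"] z(2) H'(1) by blast
  then show False using H'(2) by (auto simp: nb_Un)
qed

text \<open>
  Diamond for the array of the coordinates of the sequence. The closure conditions of the later
  arguments enter through \<open>h\<close>.
\<close>

lemma capture:
  fixes X :: "om1 \<Rightarrow> point" and h :: "om1 \<Rightarrow> om1"
  assumes "\<And>x. X x \<in> K"
  shows "\<exists>a. a \<noteq> bot \<and> (\<forall>g<a. h g < a) \<and> (\<forall>n. \<nu> n < a) \<and>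
    guessed F a = (\<lambda>x. res (X x) a) ` {..<a} \<and> (\<forall>x<a. row a x = res (X x) a)"
proof -
  obtain u where u: "\<And>x. x \<in> range \<nu> \<Longrightarrow> x < u" using countable_bounded_om1[of "range \<nu>"] by auto
  from guess[where h = "\<lambda>g. max (h g) u" and X = "\<lambda>(x, c). X x c"]
  obtain a where "(\<exists>g. g < a) \<and> (\<forall>g<a. max (h g) u < a) \<and>
     (\<forall>x b n. x < a \<longrightarrow> b < a \<longrightarrow> G a (x, b, n) = (case (x, b, n) of (x, c) \<Rightarrow> X x c))" by (rule exE)
  then have a: "\<exists>g. g < a" "\<forall>g<a. max (h g) u < a"
    "\<forall>x b n. x < a \<longrightarrow> b < a \<longrightarrow> G a (x, b, n) = (case (x, b, n) of (x, c) \<Rightarrow> X x c)" by blast+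
  have ua: "u < a" using a by auto
  have r: "row a x = res (X x) a" if "x < a" for x
    using a(3) that by (auto simp: row_def res_def fun_eq_iff)
  have nu: "\<nu> n < a" for n using u ua less_trans by blast
  have "guessed F a = (\<lambda>x. res (X x) a) ` {..<a}"
  proof -
    have "{..<a} \<union> range \<nu> = {..<a}" using nu by auto
    moreover have "row a ` {..<a} = (\<lambda>x. res (X x) a) ` {..<a}" using r by auto
    moreover have "(\<lambda>x. res (X x) a) ` {..<a} \<subseteq> tow F {..<a}" using res_in_tow[OF assms] by auto
    ultimately show ?thesis unfolding guessed_def by auto
  qed
  moreover have "a \<noteq> bot" using a(1) not_less_bot by auto
  moreover have "h g < a" if "g < a" for g using a(2) that by simp
  ultimately show ?thesis using nu r by (intro exI[of _ a] conjI allI impI)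
qed

lemma bound_blocks:
  assumes "countable (C :: (om1 \<times> nat) set)"
  obtains u where "\<And>c. c \<in> C \<Longrightarrow> fst c < u"
proof -
  obtain u where "\<And>x. x \<in> fst ` C \<Longrightarrow> x < u" using countable_bounded_om1[of "fst ` C"] assms by auto
  then show ?thesis using that by blast
qed

lemma res_separated: "x c \<noteq> y c \<Longrightarrow> fst c < a \<Longrightarrow> res x a c \<noteq> res y a c"
  by (cases c) (simp add: res_apply)

lemma guess_used_at: "a \<noteq> bot \<Longrightarrow> guess_used F a"
  using steps[of a] by (simp add: step_def)

subsection \<open>No convergent sequences\<close>

text \<open>
  A sequence that converges to \<open>l\<close> is guessed at some stage \<open>a\<close>, late enough to see that its terms
  differ from \<open>l\<close>. There \<open>res l a\<close> is the only accumulation point of the guess, so it is split, and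
  the promise makes both points above it accumulation points of the sequence.
\<close>

theorem no_convergent_sequence: "\<not> has_nontrivial_convergent_sequence (cube K)"
proof
  assume "has_nontrivial_convergent_sequence (cube K)"
  then obtain x l where x: "range x \<subseteq> K" and lim: "limitin (cube K) x l sequentially"
    and nt: "\<not> (\<exists>c. \<forall>\<^sub>F n in sequentially. x n = c)"
    unfolding has_nontrivial_convergent_sequence_def by auto
  have lK: "l \<in> K" using lim by (simp add: limitin_def)
  have conv: "\<exists>M. \<forall>n\<ge>M. x n \<in> nb H l" if "finite H" for H
  proof -
    have "\<forall>\<^sub>F n in sequentially. x n \<in> K \<inter> nb H l"
      using lim[unfolded limitin_def] openin_cube_nb[OF that, of K l] lK nb_self[of l H] by blast
    then show ?thesis unfolding eventually_sequentially by auto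
  qed
  have ne: "\<exists>n\<ge>M. x n \<noteq> l" for M
    using nt unfolding eventually_sequentially by blast
  define X where "X a = x (if a \<in> range \<nu> then inv \<nu> a else 0)" for a
  have XK: "X b \<in> K" for b using x by (auto simp: X_def)
  have X\<nu>: "X (\<nu> n) = x n" for n using \<nu> by (simp add: X_def)
  have "\<forall>n. \<exists>c. x n \<noteq> l \<longrightarrow> x n c \<noteq> l c" using t2_fun_bool by blast
  from choice[OF this] obtain d where d: "\<forall>n. x n \<noteq> l \<longrightarrow> x n (d n) \<noteq> l (d n)" by (rule exE)
  obtain u where u: "\<And>c. c \<in> range d \<Longrightarrow> fst c < u" using bound_blocks[of "range d"] by auto
  obtain a where a0: "a \<noteq> bot" "\<forall>g<a. u < a" "\<forall>n. \<nu> n < a" "guessed F a = (\<lambda>x. res (X x) a) ` {..<a}"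
     "\<forall>x<a. row a x = res (X x) a"
    using capture[where X = X and h = "\<lambda>_. u", OF XK] by (elim exE conjE)
  note a = a0[rule_format]
  have ua: "u < a" using a(2)[OF a(3)] .
  let ?V = "tow F {..<a}" and ?p = "res l a"
  define S where "S = guessed F a"
  have S: "S = range (\<lambda>n. res (x n) a)"
  proof
    show "S \<subseteq> range (\<lambda>n. res (x n) a)" unfolding S_def a(4) X_def by auto
    show "range (\<lambda>n. res (x n) a) \<subseteq> S"
    proof
      fix s assume "s \<in> range (\<lambda>n. res (x n) a)"
      then obtain n where "s = res (X (\<nu> n)) a" using X\<nu> by auto
      then show "s \<in> S" unfolding S_def a(4) using a(3) by blast
    qed
  qed
  have sep: "res (x n) a \<noteq> ?p" if "x n \<noteq> l" for n
  proof -
    have "fst (d n) < a" using u[OF rangeI] ua by (rule less_trans)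
    then show ?thesis using res_separated d that by metis
  qed
  have pV: "?p \<in> ?V" by (rule res_in_tow[OF lK]) simp
  have avoid: "\<exists>H. finite H \<and> (\<forall>n. n < M \<longrightarrow> res (x n) a \<noteq> y \<longrightarrow> res (x n) a \<notin> nb H y)" for M y
  proof -
    obtain H where "finite H" "nb H y \<inter> ((\<lambda>n. res (x n) a) ` {..<M} - {y}) = {}"
      by (rule nb_separate[of "(\<lambda>n. res (x n) a) ` {..<M} - {y}" y]) auto
    then show ?thesis by (intro exI[of _ H]) auto
  qed
  have "acc ?V S = {?p}"
  proof (intro equalityI subsetI)
    fix y assume y: "y \<in> acc ?V S"
    have "y = ?p"
    proof (rule ccontr)
      assume "y \<noteq> ?p"
      then obtain c where c: "y c \<noteq> ?p c" using t2_fun_bool by blast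
      obtain M where M: "\<forall>n\<ge>M. x n \<in> nb {c} l" using conv[of "{c}"] by auto
      obtain H where H: "finite H" "\<forall>n. n < M \<longrightarrow> res (x n) a \<noteq> y \<longrightarrow> res (x n) a \<notin> nb H y" using avoid[of M y] by (elim exE conjE)
      have "finite (insert c H)" using H(1) by simp
      then obtain s where s: "s \<in> S" "s \<in> nb (insert c H) y" "s \<noteq> y" using y unfolding acc_def by blast
      then obtain n where n: "s = res (x n) a" using S by auto
      show False
      proof (cases "n < M")
        case True
        then show ?thesis using H(2) s n by (auto simp: nb_insert)
      next
        case False
        then have "x n \<in> nb {c} l" using M by simp
        then have "s \<in> nb {c} ?p" unfolding n by (rule res_nb)
        then show ?thesis using s(2) c by (auto simp: nb_def)
      qed
    qed
    then show "y \<in> {?p}" by simp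
  next
    fix y assume "y \<in> {?p}"
    then have y: "y = ?p" by simp
    show "y \<in> acc ?V S"
      unfolding acc_def y
    proof (intro CollectI conjI pV allI impI)
      fix H :: "(om1 \<times> nat) set" assume "finite H"
      then obtain M where M: "\<forall>n\<ge>M. x n \<in> nb H l" using conv by blast
      obtain n where n: "n \<ge> M" "x n \<noteq> l" using ne by blast
      have "res (x n) a \<in> nb H ?p" using M n(1) by (intro res_nb) blast
      then show "\<exists>s\<in>S \<inter> nb H ?p. s \<noteq> ?p" using sep[OF n(2)] S by blast
    qed
  qed
  then have acc: "acc ?V (guessed F a) = {?p}" by (simp add: S_def)
  have p: "?p \<in> split_pts (F a)" and pr: "(guessed F a, {?p}) \<in> promises (F a)"
    using guess_used_at[OF a(1)] unfolding guess_used_def acc by auto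
  \<comment> \<open>the sequence accumulates at both points above \<open>res l a\<close>, one of which is \<open>l\<close>\<close>
  define i where "i = idx (F a) ?p"
  define u' where "u' n = (if n = i then \<not> l (a, i) else l (a, n))" for n
  have cp: "countable (split_pts (F a))" using pts(1)[of a] a(1) by simp
  have "fits (F a) ?p u'"
    using tow_fits[OF lK, of a] a(1) p idx_eq[OF cp _ p] unfolding fits_def u'_def i_def by auto
  then obtain z where z: "z \<in> K" "res z a = ?p" "\<And>n. z (a, n) = u' n"
    using lift_block[OF pV _ a(1)] by (metis UNIV_I)
  obtain M where M: "\<forall>n\<ge>M. x n \<in> nb {(a, i)} l" using conv[of "{(a, i)}"] by auto
  obtain H where H: "finite H" "\<forall>n. n < M \<longrightarrow> res (x n) a \<noteq> ?p \<longrightarrow> res (x n) a \<notin> nb H ?p" using avoid[of M ?p] by (elim exE conjE)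
  have fH: "finite (insert (a, i) H)" using H(1) by simp
  have "\<exists>s\<in>guessed F a. s \<noteq> res z a \<and> (\<forall>z'\<in>K. res z' a = s \<longrightarrow> z' \<in> nb (insert (a, i) H) z)"
    by (rule promise[OF _ a(1) pr z(1) _ fH]) (use z in auto)
  then obtain s where s: "s \<in> S" "s \<noteq> ?p" "\<forall>z'\<in>K. res z' a = s \<longrightarrow> z' \<in> nb (insert (a, i) H) z"
    unfolding S_def z(2) by blast
  then obtain n where n: "s = res (x n) a" using S by auto
  have "x n \<in> K" using x by auto
  then have xn: "x n \<in> nb (insert (a, i) H) z" using s(3) n by blast
  then have "x n \<in> nb H z" by (simp add: nb_insert)
  then have "res (x n) a \<in> nb H ?p" using res_nb[of "x n" H z a] z(2) by simp
  then have "n \<ge> M" using H(2) s(2) n by (meson not_le)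
  then have "x n (a, i) = l (a, i)" using M by (auto simp: nb_def)
  moreover have "x n (a, i) = z (a, i)" using xn by (simp add: nb_insert)
  ultimately show False using z(3)[of i] by (simp add: u'_def)
qed

subsection \<open>Hereditary separability\<close>

text \<open>
  The sequence is guessed at a stage \<open>a\<close> that is closed under finding, for a cylinder that contains
  terms, the first two of them and a coordinate in which they differ. Then every neighbourhood of
  \<open>res (X a) a\<close> contains two different earlier terms, one of which is not \<open>res (X a) a\<close>. So this
  point is an accumulation point of the guess, and the promise turns this into accumulation of the
  earlier terms at \<open>X a\<close>.
\<close>

lemma left_separated_limit:
  fixes X :: "om1 \<Rightarrow> point"
  assumes X: "\<And>a. X a \<in> K"
  shows "\<exists>a. \<forall>H. finite H \<longrightarrow> (\<exists>x<a. X x \<in> nb H (X a))"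
proof (rule ccontr)
  assume "\<not> ?thesis"
  then have "\<forall>a. \<exists>H. finite H \<and> (\<forall>x<a. X x \<notin> nb H (X a))" by blast
  from choice[OF this] obtain Hs where Hs: "\<forall>a. finite (Hs a) \<and> (\<forall>x<a. X x \<notin> nb (Hs a) (X a))" by (rule exE)
  have inj: "X x \<noteq> X y" if "x \<noteq> y" for x y
  proof -
    consider "x < y" | "y < x" using \<open>x \<noteq> y\<close> by fastforce
    then show ?thesis
    proof cases
      case 1
      then show ?thesis using Hs nb_self[of "X y" "Hs y"] by metis
    next
      case 2
      then show ?thesis using Hs nb_self[of "X x" "Hs x"] by metis
    qed
  qed
  have "\<forall>p. \<exists>c. fst p \<noteq> snd p \<longrightarrow> X (fst p) c \<noteq> X (snd p) c" using inj t2_fun_bool by blast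
  from choice[OF this] obtain d where d: "\<forall>p. fst p \<noteq> snd p \<longrightarrow> X (fst p) (d p) \<noteq> X (snd p) (d p)" by (rule exE)
  \<comment> \<open>the first and the second index of a point in the cylinder with the given pattern\<close>
  define cyl where "cyl HA = {z :: point. \<forall>c\<in>fst HA. z c \<longleftrightarrow> c \<in> snd HA}" for HA
  define e1 where "e1 HA = (LEAST x. X x \<in> cyl HA)" for HA
  define e2 where "e2 HA = (LEAST x. X x \<in> cyl HA \<and> x \<noteq> e1 HA)" for HA
  define Pat where "Pat g = {H. finite H \<and> H \<subseteq> {..g} \<times> (UNIV :: nat set)} \<times> {A. finite A \<and> A \<subseteq> {..g} \<times> (UNIV :: nat set)}" for g :: om1
  have cle: "countable {..g}" for g :: om1
  proof -
    have "{..g} = insert g {..<g}" by auto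
    then show ?thesis using countable_lessThan_om1[of g] by simp
  qed
  have cPat: "countable (Pat g)" for g
    unfolding Pat_def by (intro countable_SIGMA countable_Collect_finite_subset) (simp_all add: cle)
  have "\<exists>u. \<forall>x\<in>e1 ` Pat g \<union> e2 ` Pat g \<union> (fst \<circ> d) ` ({..g} \<times> {..g}). x < u" for g
  proof -
    have "countable (e1 ` Pat g \<union> e2 ` Pat g \<union> (fst \<circ> d) ` ({..g} \<times> {..g}))" using cPat cle by simp
    then obtain u where "\<And>x. x \<in> e1 ` Pat g \<union> e2 ` Pat g \<union> (fst \<circ> d) ` ({..g} \<times> {..g}) \<Longrightarrow> x < u"
      by (rule countable_bounded_om1) blast
    then show ?thesis by blast
  qed
  then have "\<forall>g. \<exists>u. \<forall>x\<in>e1 ` Pat g \<union> e2 ` Pat g \<union> (fst \<circ> d) ` ({..g} \<times> {..g}). x < u" by (rule allI)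
  from choice[OF this] obtain h where h: "\<forall>g. \<forall>x\<in>e1 ` Pat g \<union> e2 ` Pat g \<union> (fst \<circ> d) ` ({..g} \<times> {..g}). x < h g" by (rule exE)
  obtain a where a0: "a \<noteq> bot" "\<forall>g<a. h g < a" "\<forall>n. \<nu> n < a" "guessed F a = (\<lambda>x. res (X x) a) ` {..<a}"
     "\<forall>x<a. row a x = res (X x) a"
    using capture[where X = X and h = h, OF X] by (elim exE conjE)
  note a = a0[rule_format]
  let ?V = "tow F {..<a}" and ?p = "res (X a) a"
  have pV: "?p \<in> ?V" by (rule res_in_tow[OF X]) simp
  have "?p \<in> acc ?V (guessed F a)"
    unfolding acc_def
  proof (intro CollectI conjI pV allI impI)
    fix H0 :: "(om1 \<times> nat) set" assume H0: "finite H0"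
    define H where "H = H0 \<inter> {..<a} \<times> UNIV"
    have fH: "finite H" using H0 by (simp add: H_def)
    define g where "g = Max (insert (\<nu> 0) (fst ` H))"
    have "g \<in> insert (\<nu> 0) (fst ` H)" unfolding g_def by (rule Max_in) (use fH in auto)
    then have ga: "g < a" using a(3) by (auto simp: H_def)
    have "fst c \<le> g" if "c \<in> H" for c unfolding g_def by (rule Max_ge) (use fH that in auto)
    then have Hg: "H \<subseteq> {..g} \<times> UNIV" by force
    define HA where "HA = (H, {c \<in> H. X a c})"
    have P: "HA \<in> Pat g" using fH Hg by (auto simp: HA_def Pat_def intro: finite_subset[OF _ fH])
    have cyl: "z \<in> cyl HA \<longleftrightarrow> z \<in> nb H (X a)" for z by (auto simp: cyl_def HA_def nb_def)
    have hg: "h g < a" by (rule a(2)[OF ga])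
    have 1: "e1 HA < a" "X (e1 HA) \<in> cyl HA"
    proof -
      have "e1 HA < h g" using h P by blast
      then show "e1 HA < a" using hg by (rule less_trans)
      show "X (e1 HA) \<in> cyl HA" unfolding e1_def by (rule LeastI[of _ a]) (simp add: cyl)
    qed
    have 2: "e2 HA < a" "X (e2 HA) \<in> cyl HA" "e2 HA \<noteq> e1 HA"
    proof -
      have "e2 HA < h g" using h P by blast
      then show "e2 HA < a" using hg by (rule less_trans)
      have "X (e2 HA) \<in> cyl HA \<and> e2 HA \<noteq> e1 HA"
        unfolding e2_def by (rule LeastI[of _ a]) (use 1 in \<open>auto simp: cyl\<close>)
      then show "X (e2 HA) \<in> cyl HA" "e2 HA \<noteq> e1 HA" by auto
    qed
    define m where "m = max (e1 HA) (e2 HA)"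
    have ma: "m < a" using 1 2 by (simp add: m_def)
    have "(e1 HA, e2 HA) \<in> {..m} \<times> {..m}" by (simp add: m_def)
    then have "fst (d (e1 HA, e2 HA)) < h m" using h by force
    then have "fst (d (e1 HA, e2 HA)) < a" using a(2)[OF ma] by (rule less_trans)
    moreover have "X (e1 HA) (d (e1 HA, e2 HA)) \<noteq> X (e2 HA) (d (e1 HA, e2 HA))" using d 2(3) by (metis fst_conv snd_conv)
    ultimately have "res (X (e1 HA)) a \<noteq> res (X (e2 HA)) a" using res_separated by metis
    then obtain e where e: "e = e1 HA \<or> e = e2 HA" "res (X e) a \<noteq> ?p" by metis
    have ea: "e < a" "X e \<in> nb H (X a)" using e(1) 1 2 cyl by auto
    have "res (X e) a (b, n) = ?p (b, n)" if "(b, n) \<in> H0" for b n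
    proof (cases "b < a")
      case True
      then have "(b, n) \<in> H" using that by (simp add: H_def)
      then show ?thesis using ea(2) by (simp add: nb_def res_apply)
    qed (simp add: res_apply)
    then have "res (X e) a \<in> nb H0 ?p" by (auto simp: nb_def)
    then show "\<exists>s\<in>guessed F a \<inter> nb H0 ?p. s \<noteq> ?p" using e(2) ea(1) unfolding a(4) by blast
  qed
  moreover have "(guessed F a, acc ?V (guessed F a)) \<in> promises (F a)"
    using guess_used_at[OF a(1)] by (simp add: guess_used_def)
  ultimately have "\<exists>s\<in>guessed F a. s \<noteq> ?p \<and> (\<forall>z'\<in>K. res z' a = s \<longrightarrow> z' \<in> nb (Hs a) (X a))"
    using promise[OF _ a(1) _ X] Hs by blast
  then obtain x where "x < a" "X x \<in> nb (Hs a) (X a)" unfolding a(4) using X by blast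
  then show False using Hs by blast
qed

text \<open>
  In a subspace that is not separable, recursion along \<open>\<omega>\<^sub>1\<close> finds a sequence each of whose terms
  has a neighbourhood without earlier terms.
\<close>

theorem hereditarily_separable: "hereditarily separable_space (cube K)"
  unfolding hereditarily_def
proof (intro allI impI)
  fix S assume "S \<subseteq> topspace (cube K)"
  then have SK: "S \<subseteq> K" by simp
  have "\<exists>D\<subseteq>S. countable D \<and> (\<forall>z\<in>S. \<forall>H. finite H \<longrightarrow> D \<inter> nb H z \<noteq> {})"
  proof (rule ccontr)
    assume no: "\<not> ?thesis"
    define P where "P f a r \<longleftrightarrow> r \<in> S \<and> (\<exists>H. finite H \<and> (\<forall>x<a. f x \<in> S \<longrightarrow> f x \<notin> nb H r))"
      for f and a :: om1 and r :: point
    have "\<exists>X. \<forall>a. P X a (X a)"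
    proof (rule dependent_wellorder_choice)
      fix r and f g :: "om1 \<Rightarrow> point" and x :: om1 assume "\<And>y. y < x \<Longrightarrow> f y = g y"
      then show "P f x r = P g x r" by (simp add: P_def)
    next
      fix a :: om1 and f :: "om1 \<Rightarrow> point"
      have "countable (f ` {..<a} \<inter> S)" using countable_lessThan_om1[of a] by (intro countable_Int1) simp
      then obtain z H where "z \<in> S" "finite H" "(f ` {..<a} \<inter> S) \<inter> nb H z = {}" using no by (metis Int_lower2)
      then show "\<exists>r. P f a r" unfolding P_def by blast
    qed
    then obtain X where X: "\<forall>a. P X a (X a)" by (rule exE)
    have XS: "X a \<in> S" for a using X by (simp add: P_def)
    obtain a where a: "\<forall>H. finite H \<longrightarrow> (\<exists>x<a. X x \<in> nb H (X a))"
      using left_separated_limit[of X] XS SK by blast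
    obtain H where "finite H" "\<forall>x<a. X x \<in> S \<longrightarrow> X x \<notin> nb H (X a)" using X unfolding P_def by blast
    then show False using a XS by blast
  qed
  then obtain D where D: "D \<subseteq> S" "countable D" "\<forall>z\<in>S. \<forall>H. finite H \<longrightarrow> D \<inter> nb H z \<noteq> {}" by blast
  have "cube S closure_of D = S"
  proof
    show "cube S closure_of D \<subseteq> S" using closure_of_subset_topspace[of "cube S" D] by simp
    show "S \<subseteq> cube S closure_of D"
    proof
      fix z assume z: "z \<in> S"
      have "\<exists>y\<in>D. y \<in> T" if T: "z \<in> T" "openin (cube S) T" for T
      proof -
        obtain H where H: "finite H" "S \<inter> nb H z \<subseteq> T" using T unfolding openin_cube by blast
        then obtain y where "y \<in> D" "y \<in> nb H z" using D(3) z by blast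
        then show ?thesis using H(2) D(1) by blast
      qed
      then show "z \<in> cube S closure_of D" using z by (auto simp: closure_of_def)
    qed
  qed
  then show "separable_space (subtopology (cube K) S)"
    unfolding separable_space_def subtopology_cube[OF SK] using D by (intro exI[of _ D]) simp
qed

end

context limit_tower
begin

subsection \<open>Rigidity\<close>

text \<open>
  Let \<open>f\<close> move \<open>x\<close>, and choose infinitely many points \<open>p n\<close> close to \<open>x\<close>, so that one coordinate \<open>c\<close>
  separates all \<open>p n\<close> from all \<open>f (p n)\<close>. At a stage where the pairs \<open>(p n, f (p n))\<close> are guessed,
  they have an accumulation point off the diagonal, and hence a point \<open>x2\<close> is split such that a
  point \<open>z\<close> of \<open>K\<close> is a limit of points \<open>f (p n)\<close> with \<open>p n\<close> on any given side of \<open>x2\<close>. The inverse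
  \<open>g\<close> of \<open>f\<close> cannot be continuous at \<open>z\<close>: take the side on which \<open>g z\<close> does not lie.
\<close>

theorem rigid:
  assumes nh: "\<not> homog"
  shows "rigid_space (cube K)"
  unfolding rigid_space_def
proof (intro allI impI ballI, rule ccontr)
  fix f x assume f: "homeomorphic_map (cube K) (cube K) f" and "x \<in> topspace (cube K)" and fx: "f x \<noteq> x"
  then have xK: "x \<in> K" by simp
  obtain g where fg: "homeomorphic_maps (cube K) (cube K) f g"
    using f homeomorphic_map_maps by blast
  have fc: "continuous_map (cube K) (cube K) f" and gc: "continuous_map (cube K) (cube K) g"
    and gf: "\<And>z. z \<in> K \<Longrightarrow> g (f z) = z" and fgz: "\<And>z. z \<in> K \<Longrightarrow> f (g z) = z"
    using fg unfolding homeomorphic_maps_def by auto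
  have fK: "f z \<in> K" "g z \<in> K" if "z \<in> K" for z using fc gc that unfolding continuous_cube_iff by blast+
  obtain c where c: "f x c \<noteq> x c" using t2_fun_bool[OF fx] by blast
  obtain H where H: "finite H" "\<forall>z\<in>K \<inter> nb H x. f z \<in> nb {c} (f x)"
    using fc xK unfolding continuous_cube_iff by blast
  have "infinite (K \<inter> nb (insert c H) x)" by (rule infinite_nb[OF xK]) (use H(1) in simp)
  then obtain p :: "nat \<Rightarrow> point" where p: "inj p" "range p \<subseteq> K \<inter> nb (insert c H) x"
    using infinite_countable_subset by blast
  have pK: "p n \<in> K" "p n c = x c" "f (p n) c = f x c" for n
  proof -
    have pn: "p n \<in> K \<inter> nb (insert c H) x" using p(2) by blast
    then show "p n \<in> K" "p n c = x c" by (auto simp: nb_insert)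
    have "p n \<in> K \<inter> nb H x" using pn by (auto simp: nb_insert)
    then show "f (p n) c = f x c" using H(2) by (auto simp: nb_def)
  qed
  have pinj: "p n \<noteq> p m" if "n \<noteq> m" for n m using that p(1) by (auto dest: injD)
  have finj: "f (p n) \<noteq> f (p m)" if "n \<noteq> m" for n m using pinj[OF that] gf[OF pK(1), of n] gf[OF pK(1), of m] by auto
  have "\<forall>nm. \<exists>d. fst nm \<noteq> snd nm \<longrightarrow> p (fst nm) d \<noteq> p (snd nm) d" using pinj t2_fun_bool by blast
  from choice[OF this] obtain d1 where d1: "\<forall>nm. fst nm \<noteq> snd nm \<longrightarrow> p (fst nm) (d1 nm) \<noteq> p (snd nm) (d1 nm)" by (rule exE)
  have "\<forall>nm. \<exists>d. fst nm \<noteq> snd nm \<longrightarrow> f (p (fst nm)) d \<noteq> f (p (snd nm)) d" using finj t2_fun_bool by blast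
  from choice[OF this] obtain d2 where d2: "\<forall>nm. fst nm \<noteq> snd nm \<longrightarrow> f (p (fst nm)) (d2 nm) \<noteq> f (p (snd nm)) (d2 nm)" by (rule exE)
  have "countable (insert c (range d1 \<union> range d2))" by simp
  then obtain u where u: "\<And>e. e \<in> insert c (range d1 \<union> range d2) \<Longrightarrow> fst e < u"
    by (rule bound_blocks) blast
  define X where "X b = (if b \<in> range \<nu> then (if even (inv \<nu> b) then p (inv \<nu> b div 2) else f (p (inv \<nu> b div 2))) else x)" for b
  have XK: "X b \<in> K" for b using pK(1) fK(1) xK by (simp add: X_def)
  have X: "X (\<nu> (2 * n)) = p n" "X (\<nu> (2 * n + 1)) = f (p n)" for n
    using \<nu> by (simp_all add: X_def)
  obtain a where a0: "a \<noteq> bot" "\<forall>g<a. u < a" "\<forall>n. \<nu> n < a" "guessed F a = (\<lambda>x. res (X x) a) ` {..<a}"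
     "\<forall>x<a. row a x = res (X x) a"
    using capture[where X = X and h = "\<lambda>_. u", OF XK] by (elim exE conjE)
  note a = a0[rule_format]
  have ua: "u < a" using a(2)[OF a(3)] .
  let ?V = "tow F {..<a}"
  define P where "P n = res (p n) a" for n
  define Q where "Q n = res (f (p n)) a" for n
  have rP: "row a (\<nu> (2 * n)) = P n" and rQ: "row a (\<nu> (2 * n + 1)) = Q n" for n
    using a(5)[OF a(3), of "2 * n"] a(5)[OF a(3), of "2 * n + 1"] X by (simp_all add: P_def Q_def)
  have PV: "P n \<in> ?V" "Q n \<in> ?V" for n
    using res_in_tow[OF pK(1)] res_in_tow[OF fK(1)[OF pK(1)]] by (auto simp: P_def Q_def)
  have ca: "fst c < a" using u[of c] ua by auto
  have Pc: "P n c = x c" "Q n c = f x c" for n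
    using pK[of n] ca by (cases c, simp add: P_def Q_def res_apply)+
  have Pinj: "P n \<noteq> P m" if "n \<noteq> m" for n m
  proof -
    have "fst (d1 (n, m)) < a" using u[of "d1 (n, m)"] ua by auto
    moreover have "p n (d1 (n, m)) \<noteq> p m (d1 (n, m))" using d1[rule_format, of "(n, m)"] that by simp
    ultimately show ?thesis using res_separated unfolding P_def by metis
  qed
  have Qinj: "Q n \<noteq> Q m" if "n \<noteq> m" for n m
  proof -
    have "fst (d2 (n, m)) < a" using u[of "d2 (n, m)"] ua by auto
    moreover have "f (p n) (d2 (n, m)) \<noteq> f (p m) (d2 (n, m))" using d2[rule_format, of "(n, m)"] that by simp
    ultimately show ?thesis using res_separated unfolding Q_def by metis
  qed
  \<comment> \<open>by compactness the pairs \<open>(P n, Q n)\<close> have an accumulation point\<close>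
  have "closed ?V" by (rule tower.closed_tow[OF initial_tower]) simp
  then have cV: "compact (?V \<times> ?V)" by (intro compact_Times compact_eq_closed_fun_bool)
  have inf: "infinite (range (\<lambda>n. (P n, Q n)))"
    by (rule range_inj_infinite) (use Pinj in \<open>auto simp: inj_def\<close>)
  have "\<exists>xy\<in>?V \<times> ?V. \<forall>U. xy \<in> U \<and> open U \<longrightarrow> infinite (U \<inter> range (\<lambda>n. (P n, Q n)))"
    by (rule countably_compact_imp_acc_point[OF compact_imp_countably_compact[OF cV] _ inf]) (use PV in auto)
  then obtain xy where xy0: "xy \<in> ?V \<times> ?V" "\<forall>U. xy \<in> U \<and> open U \<longrightarrow> infinite (U \<inter> range (\<lambda>n. (P n, Q n)))" by (rule bexE)
  obtain x1 y1 where xye: "xy = (x1, y1)" by (rule prod.exhaust)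
  have xy: "x1 \<in> ?V" "y1 \<in> ?V" "\<forall>U. (x1, y1) \<in> U \<and> open U \<longrightarrow> infinite (U \<inter> range (\<lambda>n. (P n, Q n)))"
    using xy0 unfolding xye by (simp_all only: mem_Times_iff fst_conv snd_conv)
  have near: "infinite {n. P n \<in> nb H x1 \<and> Q n \<in> nb H y1}" if "finite H" for H
  proof
    assume fin: "finite {n. P n \<in> nb H x1 \<and> Q n \<in> nb H y1}"
    have "open (nb H x1 \<times> nb H y1)" by (intro open_Times open_nb that)
    then have "infinite ((nb H x1 \<times> nb H y1) \<inter> range (\<lambda>n. (P n, Q n)))" using xy(3) by simp
    moreover have "(nb H x1 \<times> nb H y1) \<inter> range (\<lambda>n. (P n, Q n)) \<subseteq> (\<lambda>n. (P n, Q n)) ` {n. P n \<in> nb H x1 \<and> Q n \<in> nb H y1}"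
      by auto
    ultimately show False using finite_surj[OF fin] by blast
  qed
  have xy_ne: "x1 \<noteq> y1"
  proof -
    have "{n. P n \<in> nb {c} x1 \<and> Q n \<in> nb {c} y1} \<noteq> {}" using infinite_imp_nonempty[OF near[of "{c}"]] by simp
    then obtain n where "P n \<in> nb {c} x1" "Q n \<in> nb {c} y1" by blast
    then have "x1 c = x c" "y1 c = f x c" using Pc[of n] by (auto simp: nb_def)
    then show ?thesis using c by auto
  qed
  have once: "finite {n. R n = z}" if sep: "\<And>n m. n \<noteq> m \<Longrightarrow> R n \<noteq> R m" for R :: "nat \<Rightarrow> point" and z
  proof (cases "\<exists>n. R n = z")
    case True
    then obtain n where "R n = z" by blast
    have "{n. R n = z} \<subseteq> {n}"
    proof
      fix m assume "m \<in> {n. R n = z}"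
      then have "R m = R n" using \<open>R n = z\<close> by simp
      moreover have "R m \<noteq> R n" if "m \<noteq> n" using that by (rule sep)
      ultimately show "m \<in> {n}" by auto
    qed
    then show ?thesis by (rule finite_subset) simp
  qed simp
  have "pair_limit F a x1 y1"
    unfolding pair_limit_def rP rQ
  proof (intro conjI xy(1,2) xy_ne allI impI)
    fix H :: "(om1 \<times> nat) set" assume "finite H"
    then have inf: "infinite {n. P n \<in> nb H x1 \<and> Q n \<in> nb H y1}" by (rule near)
    have "finite ({n. P n = x1} \<union> {n. Q n = y1})" using once[of P] once[of Q] Pinj Qinj by simp
    then have "infinite ({n. P n \<in> nb H x1 \<and> Q n \<in> nb H y1} - ({n. P n = x1} \<union> {n. Q n = y1}))" 
      using inf by (rule Diff_infinite_finite)
    then obtain n where "n \<in> {n. P n \<in> nb H x1 \<and> Q n \<in> nb H y1} - ({n. P n = x1} \<union> {n. Q n = y1})"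
      using infinite_imp_nonempty by blast
    then show "\<exists>n. P n \<in> ?V \<inter> nb H x1 \<and> P n \<noteq> x1 \<and> Q n \<in> ?V \<inter> nb H y1 \<and> Q n \<noteq> y1" using PV by blast
  qed
  moreover have "map_killed F a" using steps[OF a(1)] nh unfolding step_def by blast
  ultimately have "\<exists>x y. x \<in> split_pts (F a) \<and> y \<in> ?V \<and>
    (\<forall>b. ({Q n | n. P n \<in> ?V \<and> Q n \<in> ?V \<and> P n \<noteq> x \<and> side (F a) x (P n) = b}, {y}) \<in> promises (F a))"
    unfolding map_killed_def rP rQ by blast
  then obtain x2 y2 where k: "x2 \<in> split_pts (F a)" "y2 \<in> ?V"
    "\<forall>b. ({Q n | n. P n \<in> ?V \<and> Q n \<in> ?V \<and> P n \<noteq> x2 \<and> side (F a) x2 (P n) = b}, {y2}) \<in> promises (F a)"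
    by (elim exE conjE)
  obtain z where z: "z \<in> K" "res z a = y2" by (rule lift_stage[OF k(2)]) auto
  define i where "i = idx (F a) x2"
  define b where "b = (\<not> g z (a, i))"
  obtain L where L: "finite L" "\<forall>z'\<in>K \<inter> nb L z. g z' \<in> nb {(a, i)} (g z)"
    using gc z(1) unfolding continuous_cube_iff by blast
  have "\<exists>s\<in>{Q n | n. P n \<in> ?V \<and> Q n \<in> ?V \<and> P n \<noteq> x2 \<and> side (F a) x2 (P n) = b}. s \<noteq> res z a \<and> (\<forall>z'\<in>K. res z' a = s \<longrightarrow> z' \<in> nb L z)"
    by (rule promise[OF _ a(1) k(3)[rule_format, of b] z(1) _ L(1)]) (use z in auto)
  then obtain n where n: "P n \<noteq> x2" "side (F a) x2 (P n) = b" "\<forall>z'\<in>K. res z' a = Q n \<longrightarrow> z' \<in> nb L z" by blast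
  have "f (p n) \<in> K \<inter> nb L z" using n(3) fK(1)[OF pK(1)] by (simp add: Q_def)
  then have "g (f (p n)) \<in> nb {(a, i)} (g z)" using L(2) by blast
  then have "p n (a, i) \<noteq> b" using gf[OF pK(1)] by (simp add: nb_def b_def)
  moreover have "p n (a, i) = side (F a) x2 (P n)"
    using tow_fits[OF pK(1), of a n] a(1) k(1) n(1) unfolding fits_def P_def i_def by auto
  ultimately show False using n(2) by simp
qed

subsection \<open>Homeomorphic clopen sets\<close>

text \<open>
  Both sets are inverse images of clopen sets of some \<open>V\<^sub>\<alpha>\<close>, where a generator of stage \<open>\<alpha>\<close> maps one
  onto the other; it acts on \<open>K\<close>.
\<close>

lemma proper_clopens_homeomorphic:
  assumes h: homog and U: "finitely_determined K U" "U \<noteq> {}" "U \<noteq> K" and W: "finitely_determined K W" "W \<noteq> {}" "W \<noteq> K"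
  shows "cube U homeomorphic_space cube W"
proof -
  have UK: "U \<subseteq> K" "W \<subseteq> K" using U W finitely_determined_subset by blast+
  obtain HU where HU: "finite HU" "\<forall>z\<in>K. \<forall>z'\<in>K \<inter> nb HU z. z' \<in> U \<longleftrightarrow> z \<in> U"
    using U(1) by (rule finitely_determinedE)
  obtain HW where HW: "finite HW" "\<forall>z\<in>K. \<forall>z'\<in>K \<inter> nb HW z. z' \<in> W \<longleftrightarrow> z \<in> W"
    using W(1) by (rule finitely_determinedE)
  have "countable (insert (bot, 0) (HU \<union> HW))" using HU(1) HW(1) by (simp add: countable_finite)
  then obtain a where a: "\<And>c. c \<in> insert (bot, 0) (HU \<union> HW) \<Longrightarrow> fst c < a" by (rule bound_blocks) blast
  have ab: "a \<noteq> bot" using a[of "(bot, 0)"] by auto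
  let ?V = "tow F {..<a}"
  have rV: "res z a \<in> ?V" if "z \<in> K" for z by (rule res_in_tow[OF that]) simp
  have same: "z' \<in> nb H z" if r: "res z' a = res z a" and H: "H \<subseteq> HU \<union> HW" for z z' H
  proof -
    have "z' c = z c" if "c \<in> H" for c
    proof -
      have "fst c < a" using a that H by blast
      then show ?thesis using fun_cong[OF r, of c] by (cases c) (simp add: res_apply)
    qed
    then show ?thesis by (simp add: nb_def)
  qed
  have proj: "finitely_determined ?V ((\<lambda>z. res z a) ` D) \<and> (\<forall>z\<in>K. res z a \<in> (\<lambda>z. res z a) ` D \<longleftrightarrow> z \<in> D)"
    if D: "D \<subseteq> K" "finite H" "H \<subseteq> HU \<union> HW" "\<forall>z\<in>K. \<forall>z'\<in>K \<inter> nb H z. z' \<in> D \<longleftrightarrow> z \<in> D" for D H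
  proof
    show "\<forall>z\<in>K. res z a \<in> (\<lambda>z. res z a) ` D \<longleftrightarrow> z \<in> D"
    proof
      fix z assume z: "z \<in> K"
      show "res z a \<in> (\<lambda>z. res z a) ` D \<longleftrightarrow> z \<in> D"
      proof
        assume "res z a \<in> (\<lambda>z. res z a) ` D"
        then obtain z' where z': "z' \<in> D" "res z a = res z' a" by blast
        then have "z \<in> K \<inter> nb H z'" using same[OF z'(2) D(3)] z by blast
        then show "z \<in> D" using D(1,4) z'(1) by blast
      qed blast
    qed
    show "finitely_determined ?V ((\<lambda>z. res z a) ` D)"
    proof (rule finitely_determinedI[OF _ D(2)])
      show "(\<lambda>z. res z a) ` D \<subseteq> ?V" using rV D(1) by blast
      fix v v' assume v: "v \<in> ?V" "v' \<in> ?V" "v' \<in> nb H v" "v \<in> (\<lambda>z. res z a) ` D"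
      obtain z where z: "z \<in> D" "v = res z a" using v(4) by blast
      obtain z' where z': "z' \<in> K" "res z' a = v'" by (rule lift_stage[OF v(2)]) auto
      have "z' c = z c" if "c \<in> H" for c
      proof -
        have "fst c < a" using a that D(3) by blast
        moreover have "res z' a c = res z a c" using v(3) that z z' by (auto simp: nb_def)
        ultimately show ?thesis by (cases c) (simp add: res_apply)
      qed
      then have "z' \<in> K \<inter> nb H z" using z'(1) by (simp add: nb_def)
      then have "z' \<in> D" using D(1,4) z(1) by blast
      then show "v' \<in> (\<lambda>z. res z a) ` D" using z'(2) by blast
    qed
  qed
  define Ua where "Ua = (\<lambda>z. res z a) ` U"
  define Wa where "Wa = (\<lambda>z. res z a) ` W"
  have Ua: "finitely_determined ?V Ua" "\<forall>z\<in>K. res z a \<in> Ua \<longleftrightarrow> z \<in> U"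
    using proj[OF UK(1) HU(1) _ HU(2)] unfolding Ua_def by simp_all
  have Wa: "finitely_determined ?V Wa" "\<forall>z\<in>K. res z a \<in> Wa \<longleftrightarrow> z \<in> W"
    using proj[OF UK(2) HW(1) _ HW(2)] unfolding Wa_def by simp_all
  have ne: "Ua \<noteq> {}" "Wa \<noteq> {}" "Ua \<noteq> ?V" "Wa \<noteq> ?V"
  proof -
    show "Ua \<noteq> {}" "Wa \<noteq> {}" using U(2) W(2) by (auto simp: Ua_def Wa_def)
    obtain z where z: "z \<in> K" "z \<notin> U" using U(3) UK(1) by blast
    then show "Ua \<noteq> ?V" using Ua(2) rV[OF z(1)] by blast
    obtain z where z: "z \<in> K" "z \<notin> W" using W(3) UK(2) by blast
    then show "Wa \<noteq> ?V" using Wa(2) rV[OF z(1)] by blast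
  qed
  have gens: "gens_ok F a" using steps[OF ab] h unfolding step_def by blast
  interpret tower_action G N \<sigma> code \<nu> homog F UNIV a
    by unfold_locales (use h ab gens in auto)
  obtain m where m: "\<forall>z\<in>?V. gen (F a) (m, True) z \<in> Wa \<longleftrightarrow> z \<in> Ua"
    using conjunct2[OF conjunct2[OF gens[unfolded gens_ok_def]], rule_format, OF Ua(1) Wa(1) ne] by (rule exE)
  define f where "f = act F (a, m, True)"
  define g where "g = act F (a, m, False)"
  have fK: "f z \<in> K" "g z \<in> K" if "z \<in> K" for z using act_tow[OF that] by (simp_all add: f_def g_def)
  have inv: "g (f z) = z" "f (g z) = z" if "z \<in> K" for z
    using act_inv[OF that, of m False] act_inv[OF that, of m True] by (simp_all add: f_def g_def)
  have fUW: "f z \<in> W \<longleftrightarrow> z \<in> U" if z: "z \<in> K" for z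
  proof -
    have "f z \<in> W \<longleftrightarrow> res (f z) a \<in> Wa" using Wa(2) fK(1)[OF z] by simp
    also have "\<dots> \<longleftrightarrow> res z a \<in> Ua" using m rV[OF z] res_act_i[OF z] by (simp add: f_def)
    also have "\<dots> \<longleftrightarrow> z \<in> U" using Ua(2) z by simp
    finally show ?thesis .
  qed
  show ?thesis
  proof (rule homeomorphic_cubeI[of U f W g])
    show "f z \<in> W \<and> g (f z) = z" if "z \<in> U" for z using fUW inv UK that by blast
    show "g z \<in> U \<and> f (g z) = z" if z: "z \<in> W" for z
    proof -
      have "z \<in> K" using z UK by blast
      then show ?thesis using fUW[OF fK(2), of z] inv(2)[of z] z by simp
    qed
    show "\<exists>H'. finite H' \<and> (\<forall>z'\<in>U \<inter> nb H' z. f z' \<in> nb H (f z))" if zH: "z \<in> U" "finite H" for z H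
    proof -
      have "z \<in> K" using zH UK by blast
      then obtain H' where "finite H'" "\<forall>z'\<in>K \<inter> nb H' z. f z' \<in> nb H (f z)"
        unfolding f_def using zH(2) by (rule act_cont)
      then show ?thesis using UK(1) by blast
    qed
    show "\<exists>H'. finite H' \<and> (\<forall>z'\<in>W \<inter> nb H' z. g z' \<in> nb H (g z))" if zH: "z \<in> W" "finite H" for z H
    proof -
      have "z \<in> K" using zH UK by blast
      then obtain H' where "finite H'" "\<forall>z'\<in>K \<inter> nb H' z. g z' \<in> nb H (g z)"
        unfolding g_def using zH(2) by (rule act_cont)
      then show ?thesis using UK(2) by blast
    qed
  qed
qed

text \<open>
  Generators map proper clopen sets only. But \<open>K\<close> is the sum of a proper clopen set \<open>P\<close> and its
  complement, and \<open>P\<close> is also the sum of two proper clopen sets, so \<open>K\<close> and \<open>P\<close> are homeomorphic.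
\<close>

theorem clopens_homeomorphic:
  assumes h: homog and U: "finitely_determined K U" "U \<noteq> {}" and W: "finitely_determined K W" "W \<noteq> {}"
  shows "cube U homeomorphic_space cube W"
proof -
  obtain z where z: "z \<in> K" using K_nonempty by blast
  obtain q where q: "q \<in> K" "q \<noteq> z" using no_isolated_K[OF z, of "{}"] by auto
  obtain c where c: "q c \<noteq> z c" using t2_fun_bool[OF q(2)] by blast
  define P where "P = {v \<in> K. v c}"
  have P: "finitely_determined K P" unfolding P_def by (rule finitely_determined_coordinate)
  have Pne: "P \<noteq> {}" "P \<noteq> K" "K - P \<noteq> {}" "K - P \<noteq> K" using c z q by (auto simp: P_def)
  have P': "finitely_determined K (K - P)" by (rule finitely_determined_Diff[OF finitely_determined_UNIV P])
  obtain v where v: "v \<in> P" using Pne by blast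
  have vK: "v \<in> K" using v by (simp add: P_def)
  obtain v' where v': "v' \<in> K" "v' \<in> nb {c} v" "v' \<noteq> v" using no_isolated_K[OF vK, of "{c}"] by auto
  have v'P: "v' \<in> P" using v v' by (auto simp: P_def nb_def)
  obtain e where e: "v' e \<noteq> v e" using t2_fun_bool[OF v'(3)] by blast
  define P1 where "P1 = P \<inter> {v \<in> K. v e}"
  have P1: "finitely_determined K P1" unfolding P1_def
    by (rule finitely_determined_Int[OF P finitely_determined_coordinate])
  have P2: "finitely_determined K (P - P1)" by (rule finitely_determined_Diff[OF P P1])
  have PK: "P \<subseteq> K" "P1 \<subseteq> P" by (auto simp: P_def P1_def)
  have ne: "P1 \<noteq> {}" "P - P1 \<noteq> {}" "P1 \<noteq> K" "P - P1 \<noteq> K"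
  proof -
    show "P1 \<noteq> {}" "P - P1 \<noteq> {}" using v v'P vK v'(1) e by (auto simp: P1_def)
    show "P1 \<noteq> K" "P - P1 \<noteq> K" using Pne(2) PK by blast+
  qed
  have fdP: "finitely_determined P P1"
  proof -
    obtain H where H: "finite H" "\<forall>z\<in>K. \<forall>z'\<in>K \<inter> nb H z. z' \<in> P1 \<longleftrightarrow> z \<in> P1"
      using P1 by (rule finitely_determinedE)
    show ?thesis by (rule finitely_determinedI[OF PK(2) H(1)]) (use H(2) PK in blast)
  qed
  have eq: "P \<union> (K - P) = K" "P1 \<union> (P - P1) = P" using PK by auto
  have "cube (P \<union> (K - P)) homeomorphic_space cube (P1 \<union> (P - P1))"
  proof (rule homeomorphic_cube_glue)
    show "cube P homeomorphic_space cube P1" by (rule proper_clopens_homeomorphic[OF h P Pne(1,2) P1 ne(1,3)])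
    show "cube (K - P) homeomorphic_space cube (P - P1)" by (rule proper_clopens_homeomorphic[OF h P' Pne(3,4) P2 ne(2,4)])
    show "finitely_determined (P \<union> (K - P)) P" "finitely_determined (P1 \<union> (P - P1)) P1" using P fdP eq by simp_all
  qed auto
  then have KP: "cube K homeomorphic_space cube P" by (simp only: eq)
  have to_P: "cube D homeomorphic_space cube P" if "finitely_determined K D" "D \<noteq> {}" for D
  proof (cases "D = K")
    case True
    then show ?thesis using KP by simp
  next
    case False
    then show ?thesis by (rule proper_clopens_homeomorphic[OF h that _ P Pne(1,2)])
  qed
  have "cube P homeomorphic_space cube W" by (rule homeomorphic_space_sym[THEN iffD1, OF to_P[OF W]])
  then show ?thesis by (rule homeomorphic_space_trans[OF to_P[OF U]])
qed

end

section \<open>Finitely supported measures\<close>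

definition atomic :: "'a set \<Rightarrow> ('a \<Rightarrow> real) \<Rightarrow> 'a set \<Rightarrow> real" where
  "atomic A w B = (\<Sum>x\<in>A. w x * indicator B x)"

lemma atomic_eq: "finite A \<Longrightarrow> atomic A w B = (\<Sum>x\<in>A \<inter> B. w x)"
  unfolding atomic_def by (simp add: indicator_def sum.If_cases Int_def if_distrib cong: if_cong)

lemma singleton_borel:
  assumes "Hausdorff_space X" "x \<in> topspace X"
  shows "{x} \<in> borel_sets_of X"
proof -
  have "closedin X {x}" using assms by (simp add: Hausdorff_imp_t1_space closedin_t1_singleton)
  then have "openin X (topspace X - {x})" by blast
  then have "topspace X - {x} \<in> sigma_sets (topspace X) {U. openin X U}" by (intro sigma_sets.Basic) simp
  then have "topspace X - (topspace X - {x}) \<in> sigma_sets (topspace X) {U. openin X U}" by (rule sigma_sets.Compl)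
  moreover have "topspace X - (topspace X - {x}) = {x}" using assms by auto
  ultimately show ?thesis by (simp add: borel_sets_of_def)
qed

text \<open>
  The singletons of the atoms in \<open>D\<close> form an optimal partition.
\<close>

lemma variation_atomic:
  assumes X: "Hausdorff_space X" and A: "finite A" "A \<subseteq> topspace X"
  shows "variation X (atomic A w) D = ennreal (\<Sum>x\<in>A \<inter> D. \<bar>w x\<bar>)"
proof (rule antisym)
  show "variation X (atomic A w) D \<le> ennreal (\<Sum>x\<in>A \<inter> D. \<bar>w x\<bar>)"
    unfolding variation_def
  proof (rule SUP_least)
    fix P assume "P \<in> {P. finite P \<and> disjoint P \<and> P \<subseteq> borel_sets_of X \<and> \<Union>P \<subseteq> D}"
    then have P: "finite P" "disjoint P" "\<Union>P \<subseteq> D" by auto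
    have "(\<Sum>B\<in>P. \<bar>atomic A w B\<bar>) \<le> (\<Sum>B\<in>P. \<Sum>x\<in>A \<inter> B. \<bar>w x\<bar>)"
      by (rule sum_mono) (simp add: atomic_eq[OF A(1)] sum_abs)
    also have "\<dots> = (\<Sum>x\<in>(\<Union>B\<in>P. A \<inter> B). \<bar>w x\<bar>)"
      by (rule sum.UNION_disjoint[symmetric]) (use P A in \<open>auto simp: pairwise_def disjnt_def\<close>)
    also have "\<dots> \<le> (\<Sum>x\<in>A \<inter> D. \<bar>w x\<bar>)"
      by (rule sum_mono2) (use P A in auto)
    finally show "(\<Sum>B\<in>P. ennreal \<bar>atomic A w B\<bar>) \<le> ennreal (\<Sum>x\<in>A \<inter> D. \<bar>w x\<bar>)"
      by (simp add: sum_ennreal ennreal_leI)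
  qed
  define P where "P = (\<lambda>x. {x}) ` (A \<inter> D)"
  have "(\<Sum>B\<in>P. ennreal \<bar>atomic A w B\<bar>) = (\<Sum>x\<in>A \<inter> D. ennreal \<bar>atomic A w {x}\<bar>)"
    unfolding P_def by (rule sum.reindex_cong[of "\<lambda>x. {x}"]) (auto simp: inj_on_def)
  also have "\<dots> = (\<Sum>x\<in>A \<inter> D. ennreal \<bar>w x\<bar>)"
    by (rule sum.cong) (auto simp: atomic_eq[OF A(1)] Int_insert_right)
  also have "\<dots> = ennreal (\<Sum>x\<in>A \<inter> D. \<bar>w x\<bar>)" by (simp add: sum_ennreal)
  finally have eq: "(\<Sum>B\<in>P. ennreal \<bar>atomic A w B\<bar>) = ennreal (\<Sum>x\<in>A \<inter> D. \<bar>w x\<bar>)" .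
  have "{x} \<in> borel_sets_of X" if "x \<in> A" for x using singleton_borel[OF X] that A by blast
  then have "P \<in> {P. finite P \<and> disjoint P \<and> P \<subseteq> borel_sets_of X \<and> \<Union>P \<subseteq> D}"
    using A by (auto simp: P_def pairwise_def disjnt_def)
  then show "ennreal (\<Sum>x\<in>A \<inter> D. \<bar>w x\<bar>) \<le> variation X (atomic A w) D"
    unfolding variation_def eq[symmetric] by (rule SUP_upper)
qed

lemma atomic_sums:
  assumes "finite A" "disjoint_family B"
  shows "(\<lambda>i. atomic A w (B i)) sums atomic A w (\<Union>i. B i)"
  unfolding atomic_def
proof (rule sums_sum, rule sums_mult)
  fix x
  show "(\<lambda>i. indicator (B i) x :: real) sums indicator (\<Union>i. B i) x"
    by (rule indicator_sums) (use assms(2) in \<open>auto simp: disjoint_family_on_def\<close>)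
qed

lemma signed_radon_measure_atomic:
  assumes X: "Hausdorff_space X" and A: "finite A" "A \<subseteq> topspace X"
  shows "signed_radon_measure X (atomic A w)"
  unfolding signed_radon_measure_def signed_borel_measure_def
proof (intro conjI allI impI ballI)
  show "atomic A w {} = 0" by (simp add: atomic_def)
  show "(\<lambda>i. atomic A w (B i)) sums atomic A w (\<Union>i. B i)"
    if "range B \<subseteq> borel_sets_of X \<and> disjoint_family B" for B :: "nat \<Rightarrow> 'a set"
    using that A by (intro atomic_sums) auto
  fix B and e :: ennreal assume "B \<in> borel_sets_of X" "0 < e"
  show "\<exists>C\<subseteq>B. compactin X C \<and> variation X (atomic A w) (B - C) < e"
  proof (intro exI conjI)
    show "compactin X (A \<inter> B)" by (rule finite_imp_compactin) (use A in auto)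
    have "A \<inter> (B - A \<inter> B) = {}" by blast
    then show "variation X (atomic A w) (B - A \<inter> B) < e"
      using \<open>0 < e\<close> by (simp add: variation_atomic[OF X A])
  qed blast
qed

lemma finite_support_atomic:
  assumes X: "Hausdorff_space X" and A: "finite A" "A \<subseteq> topspace X"
  shows "finite (support_of X (atomic A w))"
proof (rule finite_subset[OF _ A(1)])
  have cl: "closedin X A" using X A by (simp add: closedin_Hausdorff_finite)
  have "variation X (atomic A w) (topspace X - A) = 0"
  proof -
    have "A \<inter> (topspace X - A) = {}" by blast
    then show ?thesis by (simp add: variation_atomic[OF X A])
  qed
  moreover have "openin X (topspace X - A)" using cl by blast
  ultimately show "support_of X (atomic A w) \<subseteq> A" unfolding support_of_def by force
qed

lemma jordan_pos_atomic:
  assumes X: "Hausdorff_space X" and A: "finite A" "A \<subseteq> topspace X"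
    and f: "continuous_map X euclideanreal f"
  shows "(LINT x|jordan_pos X (atomic A w). f x) = (\<Sum>x\<in>A. max 0 (w x) * f x)"
proof -
  define v where "v x = max 0 (w x)" for x
  let ?S = "borel_sets_of X" and ?g = "\<lambda>D. SUP B \<in> {B \<in> borel_sets_of X. B \<subseteq> D}. ennreal (atomic A w B)"
  interpret sa: sigma_algebra "topspace X" ?S
    unfolding borel_sets_of_def by (rule sigma_algebra_sigma_sets) (use openin_subset in blast)
  have sing: "{x} \<in> ?S" if "x \<in> A" for x using singleton_borel[OF X] that A by blast
  have fin_S: "C \<in> ?S" if "finite C" "C \<subseteq> A" for C
    using that
  proof (induction C rule: finite_induct)
    case (insert x C)
    then have "{x} \<union> C \<in> ?S" using sing by (intro sa.Un) auto
    then show ?case by simp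
  qed simp
  \<comment> \<open>the supremum is attained at the set of those atoms in \<open>D\<close> that have positive weight\<close>
  have g: "?g D = ennreal (atomic A v D)" for D
  proof (rule antisym)
    have "atomic A w B \<le> atomic A v D" if "B \<subseteq> D" for B
      unfolding atomic_def by (rule sum_mono) (use that in \<open>auto simp: v_def indicator_def\<close>)
    then show "?g D \<le> ennreal (atomic A v D)" by (intro SUP_least ennreal_leI) auto
    let ?B = "{x \<in> A \<inter> D. 0 < w x}"
    have "atomic A v D = atomic A w ?B"
      unfolding atomic_def by (rule sum.cong) (auto simp: v_def indicator_def max_def)
    moreover have "?B \<in> {B \<in> ?S. B \<subseteq> D}" using fin_S[of ?B] A by auto
    ultimately show "ennreal (atomic A v D) \<le> ?g D" by (metis (mono_tags, lifting) SUP_upper)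
  qed
  have v_pos: "0 \<le> atomic A v D" for D
    unfolding atomic_def by (intro sum_nonneg) (auto simp: v_def)
  define M where "M = jordan_pos X (atomic A w)"
  have M_eq: "M = measure_of (topspace X) {U. openin X U} (\<lambda>D. ennreal (atomic A v D))"
    unfolding M_def jordan_pos_def g ..
  have sub: "{U. openin X U} \<subseteq> Pow (topspace X)" using openin_subset by blast
  have sets_M: "sets M = ?S" unfolding M_eq borel_sets_of_def by (rule sets_measure_of[OF sub])
  have space_M: "space M = topspace X" unfolding M_eq by (rule space_measure_of[OF sub])
  have em: "emeasure M D = ennreal (atomic A v D)" if "D \<in> ?S" for D
  proof (rule emeasure_measure_of[OF M_eq sub])
    show "positive (sets M) (\<lambda>D. ennreal (atomic A v D))" by (simp add: positive_def atomic_def)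
    show "countably_additive (sets M) (\<lambda>D. ennreal (atomic A v D))"
      unfolding countably_additive_def
    proof (intro allI impI)
      fix B :: "nat \<Rightarrow> 'a set" assume "disjoint_family B"
      from atomic_sums[OF A(1) this, of v] show "(\<Sum>i. ennreal (atomic A v (B i))) = ennreal (atomic A v (\<Union>i. B i))"
        by (rule suminf_ennreal_eq[OF v_pos])
    qed
    show "D \<in> sets M" using that sets_M by simp
  qed
  have ms: "measure M {x} = v x" if "x \<in> A" for x
  proof -
    have "atomic A v {x} = v x" using that A by (simp add: atomic_eq Int_insert_right)
    then show ?thesis using em[OF sing[OF that]] by (simp add: measure_def v_def)
  qed
  have AS: "A \<in> ?S" using fin_S A by blast
  have top: "topspace X \<in> ?S" by (rule sa.top)
  have null: "topspace X - A \<in> null_sets M"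
  proof (rule null_setsI)
    show cS: "topspace X - A \<in> sets M" unfolding sets_M by (rule sa.Diff[OF top AS])
    have "atomic A v (topspace X - A) = 0" unfolding atomic_def by (rule sum.neutral) simp
    then show "emeasure M (topspace X - A) = 0" using em cS sets_M by simp
  qed
  have fm: "f \<in> borel_measurable M"
  proof (rule borel_measurableI)
    fix S :: "real set" assume "open S"
    then have "openin X {x \<in> topspace X. f x \<in> S}"
      using f by (simp add: continuous_map_def)
    moreover have "f -` S \<inter> space M = {x \<in> topspace X. f x \<in> S}" using space_M by auto
    ultimately show "f -` S \<inter> space M \<in> sets M" unfolding sets_M borel_sets_of_def by (auto intro: sigma_sets.Basic)
  qed
  have int: "integrable M (\<lambda>x. indicator {y} x *\<^sub>R f y)" "(LINT x|M. indicator {y} x *\<^sub>R f y) = v y * f y" if "y \<in> A" for y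
  proof -
    have s: "{y} \<in> sets M" "emeasure M {y} < \<infinity>" using sing[OF that] em by (auto simp: sets_M)
    show "integrable M (\<lambda>x. indicator {y} x *\<^sub>R f y)" using s by (intro integrable_scaleR_left integrable_real_indicator)
    have "(LINT x|M. indicator {y} x *\<^sub>R f y) = (LINT x|M. indicator {y} x) *\<^sub>R f y" using s by (intro integral_scaleR_left integrable_real_indicator)
    also have "(LINT x|M. indicator {y} x) = measure M ({y} \<inter> space M)" by simp
    also have "{y} \<inter> space M = {y}" using that A space_M by auto
    finally show "(LINT x|M. indicator {y} x *\<^sub>R f y) = v y * f y" using ms[OF that] by simp
  qed
  have "(LINT x|M. f x) = (LINT x|M. (\<Sum>y\<in>A. indicator {y} x *\<^sub>R f y))"
  proof (rule integral_cong_AE[OF fm])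
    show "(\<lambda>x. \<Sum>y\<in>A. indicator {y} x *\<^sub>R f y) \<in> borel_measurable M"
      by (intro borel_measurable_sum borel_measurable_integrable int(1))
    have "f x = (\<Sum>y\<in>A. indicator {y} x *\<^sub>R f y)" if "x \<in> A" for x
    proof -
      have "(\<Sum>y\<in>A. indicator {y} x *\<^sub>R f y) = (\<Sum>y\<in>A. if x = y then f y else 0)"
        by (rule sum.cong) (auto simp: indicator_def)
      then show ?thesis using that A by simp
    qed
    then show "AE x in M. f x = (\<Sum>y\<in>A. indicator {y} x *\<^sub>R f y)"
      by (intro AE_I'[OF null]) (auto simp: space_M)
  qed
  also have "\<dots> = (\<Sum>y\<in>A. LINT x|M. indicator {y} x *\<^sub>R f y)" by (rule Bochner_Integration.integral_sum) (rule int(1))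
  also have "\<dots> = (\<Sum>y\<in>A. v y * f y)" by (rule sum.cong[OF refl]) (rule int(2))
  finally show ?thesis by (simp add: M_def v_def)
qed

lemma signed_integral_atomic:
  assumes X: "Hausdorff_space X" and A: "finite A" "A \<subseteq> topspace X"
    and f: "continuous_map X euclideanreal f"
  shows "signed_integral X (atomic A w) f = (\<Sum>x\<in>A. w x * f x)"
proof -
  have neg: "(\<lambda>B. - atomic A w B) = atomic A (\<lambda>x. - w x)"
    by (auto simp: atomic_def sum_negf[symmetric])
  have "max 0 (w x) * f x - max 0 (- w x) * f x = w x * f x" for x by (auto simp: max_def)
  then show ?thesis
    unfolding signed_integral_def neg jordan_pos_atomic[OF X A f] by (simp add: sum_subtractf[symmetric])
qed

text \<open>
  The property witnessed by the weights of the measures; it mentions only points and continuous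
  functions, so it is easily transported along homeomorphisms.
\<close>

definition atomic_JN :: "'a topology \<Rightarrow> bool" where
  "atomic_JN X \<longleftrightarrow> (\<exists>A w. (\<forall>n. finite (A n) \<and> A n \<subseteq> topspace X \<and> (\<Sum>x\<in>A n. \<bar>w n x\<bar>) = 1) \<and>
     (\<forall>f. continuous_map X euclideanreal f \<longrightarrow> (\<lambda>n::nat. \<Sum>x\<in>A n. w n x * f x) \<longlonglongrightarrow> 0))"

lemma atomic_JN_imp_fsJNP:
  assumes X: "Hausdorff_space X" and J: "atomic_JN X"
  shows "fsJNP X"
proof -
  obtain A w where A: "\<And>n::nat. finite (A n)" "\<And>n. A n \<subseteq> topspace X" and w: "\<And>n. (\<Sum>x\<in>A n. \<bar>w n x\<bar>) = (1::real)"
    and lim: "\<And>f. continuous_map X euclideanreal f \<Longrightarrow> (\<lambda>n. \<Sum>x\<in>A n. w n x * f x) \<longlonglongrightarrow> 0"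
    using J unfolding atomic_JN_def by blast
  show ?thesis
    unfolding fsJNP_def
  proof (rule exI[of _ "\<lambda>n. atomic (A n) (w n)"], intro conjI allI impI)
    fix n
    show "signed_radon_measure X (atomic (A n) (w n))" by (rule signed_radon_measure_atomic[OF X A])
    show "finite (support_of X (atomic (A n) (w n)))" by (rule finite_support_atomic[OF X A])
    have "A n \<inter> topspace X = A n" using A by blast
    then show "total_variation_norm X (atomic (A n) (w n)) = 1"
      unfolding total_variation_norm_def by (simp add: variation_atomic[OF X A] w)
  next
    fix f assume f: "continuous_map X euclideanreal f"
    show "(\<lambda>n. signed_integral X (atomic (A n) (w n)) f) \<longlonglongrightarrow> 0"
      using lim[OF f] by (simp add: signed_integral_atomic[OF X A f])
  qed
qed

lemma atomic_JN_homeomorphic: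
  assumes h: "homeomorphic_map X Y h" and J: "atomic_JN X"
  shows "atomic_JN Y"
proof -
  obtain A w where A: "\<And>n::nat. finite (A n)" "\<And>n. A n \<subseteq> topspace X" and w: "\<And>n. (\<Sum>x\<in>A n. \<bar>w n x\<bar>) = (1::real)"
    and lim: "\<And>f. continuous_map X euclideanreal f \<Longrightarrow> (\<lambda>n. \<Sum>x\<in>A n. w n x * f x) \<longlonglongrightarrow> 0"
    using J unfolding atomic_JN_def by blast
  obtain g where g: "homeomorphic_maps X Y h g" using h homeomorphic_map_maps by blast
  have gh: "g (h x) = x" if "x \<in> A n" for x n using g A that by (auto simp: homeomorphic_maps_def)
  have inj: "inj_on h (A n)" for n by (rule inj_on_inverseI) (rule gh)
  have sums: "(\<Sum>y\<in>h ` A n. F y) = (\<Sum>x\<in>A n. F (h x))" for n and F :: "'b \<Rightarrow> real"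
    by (simp add: sum.reindex[OF inj])
  have hc: "continuous_map X Y h" using g by (simp add: homeomorphic_maps_def)
  show ?thesis
    unfolding atomic_JN_def
  proof (rule exI[of _ "\<lambda>n. h ` A n"], rule exI[of _ "\<lambda>n y. w n (g y)"], intro conjI allI impI)
    fix n
    show "finite (h ` A n)" using A by simp
    show "h ` A n \<subseteq> topspace Y" using hc A(2)[of n] by (auto simp: continuous_map_def)
    show "(\<Sum>x\<in>h ` A n. \<bar>w n (g x)\<bar>) = 1" unfolding sums using w[of n] gh by (simp cong: sum.cong)
  next
    fix f assume f: "continuous_map Y euclideanreal f"
    have "(\<lambda>n. \<Sum>x\<in>A n. w n x * (f \<circ> h) x) \<longlonglongrightarrow> 0" by (rule lim[OF continuous_map_compose[OF hc f]])
    moreover have "(\<Sum>x\<in>h ` A n. w n (g x) * f x) = (\<Sum>x\<in>A n. w n x * (f \<circ> h) x)" for n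
      unfolding sums by (rule sum.cong) (simp_all add: gh)
    ultimately show "(\<lambda>n. \<Sum>x\<in>h ` A n. w n (g x) * f x) \<longlonglongrightarrow> 0" by simp
  qed
qed

section \<open>Hereditarily separable spaces do not contain the Cech--Stone compactification of the naturals\<close>

text \<open>
  Different branches of the binary tree have only finitely many nodes in common, and there are
  uncountably many branches.
\<close>

definition branch :: "nat set \<Rightarrow> nat set" where
  "branch r = range (\<lambda>n. prod_encode (n, set_encode (r \<inter> {..<n})))"

lemma infinite_branch: "infinite (branch r)"
  unfolding branch_def by (rule range_inj_infinite) (auto simp: inj_def)

lemma finite_branch_Int:
  assumes "r \<noteq> s"
  shows "finite (branch r \<inter> branch s)"
proof -
  obtain k where k: "k \<in> r \<longleftrightarrow> k \<notin> s" using assms by blast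
  have "branch r \<inter> branch s \<subseteq> (\<lambda>n. prod_encode (n, set_encode (r \<inter> {..<n}))) ` {..k}"
  proof
    fix x assume "x \<in> branch r \<inter> branch s"
    then obtain n m where n: "x = prod_encode (n, set_encode (r \<inter> {..<n}))" "x = prod_encode (m, set_encode (s \<inter> {..<m}))"
      by (auto simp: branch_def)
    then have "n = m" "set_encode (r \<inter> {..<n}) = set_encode (s \<inter> {..<n})" by (auto simp: prod_encode_eq)
    then have eq: "r \<inter> {..<n} = s \<inter> {..<n}" by (simp add: set_encode_eq)
    have "n \<le> k"
    proof (rule ccontr)
      assume "\<not> n \<le> k"
      then have "k \<in> r \<inter> {..<n} \<longleftrightarrow> k \<in> r" "k \<in> s \<inter> {..<n} \<longleftrightarrow> k \<in> s" by auto
      then show False using k unfolding eq by blast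
    qed
    then show "x \<in> (\<lambda>n. prod_encode (n, set_encode (r \<inter> {..<n}))) ` {..k}" using n(1) by blast
  qed
  then show ?thesis by (rule finite_subset) simp
qed

lemma compact_accumulation:
  assumes X: "compact_space X" and A: "infinite A" "\<And>n. n \<in> A \<Longrightarrow> e n \<in> topspace X"
  shows "\<exists>x\<in>topspace X. \<forall>U. openin X U \<and> x \<in> U \<longrightarrow> infinite {n \<in> A. e n \<in> U}"
proof (rule ccontr)
  assume "\<not> ?thesis"
  then have "\<forall>x\<in>topspace X. \<exists>U. openin X U \<and> x \<in> U \<and> finite {n \<in> A. e n \<in> U}" by blast
  from bchoice[OF this] obtain U where U: "\<forall>x\<in>topspace X. openin X (U x) \<and> x \<in> U x \<and> finite {n \<in> A. e n \<in> U x}" by (rule exE)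
  have "\<exists>\<F>. finite \<F> \<and> \<F> \<subseteq> U ` topspace X \<and> topspace X \<subseteq> \<Union>\<F>"
    by (rule X[unfolded compact_space_alt, rule_format]) (use U in auto)
  then obtain \<F> where F: "finite \<F>" "\<F> \<subseteq> U ` topspace X" "topspace X \<subseteq> \<Union>\<F>" by blast
  have "A \<subseteq> (\<Union>V\<in>\<F>. {n \<in> A. e n \<in> V})"
  proof
    fix n assume n: "n \<in> A"
    then have "e n \<in> \<Union>\<F>" using subsetD[OF F(3) A(2)] by simp
    then show "n \<in> (\<Union>V\<in>\<F>. {n \<in> A. e n \<in> V})" using n by simp
  qed
  moreover have "finite (\<Union>V\<in>\<F>. {n \<in> A. e n \<in> V})" 
  proof (rule finite_UN_I[OF F(1)])
    fix V assume "V \<in> \<F>"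
    then obtain x where "x \<in> topspace X" "V = U x" using F(2) by (elim subsetD[THEN imageE])
    then show "finite {n \<in> A. e n \<in> V}" using U by simp
  qed
  ultimately show False using A(1) finite_subset by blast
qed

text \<open>
  Every branch has an accumulation point in the compactification at which the extension of the
  characteristic function of that branch is \<open>1\<close> and those of the other branches are \<open>0\<close>. So these
  points form an uncountable discrete subspace.
\<close>

lemma beta_nat_not_hereditarily_separable: "\<not> hereditarily separable_space beta_nat"
proof
  assume hs: "hereditarily separable_space beta_nat"
  define FF where "FF = {f :: nat \<Rightarrow> real. continuous_map (discrete_topology UNIV) (top_of_set {0..1}) f}"
  define Q where "Q = product_topology (\<lambda>_::nat \<Rightarrow> real. top_of_set {0..1::real}) FF"
  define e where "e n = (\<lambda>f\<in>FF. f n)" for n :: nat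
  have beta: "beta_nat = subtopology Q (Q closure_of range e)"
    unfolding beta_nat_def cech_stone_def Let_def FF_def[symmetric] Q_def[symmetric] e_def by simp
  have FF: "f \<in> FF \<longleftrightarrow> range f \<subseteq> {0..1}" for f by (auto simp: FF_def continuous_map_def)
  have "compact_space Q" unfolding Q_def compact_space_product_topology by (simp add: compact_space_subtopology)
  then have comp: "compact_space beta_nat" unfolding beta by (intro compact_space_subtopology closedin_compact_space) auto
  have eQ: "range e \<subseteq> topspace Q" by (auto simp: Q_def e_def FF image_subset_iff)
  have e_in: "e n \<in> topspace beta_nat" for n unfolding beta using closure_of_subset[OF eQ] eQ by auto
  define ch where "ch r n = (indicator (branch r) n :: real)" for r n
  have ch: "ch r \<in> FF" for r by (auto simp: FF ch_def indicator_def)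
  define U where "U r T = {p \<in> topspace beta_nat. p (ch r) \<in> T}" for r and T :: "real set"
  have oU: "openin beta_nat (U r T)" if "open T" for r T
  proof -
    have "continuous_map Q (top_of_set {0..1}) (\<lambda>p. p (ch r))"
      unfolding Q_def by (rule continuous_map_product_projection[OF ch])
    then have "continuous_map beta_nat euclideanreal (\<lambda>p. p (ch r))"
      unfolding beta by (auto intro: continuous_map_from_subtopology simp: continuous_map_in_subtopology)
    then show ?thesis using that by (simp add: continuous_map_def U_def)
  qed
  have "\<forall>r. \<exists>p\<in>topspace beta_nat. \<forall>U. openin beta_nat U \<and> p \<in> U \<longrightarrow> infinite {n \<in> branch r. e n \<in> U}"
    by (intro allI compact_accumulation[OF comp infinite_branch]) (rule e_in)
  then have "\<forall>r. \<exists>p. p \<in> topspace beta_nat \<and> (\<forall>U. openin beta_nat U \<and> p \<in> U \<longrightarrow> infinite {n \<in> branch r. e n \<in> U})" by blast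
  from choice[OF this] obtain \<phi> where \<phi>0: "\<forall>r. \<phi> r \<in> topspace beta_nat \<and>
      (\<forall>U. openin beta_nat U \<and> \<phi> r \<in> U \<longrightarrow> infinite {n \<in> branch r. e n \<in> U})" by (rule exE)
  have \<phi>: "\<phi> r \<in> topspace beta_nat" and inf: "openin beta_nat V \<Longrightarrow> \<phi> r \<in> V \<Longrightarrow> infinite {n \<in> branch r. e n \<in> V}" for r V
    using \<phi>0 by blast+
  have e_ch: "e n (ch r) = ch r n" for n r using ch by (simp add: e_def)
  have one: "\<phi> r (ch r) = 1" for r
  proof (rule ccontr)
    assume "\<phi> r (ch r) \<noteq> 1"
    then have "infinite {n \<in> branch r. e n \<in> U r (- {1})}" using \<phi> by (intro inf oU) (auto simp: U_def)
    moreover have "{n \<in> branch r. e n \<in> U r (- {1})} = {}" by (auto simp: U_def e_ch ch_def)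
    ultimately show False by simp
  qed
  have zero: "\<phi> r (ch s) = 0" if "r \<noteq> s" for r s
  proof (rule ccontr)
    assume "\<phi> r (ch s) \<noteq> 0"
    then have "infinite {n \<in> branch r. e n \<in> U s (- {0})}" using \<phi> by (intro inf oU) (auto simp: U_def)
    moreover have "{n \<in> branch r. e n \<in> U s (- {0})} \<subseteq> branch r \<inter> branch s" by (auto simp: U_def e_ch ch_def indicator_def split: if_splits)
    ultimately show False using finite_branch_Int[OF that] finite_subset by blast
  qed
  have inj: "inj \<phi>"
  proof (rule injI, rule ccontr)
    fix r s assume "\<phi> r = \<phi> s" "r \<noteq> s"
    then show False using one[of s] zero[of r s] by simp
  qed
  have sub: "range \<phi> \<subseteq> topspace beta_nat" using \<phi> by blast
  have "separable_space (subtopology beta_nat (range \<phi>))" using hs sub by (simp add: hereditarily)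
  then obtain C where C: "countable C" "subtopology beta_nat (range \<phi>) closure_of C = range \<phi>"
    unfolding separable_space_def using sub by (auto simp: Int_absorb1)
  have "\<phi> r \<in> C" for r
  proof -
    have o: "openin (subtopology beta_nat (range \<phi>)) (U r {0<..} \<inter> range \<phi>)"
      by (intro openin_subtopology_Int oU) simp
    have m: "\<phi> r \<in> U r {0<..} \<inter> range \<phi>" using \<phi> one by (simp add: U_def)
    have "\<phi> r \<in> subtopology beta_nat (range \<phi>) closure_of C" unfolding C(2) by (rule rangeI)
    then have "\<exists>p. p \<in> C \<and> p \<in> U r {0<..} \<inter> range \<phi>"
      unfolding in_closure_of by (elim conjE allE impE) (rule conjI[OF m o])
    then obtain p where p: "p \<in> C" "p \<in> U r {0<..} \<inter> range \<phi>" by (elim exE conjE)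
    then obtain s where s: "p = \<phi> s" "0 < \<phi> s (ch r)" by (auto simp: U_def)
    then have "s = r" using zero[of s r] by (cases "s = r") auto
    then show ?thesis using p s by simp
  qed
  then have "range \<phi> \<subseteq> C" by (rule image_subsetI)
  then have "countable (range \<phi>)" using C(1) by (rule countable_subset)
  then have "countable (UNIV :: nat set set)" using inj by (rule countable_image_inj_on)
  then have "range (from_nat_into (UNIV :: nat set set)) = UNIV" by (rule range_from_nat_into[rotated]) simp
  then show False using Cantors_theorem[of "UNIV :: nat set"] by auto
qed

lemma hereditarily_separable_homeomorphic:
  assumes h: "homeomorphic_map X Y h" and X: "hereditarily separable_space X"
  shows "hereditarily separable_space Y"
  unfolding hereditarily_def
proof (intro allI impI)
  fix T assume T: "T \<subseteq> topspace Y"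
  define S where "S = {x \<in> topspace X. h x \<in> T}"
  have "h ` (topspace X \<inter> S) = topspace Y \<inter> T"
    unfolding S_def homeomorphic_imp_surjective_map[OF h, symmetric] by auto
  then have "homeomorphic_map (subtopology X S) (subtopology Y T) h"
    by (rule homeomorphic_map_subtopologies[OF h])
  moreover have "separable_space (subtopology X S)" using X by (simp add: hereditarily)
  ultimately show "separable_space (subtopology Y T)"
    using homeomorphic_separable_space homeomorphic_map_imp_homeomorphic_space by blast
qed

lemma hereditarily_separable_no_beta_nat:
  assumes X: "hereditarily separable_space X"
  shows "\<not> contains_copy_of X beta_nat"
proof
  assume "contains_copy_of X beta_nat"
  then obtain S where "subtopology X S homeomorphic_space beta_nat"
    unfolding contains_copy_of_def by blast
  then obtain h where h: "homeomorphic_map (subtopology X S) beta_nat h"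
    unfolding homeomorphic_space by (rule exE)
  have "hereditarily separable_space (subtopology X S)"
    by (rule hereditarily_subtopology[OF X])
  then have "hereditarily separable_space beta_nat" by (rule hereditarily_separable_homeomorphic[OF h])
  then show False using beta_nat_not_hereditarily_separable by contradiction
qed

section \<open>Balanced measures on the limit space\<close>

context limit_tower
begin

definition bits :: "nat \<Rightarrow> point \<Rightarrow> nat set" where
  "bits m z = {i. i < m \<and> z (bot, i)}"

lemma bits_Pow: "bits m z \<in> Pow {..<m}"
  by (auto simp: bits_def)

lemma bits_Int: "m \<le> n \<Longrightarrow> bits m z = bits n z \<inter> {..<m}"
  by (auto simp: bits_def)

lemma bits_eq_iff: "bits m z = bits m z' \<longleftrightarrow> (\<forall>i<m. z (bot, i) = z' (bot, i))"
  by (auto simp: bits_def)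

lemma bits_point:
  assumes "r \<subseteq> {..<n}"
  shows "\<exists>z\<in>K. bits n z = r"
proof -
  define p where "p = (\<lambda>(c::om1, i::nat). c = bot \<and> i \<in> r)"
  have "p \<in> tow F {bot}" by (auto simp: tow_def p_def)
  then obtain q where q: "q \<in> K" "\<And>c n. c \<in> {bot} \<Longrightarrow> q (c, n) = p (c, n)"
    by (rule lift) (use bot_unique in auto)
  have "q (bot, i) \<longleftrightarrow> i \<in> r" for i using q(2)[of bot i] by (simp add: p_def)
  then have "bits n q = r" using assms by (auto simp: bits_def)
  then show ?thesis using q(1) by blast
qed

lemma bits_pair:
  assumes "r \<subseteq> {..<n}"
  shows "\<exists>z w. z \<in> K \<and> w \<in> K \<and> z \<noteq> w \<and> bits n z = r \<and> bits n w = r"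
proof -
  obtain z where z: "z \<in> K" "bits n z = r" using bits_point[OF assms] by blast
  obtain w where w: "w \<in> K" "w \<in> nb ({bot} \<times> {..<n}) z" "w \<noteq> z"
    using no_isolated_K[OF z(1), of "{bot} \<times> {..<n}"] by auto
  have "bits n w = bits n z" unfolding bits_eq_iff using w(2) by (auto simp: nb_def)
  then show ?thesis using z w by metis
qed

text \<open>
  The coordinates in \<open>H\<close> are determined by finitely many coordinates of block \<open>bot\<close> outside of a set
  of arbitrarily small proportion. This holds for every finite \<open>H\<close>, by induction on blocks: a
  coordinate of block \<open>b\<close> belongs to a point \<open>y\<close> that is split at stage \<open>b\<close>; outside of a small
  neighbourhood of \<open>y\<close> it is determined by finitely many earlier coordinates.
\<close>

definition nearly_determined :: "(om1 \<times> nat) set \<Rightarrow> bool" where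
  "nearly_determined H \<longleftrightarrow> (\<forall>e>0. \<exists>m C. C \<subseteq> Pow {..<m} \<and> real (card C) \<le> e * 2 ^ m \<and>
     (\<forall>z\<in>K. \<forall>z'\<in>K. bits m z' = bits m z \<longrightarrow> bits m z \<notin> C \<longrightarrow> z' \<in> nb H z))"

lemma card_bits_over:
  assumes "C \<subseteq> Pow {..<m}" "m \<le> n"
  shows "card {r. r \<subseteq> {..<n} \<and> r \<inter> {..<m} \<in> C} = card C * 2 ^ (n - m)"
proof -
  have "bij_betw (\<lambda>(c, d). c \<union> d) (C \<times> Pow {m..<n}) {r. r \<subseteq> {..<n} \<and> r \<inter> {..<m} \<in> C}"
  proof (rule bij_betw_byWitness[where f' = "\<lambda>r. (r \<inter> {..<m}, r \<inter> {m..<n})"])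
    have 1: "(c \<union> d) \<inter> {..<m} = c" "(c \<union> d) \<inter> {m..<n} = d" "c \<union> d \<subseteq> {..<n}" if "c \<subseteq> {..<m}" "d \<subseteq> {m..<n}" for c d
      using that assms(2) by fastforce+
    have sub: "c \<subseteq> {..<m}" if "c \<in> C" for c using assms(1) that by blast
    show "\<forall>a\<in>C \<times> Pow {m..<n}. (\<lambda>r. (r \<inter> {..<m}, r \<inter> {m..<n})) (case a of (c, d) \<Rightarrow> c \<union> d) = a"
      using 1 sub by auto
    show "(\<lambda>(c, d). c \<union> d) ` (C \<times> Pow {m..<n}) \<subseteq> {r. r \<subseteq> {..<n} \<and> r \<inter> {..<m} \<in> C}"
    proof
      fix r assume "r \<in> (\<lambda>(c, d). c \<union> d) ` (C \<times> Pow {m..<n})"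
      then obtain c d where r: "r = c \<union> d" "c \<in> C" "d \<subseteq> {m..<n}" by auto
      then show "r \<in> {r. r \<subseteq> {..<n} \<and> r \<inter> {..<m} \<in> C}" using 1[OF sub[OF r(2)] r(3)] by simp
    qed
    show "\<forall>r\<in>{r. r \<subseteq> {..<n} \<and> r \<inter> {..<m} \<in> C}. (\<lambda>(c, d). c \<union> d) (r \<inter> {..<m}, r \<inter> {m..<n}) = r"
      by auto
  qed auto
  then have "card {r. r \<subseteq> {..<n} \<and> r \<inter> {..<m} \<in> C} = card (C \<times> Pow {m..<n})" by (rule bij_betw_same_card[symmetric])
  then show ?thesis by (simp add: card_cartesian_product card_Pow)
qed

lemma small_union:
  assumes C: "C \<subseteq> Pow {..<m}" "real (card C) \<le> e / 2 * 2 ^ m"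
    and C': "C' \<subseteq> Pow {..<m'}" "real (card C') \<le> e / 2 * 2 ^ m'"
  shows "\<exists>n D. m \<le> n \<and> m' \<le> n \<and> D \<subseteq> Pow {..<n} \<and> real (card D) \<le> e * 2 ^ n \<and>
    (\<forall>z. bits n z \<notin> D \<longrightarrow> bits m z \<notin> C \<and> bits m' z \<notin> C')"
proof -
  define n where "n = max m m'"
  have n: "m \<le> n" "m' \<le> n" by (simp_all add: n_def)
  have half: "real (card {r. r \<subseteq> {..<n} \<and> r \<inter> {..<k} \<in> D}) \<le> e / 2 * 2 ^ n"
    if D: "D \<subseteq> Pow {..<k}" "real (card D) \<le> e / 2 * 2 ^ k" "k \<le> n" for k D
  proof -
    have "real (card {r. r \<subseteq> {..<n} \<and> r \<inter> {..<k} \<in> D}) = real (card D) * 2 ^ (n - k)"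
      using card_bits_over[OF D(1,3)] by simp
    also have "\<dots> \<le> (e / 2 * 2 ^ k) * 2 ^ (n - k)" by (rule mult_right_mono[OF D(2)]) simp
    also have "\<dots> = e / 2 * 2 ^ n" using D(3) by (simp add: mult.assoc power_add[symmetric])
    finally show ?thesis .
  qed
  let ?A = "{r. r \<subseteq> {..<n} \<and> r \<inter> {..<m} \<in> C}" and ?B = "{r. r \<subseteq> {..<n} \<and> r \<inter> {..<m'} \<in> C'}"
  have "real (card (?A \<union> ?B)) \<le> real (card ?A) + real (card ?B)" using card_Un_le[of ?A ?B] by linarith
  then have "real (card (?A \<union> ?B)) \<le> e * 2 ^ n"
    using half[OF C n(1)] half[OF C' n(2)] by linarith
  moreover have "bits m z \<notin> C \<and> bits m' z \<notin> C'" if "bits n z \<notin> ?A \<union> ?B" for z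
  proof -
    have "bits n z \<subseteq> {..<n}" using bits_Pow by blast
    then show ?thesis using that bits_Int[OF n(1), of z] bits_Int[OF n(2), of z] by auto
  qed
  moreover have "?A \<union> ?B \<subseteq> Pow {..<n}" by auto
  ultimately show ?thesis using n by (intro exI[of _ n] exI[of _ "?A \<union> ?B"] conjI allI impI) simp_all
qed

lemma bits_eq_mono: "m \<le> n \<Longrightarrow> bits n z' = bits n z \<Longrightarrow> bits m z' = bits m z"
  by (simp add: bits_Int)

lemma nearly_determined_Un:
  assumes "nearly_determined H" "nearly_determined H'"
  shows "nearly_determined (H \<union> H')"
  unfolding nearly_determined_def
proof (intro allI impI)
  fix e :: real assume e: "0 < e"
  then have e2: "0 < e / 2" by simp
  obtain m C where C: "C \<subseteq> Pow {..<m}" "real (card C) \<le> e / 2 * 2 ^ m"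
      "\<forall>z\<in>K. \<forall>z'\<in>K. bits m z' = bits m z \<longrightarrow> bits m z \<notin> C \<longrightarrow> z' \<in> nb H z"
    using assms(1)[unfolded nearly_determined_def, rule_format, OF e2] by (elim exE conjE)
  obtain m' C' where C': "C' \<subseteq> Pow {..<m'}" "real (card C') \<le> e / 2 * 2 ^ m'"
      "\<forall>z\<in>K. \<forall>z'\<in>K. bits m' z' = bits m' z \<longrightarrow> bits m' z \<notin> C' \<longrightarrow> z' \<in> nb H' z"
    using assms(2)[unfolded nearly_determined_def, rule_format, OF e2] by (elim exE conjE)
  obtain n D where D: "m \<le> n" "m' \<le> n" "D \<subseteq> Pow {..<n}" "real (card D) \<le> e * 2 ^ n"
    "\<forall>z. bits n z \<notin> D \<longrightarrow> bits m z \<notin> C \<and> bits m' z \<notin> C'"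
    using small_union[OF C(1,2) C'(1,2)] by (elim exE conjE)
  show "\<exists>m C. C \<subseteq> Pow {..<m} \<and> real (card C) \<le> e * 2 ^ m \<and>
     (\<forall>z\<in>K. \<forall>z'\<in>K. bits m z' = bits m z \<longrightarrow> bits m z \<notin> C \<longrightarrow> z' \<in> nb (H \<union> H') z)"
  proof (rule exI[of _ n], rule exI[of _ D], intro conjI ballI impI D(3,4))
    fix z z' assume z: "z \<in> K" "z' \<in> K" and eq: "bits n z' = bits n z" and notin: "bits n z \<notin> D"
    have "bits m z \<notin> C" "bits m' z \<notin> C'" using D(5) notin by simp_all
    then have "z' \<in> nb H z" "z' \<in> nb H' z"
      using C(3) C'(3) z bits_eq_mono[OF D(1) eq] bits_eq_mono[OF D(2) eq] by simp_all
    then show "z' \<in> nb (H \<union> H') z" by (simp add: nb_Un)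
  qed
qed

lemma nearly_determined_empty: "nearly_determined {}"
  unfolding nearly_determined_def
  by (intro allI impI exI[of _ 0] exI[of _ "{}"]) simp

lemma nearly_determined_finite:
  "finite H \<Longrightarrow> (\<And>c. c \<in> H \<Longrightarrow> nearly_determined {c}) \<Longrightarrow> nearly_determined H"
proof (induction H rule: finite_induct)
  case (insert c H)
  then have "nearly_determined ({c} \<union> H)" by (intro nearly_determined_Un) simp_all
  then show ?case by simp
qed (rule nearly_determined_empty)

lemma nearly_determined_single: "nearly_determined {(b, i)}"
proof (induction b arbitrary: i rule: less_induct)
  case (less b)
  consider "b = bot" | "b \<noteq> bot" "i \<notin> idx (F b) ` split_pts (F b)" | y where "b \<noteq> bot" "y \<in> split_pts (F b)" "i = idx (F b) y"
    by blast
  then show ?case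
  proof cases
    case 1
    have "z' \<in> nb {(b, i)} z" if "bits (Suc i) z' = bits (Suc i) z" for z z'
      using that unfolding bits_eq_iff nb_def 1 by simp
    then show ?thesis unfolding nearly_determined_def
      by (intro allI impI exI[of _ "Suc i"] exI[of _ "{}"]) simp
  next
    case 2
    have off: "\<not> z (b, i)" if "z \<in> K" for z
      using tow_fits[OF that UNIV_I 2(1)] 2(2) by (auto simp: fits_def)
    then have "z' \<in> nb {(b, i)} z" if "z \<in> K" "z' \<in> K" for z z'
      by (simp add: nb_def off[OF that(1)] off[OF that(2)])
    then show ?thesis unfolding nearly_determined_def
      by (intro allI impI exI[of _ "0::nat"] exI[of _ "{} :: nat set set"]) simp
  next
    case 3
    note y = 3(2) and i = 3(3)
    have so: "sides_ok F b" using steps[OF 3(1)] by (simp add: step_def)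
    let ?V = "tow F {..<b}"
    show ?thesis
      unfolding nearly_determined_def
    proof (intro allI impI)
      fix e :: real assume e: "0 < e"
      obtain m where m: "(1/2) ^ m < e / 2" using real_arch_pow_inv[of "e/2" "1/2"] e by auto
      let ?c = "bits m y"
      \<comment> \<open>outside of the neighbourhood of \<open>y\<close> given by the first \<open>m\<close> bits, the side with respect to \<open>y\<close> is locally constant\<close>
      define W where "W = {z \<in> ?V. bits m z \<noteq> ?c}"
      have yW: "y \<notin> W" by (simp add: W_def)
      have "finitely_determined ?V {z \<in> W. side (F b) y z}"
      proof (rule finitely_determined_compact)
        show "compact ?V" by (rule compact_eq_closed_fun_bool, rule tower.closed_tow[OF initial_tower]) simp
        show "{z \<in> W. side (F b) y z} \<subseteq> ?V" by (auto simp: W_def)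
        fix z assume z: "z \<in> ?V"
        have pz: "bits m z' = bits m z" if "z' \<in> nb ({bot} \<times> {..<m}) z" for z'
          using that unfolding bits_eq_iff by (auto simp: nb_def)
        show "\<exists>H. finite H \<and> (\<forall>z'\<in>?V \<inter> nb H z. (z' \<in> {z \<in> W. side (F b) y z}) = (z \<in> {z \<in> W. side (F b) y z}))"
        proof (cases "z \<in> W")
          case True
          then have "z \<noteq> y" using yW by blast
          then obtain H where H: "finite H" "\<forall>z'\<in>?V \<inter> nb H z. z' \<noteq> y \<and> side (F b) y z' = side (F b) y z"
            using so[unfolded sides_ok_def] y z by blast
          have "(z' \<in> {z \<in> W. side (F b) y z}) = (z \<in> {z \<in> W. side (F b) y z})"
            if z': "z' \<in> ?V \<inter> nb (H \<union> {bot} \<times> {..<m}) z" for z'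
          proof -
            have "z' \<in> ?V \<inter> nb H z" "z' \<in> nb ({bot} \<times> {..<m}) z" using z' by (auto simp: nb_Un)
            from bspec[OF H(2) this(1)] pz[OF this(2)] show ?thesis using z' True by (simp add: W_def)
          qed
          then show ?thesis using H(1) by (intro exI[of _ "H \<union> {bot} \<times> {..<m}"]) simp
        next
          case False
          have "z' \<notin> W" if "z' \<in> ?V \<inter> nb ({bot} \<times> {..<m}) z" for z'
            using False pz[of z'] that z by (simp add: W_def)
          then show ?thesis using False by (intro exI[of _ "{bot} \<times> {..<m}"]) simp
        qed
      qed
      then obtain H0 where H0: "finite H0" "\<forall>z\<in>?V. \<forall>z'\<in>?V \<inter> nb H0 z. z' \<in> {z \<in> W. side (F b) y z} \<longleftrightarrow> z \<in> {z \<in> W. side (F b) y z}"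
        by (rule finitely_determinedE)
      define H where "H = {(c, n) \<in> H0. c < b}"
      have "H \<subseteq> H0" by (auto simp: H_def)
      then have "finite H" using H0(1) by (rule finite_subset)
      then have nd: "nearly_determined H" by (rule nearly_determined_finite) (use less.IH in \<open>auto simp: H_def\<close>)
      have e2: "0 < e / 2" using e by simp
      obtain k C where C: "C \<subseteq> Pow {..<k}" "real (card C) \<le> e / 2 * 2 ^ k"
          "\<forall>z\<in>K. \<forall>z'\<in>K. bits k z' = bits k z \<longrightarrow> bits k z \<notin> C \<longrightarrow> z' \<in> nb H z"
        using nd[unfolded nearly_determined_def, rule_format, OF e2] by (elim exE conjE)
      have "real (card {?c}) \<le> e / 2 * 2 ^ m"
      proof -
        have "(1::real) = (1/2) ^ m * 2 ^ m" by (simp add: power_mult_distrib[symmetric])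
        also have "\<dots> \<le> e / 2 * 2 ^ m" by (rule mult_right_mono) (use m in auto)
        finally show ?thesis by simp
      qed
      note small = this
      have "{?c} \<subseteq> Pow {..<m}" using bits_Pow by simp
      from small_union[OF this small C(1,2)] obtain n D where D: "m \<le> n" "k \<le> n" "D \<subseteq> Pow {..<n}" "real (card D) \<le> e * 2 ^ n"
        "\<forall>z. bits n z \<notin> D \<longrightarrow> bits m z \<notin> {?c} \<and> bits k z \<notin> C"
        by (elim exE conjE)
      show "\<exists>m C. C \<subseteq> Pow {..<m} \<and> real (card C) \<le> e * 2 ^ m \<and>
         (\<forall>z\<in>K. \<forall>z'\<in>K. bits m z' = bits m z \<longrightarrow> bits m z \<notin> C \<longrightarrow> z' \<in> nb {(b, i)} z)"
      proof (rule exI[of _ n], rule exI[of _ D], intro conjI ballI impI D(3,4))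
        fix z z' assume z: "z \<in> K" "z' \<in> K" and eq: "bits n z' = bits n z" and notin: "bits n z \<notin> D"
        have pz: "bits m z \<noteq> ?c" "bits k z \<notin> C" using D(5) notin by simp_all
        have eqs: "bits m z' = bits m z" "bits k z' = bits k z"
          using bits_eq_mono[OF D(1) eq] bits_eq_mono[OF D(2) eq] by simp_all
        have zH: "z' \<in> nb H z" using C(3) z eqs pz by simp
        have bb: "bot < b" using 3(1) by (simp add: bot.not_eq_extremum)
        have pr: "bits m (res v b) = bits m v" for v using bb by (simp add: bits_def res_apply)
        have rV: "res z b \<in> ?V" "res z' b \<in> ?V" by (auto intro: res_in_tow[OF z(1)] res_in_tow[OF z(2)])
        have rW: "res z b \<in> W" "res z' b \<in> W" using rV pz eqs by (simp_all add: W_def pr)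
        have "res z' b \<in> nb H0 (res z b)"
        proof -
          have "res z' b (c, j) = res z b (c, j)" if "(c, j) \<in> H0" for c j
            using zH that unfolding nb_def H_def by (auto simp: res_apply)
          then show ?thesis by (auto simp: nb_def)
        qed
        then have "res z' b \<in> ?V \<inter> nb H0 (res z b)" using rV by blast
        from bspec[OF bspec[OF H0(2) rV(1)] this]
        have "side (F b) y (res z' b) = side (F b) y (res z b)" using rW by simp
        moreover have "v (b, i) = side (F b) y (res v b)" if "v \<in> K" "res v b \<in> W" for v
        proof -
          have "res v b \<noteq> y" using that(2) yW by blast
          then show ?thesis using tow_fits[OF that(1) UNIV_I 3(1)] y i by (auto simp: fits_def)
        qed
        ultimately show "z' \<in> nb {(b, i)} z" using z rW by (simp add: nb_def)
      qed
    qed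
  qed
qed

lemma uniformly_continuous:
  assumes f: "continuous_map (cube K) euclideanreal f" and e: "0 < e"
  shows "\<exists>H. finite H \<and> (\<forall>z\<in>K. \<forall>z'\<in>K \<inter> nb H z. \<bar>f z' - f z\<bar> < e)"
proof -
  have "\<forall>z\<in>K. \<exists>H. finite H \<and> (\<forall>z'\<in>K \<inter> nb H z. \<bar>f z' - f z\<bar> < e / 2)"
  proof
    fix z assume z: "z \<in> K"
    have "openin (cube K) {x \<in> topspace (cube K). f x \<in> {f z - e/2<..<f z + e/2}}"
      by (rule openin_continuous_map_preimage[OF f]) simp
    moreover have "z \<in> {x \<in> topspace (cube K). f x \<in> {f z - e/2<..<f z + e/2}}" using z e by simp
    ultimately obtain H where H: "finite H" "K \<inter> nb H z \<subseteq> {x \<in> topspace (cube K). f x \<in> {f z - e/2<..<f z + e/2}}"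
      unfolding openin_cube by blast
    have "\<bar>f z' - f z\<bar> < e / 2" if "z' \<in> K \<inter> nb H z" for z'
    proof -
      have "f z' \<in> {f z - e/2<..<f z + e/2}" using subsetD[OF H(2) that] by simp
      then have "f z - e/2 < f z'" "f z' < f z + e/2" by simp_all
      then show ?thesis by linarith
    qed
    then show "\<exists>H. finite H \<and> (\<forall>z'\<in>K \<inter> nb H z. \<bar>f z' - f z\<bar> < e / 2)" using H(1) by (intro exI[of _ H]) simp
  qed
  from bchoice[OF this] obtain H where H: "\<forall>z\<in>K. finite (H z) \<and> (\<forall>z'\<in>K \<inter> nb (H z) z. \<bar>f z' - f z\<bar> < e / 2)" by (rule exE)
  have "\<exists>D\<subseteq>K. finite D \<and> K \<subseteq> (\<Union>z\<in>D. nb (H z) z)"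
  proof (rule compactE_image[OF compact_K, of K "\<lambda>z. nb (H z) z"])
    show "open (nb (H z) z)" if "z \<in> K" for z using H that by (intro open_nb) simp
    show "K \<subseteq> (\<Union>z\<in>K. nb (H z) z)" using nb_self by blast
  qed blast
  then obtain D where D: "D \<subseteq> K" "finite D" "K \<subseteq> (\<Union>z\<in>D. nb (H z) z)" by (elim exE conjE)
  let ?H = "\<Union>z\<in>D. H z"
  have "finite ?H" using D H by (intro finite_UN_I) auto
  moreover have "\<bar>f z' - f z\<bar> < e" if z: "z \<in> K" and z': "z' \<in> K \<inter> nb ?H z" for z z'
  proof -
    obtain d where d: "d \<in> D" "z \<in> nb (H d) d" using subsetD[OF D(3) z] by (elim UN_E)
    have dK: "d \<in> K" using d D(1) by blast
    have "nb ?H z \<subseteq> nb (H d) z" by (rule nb_mono) (use d in blast)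
    then have "z' \<in> nb (H d) d" using z' nb_eq[OF d(2)] by blast
    then have "\<bar>f z' - f d\<bar> < e / 2" "\<bar>f z - f d\<bar> < e / 2" using bspec[OF H dK] d(2) z z' by simp_all
    then show ?thesis by linarith
  qed
  ultimately show ?thesis by (intro exI[of _ ?H]) simp
qed

text \<open>
  The measures have masses \<open>\<plusminus>2 ^ - (n + 1)\<close> at two points with the same first \<open>n\<close> bits, for each
  choice of these bits. By uniform continuity and \<open>nearly_determined\<close>, a continuous function takes
  almost the same values at the two points for all but a small proportion of the choices.
\<close>

theorem atomic_JN_limit: "atomic_JN (cube K)"
proof -
  have "\<forall>nr. \<exists>zw. snd nr \<subseteq> {..<fst nr} \<longrightarrow> fst zw \<in> K \<and> snd zw \<in> K \<and> fst zw \<noteq> snd zw \<and>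
      bits (fst nr) (fst zw) = snd nr \<and> bits (fst nr) (snd zw) = snd nr"
    using bits_pair by (metis fst_conv snd_conv)
  from choice[OF this] obtain c where c: "\<forall>nr. snd nr \<subseteq> {..<fst nr} \<longrightarrow> fst (c nr) \<in> K \<and> snd (c nr) \<in> K \<and> fst (c nr) \<noteq> snd (c nr) \<and>
      bits (fst nr) (fst (c nr)) = snd nr \<and> bits (fst nr) (snd (c nr)) = snd nr" by (rule exE)
  define p q where "p n r = fst (c (n, r))" and "q n r = snd (c (n, r))" for n r
  have pq: "p n r \<in> K" "q n r \<in> K" "p n r \<noteq> q n r" "bits n (p n r) = r" "bits n (q n r) = r"
    if "r \<in> Pow {..<n}" for n r
    using c[rule_format, of "(n, r)"] that unfolding p_def q_def by simp_all
  define A where "A n = p n ` Pow {..<n} \<union> q n ` Pow {..<n}" for n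
  define w where "w n x = (if x \<in> p n ` Pow {..<n} then 1 else -1) / (2 * 2 ^ n :: real)" for n x
  have pinj: "inj_on (p n) (Pow {..<n})" for n by (rule inj_on_inverseI[of _ "bits n"]) (rule pq(4))
  have qinj: "inj_on (q n) (Pow {..<n})" for n by (rule inj_on_inverseI[of _ "bits n"]) (rule pq(5))
  have qp: "q n r \<notin> p n ` Pow {..<n}" if r: "r \<in> Pow {..<n}" for n r
  proof
    assume "q n r \<in> p n ` Pow {..<n}"
    then obtain s where s: "s \<in> Pow {..<n}" "q n r = p n s" by blast
    then have "s = r" using pq(4)[OF s(1)] pq(5)[OF r] by simp
    then show False using s pq(3)[OF r] by simp
  qed
  have sumA: "(\<Sum>x\<in>A n. h x) = (\<Sum>r\<in>Pow {..<n}. h (p n r) + h (q n r))" for n and h :: "point \<Rightarrow> real"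
  proof -
    have "(\<Sum>x\<in>A n. h x) = (\<Sum>x\<in>p n ` Pow {..<n}. h x) + (\<Sum>x\<in>q n ` Pow {..<n}. h x)"
      unfolding A_def
    proof (rule sum.union_disjoint)
      have False if x: "x \<in> p n ` Pow {..<n}" "x \<in> q n ` Pow {..<n}" for x
      proof -
        obtain r where "x = q n r" "r \<in> Pow {..<n}" using x(2) by (rule imageE)
        then show False using qp x(1) by simp
      qed
      then show "p n ` Pow {..<n} \<inter> q n ` Pow {..<n} = {}" by blast
    qed simp_all
    then show ?thesis by (simp add: sum.reindex[OF pinj] sum.reindex[OF qinj] sum.distrib)
  qed
  have wp: "w n (p n r) = 1 / (2 * 2 ^ n)" "w n (q n r) = - (1 / (2 * 2 ^ n))" if "r \<in> Pow {..<n}" for n r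
    using that qp[OF that] unfolding w_def by auto
  show ?thesis
    unfolding atomic_JN_def
  proof (rule exI[of _ A], rule exI[of _ w], intro conjI allI impI)
    fix n
    show "finite (A n)" by (simp add: A_def)
    show "A n \<subseteq> topspace (cube K)" using pq(1,2) by (auto simp: A_def)
    have "(\<Sum>x\<in>A n. \<bar>w n x\<bar>) = (\<Sum>r\<in>Pow {..<n}. 1 / 2 ^ n)"
      unfolding sumA by (rule sum.cong) (simp_all add: wp)
    then show "(\<Sum>x\<in>A n. \<bar>w n x\<bar>) = 1" by (simp add: card_Pow)
  next
    fix f assume f: "continuous_map (cube K) euclideanreal f"
    have "compactin euclideanreal (f ` K)"
      using image_compactin[OF _ f, of K] cube_compact[OF compact_K] by (simp add: compact_space_def)
    then have "bounded (f ` K)" by (simp add: compact_imp_bounded)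
    then obtain b where b: "0 < b" "\<forall>x\<in>K. \<bar>f x\<bar> \<le> b" unfolding bounded_pos by auto
    have val: "(\<Sum>x\<in>A n. w n x * f x) = (\<Sum>r\<in>Pow {..<n}. f (p n r) - f (q n r)) / (2 * 2 ^ n)" for n
      unfolding sumA sum_divide_distrib by (rule sum.cong) (simp_all add: wp diff_divide_distrib)
    show "(\<lambda>n. \<Sum>x\<in>A n. w n x * f x) \<longlonglongrightarrow> 0"
    proof (rule LIMSEQ_I)
      fix e :: real assume e: "0 < e"
      obtain H where H: "finite H" "\<forall>z\<in>K. \<forall>z'\<in>K \<inter> nb H z. \<bar>f z' - f z\<bar> < e"
        using uniformly_continuous[OF f e] by (elim exE conjE)
      have nd: "nearly_determined H" by (rule nearly_determined_finite[OF H(1)]) (use nearly_determined_single in auto)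
      have eb: "0 < e / (4 * b)" using e b by simp
      obtain m C where C: "C \<subseteq> Pow {..<m}" "real (card C) \<le> e / (4 * b) * 2 ^ m"
          "\<forall>z\<in>K. \<forall>z'\<in>K. bits m z' = bits m z \<longrightarrow> bits m z \<notin> C \<longrightarrow> z' \<in> nb H z"
        using nd[unfolded nearly_determined_def, rule_format, OF eb] by (elim exE conjE)
      have "\<bar>\<Sum>x\<in>A n. w n x * f x\<bar> < e" if n: "m \<le> n" for n
      proof -
        let ?B = "{r. r \<subseteq> {..<n} \<and> r \<inter> {..<m} \<in> C}"
        have BP: "?B \<subseteq> Pow {..<n}" by auto
        have bad: "\<bar>f (p n r) - f (q n r)\<bar> \<le> 2 * b" if "r \<in> Pow {..<n}" for r
        proof -
          have "\<bar>f (p n r)\<bar> \<le> b" "\<bar>f (q n r)\<bar> \<le> b" using b(2) pq(1,2)[OF that] by simp_all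
          then show ?thesis by linarith
        qed
        have good: "\<bar>f (p n r) - f (q n r)\<bar> \<le> e" if r: "r \<in> Pow {..<n} - ?B" for r
        proof -
          have r': "r \<in> Pow {..<n}" using r by blast
          have pats: "bits m (p n r) = r \<inter> {..<m}" "bits m (q n r) = r \<inter> {..<m}"
            using bits_Int[OF n] pq(4,5)[OF r'] by simp_all
          moreover have "r \<inter> {..<m} \<notin> C" using r by simp
          ultimately have "p n r \<in> nb H (q n r)" using C(3) pq(1,2)[OF r'] by simp
          then have "\<bar>f (p n r) - f (q n r)\<bar> < e" using H(2) pq(1,2)[OF r'] by simp
          then show ?thesis by simp
        qed
        have "\<bar>\<Sum>r\<in>Pow {..<n}. f (p n r) - f (q n r)\<bar> \<le> (\<Sum>r\<in>Pow {..<n}. \<bar>f (p n r) - f (q n r)\<bar>)" by (rule sum_abs)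
        also have "\<dots> = (\<Sum>r\<in>Pow {..<n} - ?B. \<bar>f (p n r) - f (q n r)\<bar>) + (\<Sum>r\<in>?B. \<bar>f (p n r) - f (q n r)\<bar>)"
          by (rule sum.subset_diff[OF BP]) simp
        also have "\<dots> \<le> (\<Sum>r\<in>Pow {..<n}. e) + (\<Sum>r\<in>?B. 2 * b)"
        proof (rule add_mono)
          have "(\<Sum>r\<in>Pow {..<n} - ?B. \<bar>f (p n r) - f (q n r)\<bar>) \<le> (\<Sum>r\<in>Pow {..<n} - ?B. e)" by (rule sum_mono) (rule good)
          also have "\<dots> \<le> (\<Sum>r\<in>Pow {..<n}. e)" by (rule sum_mono2) (use e in auto)
          finally show "(\<Sum>r\<in>Pow {..<n} - ?B. \<bar>f (p n r) - f (q n r)\<bar>) \<le> (\<Sum>r\<in>Pow {..<n}. e)" .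
          show "(\<Sum>r\<in>?B. \<bar>f (p n r) - f (q n r)\<bar>) \<le> (\<Sum>r\<in>?B. 2 * b)" by (rule sum_mono) (use bad in auto)
        qed
        also have "\<dots> = 2 ^ n * e + real (card ?B) * (2 * b)" by (simp add: card_Pow)
        also have "real (card ?B) * (2 * b) = (real (card C) * 2 ^ (n - m)) * (2 * b)"
          using card_bits_over[OF C(1) n] by simp
        also have "\<dots> \<le> ((e / (4 * b) * 2 ^ m) * 2 ^ (n - m)) * (2 * b)"
          by (intro mult_right_mono C(2)) (use b in auto)
        also have "\<dots> = e / 2 * (2 ^ m * 2 ^ (n - m))" using b by (simp add: field_simps)
        also have "(2::real) ^ m * 2 ^ (n - m) = 2 ^ n" using n by (simp add: power_add[symmetric])
        finally have "\<bar>\<Sum>r\<in>Pow {..<n}. f (p n r) - f (q n r)\<bar> \<le> 3 / 2 * e * 2 ^ n" by simp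
        also have "\<dots> < e * (2 * 2 ^ n)" using e by simp
        finally have "\<bar>\<Sum>r\<in>Pow {..<n}. f (p n r) - f (q n r)\<bar> / (2 * 2 ^ n) < e" by (simp add: pos_divide_less_eq)
        then show ?thesis unfolding val by (simp add: abs_divide)
      qed
      then show "\<exists>N. \<forall>n\<ge>N. norm ((\<Sum>x\<in>A n. w n x * f x) - 0) < e" by (intro exI[of _ m]) simp
    qed
  qed
qed

end

section \<open>Transport to sets of sets of natural numbers\<close>

lemma rigid_homeomorphic:
  assumes h: "homeomorphic_map X Y h" and X: "rigid_space X"
  shows "rigid_space Y"
  unfolding rigid_space_def
proof (intro allI impI ballI)
  fix f y assume f: "homeomorphic_map Y Y f" and y: "y \<in> topspace Y"
  obtain g where g: "homeomorphic_maps X Y h g" using h homeomorphic_map_maps by blast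
  then have gm: "homeomorphic_map Y X g" by (rule homeomorphic_maps_imp_map[OF homeomorphic_maps_sym[THEN iffD1]])
  have "homeomorphic_map X X (g \<circ> (f \<circ> h))"
    by (intro homeomorphic_map_compose[OF _ gm] homeomorphic_map_compose[OF h f])
  moreover have gy: "g y \<in> topspace X" using homeomorphic_imp_surjective_map[OF gm] y by blast
  ultimately have "(g \<circ> (f \<circ> h)) (g y) = g y" using X unfolding rigid_space_def by blast
  moreover have "h (g v) = v" if "v \<in> topspace Y" for v using g that by (simp add: homeomorphic_maps_def)
  moreover have "f y \<in> topspace Y" using homeomorphic_imp_surjective_map[OF f] y by blast
  ultimately show "f y = y" using y by (metis comp_apply)
qed

lemma totally_disconnected_homeomorphic:
  assumes h: "homeomorphic_map X Y h" and X: "totally_disconnected_space X"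
  shows "totally_disconnected_space Y"
  unfolding totally_disconnected_space_def homeomorphic_map_connected_components_of[OF h]
proof
  fix C assume "C \<in> image h ` connected_components_of X"
  then obtain D where D: "D \<in> connected_components_of X" "C = h ` D" by blast
  then obtain x where "D = {x}" using X unfolding totally_disconnected_space_def by blast
  then show "\<exists>y. C = {y}" using D(2) by simp
qed

lemma convergent_sequence_homeomorphic:
  assumes h: "homeomorphic_map X Y h" and Y: "has_nontrivial_convergent_sequence Y"
  shows "has_nontrivial_convergent_sequence X"
proof -
  obtain g where g: "homeomorphic_maps X Y h g" using h homeomorphic_map_maps by blast
  obtain x l where x: "range x \<subseteq> topspace Y" "limitin Y x l sequentially" "\<not> (\<exists>c. \<forall>\<^sub>F n in sequentially. x n = c)"
    using Y unfolding has_nontrivial_convergent_sequence_def by (elim exE conjE)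
  have gc: "continuous_map Y X g" using g by (simp add: homeomorphic_maps_def)
  have hg: "h (g (x n)) = x n" for n using g x(1) by (auto simp: homeomorphic_maps_def)
  show ?thesis
    unfolding has_nontrivial_convergent_sequence_def
  proof (intro exI conjI notI)
    show "range (g \<circ> x) \<subseteq> topspace X" using x(1) gc by (auto simp: continuous_map_def)
    show "limitin X (g \<circ> x) (g l) sequentially" by (rule continuous_map_limit[OF gc x(2)])
    assume "\<exists>c. \<forall>\<^sub>F n in sequentially. (g \<circ> x) n = c"
    then obtain c where c: "\<forall>\<^sub>F n in sequentially. (g \<circ> x) n = c" by (rule exE)
    have "\<forall>\<^sub>F n in sequentially. x n = h c"
      using c
    proof (rule eventually_mono)
      fix n assume "(g \<circ> x) n = c"
      then have "h (g (x n)) = h c" by simp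
      then show "x n = h c" by (simp only: hg)
    qed
    then have "\<exists>c. \<forall>\<^sub>F n in sequentially. x n = c" by (rule exI)
    with x(3) show False by contradiction
  qed
qed

lemma clopens_homeomorphic_transport:
  assumes h: "homeomorphic_map X Y h"
    and X: "\<And>U V. clopenin X U \<Longrightarrow> clopenin X V \<Longrightarrow> U \<noteq> {} \<Longrightarrow> V \<noteq> {} \<Longrightarrow>
      subtopology X U homeomorphic_space subtopology X V"
    and U: "clopenin Y U" "U \<noteq> {}" and V: "clopenin Y V" "V \<noteq> {}"
  shows "subtopology Y U homeomorphic_space subtopology Y V"
proof -
  obtain g where g: "homeomorphic_maps X Y h g" using h homeomorphic_map_maps by blast
  then have gm: "homeomorphic_map Y X g" by (rule homeomorphic_maps_imp_map[OF homeomorphic_maps_sym[THEN iffD1]])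
  have cl: "clopenin X (g ` W)" "subtopology Y W homeomorphic_space subtopology X (g ` W)" if W: "clopenin Y W" for W
  proof -
    have sub: "W \<subseteq> topspace Y" using W openin_subset unfolding clopenin_def by blast
    show "clopenin X (g ` W)"
      using W homeomorphic_map_openness[OF gm sub] homeomorphic_map_closedness[OF gm sub] by (simp add: clopenin_def)
    have "g ` (topspace Y \<inter> W) = topspace X \<inter> g ` W"
      using sub homeomorphic_imp_surjective_map[OF gm] by blast
    then show "subtopology Y W homeomorphic_space subtopology X (g ` W)"
      by (rule homeomorphic_map_imp_homeomorphic_space[OF homeomorphic_map_subtopologies[OF gm]])
  qed
  have "subtopology X (g ` U) homeomorphic_space subtopology X (g ` V)"
    by (rule X) (use cl U V in auto)
  from homeomorphic_space_trans[OF homeomorphic_space_trans[OF cl(2)[OF U(1)] this]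
      homeomorphic_space_sym[THEN iffD1, OF cl(2)[OF V(1)]]]
  show ?thesis .
qed

lemma injective_copy:
  assumes "inj (h :: 'a \<Rightarrow> 'b)"
  obtains Y where "homeomorphic_map X Y h"
proof
  let ?Y = "pullback_topology (h ` topspace X) (inv h) X"
  have ih: "inv h (h x) = x" for x using assms by simp
  have "homeomorphic_maps X ?Y h (inv h)"
    unfolding homeomorphic_maps_def
  proof (intro conjI ballI)
    show "continuous_map X ?Y h"
      unfolding continuous_map
    proof (intro conjI allI impI)
      show "h ` topspace X \<subseteq> topspace ?Y" by (auto simp: topspace_pullback_topology ih)
      fix S assume "openin ?Y S"
      then obtain U where U: "openin X U" "S = inv h -` U \<inter> h ` topspace X" unfolding openin_pullback_topology by blast
      then have "{x \<in> topspace X. h x \<in> S} = U" using openin_subset[OF U(1)] by (auto simp: ih)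
      then show "openin X {x \<in> topspace X. h x \<in> S}" using U(1) by simp
    qed
    show "continuous_map ?Y X (inv h)"
      using continuous_map_pullback[OF continuous_map_id, of "h ` topspace X" "inv h" X] by simp
    show "inv h (h x) = x" for x by (rule ih)
    show "h (inv h y) = y" if "y \<in> topspace ?Y" for y using that by (auto simp: topspace_pullback_topology ih)
  qed
  then show "homeomorphic_map X ?Y h" by (rule homeomorphic_maps_imp_map)
qed

lemma coordinate_code: obtains e :: "om1 \<times> nat \<Rightarrow> nat set" where "inj e"
proof -
  obtain b :: "om1 \<times> om1 \<times> nat \<Rightarrow> om1" where b: "inj b" by (rule inj_om1_triples)
  have "inj (\<lambda>c. Rep_om1 (b (fst c, fst c, snd c)))"
  proof (rule injI)
    fix c d :: "om1 \<times> nat" assume "Rep_om1 (b (fst c, fst c, snd c)) = Rep_om1 (b (fst d, fst d, snd d))"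
    then have "b (fst c, fst c, snd c) = b (fst d, fst d, snd d)" by (simp only: Rep_om1_inject)
    then have "(fst c, fst c, snd c) = (fst d, fst d, snd d)" by (rule injD[OF b])
    then show "c = d" by (simp add: prod_eq_iff)
  qed
  then show ?thesis by (rule that)
qed

text \<open>
  Coordinates are coded by sets of natural numbers, and a point by the set of the codes of its true
  coordinates.
\<close>

lemma point_encoding: obtains h :: "point \<Rightarrow> nat set set" where "inj h"
proof -
  obtain e :: "om1 \<times> nat \<Rightarrow> nat set" where e: "inj e" by (rule coordinate_code)
  have "inj (\<lambda>z :: point. e ` {c. z c})"
  proof (rule injI)
    fix z z' :: point assume "e ` {c. z c} = e ` {c. z' c}"
    then have "{c. z c} = {c. z' c}" by (simp only: inj_image_eq_iff[OF e])
    then show "z = z'" by (simp add: fun_eq_iff set_eq_iff)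
  qed
  then show ?thesis by (rule that)
qed

section \<open>The two spaces\<close>

lemma (in limit_tower) copy_properties:
  assumes h: "homeomorphic_map (cube K) Y h"
  shows "hereditarily separable_space Y" "totally_disconnected_space Y" "efimov_space Y" "fsJNP Y"
proof -
  have hs: "cube K homeomorphic_space Y" using h by (rule homeomorphic_map_imp_homeomorphic_space)
  show sep: "hereditarily separable_space Y" by (rule hereditarily_separable_homeomorphic[OF h hereditarily_separable])
  show "totally_disconnected_space Y" by (rule totally_disconnected_homeomorphic[OF h cube_totally_disconnected])
  have Hd: "Hausdorff_space Y" by (rule homeomorphic_Hausdorff_space[OF hs, THEN iffD1, OF cube_Hausdorff])
  have "atomic_JN Y" by (rule atomic_JN_homeomorphic[OF h atomic_JN_limit])
  with Hd show "fsJNP Y" by (rule atomic_JN_imp_fsJNP)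
  obtain z where "z \<in> K" using K_nonempty by blast
  from infinite_nb[OF this, of "{}"] have "infinite K" by simp
  moreover have "h ` K = topspace Y" "inj_on h K"
    using homeomorphic_imp_surjective_map[OF h] homeomorphic_imp_injective_map[OF h] by simp_all
  ultimately have inf: "infinite (topspace Y)" using finite_image_iff by metis
  have "compact_space Y" by (rule homeomorphic_compact_space[OF hs, THEN iffD1, OF cube_compact[OF compact_K]])
  moreover have "\<not> has_nontrivial_convergent_sequence Y"
    using convergent_sequence_homeomorphic[OF h] no_convergent_sequence by blast
  ultimately show "efimov_space Y"
    unfolding efimov_space_def using inf Hd hereditarily_separable_no_beta_nat[OF sep] by simp
qed

lemma limit_tower_exists:
  assumes diamond
  shows "\<exists>G N \<sigma> code \<nu> F. limit_tower G N \<sigma> code \<nu> homog F"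
proof (rule diamond_arrays[OF assms])
  fix G :: "om1 \<Rightarrow> om1 \<times> om1 \<times> nat \<Rightarrow> bool"
  assume G: "\<And>X h. \<exists>a. (\<exists>g. g < a) \<and> (\<forall>g<a. h g < a) \<and>
      (\<forall>x b n. x < a \<longrightarrow> b < a \<longrightarrow> G a (x, b, n) = X (x, b, n))"
  obtain N :: "nat \<Rightarrow> nat" and \<sigma> :: "nat set \<times> bool \<Rightarrow> nat \<Rightarrow> nat \<Rightarrow> nat" where \<sigma>:
      "\<And>k. 0 < N k" "\<And>a k. bij_betw (\<sigma> a k) {..<N k} {..<N k}"
      "\<And>r s k l. l < N k \<Longrightarrow> \<sigma> (r, s) k (\<sigma> (r, \<not> s) k l) = l"
      "\<And>w. reduced_word w \<Longrightarrow> w \<noteq> [] \<Longrightarrow> \<exists>k0. \<forall>k\<ge>k0. \<forall>l<N k. foldr (\<lambda>a. \<sigma> a k) w l \<noteq> l"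
    by (rule free_labels) (rule that)
  obtain code :: "om1 \<times> nat \<Rightarrow> nat set" where code: "inj code" by (rule coordinate_code)
  obtain \<nu> :: "nat \<Rightarrow> om1" where \<nu>: "inj \<nu>"
    using infinite_countable_subset[OF uncountable_infinite[OF uncountable_om1]] by (elim exE conjE)
  have p: "parameters G N \<sigma> code \<nu>"
    by (rule parameters.intro[OF G \<sigma> code \<nu>])
  obtain F where "\<forall>a. a \<noteq> bot \<longrightarrow> parameters.step G N \<sigma> code \<nu> homog F a"
    using parameters.tower_exists[OF p] by (rule exE)
  then have "limit_tower G N \<sigma> code \<nu> homog F"
    by (intro limit_tower.intro[OF p] limit_tower_axioms.intro) simp
  then show ?thesis by blast
qed

theorem corollary9p22:
  assumes "diamond"
  shows "(\<exists>K :: nat set set topology.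
            hereditarily separable_space K \<and> totally_disconnected_space K \<and>
            rigid_space K \<and> efimov_space K \<and> fsJNP K) \<and>
         (\<exists>K :: nat set set topology.
            hereditarily separable_space K \<and> totally_disconnected_space K \<and>
            efimov_space K \<and> fsJNP K \<and>
            (\<forall>U V. clopenin K U \<and> clopenin K V \<and> U \<noteq> {} \<and> V \<noteq> {}
               \<longrightarrow> subtopology K U homeomorphic_space subtopology K V))"
proof
  obtain h :: "point \<Rightarrow> nat set set" where h: "inj h" by (rule point_encoding)
  obtain G N \<sigma> code \<nu> F where L: "limit_tower G N \<sigma> code \<nu> False F"
    using limit_tower_exists[OF assms, of False] by blast
  obtain Y where Y: "homeomorphic_map (cube (tow F UNIV)) Y h" by (rule injective_copy[OF h])
  have "rigid_space Y" by (rule rigid_homeomorphic[OF Y limit_tower.rigid[OF L]]) simp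
  then show "\<exists>K :: nat set set topology.
            hereditarily separable_space K \<and> totally_disconnected_space K \<and>
            rigid_space K \<and> efimov_space K \<and> fsJNP K"
    using limit_tower.copy_properties[OF L Y] by blast
next
  obtain h :: "point \<Rightarrow> nat set set" where h: "inj h" by (rule point_encoding)
  obtain G N \<sigma> code \<nu> F where L: "limit_tower G N \<sigma> code \<nu> True F"
    using limit_tower_exists[OF assms, of True] by blast
  let ?K = "tow F UNIV"
  obtain Y where Y: "homeomorphic_map (cube ?K) Y h" by (rule injective_copy[OF h])
  have "subtopology (cube ?K) U homeomorphic_space subtopology (cube ?K) V"
    if U: "clopenin (cube ?K) U" "U \<noteq> {}" and V: "clopenin (cube ?K) V" "V \<noteq> {}" for U V
  proof -
    note fd = clopen_finitely_determined[OF limit_tower.compact_K[OF L]]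
    have "cube U homeomorphic_space cube V"
      by (rule limit_tower.clopens_homeomorphic[OF L TrueI fd[OF U(1)] U(2) fd[OF V(1)] V(2)])
    then show ?thesis
      by (simp add: subtopology_cube finitely_determined_subset[OF fd[OF U(1)]] finitely_determined_subset[OF fd[OF V(1)]])
  qed
  then have "\<forall>U V. clopenin Y U \<and> clopenin Y V \<and> U \<noteq> {} \<and> V \<noteq> {} \<longrightarrow>
      subtopology Y U homeomorphic_space subtopology Y V"
    using clopens_homeomorphic_transport[OF Y] by simp
  then show "\<exists>K :: nat set set topology.
            hereditarily separable_space K \<and> totally_disconnected_space K \<and>
            efimov_space K \<and> fsJNP K \<and>
            (\<forall>U V. clopenin K U \<and> clopenin K V \<and> U \<noteq> {} \<and> V \<noteq> {}
               \<longrightarrow> subtopology K U homeomorphic_space subtopology K V)"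
    using limit_tower.copy_properties[OF L Y] by blast
qed

end
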